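(* Let $M$ be a complex symplectic manifold with a Hamiltonian holomorphic $GL(n,\mathbb C)$-action, with moment map $\mu$. Then $M$ is isomorphic, as a symplectic manifold, to the symplectic quotient (at the zero level of the moment map) of $$M\times T^*GL(n,\mathbb C)\times T^*GL(n-1,\mathbb C)\times\cdots\times T^*GL(1,\mathbb C)\quad\text{by}\quad H=\prod_{i=1}^nGL(i,\mathbb C),$$ where, for $i<n$, the factor $GL(i,\mathbb C)$ acts on $T^*GL(i,\mathbb C)$ by the right action and on $T^*GL(i+1,\mathbb C)$ by the left action restricted to the subgroup $GL(i,\mathbb C)\subset GL(i+1,\mathbb C)$ of upper-left $i\times i$ blocks, and $GL(n,\mathbb C)$ acts in the given way on $M$ and by the right action on $T^*GL(n,\mathbb C)$.
   Context: All manifolds, symplectic structures, actions and moment maps are holomorphic; symplectic quotients are taken at the zero level of the moment maps. Lie algebras $\mathfrak{gl}(m,\mathbb C)$ are identified with their duals by the trace form. $T^*GL(m,\mathbb C)$ is identified with $GL(m,\mathbb C)\times\mathfrak{gl}(m,\mathbb C)\ni(g,B)$ using right-invariant forms and the trace form; its symplectic form is $\omega\bigl((\rho,b),(\hat\rho,\hat b)\bigr)=\mathrm{tr}(\rho\hat b-\hat\rho b-B[\rho,\hat\rho])$, where $\rho,\hat\rho$ represent right-invariant vector fields. The left and right actions are $h\cdot_L(g,B)=(hg,hBh^{-1})$ and $h\cdot_R(g,B)=(gh^{-1},B)$, with moment maps $\mu_L(g,B)=B$, $\mu_R(g,B)=-g^{-1}Bg$. The group $GL(i,\mathbb C)$ is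 embedded in $GL(i+1,\mathbb C)$ as matrices $\mathrm{diag}(h,1)$; the corresponding moment map is the upper-left $i\times i$ block of $\mu_L$. *)

theory Defs
  imports "HOL-Analysis.Analysis" "Jordan_Normal_Form.Gauss_Jordan_Elimination"
begin

section \<open>Holomorphic functions of several variables\<close>

text \<open>Coordinates are indexed by an arbitrary finite set \<open>J\<close>, which makes products of
  manifolds painless: the coordinate space \<open>\<complex>\<^sup>J\<close> consists of the functions vanishing outside
  \<open>J\<close>, with the topology induced by the product topology on functions.\<close>

definition cspace :: "'j set \<Rightarrow> ('j \<Rightarrow> complex) set" where
  "cspace J = {x. \<forall>j. j \<notin> J \<longrightarrow> x j = 0}"

definition cdiff_at :: "'j set \<Rightarrow> (('j \<Rightarrow> complex) \<Rightarrow> complex) \<Rightarrow> ('j \<Rightarrow> complex) \<Rightarrow> bool" where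
  "cdiff_at J f x \<longleftrightarrow> (\<exists>a :: 'j \<Rightarrow> complex.
     ((\<lambda>y. (f y - f x - (\<Sum>j\<in>J. a j * (y j - x j))) /
           complex_of_real (L2_set (\<lambda>j. cmod (y j - x j)) J)) \<longlongrightarrow> 0) (at x within cspace J))"

definition holo_on :: "'j set \<Rightarrow> (('j \<Rightarrow> complex) \<Rightarrow> complex) \<Rightarrow> ('j \<Rightarrow> complex) set \<Rightarrow> bool" where
  "holo_on J f V \<longleftrightarrow> (\<forall>x\<in>V. cdiff_at J f x)"

definition partial :: "'j \<Rightarrow> (('j \<Rightarrow> complex) \<Rightarrow> complex) \<Rightarrow> ('j \<Rightarrow> complex) \<Rightarrow> complex" where
  "partial j f x = deriv (\<lambda>t. f (x(j := t))) (x j)"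


section \<open>Complex manifolds\<close>

text \<open>A chart is a pair \<open>(U, \<phi>)\<close> of a domain and a coordinate map; the values of \<open>\<phi>\<close> outside
  \<open>U\<close> are irrelevant. The atlas need not be maximal.\<close>

record ('p, 'j) cmfd =
  mtop :: "'p topology"
  cidx :: "'j set"
  atlas :: "('p set \<times> ('p \<Rightarrow> 'j \<Rightarrow> complex)) set"

abbreviation points :: "('p, 'j) cmfd \<Rightarrow> 'p set" where
  "points X \<equiv> topspace (mtop X)"

definition complex_manifold :: "('p, 'j) cmfd \<Rightarrow> bool" where
  "complex_manifold X \<longleftrightarrow>
     Hausdorff_space (mtop X) \<and> second_countable (mtop X) \<and> finite (cidx X) \<and>
     points X = (\<Union>(U, \<phi>)\<in>atlas X. U) \<and>
     (\<forall>(U, \<phi>)\<in>atlas X.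
        openin (mtop X) U \<and>
        openin (top_of_set (cspace (cidx X))) (\<phi> ` U) \<and>
        homeomorphic_map (subtopology (mtop X) U) (top_of_set (\<phi> ` U)) \<phi>) \<and>
     (\<forall>(U, \<phi>)\<in>atlas X. \<forall>(V, \<psi>)\<in>atlas X. \<forall>j\<in>cidx X.
        holo_on (cidx X) (\<lambda>x. \<psi> (inv_into U \<phi> x) j) (\<phi> ` (U \<inter> V)))"

definition holo_at :: "('p, 'j) cmfd \<Rightarrow> 'p \<Rightarrow> ('p \<Rightarrow> complex) \<Rightarrow> bool" where
  "holo_at X p h \<longleftrightarrow> (\<exists>W. openin (mtop X) W \<and> p \<in> W \<and>
     (\<forall>(U, \<phi>)\<in>atlas X. holo_on (cidx X) (h \<circ> inv_into U \<phi>) (\<phi> ` (U \<inter> W))))"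

definition holomorphic_map :: "('p, 'j) cmfd \<Rightarrow> ('q, 'k) cmfd \<Rightarrow> ('p \<Rightarrow> 'q) \<Rightarrow> bool" where
  "holomorphic_map X Y F \<longleftrightarrow>
     continuous_map (mtop X) (mtop Y) F \<and>
     (\<forall>(U, \<phi>)\<in>atlas X. \<forall>(V, \<psi>)\<in>atlas Y. \<forall>k\<in>cidx Y.
        holo_on (cidx X) (\<lambda>x. \<psi> (F (inv_into U \<phi> x)) k) (\<phi> ` (U \<inter> F -` V)))"

text \<open>A holomorphic tangent vector at \<open>p\<close> is a directional derivative acting on functions
  holomorphic near \<open>p\<close>. By convention it sends every other function to \<open>0\<close>, so that equality of
  tangent vectors is equality of functionals.\<close>

type_synonym 'p tangent = "('p \<Rightarrow> complex) \<Rightarrow> complex"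

definition coord_vec ::
  "('p, 'j) cmfd \<Rightarrow> 'p set \<Rightarrow> ('p \<Rightarrow> 'j \<Rightarrow> complex) \<Rightarrow> 'j \<Rightarrow> 'p \<Rightarrow> 'p tangent" where
  "coord_vec X U \<phi> j p =
     (\<lambda>h. if holo_at X p h then partial j (h \<circ> inv_into U \<phi>) (\<phi> p) else 0)"

definition tangent_space :: "('p, 'j) cmfd \<Rightarrow> 'p \<Rightarrow> 'p tangent set" where
  "tangent_space X p =
     {\<lambda>h. \<Sum>j\<in>cidx X. a j * coord_vec X U \<phi> j p h | a U \<phi>. (U, \<phi>) \<in> atlas X \<and> p \<in> U}"

definition differential ::
  "('q, 'k) cmfd \<Rightarrow> ('p \<Rightarrow> 'q) \<Rightarrow> 'p \<Rightarrow> 'p tangent \<Rightarrow> 'q tangent" where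
  "differential Y F p v = (\<lambda>h. if holo_at Y (F p) h then v (h \<circ> F) else 0)"

definition prod_cmfd :: "('p, 'j) cmfd \<Rightarrow> ('q, 'k) cmfd \<Rightarrow> ('p \<times> 'q, 'j + 'k) cmfd" where
  "prod_cmfd X Y =
     \<lparr>mtop = prod_topology (mtop X) (mtop Y),
      cidx = cidx X <+> cidx Y,
      atlas = {(U \<times> V, \<lambda>(x, y). case_sum (\<phi> x) (\<psi> y)) | U \<phi> V \<psi>.
                 (U, \<phi>) \<in> atlas X \<and> (V, \<psi>) \<in> atlas Y}\<rparr>"

definition Pi_cmfd ::
  "'i set \<Rightarrow> ('i \<Rightarrow> ('p, 'j) cmfd) \<Rightarrow> ('i \<Rightarrow> 'p, 'i \<times> 'j) cmfd" where
  "Pi_cmfd I X =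
     \<lparr>mtop = product_topology (\<lambda>i. mtop (X i)) I,
      cidx = Sigma I (\<lambda>i. cidx (X i)),
      atlas = {(PiE I (\<lambda>i. fst (c i)), \<lambda>x (i, j). if i \<in> I then snd (c i) (x i) j else 0) | c.
                 c \<in> PiE I (\<lambda>i. atlas (X i))}\<rparr>"

definition embedded_submanifold :: "('p, 'k) cmfd \<Rightarrow> ('p, 'j) cmfd \<Rightarrow> bool" where
  "embedded_submanifold Z X \<longleftrightarrow>
     complex_manifold Z \<and> points Z \<subseteq> points X \<and> mtop Z = subtopology (mtop X) (points Z) \<and>
     holomorphic_map Z X id \<and>
     (\<forall>p\<in>points Z. inj_on (differential X id p) (tangent_space Z p))"

definition submersion :: "('p, 'j) cmfd \<Rightarrow> ('q, 'k) cmfd \<Rightarrow> ('p \<Rightarrow> 'q) \<Rightarrow> bool" where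
  "submersion X Y F \<longleftrightarrow> holomorphic_map X Y F \<and>
     (\<forall>p\<in>points X. differential Y F p ` tangent_space X p = tangent_space Y (F p))"


section \<open>Complex symplectic manifolds\<close>

type_synonym 'p two_form = "'p \<Rightarrow> 'p tangent \<Rightarrow> 'p tangent \<Rightarrow> complex"

definition form_coeff ::
  "('p, 'j) cmfd \<Rightarrow> 'p two_form \<Rightarrow> 'p set \<Rightarrow> ('p \<Rightarrow> 'j \<Rightarrow> complex) \<Rightarrow> 'j \<Rightarrow> 'j \<Rightarrow>
   ('j \<Rightarrow> complex) \<Rightarrow> complex" where
  "form_coeff X \<omega> U \<phi> i j x =
     (let p = inv_into U \<phi> x in \<omega> p (coord_vec X U \<phi> i p) (coord_vec X U \<phi> j p))"

definition holomorphic_two_form :: "('p, 'j) cmfd \<Rightarrow> 'p two_form \<Rightarrow> bool" where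
  "holomorphic_two_form X \<omega> \<longleftrightarrow>
     (\<forall>p\<in>points X. \<forall>u\<in>tangent_space X p. \<forall>v\<in>tangent_space X p. \<forall>w\<in>tangent_space X p. \<forall>c.
        \<omega> p (\<lambda>h. u h + c * v h) w = \<omega> p u w + c * \<omega> p v w \<and>
        \<omega> p v w = - \<omega> p w v) \<and>
     (\<forall>(U, \<phi>)\<in>atlas X. \<forall>i\<in>cidx X. \<forall>j\<in>cidx X.
        holo_on (cidx X) (form_coeff X \<omega> U \<phi> i j) (\<phi> ` U))"

definition closed_form :: "('p, 'j) cmfd \<Rightarrow> 'p two_form \<Rightarrow> bool" where
  "closed_form X \<omega> \<longleftrightarrow>
     (\<forall>(U, \<phi>)\<in>atlas X. \<forall>i\<in>cidx X. \<forall>j\<in>cidx X. \<forall>k\<in>cidx X. \<forall>x\<in>\<phi> ` U.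
        partial i (form_coeff X \<omega> U \<phi> j k) x + partial j (form_coeff X \<omega> U \<phi> k i) x
          + partial k (form_coeff X \<omega> U \<phi> i j) x = 0)"

definition nondegenerate_form :: "('p, 'j) cmfd \<Rightarrow> 'p two_form \<Rightarrow> bool" where
  "nondegenerate_form X \<omega> \<longleftrightarrow>
     (\<forall>p\<in>points X. \<forall>u\<in>tangent_space X p.
        (\<forall>v\<in>tangent_space X p. \<omega> p u v = 0) \<longrightarrow> u = (\<lambda>h. 0))"

definition symplectic_manifold :: "('p, 'j) cmfd \<Rightarrow> 'p two_form \<Rightarrow> bool" where
  "symplectic_manifold X \<omega> \<longleftrightarrow>
     complex_manifold X \<and> holomorphic_two_form X \<omega> \<and> closed_form X \<omega> \<and> nondegenerate_form X \<omega>"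

definition preserves_forms ::
  "('p, 'j) cmfd \<Rightarrow> 'p two_form \<Rightarrow> ('q, 'k) cmfd \<Rightarrow> 'q two_form \<Rightarrow> ('p \<Rightarrow> 'q) \<Rightarrow> bool" where
  "preserves_forms X \<omega> Y \<eta> F \<longleftrightarrow>
     (\<forall>p\<in>points X. \<forall>v\<in>tangent_space X p. \<forall>w\<in>tangent_space X p.
        \<eta> (F p) (differential Y F p v) (differential Y F p w) = \<omega> p v w)"

definition symplectically_isomorphic ::
  "('p, 'j) cmfd \<Rightarrow> 'p two_form \<Rightarrow> ('q, 'k) cmfd \<Rightarrow> 'q two_form \<Rightarrow> bool" where
  "symplectically_isomorphic X \<omega> Y \<eta> \<longleftrightarrow>
     (\<exists>F G. holomorphic_map X Y F \<and> holomorphic_map Y X G \<and>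
        (\<forall>p\<in>points X. G (F p) = p) \<and> (\<forall>q\<in>points Y. F (G q) = q) \<and>
        preserves_forms X \<omega> Y \<eta> F)"

definition prod_form ::
  "('p, 'j) cmfd \<Rightarrow> 'p two_form \<Rightarrow> ('q, 'k) cmfd \<Rightarrow> 'q two_form \<Rightarrow> ('p \<times> 'q) two_form" where
  "prod_form X \<omega> Y \<eta> x v w =
     \<omega> (fst x) (differential X fst x v) (differential X fst x w) +
     \<eta> (snd x) (differential Y snd x v) (differential Y snd x w)"

definition Pi_form ::
  "'i set \<Rightarrow> ('i \<Rightarrow> ('p, 'j) cmfd) \<Rightarrow> ('i \<Rightarrow> 'p two_form) \<Rightarrow> ('i \<Rightarrow> 'p) two_form" where
  "Pi_form I X \<omega> x v w =
     (\<Sum>i\<in>I. \<omega> i (x i) (differential (X i) (\<lambda>y. y i) x v) (differential (X i) (\<lambda>y. y i) x w))"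


section \<open>General linear groups\<close>

definition mtrace :: "complex mat \<Rightarrow> complex" where
  "mtrace A = (\<Sum>i<dim_row A. A $$ (i, i))"

definition minv :: "complex mat \<Rightarrow> complex mat" where
  "minv A = the (mat_inverse A)"

definition mat_coords :: "nat \<Rightarrow> complex mat \<Rightarrow> nat \<times> nat \<Rightarrow> complex" where
  "mat_coords n A = (\<lambda>(i, j). if i < n \<and> j < n then A $$ (i, j) else 0)"

definition gl_cmfd :: "nat \<Rightarrow> (complex mat, nat \<times> nat) cmfd" where
  "gl_cmfd n =
     \<lparr>mtop = pullback_topology (carrier_mat n n) (mat_coords n) euclidean,
      cidx = {..<n} \<times> {..<n},
      atlas = {(carrier_mat n n, mat_coords n)}\<rparr>"

definition GL :: "nat \<Rightarrow> complex mat set" where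
  "GL n = {A \<in> carrier_mat n n. invertible_mat A}"

definition GL_cmfd :: "nat \<Rightarrow> (complex mat, nat \<times> nat) cmfd" where
  "GL_cmfd n =
     \<lparr>mtop = subtopology (mtop (gl_cmfd n)) (GL n),
      cidx = {..<n} \<times> {..<n},
      atlas = {(GL n, mat_coords n)}\<rparr>"

definition mat_deriv :: "nat \<Rightarrow> ('p \<Rightarrow> complex mat) \<Rightarrow> 'p tangent \<Rightarrow> complex mat" where
  "mat_deriv n F v = Matrix.mat n n (\<lambda>(i, j). v (\<lambda>x. F x $$ (i, j)))"

text \<open>The vector field generated by \<open>\<xi>\<close>: at \<open>p\<close> it is the image of \<open>\<xi>\<close> under the
  differential at the identity of the orbit map \<open>g \<mapsto> g p\<close>. The curve \<open>1 + t\<xi>\<close>, which is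
  invertible for small \<open>t\<close>, has the same velocity at the identity as \<open>exp (t\<xi>)\<close>.\<close>

definition fundamental_field ::
  "nat \<Rightarrow> ('p, 'j) cmfd \<Rightarrow> (complex mat \<Rightarrow> 'p \<Rightarrow> 'p) \<Rightarrow> complex mat \<Rightarrow> 'p \<Rightarrow> 'p tangent" where
  "fundamental_field n X act \<xi> p =
     (\<lambda>h. if holo_at X p h then deriv (\<lambda>t. h (act (1\<^sub>m n + t \<cdot>\<^sub>m \<xi>) p)) 0 else 0)"

definition holomorphic_GL_action ::
  "nat \<Rightarrow> ('p, 'j) cmfd \<Rightarrow> (complex mat \<Rightarrow> 'p \<Rightarrow> 'p) \<Rightarrow> bool" where
  "holomorphic_GL_action n X act \<longleftrightarrow>
     holomorphic_map (prod_cmfd (GL_cmfd n) X) X (\<lambda>(g, p). act g p) \<and>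
     (\<forall>p\<in>points X. act (1\<^sub>m n) p = p) \<and>
     (\<forall>g\<in>GL n. \<forall>h\<in>GL n. \<forall>p\<in>points X. act (g * h) p = act g (act h p))"

text \<open>The moment map takes values in \<open>gl(n)\<close>, identified with its dual by the trace form; it is
  equivariant for the (co)adjoint action. The sign convention
  \<open>d tr(\<xi> \<mu>) = \<omega>(X\<^sub>\<xi>, \<cdot>)\<close> is the one for which the left and right actions on the cotangent
  bundle of \<open>GL(n)\<close> have the moment maps \<open>B\<close> and \<open>- g\<^sup>-\<^sup>1 B g\<close>.\<close>

definition hamiltonian_GL_action ::
  "nat \<Rightarrow> ('p, 'j) cmfd \<Rightarrow> 'p two_form \<Rightarrow> (complex mat \<Rightarrow> 'p \<Rightarrow> 'p) \<Rightarrow> ('p \<Rightarrow> complex mat) \<Rightarrow> bool"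
where
  "hamiltonian_GL_action n X \<omega> act \<mu> \<longleftrightarrow>
     holomorphic_GL_action n X act \<and>
     (\<forall>g\<in>GL n. preserves_forms X \<omega> X \<omega> (act g)) \<and>
     holomorphic_map X (gl_cmfd n) \<mu> \<and>
     (\<forall>g\<in>GL n. \<forall>p\<in>points X. \<mu> (act g p) = g * \<mu> p * minv g) \<and>
     (\<forall>\<xi>\<in>carrier_mat n n. \<forall>p\<in>points X. \<forall>v\<in>tangent_space X p.
        mtrace (\<xi> * mat_deriv n \<mu> v) = \<omega> p (fundamental_field n X act \<xi> p) v)"


section \<open>The cotangent bundle of the general linear group\<close>

definition TGL_cmfd :: "nat \<Rightarrow> (complex mat \<times> complex mat, nat \<times> nat + nat \<times> nat) cmfd" where
  "TGL_cmfd n = prod_cmfd (GL_cmfd n) (gl_cmfd n)"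

text \<open>A tangent vector with components \<open>(dg, dB)\<close> at \<open>(g, B)\<close> is represented by
  \<open>(\<rho>, b) = (dg g\<^sup>-\<^sup>1, dB)\<close>, since the value at \<open>g\<close> of the right-invariant vector field
  given by \<open>\<rho>\<close> is \<open>\<rho> g\<close>.\<close>

definition TGL_form :: "nat \<Rightarrow> (complex mat \<times> complex mat) two_form" where
  "TGL_form n x v w =
     (let B = snd x;
          \<rho> = mat_deriv n fst v * minv (fst x); b = mat_deriv n snd v;
          \<rho>' = mat_deriv n fst w * minv (fst x); b' = mat_deriv n snd w
      in mtrace (\<rho> * b' - \<rho>' * b - B * (\<rho> * \<rho>' - \<rho>' * \<rho>)))"

definition left_act ::
  "complex mat \<Rightarrow> complex mat \<times> complex mat \<Rightarrow> complex mat \<times> complex mat" where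
  "left_act h x = (h * fst x, h * snd x * minv h)"

definition right_act ::
  "complex mat \<Rightarrow> complex mat \<times> complex mat \<Rightarrow> complex mat \<times> complex mat" where
  "right_act h x = (fst x * minv h, snd x)"

definition mu_L :: "complex mat \<times> complex mat \<Rightarrow> complex mat" where
  "mu_L x = snd x"

definition mu_R :: "complex mat \<times> complex mat \<Rightarrow> complex mat" where
  "mu_R x = - (minv (fst x) * snd x * fst x)"

definition diag_embed :: "nat \<Rightarrow> complex mat \<Rightarrow> complex mat" where
  "diag_embed i h = four_block_mat h (0\<^sub>m i 1) (0\<^sub>m 1 i) (1\<^sub>m 1)"

definition upper_left :: "nat \<Rightarrow> complex mat \<Rightarrow> complex mat" where
  "upper_left i A = Matrix.mat i i (\<lambda>(a, b). A $$ (a, b))"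


section \<open>Symplectic quotients by products of general linear groups\<close>

definition GL_product :: "nat \<Rightarrow> (nat \<Rightarrow> complex mat) set" where
  "GL_product n = PiE {1..n} GL"

definition orbit_of :: "nat \<Rightarrow> ((nat \<Rightarrow> complex mat) \<Rightarrow> 'p \<Rightarrow> 'p) \<Rightarrow> 'p \<Rightarrow> 'p set" where
  "orbit_of n act x = {act h x | h. h \<in> GL_product n}"

text \<open>\<open>(Q, \<eta>)\<close> is the Marsden--Weinstein quotient of \<open>(X, \<omega>)\<close> at the zero level of the moment map
  \<open>\<mu>\<close>, with components \<open>\<mu> i\<close> in \<open>gl(i)\<close>, by \<open>H = GL(1) \<times> \<dots> \<times> GL(n)\<close>: zero is a regular value,
  \<open>H\<close> acts freely on the zero level \<open>Z\<close>, the points of \<open>Q\<close> are the orbits in \<open>Z\<close>, \<open>Q\<close> has the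
  quotient topology and the complex structure for which \<open>Z \<rightarrow> Q\<close> is a submersion, and the
  pullbacks of \<open>\<eta>\<close> and \<open>\<omega>\<close> to \<open>Z\<close> agree. The manifold \<open>Z\<close> (with the structure of an embedded
  submanifold) and \<open>(Q, \<eta>)\<close> are unique up to the choice of atlas.\<close>

definition is_symplectic_quotient ::
  "('p, 'j) cmfd \<Rightarrow> 'p two_form \<Rightarrow> nat \<Rightarrow> ((nat \<Rightarrow> complex mat) \<Rightarrow> 'p \<Rightarrow> 'p) \<Rightarrow>
   (nat \<Rightarrow> 'p \<Rightarrow> complex mat) \<Rightarrow> ('p set, 'k) cmfd \<Rightarrow> 'p set two_form \<Rightarrow> bool" where
  "is_symplectic_quotient X \<omega> n act \<mu> Q \<eta> \<longleftrightarrow>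
     (let Z0 = {x \<in> points X. \<forall>i\<in>{1..n}. \<mu> i x = 0\<^sub>m i i}; orb = orbit_of n act in
       (\<forall>x\<in>Z0. \<forall>c\<in>PiE {1..n} (\<lambda>i. carrier_mat i i). \<exists>v\<in>tangent_space X x.
          \<forall>i\<in>{1..n}. mat_deriv i (\<mu> i) v = c i) \<and>
       (\<forall>x\<in>Z0. \<forall>h\<in>GL_product n. act h x = x \<longrightarrow> h = (\<lambda>i\<in>{1..n}. 1\<^sub>m i)) \<and>
       symplectic_manifold Q \<eta> \<and>
       points Q = orb ` Z0 \<and>
       quotient_map (subtopology (mtop X) Z0) (mtop Q) orb \<and>
       (\<exists>Z :: ('p, 'j) cmfd.
          embedded_submanifold Z X \<and> points Z = Z0 \<and> submersion Z Q orb \<and>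
          (\<forall>z\<in>points Z. \<forall>v\<in>tangent_space Z z. \<forall>w\<in>tangent_space Z z.
             \<eta> (orb z) (differential Q orb z v) (differential Q orb z w) =
             \<omega> z (differential X id z v) (differential X id z w))))"


section \<open>The Hamiltonian space to be reduced\<close>

definition TGL_tower_cmfd ::
  "nat \<Rightarrow> (nat \<Rightarrow> complex mat \<times> complex mat, nat \<times> (nat \<times> nat + nat \<times> nat)) cmfd" where
  "TGL_tower_cmfd n = Pi_cmfd {1..n} TGL_cmfd"

definition total_cmfd ::
  "nat \<Rightarrow> ('p, 'j) cmfd \<Rightarrow>
   ('p \<times> (nat \<Rightarrow> complex mat \<times> complex mat), 'j + nat \<times> (nat \<times> nat + nat \<times> nat)) cmfd" where
  "total_cmfd n M = prod_cmfd M (TGL_tower_cmfd n)"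

definition total_form ::
  "nat \<Rightarrow> ('p, 'j) cmfd \<Rightarrow> 'p two_form \<Rightarrow> ('p \<times> (nat \<Rightarrow> complex mat \<times> complex mat)) two_form" where
  "total_form n M \<omega> =
     prod_form M \<omega> (TGL_tower_cmfd n) (Pi_form {1..n} TGL_cmfd TGL_form)"

text \<open>The component \<open>h i\<close> acts from the right on the \<open>i\<close>-th factor and, for \<open>i < n\<close>, from the left
  on the next one; seen from the \<open>i\<close>-th factor, the left action is that of \<open>h (i - 1)\<close>.\<close>

definition total_act ::
  "nat \<Rightarrow> (complex mat \<Rightarrow> 'p \<Rightarrow> 'p) \<Rightarrow> (nat \<Rightarrow> complex mat) \<Rightarrow>
   'p \<times> (nat \<Rightarrow> complex mat \<times> complex mat) \<Rightarrow> 'p \<times> (nat \<Rightarrow> complex mat \<times> complex mat)" where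
  "total_act n act h = (\<lambda>(m, x).
     (act (h n) m,
      \<lambda>i\<in>{1..n}. if i = 1 then right_act (h 1) (x 1)
                 else left_act (diag_embed (i - 1) (h (i - 1))) (right_act (h i) (x i))))"

definition total_moment ::
  "nat \<Rightarrow> ('p \<Rightarrow> complex mat) \<Rightarrow> nat \<Rightarrow>
   'p \<times> (nat \<Rightarrow> complex mat \<times> complex mat) \<Rightarrow> complex mat" where
  "total_moment n \<mu> i = (\<lambda>(m, x).
     if i = n then \<mu> m + mu_R (x n)
     else mu_R (x i) + upper_left i (mu_L (x (i + 1))))"

end

(* The zero level has a global parametrisation. Put a_0 = 1 and a_i = diag(a_(i-1), 1) g_i, where
   (g_i, B_i) is the point of the i-th cotangent bundle, and m' = a_n . m. The moment map equations
   say precisely that B_i = e_i^-1 U_i e_i with e_i = diag(a_(i-1), 1) and U_i the upper-left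
   i x i block of mu(m'). Hence (m', a_1, ..., a_n) are global coordinates on the zero level, the
   product of the GL(i) acts by a_i |-> a_i h_i^-1, and the quotient is M, with projection m'.

   For the forms, put s_i = da_i a_i^-1 and
     f_i = tr(s_i dU_i' - s_i' dU_i - U_i [s_i, s_i']).
   The form of the i-th cotangent bundle restricts to f_i - f_(i-1), so their sum telescopes to f_n,
   while the form of M, pulled back by (m', a_n) |-> a_n^-1 . m', is omega(dm', dm') - f_n: this
   last identity is the defining property of the moment map together with its equivariance. *)

theory Submission
  imports Defs "Jordan_Normal_Form.Determinant"
begin

section \<open>Differentiability in several variables\<close>

text \<open>The zero level is not reached through an implicit function theorem. The map
  \<open>retr\<close>, which forgets the B_i, is holomorphic on the whole total space and is a left
  inverse of the parametrisation \<open>iota\<close>; composing the two retracts the total space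
  onto the zero level. The subspace topology, the injective differentials and, through sections of
  the orbit projection, the submersion property all come from such one-sided inverses, with no
  computation of ranks. Regularity of the value zero is checked directly: it is enough to vary the
  B_i, in which the moment maps are affine.

  The sum telescopes because (g_i, B_i) with g_i = e_i^-1 a_i and B_i = e_i^-1 U_i e_i is a gauge
  transform of (a_i, U_i). The cotangent form is invariant under conjugation, so the transformation
  costs only the cotangent form evaluated on de_i e_i^-1. That matrix is s_(i-1) bordered by zeros,
  and its pairings with U_i and dU_i see nothing but the upper-left blocks, which are U_(i-1) and
  dU_(i-1).\<close>

definition cnhds :: "'j set \<Rightarrow> ('j \<Rightarrow> complex) \<Rightarrow> ('j \<Rightarrow> complex) filter" where
  "cnhds J x = inf (nhds x) (principal (cspace J))"

text \<open>Caratheodory's form of complex differentiability: the difference quotients are continuous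
  coefficients \<open>c\<close>, whose values at \<open>x\<close> are the partial derivatives. The chain, product and quotient
  rules become algebraic identities for the coefficients.\<close>

definition slope_at :: "'j set \<Rightarrow> (('j \<Rightarrow> complex) \<Rightarrow> complex) \<Rightarrow> ('j \<Rightarrow> complex) \<Rightarrow>
    ('j \<Rightarrow> ('j \<Rightarrow> complex) \<Rightarrow> complex) \<Rightarrow> bool" where
  "slope_at J f x c \<longleftrightarrow> (\<forall>j\<in>J. (c j \<longlongrightarrow> c j x) (cnhds J x)) \<and>
     (\<forall>\<^sub>F y in cnhds J x. f y - f x = (\<Sum>j\<in>J. c j y * (y j - x j)))"

lemma eventually_cnhds:
  "eventually P (cnhds J x) \<longleftrightarrow> (\<exists>S. open S \<and> x \<in> S \<and> (\<forall>y\<in>S \<inter> cspace J. P y))"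
  by (auto simp: cnhds_def eventually_inf_principal eventually_nhds)

lemma eventually_cnhds_openin:
  assumes "openin (top_of_set (cspace J)) S" "x \<in> S" "\<And>y. y \<in> S \<Longrightarrow> P y"
  shows "eventually P (cnhds J x)"
  using assms unfolding eventually_cnhds openin_open by blast

lemma eventually_cnhds_in_openin:
  assumes "openin (top_of_set (cspace J)) S" "x \<in> S"
  shows "eventually (\<lambda>y. y \<in> S) (cnhds J x)"
  by (rule eventually_cnhds_openin[OF assms])

lemma eventually_cnhds_cspace: "eventually (\<lambda>y. y \<in> cspace J) (cnhds J x)"
  unfolding eventually_cnhds by (intro exI[of _ UNIV]) auto

text \<open>Unlike \<open>at x within cspace J\<close>, the filter \<open>cnhds\<close> is not
  punctured. Hence eventual statements hold at \<open>x\<close> itself, and limits along it can be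
  composed with maps and curves that return to the value \<open>x\<close>.\<close>

lemma eventually_cnhds_self:
  "eventually P (cnhds J x) \<Longrightarrow> x \<in> cspace J \<Longrightarrow> P x"
  unfolding eventually_cnhds by blast

lemma cnhds_at_within: "x \<in> cspace J \<Longrightarrow>
    eventually P (cnhds J x) \<longleftrightarrow> P x \<and> eventually P (at x within cspace J)"
proof -
  assume x: "x \<in> cspace J"
  have "eventually (\<lambda>y. y \<in> cspace J \<longrightarrow> P y) (nhds x) \<longleftrightarrow>
      P x \<and> eventually (\<lambda>y. y \<in> cspace J - {x} \<longrightarrow> P y) (nhds x)"
    (is "?l = (_ \<and> ?r)")
  proof
    assume ?l
    from eventually_nhds_x_imp_x[OF this] x eventually_mono[OF this]
    show "P x \<and> ?r" by simp
  next
    assume "P x \<and> ?r"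
    then have ?r "P x" by auto
    then show ?l by (elim eventually_mono) auto
  qed
  then show ?thesis by (simp add: cnhds_def at_within_def eventually_inf_principal)
qed

lemma tendsto_cnhds_at_within:
  assumes "x \<in> cspace J"
  shows "(c \<longlongrightarrow> c x) (cnhds J x) \<longleftrightarrow> (c \<longlongrightarrow> c x) (at x within cspace J)"
  unfolding tendsto_def using assms by (auto simp: cnhds_at_within)

lemma tendsto_cnhds_coordinate: "((\<lambda>y. y j) \<longlongrightarrow> x j) (cnhds J x)"
proof -
  have "((\<lambda>y. y j) \<longlongrightarrow> x j) (at x)" for x :: "'a \<Rightarrow> complex"
    using continuous_on_product_coordinates[of j] unfolding continuous_on_def by auto
  then have "((\<lambda>y. y j) \<longlongrightarrow> x j) (nhds x)"
    by (simp add: tendsto_nhds_iff)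
  then show ?thesis unfolding cnhds_def
    by (meson inf.cobounded1 tendsto_mono)
qed

text \<open>Coordinates outside \<open>J\<close> vanish on both sides, and convergence in the
  product topology is coordinatewise; so the coordinates in \<open>J\<close> decide.\<close>

lemma filterlim_cnhds:
  assumes "x \<in> cspace J" and ev: "eventually (\<lambda>t. \<gamma> t \<in> cspace J) F"
    and "\<And>j. j \<in> J \<Longrightarrow> ((\<lambda>t. \<gamma> t j) \<longlongrightarrow> x j) F"
  shows "filterlim \<gamma> (cnhds J x) F"
proof -
  have *: "((\<lambda>t. \<gamma> t j) \<longlongrightarrow> x j) F" for j
  proof (cases "j \<in> J")
    case False
    then have "eventually (\<lambda>t. \<gamma> t j = x j) F"
      using ev assms(1) by (auto simp: cspace_def elim!: eventually_mono)
    then show ?thesis by (simp add: tendsto_eventually)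
  qed (use assms in auto)
  have "limitin (product_topology (\<lambda>i. euclidean) UNIV) \<gamma> x F"
    unfolding limitin_componentwise using * by auto
  then have "(\<gamma> \<longlongrightarrow> x) F"
    by (simp add: euclidean_product_topology)
  then show ?thesis using ev by (simp add: cnhds_def filterlim_inf filterlim_principal)
qed

lemma cdiff_at_iff_slope:
  assumes J: "finite J" and x: "x \<in> cspace J"
  shows "cdiff_at J f x \<longleftrightarrow> (\<exists>c. slope_at J f x c)"
proof
  define L where "L y = complex_of_real (L2_set (\<lambda>j. cmod (y j - x j)) J)" for y :: "'a \<Rightarrow> complex"
  have L_ge: "cmod (y j - x j) \<le> cmod (L y)" if "j \<in> J" for y j
    using that member_le_L2_set[OF J that, of "\<lambda>j. cmod (y j - x j)"]
    by (simp add: L_def L2_set_nonneg)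
  have L0: "L y \<noteq> 0" if "y \<in> cspace J" "y \<noteq> x" for y
  proof
    assume "L y = 0"
    then have "\<forall>j\<in>J. y j = x j" using L_ge[of _ y] by simp
    then have "y = x" using that x by (auto simp: cspace_def fun_eq_iff)
    then show False using that by simp
  qed
  {
    assume "cdiff_at J f x"
    then obtain a where a: "((\<lambda>y. (f y - f x - (\<Sum>j\<in>J. a j * (y j - x j))) / L y) \<longlongrightarrow> 0)
        (at x within cspace J)"
      by (auto simp: cdiff_at_def L_def)
    define R where "R y = f y - f x - (\<Sum>j\<in>J. a j * (y j - x j))" for y
    \<comment> \<open>The remainder \<open>R\<close> is spread over the coordinates with weights cnj
      (y j - x j) / L^2. Multiplied by y j - x j these weights add up to 1, because the sum of the
      squares |y j - x j|^2 is L^2; at \<open>x\<close> the correction vanishes.\<close>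
    define c where "c j y = a j + cnj (y j - x j) * R y / (L y)\<^sup>2" for j y
    have cx: "c j x = a j" for j by (simp add: c_def)
    have "(c j \<longlongrightarrow> c j x) (cnhds J x)" if j: "j \<in> J" for j
    proof -
      have "((\<lambda>y. cnj (y j - x j) * R y / (L y)\<^sup>2) \<longlongrightarrow> 0) (at x within cspace J)"
      proof (rule Lim_null_comparison)
        show "\<forall>\<^sub>F y in at x within cspace J. cmod (cnj (y j - x j) * R y / (L y)\<^sup>2) \<le> cmod (R y / L y)"
          unfolding eventually_at_filter
        proof (intro always_eventually allI impI)
          fix y assume "y \<noteq> x" "y \<in> cspace J"
          then have L: "L y \<noteq> 0" using L0 by auto
          have "cmod (cnj (y j - x j) * R y / (L y)\<^sup>2) = cmod (y j - x j) / cmod (L y) * cmod (R y / L y)"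
            by (simp only: norm_mult norm_divide power2_eq_square complex_mod_cnj) simp
          also have "\<dots> \<le> 1 * cmod (R y / L y)"
            using L_ge[OF j] L by (intro mult_right_mono) (auto simp: divide_le_eq)
          finally show "cmod (cnj (y j - x j) * R y / (L y)\<^sup>2) \<le> cmod (R y / L y)" by simp
        qed
        show "((\<lambda>y. cmod (R y / L y)) \<longlongrightarrow> 0) (at x within cspace J)"
          using a tendsto_norm_zero unfolding R_def by blast
      qed
      from tendsto_add[OF tendsto_const[of "a j"] this]
      have "(c j \<longlongrightarrow> c j x) (at x within cspace J)" by (simp add: c_def[abs_def])
      then show ?thesis using tendsto_cnhds_at_within[OF x] by blast
    qed
    moreover have "f y - f x = (\<Sum>j\<in>J. c j y * (y j - x j))" if y: "y \<in> cspace J" for y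
    proof (cases "y = x")
      case False
      have "(\<Sum>j\<in>J. cnj (y j - x j) * (y j - x j)) = (\<Sum>j\<in>J. complex_of_real ((cmod (y j - x j))\<^sup>2))"
        by (intro sum.cong refl) (metis complex_norm_square mult.commute)
      also have "\<dots> = (L y)\<^sup>2"
        by (simp add: L_def L2_set_def sum_nonneg of_real_power[symmetric] del: of_real_power)
      finally have L2: "(\<Sum>j\<in>J. cnj (y j - x j) * (y j - x j)) = (L y)\<^sup>2" .
      have "(\<Sum>j\<in>J. cnj (y j - x j) * R y / (L y)\<^sup>2 * (y j - x j)) = (L y)\<^sup>2 * (R y / (L y)\<^sup>2)"
        by (subst (2) L2[symmetric], unfold sum_distrib_right) (intro sum.cong refl, simp)
      also have "\<dots> = R y" using L0[OF y False] by simp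
      finally show ?thesis by (simp add: c_def distrib_right sum.distrib R_def)
    qed simp
    then have "eventually (\<lambda>y. f y - f x = (\<Sum>j\<in>J. c j y * (y j - x j))) (cnhds J x)"
      using eventually_cnhds_cspace by (rule eventually_mono[rotated])
    ultimately show "\<exists>c. slope_at J f x c" unfolding slope_at_def by blast
  }
  {
    assume "\<exists>c. slope_at J f x c"
    then obtain c where c: "slope_at J f x c" by blast
    \<comment> \<open>Conversely, |y j - x j| is at most |L y|, so the remainder divided by
      \<open>L y\<close> is bounded by the variation of the coefficients.\<close>
    have "((\<lambda>y. \<Sum>j\<in>J. cmod (c j y - c j x)) \<longlongrightarrow> 0) (at x within cspace J)"
    proof (rule tendsto_null_sum)
      fix j assume "j \<in> J"
      then have "(c j \<longlongrightarrow> c j x) (at x within cspace J)"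
        using c x by (simp add: slope_at_def flip: tendsto_cnhds_at_within)
      then show "((\<lambda>y. cmod (c j y - c j x)) \<longlongrightarrow> 0) (at x within cspace J)"
        by (simp add: LIM_zero tendsto_norm_zero)
    qed
    moreover have "\<forall>\<^sub>F y in at x within cspace J. 
      cmod ((f y - f x - (\<Sum>j\<in>J. c j x * (y j - x j))) / L y) \<le> (\<Sum>j\<in>J. cmod (c j y - c j x))"
    proof -
      have "\<forall>\<^sub>F y in at x within cspace J. f y - f x = (\<Sum>j\<in>J. c j y * (y j - x j))"
        using c cnhds_at_within[OF x] by (auto simp: slope_at_def)
      moreover have "\<forall>\<^sub>F y in at x within cspace J. y \<in> cspace J \<and> y \<noteq> x"
        by (auto simp: eventually_at_filter)
      ultimately show ?thesis
      proof eventually_elim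
        case (elim y)
        have "cmod (\<Sum>j\<in>J. (c j y - c j x) * (y j - x j)) \<le> (\<Sum>j\<in>J. cmod (c j y - c j x) * cmod (L y))"
          using L_ge by (intro sum_norm_le) (auto simp: norm_mult intro!: mult_left_mono)
        also have "\<dots> = (\<Sum>j\<in>J. cmod (c j y - c j x)) * cmod (L y)"
          by (simp add: sum_distrib_right)
        finally show ?case using elim L0[of y]
          by (simp add: norm_divide divide_le_eq left_diff_distrib sum_subtractf)
      qed
    qed
    ultimately have "((\<lambda>y. (f y - f x - (\<Sum>j\<in>J. c j x * (y j - x j))) / L y) \<longlongrightarrow> 0) (at x within cspace J)"
      by (rule Lim_null_comparison[rotated])
    then show "cdiff_at J f x" unfolding cdiff_at_def L_def by (intro exI)
  }
qed

lemma slope_at_imp_cdiff_at: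
  "slope_at J f x c \<Longrightarrow> finite J \<Longrightarrow> x \<in> cspace J \<Longrightarrow> cdiff_at J f x"
  using cdiff_at_iff_slope by blast

lemma cdiff_at_slopes:
  assumes "\<And>k. k \<in> K \<Longrightarrow> cdiff_at J (f k) x" and J: "finite J" and x: "x \<in> cspace J"
  obtains d where "\<And>k. k \<in> K \<Longrightarrow> slope_at J (f k) x (d k)"
proof -
  have "\<forall>k\<in>K. \<exists>c. slope_at J (f k) x c"
    using assms by (simp add: cdiff_at_iff_slope[OF J x])
  from bchoice[OF this] show ?thesis using that by blast
qed

lemma slope_at_tendsto:
  assumes "slope_at J f x c"
  shows "(f \<longlongrightarrow> f x) (cnhds J x)"
proof -
  have "((\<lambda>y. f x + (\<Sum>j\<in>J. c j y * (y j - x j))) \<longlongrightarrow> f x + (\<Sum>j\<in>J. c j x * (x j - x j))) (cnhds J x)"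
    using assms by (intro tendsto_intros tendsto_cnhds_coordinate) (auto simp: slope_at_def)
  moreover have "\<forall>\<^sub>F y in cnhds J x. f x + (\<Sum>j\<in>J. c j y * (y j - x j)) = f y"
    using assms unfolding slope_at_def by (auto elim!: eventually_mono simp: algebra_simps)
  ultimately show ?thesis by (simp add: tendsto_cong)
qed

lemma slope_at_compose:
  assumes f: "slope_at K f (G x) c" and x: "x \<in> cspace J" and J: "finite J" "finite K"
    and G: "\<And>k. k \<in> K \<Longrightarrow> slope_at J (\<lambda>y. G y k) x (d k)"
    and ev: "eventually (\<lambda>y. G y \<in> cspace K) (cnhds J x)"
  shows "slope_at J (\<lambda>y. f (G y)) x (\<lambda>j y. \<Sum>k\<in>K. c k (G y) * d k j y)"
proof -
  have lim: "filterlim G (cnhds K (G x)) (cnhds J x)"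
    using ev eventually_cnhds_self[OF ev x] slope_at_tendsto[OF G] by (intro filterlim_cnhds) auto
  have 1: "((\<lambda>y. c k (G y)) \<longlongrightarrow> c k (G x)) (cnhds J x)" if "k \<in> K" for k
    using f that filterlim_compose[OF _ lim] by (auto simp: slope_at_def)
  have 2: "\<forall>\<^sub>F y in cnhds J x. f (G y) - f (G x) = (\<Sum>k\<in>K. c k (G y) * (G y k - G x k))"
    using f lim by (auto simp: slope_at_def filterlim_iff)
  have 3: "\<forall>\<^sub>F y in cnhds J x. \<forall>k\<in>K. G y k - G x k = (\<Sum>j\<in>J. d k j y * (y j - x j))"
    using G J by (auto simp: slope_at_def intro: eventually_ball_finite)
  show ?thesis unfolding slope_at_def
  proof (intro conjI ballI)
    fix j assume "j \<in> J"
    then show "((\<lambda>y. \<Sum>k\<in>K. c k (G y) * d k j y) \<longlongrightarrow> (\<Sum>k\<in>K. c k (G x) * d k j x)) (cnhds J x)"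
      using G by (intro tendsto_intros 1) (auto simp: slope_at_def)
  next
    show "\<forall>\<^sub>F y in cnhds J x. f (G y) - f (G x) = (\<Sum>j\<in>J. (\<Sum>k\<in>K. c k (G y) * d k j y) * (y j - x j))"
      using 2 3
    proof eventually_elim
      case (elim y)
      then have "f (G y) - f (G x) = (\<Sum>k\<in>K. \<Sum>j\<in>J. c k (G y) * d k j y * (y j - x j))"
        by (simp add: sum_distrib_left mult.assoc)
      then show ?case by (subst (asm) sum.swap) (simp add: sum_distrib_right)
    qed
  qed
qed

section \<open>Derivatives along curves, partial derivatives and the chain rule\<close>

lemma slope_at_curve:
  assumes f: "slope_at J f (\<gamma> t0) c" and x: "\<gamma> t0 \<in> cspace J" and J: "finite J"
    and \<gamma>: "\<And>j. j \<in> J \<Longrightarrow> ((\<lambda>t. \<gamma> t j) has_field_derivative d j) (at t0)"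
    and ev: "eventually (\<lambda>t. \<gamma> t \<in> cspace J) (at t0)"
  shows "((\<lambda>t. f (\<gamma> t)) has_field_derivative (\<Sum>j\<in>J. c j (\<gamma> t0) * d j)) (at t0)"
proof -
  have lim: "filterlim \<gamma> (cnhds J (\<gamma> t0)) (at t0)"
    using ev x DERIV_isCont[OF \<gamma>] by (intro filterlim_cnhds) (auto simp: isCont_def)
  have 1: "((\<lambda>t. c j (\<gamma> t)) \<longlongrightarrow> c j (\<gamma> t0)) (at t0)" if "j \<in> J" for j
    using f that filterlim_compose[OF _ lim] by (auto simp: slope_at_def)
  have 2: "\<forall>\<^sub>F t in at t0. f (\<gamma> t) - f (\<gamma> t0) = (\<Sum>j\<in>J. c j (\<gamma> t) * (\<gamma> t j - \<gamma> t0 j))"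
    using f lim by (auto simp: slope_at_def filterlim_iff)
  have "((\<lambda>t. \<Sum>j\<in>J. c j (\<gamma> t) * ((\<gamma> t j - \<gamma> t0 j) / (t - t0))) \<longlongrightarrow> (\<Sum>j\<in>J. c j (\<gamma> t0) * d j)) (at t0)"
    using \<gamma> by (intro tendsto_intros 1) (auto simp: has_field_derivative_iff)
  moreover have "\<forall>\<^sub>F t in at t0. (\<Sum>j\<in>J. c j (\<gamma> t) * ((\<gamma> t j - \<gamma> t0 j) / (t - t0))) =
      (f (\<gamma> t) - f (\<gamma> t0)) / (t - t0)"
    using 2 by eventually_elim (simp add: sum_divide_distrib)
  ultimately show ?thesis by (simp add: has_field_derivative_iff tendsto_cong)
qed

lemma cspace_fun_upd: "x \<in> cspace J \<Longrightarrow> j \<in> J \<Longrightarrow> x(j := t) \<in> cspace J"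
  by (auto simp: cspace_def)

text \<open>The coefficient functions of \<open>slope_at\<close> are not unique, but their values at
  \<open>x\<close> are: the coordinate line through \<open>x\<close> in direction \<open>j\<close>
  recovers them.\<close>

lemma slope_at_partial:
  assumes f: "slope_at J f x c" and x: "x \<in> cspace J" and J: "finite J" and j: "j \<in> J"
  shows "partial j f x = c j x"
proof -
  have "((\<lambda>t. f (x(j := t))) has_field_derivative (\<Sum>i\<in>J. c i (x(j := x j)) * (if i = j then 1 else 0))) (at (x j))"
  proof (rule slope_at_curve)
    show "((\<lambda>t. (x(j := t)) i) has_field_derivative (if i = j then 1 else 0)) (at (x j))" for i
      by (cases "i = j") auto
    show "\<forall>\<^sub>F t in at (x j). x(j := t) \<in> cspace J"
      using cspace_fun_upd[OF x j] by (intro always_eventually) simp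
  qed (use f x J in auto)
  also have "(\<Sum>i\<in>J. c i (x(j := x j)) * (if i = j then 1 else 0)) = c j x"
    using J j by (simp add: if_distrib cong: if_cong)
  finally show ?thesis unfolding partial_def by (rule DERIV_imp_deriv)
qed

lemma cdiff_at_curve:
  assumes f: "cdiff_at J f (\<gamma> t0)" and x: "\<gamma> t0 \<in> cspace J" and J: "finite J"
    and \<gamma>: "\<And>j. j \<in> J \<Longrightarrow> ((\<lambda>t. \<gamma> t j) has_field_derivative d j) (at t0)"
    and ev: "eventually (\<lambda>t. \<gamma> t \<in> cspace J) (at t0)"
  shows "((\<lambda>t. f (\<gamma> t)) has_field_derivative (\<Sum>j\<in>J. partial j f (\<gamma> t0) * d j)) (at t0)"
proof -
  obtain c where c: "slope_at J f (\<gamma> t0) c" using f cdiff_at_iff_slope[OF J x] by auto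
  have "(\<Sum>j\<in>J. c j (\<gamma> t0) * d j) = (\<Sum>j\<in>J. partial j f (\<gamma> t0) * d j)"
    by (intro sum.cong) (auto simp: slope_at_partial[OF c x J])
  then show ?thesis using slope_at_curve[OF c x J \<gamma> ev] by simp
qed

lemma cdiff_at_compose:
  assumes f: "cdiff_at K f (G x)" and x: "x \<in> cspace J" and J: "finite J" "finite K"
    and G: "\<And>k. k \<in> K \<Longrightarrow> cdiff_at J (\<lambda>y. G y k) x"
    and ev: "eventually (\<lambda>y. G y \<in> cspace K) (cnhds J x)"
  shows "cdiff_at J (\<lambda>y. f (G y)) x"
proof -
  have "G x \<in> cspace K" using eventually_cnhds_self[OF ev x] .
  then obtain c where "slope_at K f (G x) c" using f cdiff_at_iff_slope J by blast
  moreover obtain d where "\<And>k. k \<in> K \<Longrightarrow> slope_at J (\<lambda>y. G y k) x (d k)"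
    using G by (rule cdiff_at_slopes[OF _ J(1) x]) auto
  ultimately show ?thesis using slope_at_compose[OF _ x J _ ev] cdiff_at_iff_slope[OF J(1) x] by blast
qed

lemma partial_compose:
  assumes f: "cdiff_at K f (G x)" and x: "x \<in> cspace J" and J: "finite J" "finite K"
    and G: "\<And>k. k \<in> K \<Longrightarrow> cdiff_at J (\<lambda>y. G y k) x"
    and ev: "eventually (\<lambda>y. G y \<in> cspace K) (cnhds J x)" and j: "j \<in> J"
  shows "partial j (\<lambda>y. f (G y)) x = (\<Sum>k\<in>K. partial k f (G x) * partial j (\<lambda>y. G y k) x)"
proof -
  have Gx: "G x \<in> cspace K" using eventually_cnhds_self[OF ev x] .
  then obtain c where c: "slope_at K f (G x) c" using f cdiff_at_iff_slope J by blast
  obtain d where d: "\<And>k. k \<in> K \<Longrightarrow> slope_at J (\<lambda>y. G y k) x (d k)"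
    using G by (rule cdiff_at_slopes[OF _ J(1) x]) auto
  show ?thesis
    using slope_at_partial[OF slope_at_compose[OF c x J d ev] x J(1) j]
    by (simp add: slope_at_partial[OF c Gx J(2)] slope_at_partial[OF d x J(1) j])
qed

section \<open>Congruence and arithmetic of differentiable functions\<close>

lemma slope_at_cong:
  assumes "slope_at J f x c" "eventually (\<lambda>y. f y = g y) (cnhds J x)" "x \<in> cspace J"
  shows "slope_at J g x c"
proof -
  have "f x = g x" using eventually_cnhds_self[OF assms(2,3)] .
  moreover have "\<forall>\<^sub>F y in cnhds J x. f y - f x = (\<Sum>j\<in>J. c j y * (y j - x j))"
    using assms by (simp add: slope_at_def)
  ultimately have "\<forall>\<^sub>F y in cnhds J x. g y - g x = (\<Sum>j\<in>J. c j y * (y j - x j))"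
    using assms(2) by (auto elim: eventually_elim2)
  then show ?thesis using assms by (simp add: slope_at_def)
qed

lemma cdiff_at_cong:
  assumes "cdiff_at J f x" "eventually (\<lambda>y. f y = g y) (cnhds J x)" "x \<in> cspace J" "finite J"
  shows "cdiff_at J g x"
  using assms slope_at_cong by (metis cdiff_at_iff_slope)

lemma partial_cong:
  assumes ev: "eventually (\<lambda>y. f y = g y) (cnhds J x)" and x: "x \<in> cspace J" and j: "j \<in> J"
  shows "partial j f x = partial j g x"
proof -
  have "filterlim (\<lambda>t. x(j := t)) (cnhds J x) (nhds (x j))"
  proof (rule filterlim_cnhds[OF x])
    show "((\<lambda>t. (x(j := t)) i) \<longlongrightarrow> x i) (nhds (x j))" for i
      by (cases "i = j") (auto simp: filterlim_ident)
  qed (use cspace_fun_upd[OF x j] in auto)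
  then have "\<forall>\<^sub>F t in nhds (x j). f (x(j := t)) = g (x(j := t))"
    by (rule eventually_compose_filterlim[OF ev])
  then show ?thesis unfolding partial_def by (rule deriv_cong_ev) simp
qed

lemma slope_at_coordinate: "j \<in> J \<Longrightarrow> finite J \<Longrightarrow> slope_at J (\<lambda>y. y j) x (\<lambda>i y. if i = j then 1 else 0)"
  by (auto simp: slope_at_def if_distribR if_distrib[of "\<lambda>u. u * _"] cong: if_cong)

lemma cdiff_at_coordinate: "j \<in> J \<Longrightarrow> finite J \<Longrightarrow> x \<in> cspace J \<Longrightarrow> cdiff_at J (\<lambda>y. y j) x"
  by (rule slope_at_imp_cdiff_at[OF slope_at_coordinate])

lemma cdiff_at_const: "cdiff_at J (\<lambda>y. c) x"
  unfolding cdiff_at_def by (rule exI[of _ "\<lambda>_. 0"]) simp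

lemma cdiff_at_add:
  assumes "cdiff_at J f x" "cdiff_at J g x" and J: "finite J" and x: "x \<in> cspace J"
  shows "cdiff_at J (\<lambda>y. f y + g y) x"
proof -
  obtain c d where c: "slope_at J f x c" and d: "slope_at J g x d" 
    using assms cdiff_at_iff_slope[OF J x] by blast
  have "slope_at J (\<lambda>y. f y + g y) x (\<lambda>j y. c j y + d j y)"
    unfolding slope_at_def
  proof (intro conjI ballI)
    fix j assume "j \<in> J"
    then show "((\<lambda>y. c j y + d j y) \<longlongrightarrow> c j x + d j x) (cnhds J x)"
      using c d by (auto simp: slope_at_def intro!: tendsto_intros)
  next
    have "\<forall>\<^sub>F y in cnhds J x. f y - f x = (\<Sum>j\<in>J. c j y * (y j - x j))"
         "\<forall>\<^sub>F y in cnhds J x. g y - g x = (\<Sum>j\<in>J. d j y * (y j - x j))"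
      using c d by (auto simp: slope_at_def)
    then show "\<forall>\<^sub>F y in cnhds J x. f y + g y - (f x + g x) = (\<Sum>j\<in>J. (c j y + d j y) * (y j - x j))"
      by eventually_elim (simp add: sum.distrib distrib_right add_diff_add)
  qed
  then show ?thesis by (rule slope_at_imp_cdiff_at[OF _ J x])
qed

lemma cdiff_at_mult:
  assumes "cdiff_at J f x" "cdiff_at J g x" and J: "finite J" and x: "x \<in> cspace J"
  shows "cdiff_at J (\<lambda>y. f y * g y) x"
proof -
  obtain c d where c: "slope_at J f x c" and d: "slope_at J g x d" 
    using assms cdiff_at_iff_slope[OF J x] by blast
  have "slope_at J (\<lambda>y. f y * g y) x (\<lambda>j y. c j y * g y + f x * d j y)"
    unfolding slope_at_def
  proof (intro conjI ballI)
    fix j assume "j \<in> J"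
    then show "((\<lambda>y. c j y * g y + f x * d j y) \<longlongrightarrow> c j x * g x + f x * d j x) (cnhds J x)"
      using c d by (auto simp: slope_at_def intro!: tendsto_intros slope_at_tendsto[OF d])
  next
    have "\<forall>\<^sub>F y in cnhds J x. f y - f x = (\<Sum>j\<in>J. c j y * (y j - x j))"
         "\<forall>\<^sub>F y in cnhds J x. g y - g x = (\<Sum>j\<in>J. d j y * (y j - x j))"
      using c d by (auto simp: slope_at_def)
    then show "\<forall>\<^sub>F y in cnhds J x. f y * g y - f x * g x = (\<Sum>j\<in>J. (c j y * g y + f x * d j y) * (y j - x j))"
    proof eventually_elim
      case (elim y)
      have "f y * g y - f x * g x = (f y - f x) * g y + f x * (g y - g x)" by (simp add: algebra_simps)
      then show ?case unfolding elim
        by (simp add: sum_distrib_left sum_distrib_right distrib_right distrib_left sum.distrib mult_ac)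
    qed
  qed
  then show ?thesis by (rule slope_at_imp_cdiff_at[OF _ J x])
qed

lemma cdiff_at_inverse:
  assumes "cdiff_at J f x" and J: "finite J" and x: "x \<in> cspace J" and 0: "f x \<noteq> 0"
  shows "cdiff_at J (\<lambda>y. inverse (f y)) x"
proof -
  obtain c where c: "slope_at J f x c" 
    using assms cdiff_at_iff_slope[OF J x] by blast
  have "slope_at J (\<lambda>y. inverse (f y)) x (\<lambda>j y. - c j y * inverse (f y) * inverse (f x))"
    unfolding slope_at_def
  proof (intro conjI ballI)
    fix j assume "j \<in> J"
    then show "((\<lambda>y. - c j y * inverse (f y) * inverse (f x)) \<longlongrightarrow> - c j x * inverse (f x) * inverse (f x)) (cnhds J x)"
      using c 0 by (auto simp: slope_at_def intro!: tendsto_intros slope_at_tendsto[OF c])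
  next
    have "\<forall>\<^sub>F y in cnhds J x. f y - f x = (\<Sum>j\<in>J. c j y * (y j - x j))"
         "\<forall>\<^sub>F y in cnhds J x. f y \<noteq> 0"
      using c tendsto_imp_eventually_ne[OF slope_at_tendsto[OF c] 0] by (auto simp: slope_at_def)
    then show "\<forall>\<^sub>F y in cnhds J x. inverse (f y) - inverse (f x) = 
        (\<Sum>j\<in>J. (- c j y * inverse (f y) * inverse (f x)) * (y j - x j))"
    proof eventually_elim
      case (elim y)
      have "inverse (f y) - inverse (f x) = - inverse (f y) * inverse (f x) * (f y - f x)" 
        using elim 0 by (simp add: field_simps)
      then show ?case unfolding elim by (simp add: sum_distrib_left mult_ac)
    qed
  qed
  then show ?thesis by (rule slope_at_imp_cdiff_at[OF _ J x])
qed

section \<open>Holomorphic functions and maps\<close>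

lemma complex_manifoldD:
  assumes "complex_manifold X"
  shows cidx_finite: "finite (cidx X)"
    and chart_open: "\<And>U \<phi>. (U, \<phi>) \<in> atlas X \<Longrightarrow> openin (mtop X) U"
    and chart_image_open: "\<And>U \<phi>. (U, \<phi>) \<in> atlas X \<Longrightarrow> openin (top_of_set (cspace (cidx X))) (\<phi> ` U)"
    and chart_homeo: "\<And>U \<phi>. (U, \<phi>) \<in> atlas X \<Longrightarrow>
          homeomorphic_map (subtopology (mtop X) U) (top_of_set (\<phi> ` U)) \<phi>"
    and chart_transition: "\<And>U \<phi> V \<psi> j. (U, \<phi>) \<in> atlas X \<Longrightarrow> (V, \<psi>) \<in> atlas X \<Longrightarrow> j \<in> cidx X \<Longrightarrow>
          holo_on (cidx X) (\<lambda>x. \<psi> (inv_into U \<phi> x) j) (\<phi> ` (U \<inter> V))"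
    and chart_cover: "points X = (\<Union>(U, \<phi>)\<in>atlas X. U)"
  using assms unfolding complex_manifold_def by fast+

lemma chart_ex:
  assumes "complex_manifold X" "p \<in> points X"
  obtains U \<phi> where "(U, \<phi>) \<in> atlas X" "p \<in> U"
  using assms(2) that unfolding chart_cover[OF assms(1)] by blast

lemma chart_sub: "complex_manifold X \<Longrightarrow> (U, \<phi>) \<in> atlas X \<Longrightarrow> U \<subseteq> points X"
  using chart_open openin_subset by blast

lemma chart_point: "complex_manifold X \<Longrightarrow> (U, \<phi>) \<in> atlas X \<Longrightarrow> p \<in> U \<Longrightarrow> p \<in> points X"
  using chart_sub by blast

lemma chart_inj:
  assumes "complex_manifold X" "(U, \<phi>) \<in> atlas X"
  shows "inj_on \<phi> U"
proof -
  have "topspace (subtopology (mtop X) U) = U"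
    using chart_sub[OF assms] by (simp add: Int_absorb1)
  with chart_homeo[OF assms] show ?thesis
    unfolding homeomorphic_eq_everything_map by simp
qed

lemma chart_inv:
  "complex_manifold X \<Longrightarrow> (U, \<phi>) \<in> atlas X \<Longrightarrow> p \<in> U \<Longrightarrow> inv_into U \<phi> (\<phi> p) = p"
  using chart_inj inv_into_f_f by fastforce

lemma chart_cspace:
  "complex_manifold X \<Longrightarrow> (U, \<phi>) \<in> atlas X \<Longrightarrow> p \<in> U \<Longrightarrow> \<phi> p \<in> cspace (cidx X)"
  using chart_image_open[of X U \<phi>] openin_imp_subset by blast

lemma chart_image_openin:
  assumes X: "complex_manifold X" "(U, \<phi>) \<in> atlas X" and W: "openin (mtop X) W"
  shows "openin (top_of_set (cspace (cidx X))) (\<phi> ` (U \<inter> W))"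
proof -
  have "openin (subtopology (mtop X) U) (U \<inter> W)"
    using W openin_subtopology_Int by (metis inf_commute)
  then have "openin (top_of_set (\<phi> ` U)) (\<phi> ` (U \<inter> W))"
    using chart_homeo[OF X] unfolding homeomorphic_eq_everything_map open_map_def by blast
  then show ?thesis using chart_image_open[OF X] openin_trans by blast
qed

lemma chart_vimage_openin:
  assumes X: "complex_manifold X" "(U, \<phi>) \<in> atlas X" and S: "openin (top_of_set (cspace (cidx X))) S"
  shows "openin (mtop X) {p \<in> U. \<phi> p \<in> S}"
proof -
  have "continuous_map (subtopology (mtop X) U) (top_of_set (\<phi> ` U)) \<phi>"
    using chart_homeo[OF X] homeomorphic_imp_continuous_map by blast
  moreover have "openin (top_of_set (\<phi> ` U)) (\<phi> ` U \<inter> S)"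
    using S chart_cspace[OF X] unfolding openin_open by blast
  ultimately have "openin (subtopology (mtop X) U) {p \<in> topspace (subtopology (mtop X) U). \<phi> p \<in> \<phi> ` U \<inter> S}"
    by (rule openin_continuous_map_preimage)
  moreover have "{p \<in> topspace (subtopology (mtop X) U). \<phi> p \<in> \<phi> ` U \<inter> S} = {p \<in> U. \<phi> p \<in> S}"
    using chart_sub[OF X] by auto
  ultimately show ?thesis
    using chart_open[OF X] openin_trans_full by metis
qed

lemma eventually_chart:
  assumes X: "complex_manifold X" "(U, \<phi>) \<in> atlas X" and W: "openin (mtop X) W" "p \<in> U" "p \<in> W"
  shows "\<forall>\<^sub>F x in cnhds (cidx X) (\<phi> p). x \<in> \<phi> ` U \<and> inv_into U \<phi> x \<in> U \<inter> W \<and> \<phi> (inv_into U \<phi> x) = x"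
  by (rule eventually_cnhds_openin[OF chart_image_openin[OF X W(1)]])
     (use W chart_inv[OF X] in auto)

section \<open>Differentiability at a point and holomorphy near it\<close>

text \<open>\<open>holo_at\<close> is differentiability on a neighbourhood; \<open>mdiff\<close> is the condition at a single point,
  which by \<open>mdiff_iff\<close> can be tested in any one chart.\<close>

definition mdiff :: "('p, 'j) cmfd \<Rightarrow> 'p \<Rightarrow> ('p \<Rightarrow> complex) \<Rightarrow> bool" where
  "mdiff X q h \<longleftrightarrow> (\<exists>(U, \<phi>)\<in>atlas X. q \<in> U \<and> cdiff_at (cidx X) (h \<circ> inv_into U \<phi>) (\<phi> q))"

lemma chart_change_cdiff:
  assumes X: "complex_manifold X" and U: "(U, \<phi>) \<in> atlas X" "q \<in> U" and V: "(V, \<psi>) \<in> atlas X" "q \<in> V"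
    and h: "cdiff_at (cidx X) (h \<circ> inv_into U \<phi>) (\<phi> q)"
  shows "cdiff_at (cidx X) (h \<circ> inv_into V \<psi>) (\<psi> q)"
proof -
  let ?J = "cidx X"
  let ?G = "\<lambda>x. \<phi> (inv_into V \<psi> x)"
  have ev: "\<forall>\<^sub>F x in cnhds ?J (\<psi> q). x \<in> \<psi> ` V \<and> inv_into V \<psi> x \<in> V \<inter> U \<and> \<psi> (inv_into V \<psi> x) = x"
    using eventually_chart[OF X V(1) chart_open[OF X U(1)]] U V by auto
  have Gq: "?G (\<psi> q) = \<phi> q" using chart_inv[OF X V] by simp
  have J: "finite ?J" using cidx_finite[OF X] .
  have x: "\<psi> q \<in> cspace ?J" using chart_cspace[OF X V] .
  have "cdiff_at ?J (\<lambda>x. (h \<circ> inv_into U \<phi>) (?G x)) (\<psi> q)"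
  proof (rule cdiff_at_compose[where G = ?G, OF _ x J J])
    show "cdiff_at ?J (h \<circ> inv_into U \<phi>) (?G (\<psi> q))" using h Gq by simp
    show "cdiff_at ?J (\<lambda>x. ?G x k) (\<psi> q)" if "k \<in> ?J" for k
      using chart_transition[OF X V(1) U(1) that] U V by (auto simp: holo_on_def)
    show "\<forall>\<^sub>F x in cnhds ?J (\<psi> q). ?G x \<in> cspace ?J"
      using ev by eventually_elim (auto intro: chart_cspace[OF X U(1)])
  qed
  then show ?thesis
  proof (rule cdiff_at_cong[OF _ _ x J])
    show "\<forall>\<^sub>F x in cnhds ?J (\<psi> q). (h \<circ> inv_into U \<phi>) (?G x) = (h \<circ> inv_into V \<psi>) x"
      using ev by eventually_elim (simp add: chart_inv[OF X U(1)])
  qed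
qed

lemma mdiff_iff:
  assumes X: "complex_manifold X" and U: "(U, \<phi>) \<in> atlas X" "q \<in> U"
  shows "mdiff X q h \<longleftrightarrow> cdiff_at (cidx X) (h \<circ> inv_into U \<phi>) (\<phi> q)"
  using chart_change_cdiff[OF X _ _ U] U unfolding mdiff_def by blast

lemma holo_at_iff_mdiff:
  assumes X: "complex_manifold X"
  shows "holo_at X p h \<longleftrightarrow> (\<exists>W. openin (mtop X) W \<and> p \<in> W \<and> (\<forall>q\<in>W. mdiff X q h))"
  unfolding holo_at_def
proof (intro iff_exI conj_cong refl iffI ballI)
  fix W q assume W: "openin (mtop X) W" and 
    *: "\<forall>(U, \<phi>)\<in>atlas X. holo_on (cidx X) (h \<circ> inv_into U \<phi>) (\<phi> ` (U \<inter> W))" and q: "q \<in> W"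
  then have "q \<in> points X" using openin_subset by blast
  then obtain U \<phi> where U: "(U, \<phi>) \<in> atlas X" "q \<in> U" using chart_ex[OF X] by blast
  then show "mdiff X q h" using * q unfolding mdiff_iff[OF X U] holo_on_def by blast
next
  fix W c assume "openin (mtop X) W" and 
    *: "\<forall>q\<in>W. mdiff X q h" and c: "c \<in> atlas X"
  obtain U \<phi> where [simp]: "c = (U, \<phi>)" by (cases c)
  show "case c of (U, \<phi>) \<Rightarrow> holo_on (cidx X) (h \<circ> inv_into U \<phi>) (\<phi> ` (U \<inter> W))"
    using * c mdiff_iff[OF X] by (auto simp: holo_on_def)
qed

lemma holo_at_imp_mdiff: "complex_manifold X \<Longrightarrow> holo_at X p h \<Longrightarrow> mdiff X p h"
  by (auto simp: holo_at_iff_mdiff)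

lemma holo_at_point: "holo_at X p h \<Longrightarrow> p \<in> points X"
  unfolding holo_at_def using openin_subset by blast

lemma holo_at_mono1:
  assumes X: "complex_manifold X" and f: "holo_at X p f" 
    and "\<And>q. q \<in> points X \<Longrightarrow> mdiff X q f \<Longrightarrow> mdiff X q k"
  shows "holo_at X p k"
proof -
  obtain W where W: "openin (mtop X) W" "p \<in> W" "\<forall>q\<in>W. mdiff X q f"
    using f unfolding holo_at_iff_mdiff[OF X] by blast
  then have "\<forall>q\<in>W. mdiff X q k" using assms(3) openin_subset[OF W(1)] by blast
  with W show ?thesis unfolding holo_at_iff_mdiff[OF X] by blast
qed

lemma holo_at_mono2:
  assumes X: "complex_manifold X" and f: "holo_at X p f" "holo_at X p g"
    and *: "\<And>q. q \<in> points X \<Longrightarrow> mdiff X q f \<Longrightarrow> mdiff X q g \<Longrightarrow> mdiff X q k"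
  shows "holo_at X p k"
proof -
  obtain W1 W2 where W: "openin (mtop X) W1" "p \<in> W1" "\<forall>q\<in>W1. mdiff X q f"
    "openin (mtop X) W2" "p \<in> W2" "\<forall>q\<in>W2. mdiff X q g"
    using f unfolding holo_at_iff_mdiff[OF X] by blast
  then have "openin (mtop X) (W1 \<inter> W2)" by blast
  moreover from this have "\<forall>q\<in>W1 \<inter> W2. mdiff X q k"
    using W * openin_subset[OF W(1)] by blast
  ultimately show ?thesis using W unfolding holo_at_iff_mdiff[OF X] by blast
qed

lemma mdiff_add:
  assumes X: "complex_manifold X" and q: "q \<in> points X" and "mdiff X q f" "mdiff X q g"
  shows "mdiff X q (\<lambda>x. f x + g x)"
proof -
  obtain U \<phi> where U: "(U, \<phi>) \<in> atlas X" "q \<in> U" using chart_ex[OF X q] by blast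
  show ?thesis using assms cdiff_at_add[OF _ _ cidx_finite[OF X] chart_cspace[OF X U]] 
    by (simp add: mdiff_iff[OF X U] comp_def)
qed

lemma mdiff_mult:
  assumes X: "complex_manifold X" and q: "q \<in> points X" and "mdiff X q f" "mdiff X q g"
  shows "mdiff X q (\<lambda>x. f x * g x)"
proof -
  obtain U \<phi> where U: "(U, \<phi>) \<in> atlas X" "q \<in> U" using chart_ex[OF X q] by blast
  show ?thesis using assms cdiff_at_mult[OF _ _ cidx_finite[OF X] chart_cspace[OF X U]] 
    by (simp add: mdiff_iff[OF X U] comp_def)
qed

lemma mdiff_inverse:
  assumes X: "complex_manifold X" and q: "q \<in> points X" and "mdiff X q f" "f q \<noteq> 0"
  shows "mdiff X q (\<lambda>x. inverse (f x))"
proof -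
  obtain U \<phi> where U: "(U, \<phi>) \<in> atlas X" "q \<in> U" using chart_ex[OF X q] by blast
  show ?thesis using assms cdiff_at_inverse[OF _ cidx_finite[OF X] chart_cspace[OF X U]] chart_inv[OF X U]
    by (simp add: mdiff_iff[OF X U] comp_def)
qed

lemma mdiff_const:
  assumes X: "complex_manifold X" and q: "q \<in> points X"
  shows "mdiff X q (\<lambda>x. c)"
proof -
  obtain U \<phi> where U: "(U, \<phi>) \<in> atlas X" "q \<in> U" using chart_ex[OF X q] by blast
  show ?thesis using cdiff_at_const by (simp add: mdiff_iff[OF X U] comp_def)
qed

lemma holo_at_const: "complex_manifold X \<Longrightarrow> p \<in> points X \<Longrightarrow> holo_at X p (\<lambda>_. c)"
  unfolding holo_at_iff_mdiff by (intro exI[of _ "points X"]) (simp add: mdiff_const)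

lemma holo_at_add:
  assumes X: "complex_manifold X" and f: "holo_at X p f" "holo_at X p g"
  shows "holo_at X p (\<lambda>x. f x + g x)"
  by (rule holo_at_mono2[OF X f]) (rule mdiff_add[OF X])

lemma holo_at_mult:
  assumes X: "complex_manifold X" and f: "holo_at X p f" "holo_at X p g"
  shows "holo_at X p (\<lambda>x. f x * g x)"
  by (rule holo_at_mono2[OF X f]) (rule mdiff_mult[OF X])

lemma holo_at_uminus:
  assumes "complex_manifold X" "holo_at X p f" 
  shows "holo_at X p (\<lambda>x. - f x)"
  using holo_at_mult[OF assms(1) holo_at_const[OF assms(1) holo_at_point[OF assms(2)], of "-1"] assms(2)] by simp

lemma holo_at_inverse:
  assumes X: "complex_manifold X" and f: "holo_at X p f" and 0: "\<And>q. q \<in> points X \<Longrightarrow> f q \<noteq> 0"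
  shows "holo_at X p (\<lambda>x. inverse (f x))"
  by (rule holo_at_mono1[OF X f]) (rule mdiff_inverse[OF X _ _ 0])

lemma holo_at_sum:
  assumes "complex_manifold X" "p \<in> points X"
  shows "(\<And>i. i \<in> I \<Longrightarrow> holo_at X p (f i)) \<Longrightarrow> holo_at X p (\<lambda>x. \<Sum>i\<in>I. f i x)"
  by (induction I rule: infinite_finite_induct) (auto intro!: holo_at_const holo_at_add assms)

lemma holo_at_prod:
  assumes "complex_manifold X" "p \<in> points X"
  shows "(\<And>i. i \<in> I \<Longrightarrow> holo_at X p (f i)) \<Longrightarrow> holo_at X p (\<lambda>x. \<Prod>i\<in>I. f i x)"
  by (induction I rule: infinite_finite_induct) (auto intro!: holo_at_const holo_at_mult assms)

lemma mdiff_cong: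
  assumes X: "complex_manifold X" and f: "mdiff X q f" 
    and W: "openin (mtop X) W" "q \<in> W" and eq: "\<And>r. r \<in> W \<Longrightarrow> f r = g r"
  shows "mdiff X q g"
proof -
  have q: "q \<in> points X" using W openin_subset by blast
  obtain U \<phi> where U: "(U, \<phi>) \<in> atlas X" "q \<in> U" using chart_ex[OF X q] by blast
  show ?thesis using f unfolding mdiff_iff[OF X U]
  proof (rule cdiff_at_cong[OF _ _ chart_cspace[OF X U] cidx_finite[OF X]])
    show "\<forall>\<^sub>F y in cnhds (cidx X) (\<phi> q). (f \<circ> inv_into U \<phi>) y = (g \<circ> inv_into U \<phi>) y"
      using eventually_chart[OF X U(1) W(1) U(2) W(2)] by eventually_elim (simp add: eq)
  qed
qed

lemma holo_at_cong_open:
  assumes X: "complex_manifold X" and f: "holo_at X p f" 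
    and W: "openin (mtop X) W" "p \<in> W" and eq: "\<And>q. q \<in> W \<Longrightarrow> f q = g q"
  shows "holo_at X p g"
proof -
  obtain W' where W': "openin (mtop X) W'" "p \<in> W'" "\<forall>q\<in>W'. mdiff X q f"
    using f unfolding holo_at_iff_mdiff[OF X] by blast
  then have o: "openin (mtop X) (W \<inter> W')" using W by blast
  have "\<forall>q\<in>W \<inter> W'. mdiff X q g"
    using mdiff_cong[OF X _ o] W' eq by blast
  with o show ?thesis using W W' unfolding holo_at_iff_mdiff[OF X] by blast
qed

lemma holo_at_cong:
  assumes X: "complex_manifold X" and f: "holo_at X p f" 
    and eq: "\<And>q. q \<in> points X \<Longrightarrow> f q = g q"
  shows "holo_at X p g"
  using holo_at_cong_open[OF X f openin_topspace holo_at_point[OF f] eq] .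

lemma chart_coord_mdiff:
  assumes X: "complex_manifold X" and U: "(U, \<phi>) \<in> atlas X" "q \<in> U" and "j \<in> cidx X"
  shows "mdiff X q (\<lambda>q. \<phi> q j)"
  unfolding mdiff_iff[OF X U] using chart_transition[OF X U(1) U(1) assms(4)] U 
  by (auto simp: holo_on_def comp_def)

lemma chart_coord_holo:
  assumes X: "complex_manifold X" and U: "(U, \<phi>) \<in> atlas X" "p \<in> U" and "j \<in> cidx X"
  shows "holo_at X p (\<lambda>q. \<phi> q j)"
  unfolding holo_at_iff_mdiff[OF X]
  by (intro exI[of _ U]) (simp add: chart_coord_mdiff[OF X U(1) _ assms(4)] chart_open[OF X U(1)] U(2))

section \<open>Holomorphic maps and their composition\<close>

lemma mdiff_compose:
  assumes X: "complex_manifold X" and Y: "complex_manifold Y" 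
    and F: "continuous_map (mtop X) (mtop Y) F" and q: "q \<in> points X"
    and V: "(V, \<psi>) \<in> atlas Y" "F q \<in> V" and h: "mdiff Y (F q) h"
    and d: "\<And>k. k \<in> cidx Y \<Longrightarrow> mdiff X q (\<lambda>q. \<psi> (F q) k)"
  shows "mdiff X q (h \<circ> F)"
proof -
  obtain U \<phi> where U: "(U, \<phi>) \<in> atlas X" "q \<in> U" using chart_ex[OF X q] by blast
  let ?J = "cidx X" and ?K = "cidx Y"
  let ?G = "\<lambda>x. \<psi> (F (inv_into U \<phi> x))"
  have "openin (mtop X) {p \<in> points X. F p \<in> V}"
    using F chart_open[OF Y V(1)] by (rule openin_continuous_map_preimage)
  from eventually_chart[OF X U(1) this U(2)] q V
  have ev: "\<forall>\<^sub>F x in cnhds ?J (\<phi> q). x \<in> \<phi> ` U \<and> inv_into U \<phi> x \<in> U \<and> F (inv_into U \<phi> x) \<in> V"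
    by (auto elim: eventually_mono)
  have Gq: "?G (\<phi> q) = \<psi> (F q)" using chart_inv[OF X U] by simp
  have x: "\<phi> q \<in> cspace ?J" using chart_cspace[OF X U] .
  have "cdiff_at ?J (\<lambda>x. (h \<circ> inv_into V \<psi>) (?G x)) (\<phi> q)"
  proof (rule cdiff_at_compose[where G = ?G, OF _ x cidx_finite[OF X] cidx_finite[OF Y]])
    show "cdiff_at ?K (h \<circ> inv_into V \<psi>) (?G (\<phi> q))" using h Gq mdiff_iff[OF Y V] by simp
    show "cdiff_at ?J (\<lambda>x. ?G x k) (\<phi> q)" if "k \<in> ?K" for k
      using d[OF that] mdiff_iff[OF X U] by (auto simp: comp_def)
    show "\<forall>\<^sub>F x in cnhds ?J (\<phi> q). ?G x \<in> cspace ?K"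
      using ev by eventually_elim (auto intro: chart_cspace[OF Y V(1)])
  qed
  then show ?thesis unfolding mdiff_iff[OF X U]
  proof (rule cdiff_at_cong[OF _ _ x cidx_finite[OF X]])
    show "\<forall>\<^sub>F x in cnhds ?J (\<phi> q). (h \<circ> inv_into V \<psi>) (?G x) = (h \<circ> F \<circ> inv_into U \<phi>) x"
      using ev by eventually_elim (simp add: chart_inv[OF Y V(1)])
  qed
qed

lemma holomorphic_map_continuous: "holomorphic_map X Y F \<Longrightarrow> continuous_map (mtop X) (mtop Y) F"
  by (simp add: holomorphic_map_def)

lemma holomorphic_map_points: "holomorphic_map X Y F \<Longrightarrow> p \<in> points X \<Longrightarrow> F p \<in> points Y"
  using holomorphic_map_continuous continuous_map_image_subset_topspace by blast

lemma holomorphic_map_coord_mdiff: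
  assumes X: "complex_manifold X" and F: "holomorphic_map X Y F"
    and V: "(V, \<psi>) \<in> atlas Y" "F q \<in> V" and q: "q \<in> points X" and k: "k \<in> cidx Y"
  shows "mdiff X q (\<lambda>q. \<psi> (F q) k)"
proof -
  obtain U \<phi> where U: "(U, \<phi>) \<in> atlas X" "q \<in> U" using chart_ex[OF X q] by blast
  then have "holo_on (cidx X) (\<lambda>x. \<psi> (F (inv_into U \<phi> x)) k) (\<phi> ` (U \<inter> F -` V))"
    using F V k unfolding holomorphic_map_def by blast
  then show ?thesis unfolding mdiff_iff[OF X U] using V U by (auto simp: holo_on_def comp_def)
qed

lemma holomorphic_map_mdiff:
  assumes X: "complex_manifold X" and Y: "complex_manifold Y" and F: "holomorphic_map X Y F"
    and h: "mdiff Y (F q) h" and q: "q \<in> points X"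
  shows "mdiff X q (h \<circ> F)"
proof -
  obtain V \<psi> where V: "(V, \<psi>) \<in> atlas Y" "F q \<in> V"
    using chart_ex[OF Y holomorphic_map_points[OF F q]] by blast
  show ?thesis
    by (rule mdiff_compose[OF X Y holomorphic_map_continuous[OF F] q V h])
       (rule holomorphic_map_coord_mdiff[OF X F V q])
qed

lemma holo_at_compose:
  assumes X: "complex_manifold X" and Y: "complex_manifold Y" and F: "holomorphic_map X Y F"
    and h: "holo_at Y (F p) h" and p: "p \<in> points X"
  shows "holo_at X p (h \<circ> F)"
proof -
  obtain W where W: "openin (mtop Y) W" "F p \<in> W" "\<forall>q\<in>W. mdiff Y q h"
    using h unfolding holo_at_iff_mdiff[OF Y] by blast
  have "openin (mtop X) {q \<in> points X. F q \<in> W}"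
    using holomorphic_map_continuous[OF F] W(1) by (rule openin_continuous_map_preimage)
  moreover have "\<forall>q\<in>{q \<in> points X. F q \<in> W}. mdiff X q (h \<circ> F)"
    using W by (simp add: holomorphic_map_mdiff[OF X Y F])
  ultimately show ?thesis using W p unfolding holo_at_iff_mdiff[OF X] by blast
qed

text \<open>The definition of \<open>holomorphic_map\<close> ranges over all pairs of charts. Since
  transition maps are differentiable and \<open>F\<close> is continuous, one target chart around
  each image point decides for all of them.\<close>

lemma holomorphic_mapI:
  assumes X: "complex_manifold X" and Y: "complex_manifold Y" 
    and F: "continuous_map (mtop X) (mtop Y) F"
    and *: "\<And>p. p \<in> points X \<Longrightarrow> \<exists>(V, \<psi>)\<in>atlas Y. F p \<in> V \<and> (\<forall>k\<in>cidx Y. holo_at X p (\<lambda>q. \<psi> (F q) k))"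
  shows "holomorphic_map X Y F"
  unfolding holomorphic_map_def
proof (intro conjI F, clarify)
  fix U \<phi> V' \<psi>' k assume U: "(U, \<phi>) \<in> atlas X" and V': "(V', \<psi>') \<in> atlas Y" and k: "k \<in> cidx Y"
  show "holo_on (cidx X) (\<lambda>x. \<psi>' (F (inv_into U \<phi> x)) k) (\<phi> ` (U \<inter> F -` V'))"
    unfolding holo_on_def
  proof clarify
    fix q assume q: "q \<in> U" "F q \<in> V'"
    have qX: "q \<in> points X" using chart_point[OF X U] q by blast
    obtain V \<psi> where V: "(V, \<psi>) \<in> atlas Y" "F q \<in> V" "\<forall>k\<in>cidx Y. holo_at X q (\<lambda>q. \<psi> (F q) k)"
      using *[OF qX] by auto
    have "mdiff X q ((\<lambda>r. \<psi>' r k) \<circ> F)"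
      by (rule mdiff_compose[OF X Y F qX V(1,2)])
         (use chart_coord_mdiff[OF Y V' q(2) k] V holo_at_imp_mdiff[OF X] in auto)
    then show "cdiff_at (cidx X) (\<lambda>x. \<psi>' (F (inv_into U \<phi> x)) k) (\<phi> q)"
      unfolding mdiff_iff[OF X U q(1)] by (simp add: comp_def)
  qed
qed

lemma holomorphic_map_coord_holo:
  assumes X: "complex_manifold X" and Y: "complex_manifold Y" and F: "holomorphic_map X Y F"
    and V: "(V, \<psi>) \<in> atlas Y" "F p \<in> V" and p: "p \<in> points X" and k: "k \<in> cidx Y"
  shows "holo_at X p (\<lambda>q. \<psi> (F q) k)"
  using holo_at_compose[OF X Y F chart_coord_holo[OF Y V k] p] by (simp add: comp_def)

lemma holomorphic_map_compose:
  assumes X: "complex_manifold X" and Y: "complex_manifold Y" and Z: "complex_manifold Z"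
    and F: "holomorphic_map X Y F" and G: "holomorphic_map Y Z G"
  shows "holomorphic_map X Z (G \<circ> F)"
proof (rule holomorphic_mapI[OF X Z])
  show "continuous_map (mtop X) (mtop Z) (G \<circ> F)"
    using holomorphic_map_continuous[OF F] holomorphic_map_continuous[OF G] by (rule continuous_map_compose)
  fix p assume p: "p \<in> points X"
  obtain V \<psi> where V: "(V, \<psi>) \<in> atlas Z" "G (F p) \<in> V"
    using chart_ex[OF Z holomorphic_map_points[OF G holomorphic_map_points[OF F p]]] by blast
  have "holo_at X p (\<lambda>q. \<psi> ((G \<circ> F) q) k)" if "k \<in> cidx Z" for k
    using holo_at_compose[OF X Y F holomorphic_map_coord_holo[OF Y Z G V holomorphic_map_points[OF F p] that] p]
    by (simp add: comp_def)
  then show "\<exists>(V, \<psi>)\<in>atlas Z. (G \<circ> F) p \<in> V \<and> (\<forall>k\<in>cidx Z. holo_at X p (\<lambda>q. \<psi> ((G \<circ> F) q) k))"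
    using V by auto
qed

lemma holomorphic_map_cong:
  assumes X: "complex_manifold X" and Y: "complex_manifold Y" 
    and F: "holomorphic_map X Y F" and eq: "\<And>p. p \<in> points X \<Longrightarrow> F p = G p"
  shows "holomorphic_map X Y G"
proof (rule holomorphic_mapI[OF X Y])
  show "continuous_map (mtop X) (mtop Y) G"
    using holomorphic_map_continuous[OF F] eq by (rule continuous_map_eq)
  fix p assume p: "p \<in> points X"
  obtain V \<psi> where V: "(V, \<psi>) \<in> atlas Y" "F p \<in> V"
    using chart_ex[OF Y holomorphic_map_points[OF F p]] by blast
  have "holo_at X p (\<lambda>q. \<psi> (G q) k)" if "k \<in> cidx Y" for k
    using holo_at_cong[OF X holomorphic_map_coord_holo[OF X Y F V p that], of "\<lambda>q. \<psi> (G q) k"] eq by simp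
  then show "\<exists>(V, \<psi>)\<in>atlas Y. G p \<in> V \<and> (\<forall>k\<in>cidx Y. holo_at X p (\<lambda>q. \<psi> (G q) k))"
    using V eq[OF p] by auto
qed

lemma holomorphic_map_id:
  assumes X: "complex_manifold X"
  shows "holomorphic_map X X id"
proof (rule holomorphic_mapI[OF X X])
  fix p assume p: "p \<in> points X"
  obtain V \<psi> where V: "(V, \<psi>) \<in> atlas X" "p \<in> V" using chart_ex[OF X p] by blast
  then show "\<exists>(V, \<psi>)\<in>atlas X. id p \<in> V \<and> (\<forall>k\<in>cidx X. holo_at X p (\<lambda>q. \<psi> (id q) k))"
    using chart_coord_holo[OF X V] by auto
qed auto

section \<open>Tangent vectors\<close>

lemma coord_vec_holo: "holo_at X p h \<Longrightarrow> coord_vec X U \<phi> j p h = partial j (h \<circ> inv_into U \<phi>) (\<phi> p)"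
  and coord_vec_not_holo: "\<not> holo_at X p h \<Longrightarrow> coord_vec X U \<phi> j p h = 0"
  by (simp_all add: coord_vec_def)

lemma coord_vec_change:
  assumes X: "complex_manifold X" and U: "(U, \<phi>) \<in> atlas X" "p \<in> U" and V: "(V, \<psi>) \<in> atlas X" "p \<in> V"
    and k: "k \<in> cidx X"
  shows "coord_vec X V \<psi> k p h =
    (\<Sum>j\<in>cidx X. partial k (\<lambda>x. \<phi> (inv_into V \<psi> x) j) (\<psi> p) * coord_vec X U \<phi> j p h)"
proof (cases "holo_at X p h")
  case False
  then show ?thesis by (simp add: coord_vec_def)
next
  case True
  let ?J = "cidx X"
  let ?G = "\<lambda>x. \<phi> (inv_into V \<psi> x)"
  have ev: "\<forall>\<^sub>F x in cnhds ?J (\<psi> p). x \<in> \<psi> ` V \<and> inv_into V \<psi> x \<in> V \<inter> U \<and> \<psi> (inv_into V \<psi> x) = x"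
    using eventually_chart[OF X V(1) chart_open[OF X U(1)]] U V by auto
  have Gq: "?G (\<psi> p) = \<phi> p" using chart_inv[OF X V] by simp
  have J: "finite ?J" using cidx_finite[OF X] .
  have x: "\<psi> p \<in> cspace ?J" using chart_cspace[OF X V] .
  have "partial k (h \<circ> inv_into V \<psi>) (\<psi> p) = partial k (\<lambda>x. (h \<circ> inv_into U \<phi>) (?G x)) (\<psi> p)"
  proof (rule partial_cong[OF _ x k])
    show "\<forall>\<^sub>F x in cnhds ?J (\<psi> p). (h \<circ> inv_into V \<psi>) x = (h \<circ> inv_into U \<phi>) (?G x)"
      using ev by eventually_elim (simp add: chart_inv[OF X U(1)])
  qed
  also have "\<dots> = (\<Sum>j\<in>?J. partial j (h \<circ> inv_into U \<phi>) (?G (\<psi> p)) * partial k (\<lambda>x. ?G x j) (\<psi> p))"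
  proof (rule partial_compose[where G = ?G, OF _ x J J _ _ k])
    show "cdiff_at ?J (h \<circ> inv_into U \<phi>) (?G (\<psi> p))" 
      using holo_at_imp_mdiff[OF X True] Gq mdiff_iff[OF X U] by simp
    show "cdiff_at ?J (\<lambda>x. ?G x k) (\<psi> p)" if "k \<in> ?J" for k
      using chart_transition[OF X V(1) U(1) that] U V by (auto simp: holo_on_def)
    show "\<forall>\<^sub>F x in cnhds ?J (\<psi> p). ?G x \<in> cspace ?J"
      using ev by eventually_elim (auto intro: chart_cspace[OF X U(1)])
  qed
  finally show ?thesis by (simp add: coord_vec_holo[OF True] Gq mult.commute)
qed

lemma tangentI:
  "(U, \<phi>) \<in> atlas X \<Longrightarrow> p \<in> U \<Longrightarrow> (\<lambda>h. \<Sum>j\<in>cidx X. a j * coord_vec X U \<phi> j p h) \<in> tangent_space X p"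
  unfolding tangent_space_def by blast

text \<open>\<open>tangent_space\<close> is a union over all charts at \<open>p\<close>. The change
  of coordinates shows that every single chart already yields all of it, which is what makes sums of
  tangent vectors tangent vectors.\<close>

lemma tangent_chart:
  assumes X: "complex_manifold X" and U: "(U, \<phi>) \<in> atlas X" "p \<in> U" and v: "v \<in> tangent_space X p"
  obtains a where "v = (\<lambda>h. \<Sum>j\<in>cidx X. a j * coord_vec X U \<phi> j p h)"
proof -
  obtain b V \<psi> where v: "v = (\<lambda>h. \<Sum>k\<in>cidx X. b k * coord_vec X V \<psi> k p h)" and V: "(V, \<psi>) \<in> atlas X" "p \<in> V"
    using v unfolding tangent_space_def by blast
  have "v h = (\<Sum>j\<in>cidx X. (\<Sum>k\<in>cidx X. b k * partial k (\<lambda>x. \<phi> (inv_into V \<psi> x) j) (\<psi> p)) * coord_vec X U \<phi> j p h)" for h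
    unfolding v using coord_vec_change[OF X U V]
    by (simp add: sum_distrib_left sum_distrib_right mult.assoc) (rule sum.swap)
  then have "v = (\<lambda>h. \<Sum>j\<in>cidx X. (\<Sum>k\<in>cidx X. b k * partial k (\<lambda>x. \<phi> (inv_into V \<psi> x) j) (\<psi> p)) * coord_vec X U \<phi> j p h)"
    by (rule ext)
  then show ?thesis by (rule that)
qed

lemma tangent_not_holo: "v \<in> tangent_space X p \<Longrightarrow> \<not> holo_at X p h \<Longrightarrow> v h = 0"
  unfolding tangent_space_def by (auto simp: coord_vec_def)

lemma tangent_linear:
  assumes X: "complex_manifold X" and p: "p \<in> points X" and "u \<in> tangent_space X p" "v \<in> tangent_space X p"
  shows "(\<lambda>h. u h + c * v h) \<in> tangent_space X p"
proof -
  obtain U \<phi> where U: "(U, \<phi>) \<in> atlas X" "p \<in> U" using chart_ex[OF X p] by blast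
  obtain a where a: "u = (\<lambda>h. \<Sum>j\<in>cidx X. a j * coord_vec X U \<phi> j p h)"
    using tangent_chart[OF X U assms(3)] by blast
  obtain b where b: "v = (\<lambda>h. \<Sum>j\<in>cidx X. b j * coord_vec X U \<phi> j p h)"
    using tangent_chart[OF X U assms(4)] by blast
  have "(\<lambda>h. u h + c * v h) = (\<lambda>h. \<Sum>j\<in>cidx X. (a j + c * b j) * coord_vec X U \<phi> j p h)"
    by (rule ext) (simp add: a b sum.distrib sum_distrib_left distrib_right mult.assoc)
  then show ?thesis using tangentI[OF U] by simp
qed

lemma curve_chain:
  assumes X: "complex_manifold X" and U: "(U, \<phi>) \<in> atlas X" "\<gamma> 0 \<in> U"
    and ev: "\<forall>\<^sub>F t in nhds 0. \<gamma> t \<in> U"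
    and d: "\<And>j. j \<in> cidx X \<Longrightarrow> ((\<lambda>t. \<phi> (\<gamma> t) j) has_field_derivative d j) (at 0)"
    and h: "holo_at X (\<gamma> 0) h"
  shows "((\<lambda>t. h (\<gamma> t)) has_field_derivative (\<Sum>j\<in>cidx X. d j * coord_vec X U \<phi> j (\<gamma> 0) h)) (at 0)"
proof -
  have "((\<lambda>t. (h \<circ> inv_into U \<phi>) (\<phi> (\<gamma> t))) has_field_derivative
      (\<Sum>j\<in>cidx X. partial j (h \<circ> inv_into U \<phi>) (\<phi> (\<gamma> 0)) * d j)) (at 0)"
  proof (rule cdiff_at_curve[where \<gamma> = "\<lambda>t. \<phi> (\<gamma> t)", OF _ _ cidx_finite[OF X] d])
    show "cdiff_at (cidx X) (h \<circ> inv_into U \<phi>) (\<phi> (\<gamma> 0))"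
      using holo_at_imp_mdiff[OF X h] mdiff_iff[OF X U] by simp
    show "\<phi> (\<gamma> 0) \<in> cspace (cidx X)" using chart_cspace[OF X U] .
    have "\<forall>\<^sub>F t in at 0. \<gamma> t \<in> U" using ev eventually_nhds_conv_at by blast
    then show "\<forall>\<^sub>F t in at 0. \<phi> (\<gamma> t) \<in> cspace (cidx X)"
      by eventually_elim (rule chart_cspace[OF X U(1)])
  qed
  moreover have "\<forall>\<^sub>F t in nhds 0. (h \<circ> inv_into U \<phi>) (\<phi> (\<gamma> t)) = h (\<gamma> t)"
    using ev by eventually_elim (simp add: chart_inv[OF X U(1)])
  ultimately show ?thesis
    by (subst DERIV_cong_ev[OF refl _ refl, symmetric]) (auto simp: coord_vec_holo[OF h] mult.commute)
qed

text \<open>Every tangent vector is the velocity of a curve. This reduces the derivation rules to the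
  rules for functions of one complex variable.\<close>

lemma tangent_curve:
  fixes X :: "('p, 'j) cmfd"
  assumes X: "complex_manifold X" and p: "p \<in> points X" and v: "v \<in> tangent_space X p"
  obtains \<gamma> :: "complex \<Rightarrow> 'p" where "\<gamma> 0 = p" "\<And>W. openin (mtop X) W \<Longrightarrow> p \<in> W \<Longrightarrow> \<forall>\<^sub>F t in nhds 0. \<gamma> t \<in> W"
    "\<And>h. holo_at X p h \<Longrightarrow> ((\<lambda>t. h (\<gamma> t)) has_field_derivative v h) (at 0)"
proof -
  obtain U \<phi> where U: "(U, \<phi>) \<in> atlas X" "p \<in> U" using chart_ex[OF X p] by blast
  obtain a where a: "v = (\<lambda>h. \<Sum>j\<in>cidx X. a j * coord_vec X U \<phi> j p h)"
    using tangent_chart[OF X U v] by blast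
  \<comment> \<open>The straight line with velocity \<open>a\<close> in coordinates. It is cut to 0
    outside \<open>cidx X\<close> because \<open>a\<close> is arbitrary there, while the line has to
    stay in \<open>cspace (cidx X)\<close>.\<close>
  define c where "c t = (\<lambda>j. if j \<in> cidx X then \<phi> p j + t * a j else 0)" for t
  define \<gamma> where "\<gamma> t = inv_into U \<phi> (c t)" for t
  have x: "\<phi> p \<in> cspace (cidx X)" using chart_cspace[OF X U] .
  then have c0: "c 0 = \<phi> p" by (auto simp: c_def cspace_def)
  have cc: "c t \<in> cspace (cidx X)" for t by (simp add: c_def cspace_def)
  have "filterlim c (cnhds (cidx X) (\<phi> p)) (nhds 0)"
  proof (rule filterlim_cnhds[OF x])
    fix j assume j: "j \<in> cidx X"
    have "((\<lambda>t. \<phi> p j + t * a j) \<longlongrightarrow> \<phi> p j + 0 * a j) (nhds 0)"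
      by (intro tendsto_intros filterlim_ident)
    then show "((\<lambda>t. c t j) \<longlongrightarrow> \<phi> p j) (nhds 0)" using j by (simp add: c_def)
  qed (use cc in auto)
  note lim = eventually_compose_filterlim[OF _ this]
  have \<gamma>0: "\<gamma> 0 = p" by (simp add: \<gamma>_def c0 chart_inv[OF X U])
  have ev: "\<forall>\<^sub>F t in nhds 0. c t \<in> \<phi> ` U \<and> \<gamma> t \<in> U \<inter> W \<and> \<phi> (\<gamma> t) = c t" 
    if "openin (mtop X) W" "p \<in> W" for W
    unfolding \<gamma>_def by (rule lim[OF eventually_chart[OF X U(1) that(1) U(2) that(2)]])
  have evU: "\<forall>\<^sub>F t in nhds 0. \<gamma> t \<in> U" and \<phi>\<gamma>: "\<forall>\<^sub>F t in nhds 0. \<phi> (\<gamma> t) = c t"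
    using ev[OF chart_open[OF X U(1)] U(2)] by (auto elim: eventually_mono)
  show ?thesis
  proof (rule that[of \<gamma>, OF \<gamma>0])
    show "\<forall>\<^sub>F t in nhds 0. \<gamma> t \<in> W" if "openin (mtop X) W" "p \<in> W" for W
      using ev[OF that] by (auto elim: eventually_mono)
    fix h assume h: "holo_at X p h"
    have "((\<lambda>t. h (\<gamma> t)) has_field_derivative (\<Sum>j\<in>cidx X. a j * coord_vec X U \<phi> j (\<gamma> 0) h)) (at 0)"
    proof (rule curve_chain[OF X U(1) _ evU])
      fix j assume j: "j \<in> cidx X"
      have "((\<lambda>t. c t j) has_field_derivative a j) (at 0)"
        using j by (auto simp: c_def intro!: derivative_eq_intros)
      then show "((\<lambda>t. \<phi> (\<gamma> t) j) has_field_derivative a j) (at 0)"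
        by (rule DERIV_cong_ev[THEN iffD1, OF refl _ refl, rotated]) (use \<phi>\<gamma> in \<open>auto elim: eventually_mono\<close>)
    qed (use U h \<gamma>0 in auto)
    then show "((\<lambda>t. h (\<gamma> t)) has_field_derivative v h) (at 0)" by (simp add: a \<gamma>0)
  qed
qed

lemma tangent_add:
  fixes X :: "('p, 'j) cmfd"
  assumes X: "complex_manifold X" and p: "p \<in> points X" and v: "v \<in> tangent_space X p"
    and f: "holo_at X p f" and g: "holo_at X p g"
  shows "v (\<lambda>x. f x + g x) = v f + v g"
proof -
  obtain \<gamma> :: "complex \<Rightarrow> 'p" where \<gamma>0: "\<gamma> 0 = p" and \<gamma>W: "\<And>W. openin (mtop X) W \<Longrightarrow> p \<in> W \<Longrightarrow> \<forall>\<^sub>F t in nhds 0. \<gamma> t \<in> W"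
    and \<gamma>D: "\<And>h. holo_at X p h \<Longrightarrow> ((\<lambda>t. h (\<gamma> t)) has_field_derivative v h) (at 0)"
    by (fact tangent_curve[OF X p v])
  show ?thesis
    using DERIV_unique[OF \<gamma>D[OF holo_at_add[OF X f g]] DERIV_add[OF \<gamma>D[OF f] \<gamma>D[OF g]]] .
qed

lemma tangent_mult:
  fixes X :: "('p, 'j) cmfd"
  assumes X: "complex_manifold X" and p: "p \<in> points X" and v: "v \<in> tangent_space X p"
    and f: "holo_at X p f" and g: "holo_at X p g"
  shows "v (\<lambda>x. f x * g x) = v f * g p + f p * v g"
proof -
  obtain \<gamma> :: "complex \<Rightarrow> 'p" where \<gamma>0: "\<gamma> 0 = p" and \<gamma>W: "\<And>W. openin (mtop X) W \<Longrightarrow> p \<in> W \<Longrightarrow> \<forall>\<^sub>F t in nhds 0. \<gamma> t \<in> W"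
    and \<gamma>D: "\<And>h. holo_at X p h \<Longrightarrow> ((\<lambda>t. h (\<gamma> t)) has_field_derivative v h) (at 0)"
    by (fact tangent_curve[OF X p v])
  show ?thesis
    using DERIV_unique[OF \<gamma>D[OF holo_at_mult[OF X f g]] DERIV_mult[OF \<gamma>D[OF f] \<gamma>D[OF g]]] \<gamma>0 
    by (simp add: mult.commute)
qed

lemma tangent_const:
  fixes X :: "('p, 'j) cmfd"
  assumes X: "complex_manifold X" and p: "p \<in> points X" and v: "v \<in> tangent_space X p"
  shows "v (\<lambda>x. c) = 0"
proof -
  obtain \<gamma> :: "complex \<Rightarrow> 'p" where \<gamma>0: "\<gamma> 0 = p" and \<gamma>W: "\<And>W. openin (mtop X) W \<Longrightarrow> p \<in> W \<Longrightarrow> \<forall>\<^sub>F t in nhds 0. \<gamma> t \<in> W"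
    and \<gamma>D: "\<And>h. holo_at X p h \<Longrightarrow> ((\<lambda>t. h (\<gamma> t)) has_field_derivative v h) (at 0)"
    by (fact tangent_curve[OF X p v])
  show ?thesis
    using DERIV_unique[OF \<gamma>D[OF holo_at_const[OF X p]] DERIV_const] .
qed

lemma tangent_sum:
  assumes X: "complex_manifold X" and p: "p \<in> points X" and v: "v \<in> tangent_space X p"
  shows "(\<And>i. i \<in> I \<Longrightarrow> holo_at X p (f i)) \<Longrightarrow> v (\<lambda>x. \<Sum>i\<in>I. f i x) = (\<Sum>i\<in>I. v (f i))"
  by (induction I rule: infinite_finite_induct)
     (simp_all add: tangent_const[OF X p v] tangent_add[OF X p v] holo_at_sum[OF X p])

text \<open>Locality of tangent vectors. If \<open>f\<close> is not holomorphic near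
  \<open>p\<close>, neither is \<open>g\<close>, and both values are 0 by the convention on tangent
  functionals.\<close>

lemma tangent_cong_open:
  fixes X :: "('p, 'j) cmfd"
  assumes X: "complex_manifold X" and p: "p \<in> points X" and v: "v \<in> tangent_space X p"
    and W: "openin (mtop X) W" "p \<in> W" and eq: "\<And>q. q \<in> W \<Longrightarrow> f q = g q"
  shows "v f = v g"
proof (cases "holo_at X p f")
  case True
  then have g: "holo_at X p g" by (rule holo_at_cong_open[OF X _ W eq])
  obtain \<gamma> :: "complex \<Rightarrow> 'p" where \<gamma>0: "\<gamma> 0 = p" and \<gamma>W: "\<And>W. openin (mtop X) W \<Longrightarrow> p \<in> W \<Longrightarrow> \<forall>\<^sub>F t in nhds 0. \<gamma> t \<in> W"
    and \<gamma>D: "\<And>h. holo_at X p h \<Longrightarrow> ((\<lambda>t. h (\<gamma> t)) has_field_derivative v h) (at 0)"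
    by (fact tangent_curve[OF X p v])
  have "((\<lambda>t. g (\<gamma> t)) has_field_derivative v f) (at 0)"
    using \<gamma>D[OF True]
    by (rule DERIV_cong_ev[THEN iffD1, OF refl _ refl, rotated]) (use \<gamma>W[OF W] eq in \<open>auto elim: eventually_mono\<close>)
  from DERIV_unique[OF this \<gamma>D[OF g]] show ?thesis .
next
  case False
  then have "\<not> holo_at X p g" using holo_at_cong_open[OF X _ W, of g f] eq by auto
  with False show ?thesis using tangent_not_holo[OF v] by simp
qed

lemma tangent_cong:
  assumes X: "complex_manifold X" and p: "p \<in> points X" and v: "v \<in> tangent_space X p"
    and eq: "\<And>q. q \<in> points X \<Longrightarrow> f q = g q"
  shows "v f = v g"
  by (rule tangent_cong_open[OF X p v openin_topspace p eq])

text \<open>If a curve has velocity \<open>v\<close>, its image under \<open>F\<close> has the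
  coordinate velocities on the right-hand side; differentiating \<open>h\<close> along the image
  curve in two ways gives the formula. It is the coordinate expression of the differential.\<close>

lemma differential_chain:
  fixes X :: "('p, 'j) cmfd"
  assumes X: "complex_manifold X" and Y: "complex_manifold Y" and F: "holomorphic_map X Y F"
    and p: "p \<in> points X" and v: "v \<in> tangent_space X p"
    and V: "(V, \<psi>) \<in> atlas Y" "F p \<in> V" and h: "holo_at Y (F p) h"
  shows "v (h \<circ> F) = (\<Sum>k\<in>cidx Y. v (\<lambda>q. \<psi> (F q) k) * coord_vec Y V \<psi> k (F p) h)"
proof -
  obtain \<gamma> :: "complex \<Rightarrow> 'p" where \<gamma>0: "\<gamma> 0 = p" and \<gamma>W: "\<And>W. openin (mtop X) W \<Longrightarrow> p \<in> W \<Longrightarrow> \<forall>\<^sub>F t in nhds 0. \<gamma> t \<in> W"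
    and \<gamma>D: "\<And>h. holo_at X p h \<Longrightarrow> ((\<lambda>t. h (\<gamma> t)) has_field_derivative v h) (at 0)"
    by (fact tangent_curve[OF X p v])
  have "openin (mtop X) {q \<in> points X. F q \<in> V}"
    using holomorphic_map_continuous[OF F] chart_open[OF Y V(1)] by (rule openin_continuous_map_preimage)
  from \<gamma>W[OF this] p V have ev: "\<forall>\<^sub>F t in nhds 0. F (\<gamma> t) \<in> V" by (auto elim: eventually_mono)
  have "((\<lambda>t. h (F (\<gamma> t))) has_field_derivative
      (\<Sum>k\<in>cidx Y. v (\<lambda>q. \<psi> (F q) k) * coord_vec Y V \<psi> k (F (\<gamma> 0)) h)) (at 0)"
  proof (rule curve_chain[where \<gamma> = "\<lambda>t. F (\<gamma> t)", OF Y V(1) _ ev])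
    fix k assume k: "k \<in> cidx Y"
    show "((\<lambda>t. \<psi> (F (\<gamma> t)) k) has_field_derivative v (\<lambda>q. \<psi> (F q) k)) (at 0)"
      by (rule \<gamma>D[OF holomorphic_map_coord_holo[OF X Y F V p k]])
  qed (use V h \<gamma>0 in auto)
  moreover have "((\<lambda>t. h (F (\<gamma> t))) has_field_derivative v (h \<circ> F)) (at 0)"
    using \<gamma>D[OF holo_at_compose[OF X Y F h p]] by simp
  ultimately show ?thesis unfolding \<gamma>0 by (rule DERIV_unique[rotated])
qed

lemma differential_tangent:
  assumes X: "complex_manifold X" and Y: "complex_manifold Y" and F: "holomorphic_map X Y F"
    and p: "p \<in> points X" and v: "v \<in> tangent_space X p"
  shows "differential Y F p v \<in> tangent_space Y (F p)"
proof -
  obtain V \<psi> where V: "(V, \<psi>) \<in> atlas Y" "F p \<in> V"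
    using chart_ex[OF Y holomorphic_map_points[OF F p]] by blast
  have "differential Y F p v = (\<lambda>h. \<Sum>k\<in>cidx Y. v (\<lambda>q. \<psi> (F q) k) * coord_vec Y V \<psi> k (F p) h)"
    unfolding differential_def
    by (rule ext) (simp add: differential_chain[OF X Y F p v V] coord_vec_not_holo)
  then show ?thesis using tangentI[OF V] by simp
qed

text \<open>The chain rule for the identity map: the coefficients of a tangent vector are its values
  on the coordinate functions.\<close>

lemma tangent_expand:
  assumes X: "complex_manifold X" and U: "(U, \<phi>) \<in> atlas X" "p \<in> U" and v: "v \<in> tangent_space X p"
  shows "v h = (\<Sum>j\<in>cidx X. v (\<lambda>q. \<phi> q j) * coord_vec X U \<phi> j p h)"
proof (cases "holo_at X p h")
  case True
  have "p \<in> points X" using chart_point[OF X U] .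
  from differential_chain[OF X X holomorphic_map_id[OF X] this v, of U \<phi> h] U True show ?thesis by simp
qed (simp add: tangent_not_holo[OF v] coord_vec_not_holo)

text \<open>An identity of functionals. Holomorphy of \<open>G\<close> ensures that
  \<open>h \<circ> G\<close> passes the test in the inner \<open>differential\<close> whenever
  \<open>h\<close> passes the one in the outer; for all other \<open>h\<close> both sides are
  0.\<close>

lemma differential_compose:
  assumes Y: "complex_manifold Y" and Z: "complex_manifold Z" and G: "holomorphic_map Y Z G" and p: "F p \<in> points Y"
  shows "differential Z G (F p) (differential Y F p v) = differential Z (G \<circ> F) p v"
  unfolding differential_def using holo_at_compose[OF Y Z G _ p] by (auto simp: comp_assoc)

lemma differential_cong:
  assumes X: "complex_manifold X" and p: "p \<in> points X" and v: "v \<in> tangent_space X p"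
    and eq: "\<And>q. q \<in> points X \<Longrightarrow> F q = G q"
  shows "differential Y F p v = differential Y G p v"
proof -
  have "v (h \<circ> F) = v (h \<circ> G)" for h by (rule tangent_cong[OF X p v]) (simp add: eq)
  then show ?thesis by (simp add: differential_def eq[OF p] cong: if_cong)
qed

lemma differential_id: "v \<in> tangent_space X p \<Longrightarrow> differential X id p v = v"
  unfolding differential_def using tangent_not_holo by fastforce

lemma differential_linear:
  "differential Y F p (\<lambda>h. u h + c * v h) = (\<lambda>h. differential Y F p u h + c * differential Y F p v h)"
  by (auto simp: differential_def)

lemma differential_apply: "holo_at Y (F p) h \<Longrightarrow> differential Y F p v h = v (h \<circ> F)"
  by (simp add: differential_def)

text \<open>A one-sided inverse makes the differential of one map injective and that of the other
  surjective. All immersion and submersion claims below are obtained in this way.\<close>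

lemma differential_left_inverse:
  assumes X: "complex_manifold X" and Y: "complex_manifold Y" 
    and F: "holomorphic_map X Y F" and G: "holomorphic_map Y X G"
    and inv: "\<And>p. p \<in> points X \<Longrightarrow> G (F p) = p" and p: "p \<in> points X" and v: "v \<in> tangent_space X p"
  shows "differential X G (F p) (differential Y F p v) = v"
proof -
  have "differential X G (F p) (differential Y F p v) = differential X (G \<circ> F) p v"
    by (rule differential_compose[where F = F, OF Y X G holomorphic_map_points[OF F p]])
  also have "\<dots> = differential X id p v"
    by (rule differential_cong[OF X p v]) (simp add: inv)
  finally show ?thesis using differential_id[OF v] by simp
qed

section \<open>Transport along an injection\<close>

text \<open>Both the zero level and the orbit space receive their structure in this way, the former
  from the slice and the latter from \<open>M\<close>. That these structures fit the ambient
  topology and the orbit projection is proved afterwards.\<close>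

definition image_cmfd :: "('p \<Rightarrow> 'q) \<Rightarrow> ('p, 'j) cmfd \<Rightarrow> ('q, 'j) cmfd" where
  "image_cmfd f X =
     \<lparr>mtop = pullback_topology (f ` points X) (inv_into (points X) f) (mtop X),
      cidx = cidx X,
      atlas = (\<lambda>(U, \<phi>). (f ` U, \<phi> \<circ> inv_into (points X) f)) ` atlas X\<rparr>"

lemma image_cmfd_homeo:
  assumes f: "inj_on f (points X)"
  shows "homeomorphic_maps (mtop X) (mtop (image_cmfd f X)) f (inv_into (points X) f)"
    and points_image_cmfd: "points (image_cmfd f X) = f ` points X"
proof -
  let ?g = "inv_into (points X) f"
  let ?T = "pullback_topology (f ` points X) ?g (mtop X)"
  have T: "mtop (image_cmfd f X) = ?T" by (simp add: image_cmfd_def)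
  show P: "points (image_cmfd f X) = f ` points X"
    using f unfolding T topspace_pullback_topology by (auto simp: inv_into_into)
  have "continuous_map ?T (mtop X) (id \<circ> ?g)"
    by (rule continuous_map_pullback) simp
  moreover have "continuous_map (mtop X) ?T f"
  proof (rule continuous_map_pullback')
    show "continuous_map (mtop X) (mtop X) (?g \<circ> f)"
      by (rule continuous_map_eq[OF continuous_map_id]) (simp add: f)
  qed auto
  ultimately show "homeomorphic_maps (mtop X) (mtop (image_cmfd f X)) f ?g"
    unfolding homeomorphic_maps_def using f P by (auto simp: T f_inv_into_f)
qed

lemma image_cmfd_atlas:
  "c \<in> atlas (image_cmfd f X) \<longleftrightarrow> (\<exists>(U, \<phi>)\<in>atlas X. c = (f ` U, \<phi> \<circ> inv_into (points X) f))"
  by (auto simp: image_cmfd_def)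

lemma cidx_image_cmfd [simp]: "cidx (image_cmfd f X) = cidx X"
  by (simp add: image_cmfd_def)

lemma image_chart_inv:
  assumes X: "complex_manifold X" and f: "inj_on f (points X)" and U: "(U, \<phi>) \<in> atlas X" and x: "x \<in> \<phi> ` U"
  shows "inv_into (f ` U) (\<phi> \<circ> inv_into (points X) f) x = f (inv_into U \<phi> x)"
proof -
  let ?g = "inv_into (points X) f"
  obtain p where p: "p \<in> U" "x = \<phi> p" using x by blast
  have gf: "?g (f q) = q" if "q \<in> U" for q using f chart_sub[OF X U] that by auto
  have "inj_on (\<phi> \<circ> ?g) (f ` U)"
    using chart_inj[OF X U] gf by (auto simp: inj_on_def)
  moreover have "(\<phi> \<circ> ?g) (f p) = x" using gf p by simp
  ultimately show ?thesis using p chart_inv[OF X U p(1)] by (metis imageI inv_into_f_f)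
qed

lemma complex_manifold_image:
  assumes X: "complex_manifold X" and f: "inj_on f (points X)"
  shows "complex_manifold (image_cmfd f X)"
proof -
  let ?g = "inv_into (points X) f"
  let ?Y = "image_cmfd f X"
  note H = image_cmfd_homeo[OF f] and P = points_image_cmfd[OF f]
  have hs: "mtop X homeomorphic_space mtop ?Y" using H homeomorphic_maps_imp_homeomorphic_space by blast
  have gf: "?g (f q) = q" if "q \<in> points X" for q using f that by auto
  have fo: "homeomorphic_map (mtop X) (mtop ?Y) f" and go: "homeomorphic_map (mtop ?Y) (mtop X) ?g"
    using H homeomorphic_maps_map by blast+
  show ?thesis unfolding complex_manifold_def
  proof (intro conjI)
    show "Hausdorff_space (mtop ?Y)" "second_countable (mtop ?Y)"
      using X homeomorphic_Hausdorff_space[OF hs] homeomorphic_space_second_countability[OF hs]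
      by (simp_all add: complex_manifold_def)
    show "finite (cidx ?Y)" using cidx_finite[OF X] by simp
    show "points ?Y = (\<Union>(U, \<phi>)\<in>atlas ?Y. U)"
      unfolding P using chart_cover[OF X] by (auto simp: image_cmfd_def)
    show "\<forall>(V, \<psi>)\<in>atlas ?Y. openin (mtop ?Y) V \<and> openin (top_of_set (cspace (cidx ?Y))) (\<psi> ` V) \<and>
       homeomorphic_map (subtopology (mtop ?Y) V) (top_of_set (\<psi> ` V)) \<psi>"
    proof (clarify, unfold image_cmfd_atlas, clarify)
      fix U \<phi> assume U: "(U, \<phi>) \<in> atlas X"
      have UX: "U \<subseteq> points X" using chart_sub[OF X U] .
      have gU: "?g ` f ` U = U" using gf UX by force
      have o: "openin (mtop ?Y) (f ` U)"
        using homeomorphic_map_openness[OF fo UX] chart_open[OF X U] by simp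
      have im: "(\<phi> \<circ> ?g) ` f ` U = \<phi> ` U" using gU by (metis image_comp)
      have "homeomorphic_map (subtopology (mtop ?Y) (f ` U)) (subtopology (mtop X) U) ?g"
      proof (rule homeomorphic_map_subtopologies[OF go])
        have "points ?Y \<inter> f ` U = f ` U" "points X \<inter> U = U" using UX P by auto
        then show "?g ` (points ?Y \<inter> f ` U) = points X \<inter> U" using gU by simp
      qed
      then have "homeomorphic_map (subtopology (mtop ?Y) (f ` U)) (top_of_set (\<phi> ` U)) (\<phi> \<circ> ?g)"
        using chart_homeo[OF X U] by (rule homeomorphic_map_compose)
      then show "openin (mtop ?Y) (f ` U) \<and> openin (top_of_set (cspace (cidx ?Y))) ((\<phi> \<circ> ?g) ` f ` U) \<and>
       homeomorphic_map (subtopology (mtop ?Y) (f ` U)) (top_of_set ((\<phi> \<circ> ?g) ` f ` U)) (\<phi> \<circ> ?g)"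
        using o chart_image_open[OF X U] by (simp only: im cidx_image_cmfd)
    qed
    show "\<forall>(U, \<phi>)\<in>atlas ?Y. \<forall>(V, \<psi>)\<in>atlas ?Y. \<forall>j\<in>cidx ?Y.
        holo_on (cidx ?Y) (\<lambda>x. \<psi> (inv_into U \<phi> x) j) (\<phi> ` (U \<inter> V))"
    proof (clarify, unfold image_cmfd_atlas, clarify)
      fix U \<phi> V \<psi> j assume U: "(U, \<phi>) \<in> atlas X" and V: "(V, \<psi>) \<in> atlas X" and j: "j \<in> cidx ?Y"
      have UX: "U \<subseteq> points X" "V \<subseteq> points X" using chart_sub[OF X] U V by auto
      have "(\<phi> \<circ> ?g) ` (f ` U \<inter> f ` V) = \<phi> ` (U \<inter> V)"
      proof -
        have "(\<phi> \<circ> ?g) (f q) = \<phi> q" if "q \<in> U \<inter> V" for q using gf UX that by auto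
        then have "(\<phi> \<circ> ?g) ` f ` (U \<inter> V) = \<phi> ` (U \<inter> V)"
          unfolding image_image by (rule image_cong[OF refl])
        then show ?thesis using inj_on_image_Int[OF f UX] by simp
      qed
      moreover have "holo_on (cidx ?Y) (\<lambda>x. (\<psi> \<circ> ?g) (inv_into (f ` U) (\<phi> \<circ> ?g) x) j) (\<phi> ` (U \<inter> V))"
        unfolding holo_on_def
      proof clarify
        fix q assume q: "q \<in> U" "q \<in> V"
        have "cdiff_at (cidx X) (\<lambda>x. \<psi> (inv_into U \<phi> x) j) (\<phi> q)"
          using chart_transition[OF X U V, of j] j q by (auto simp: holo_on_def)
        then have "cdiff_at (cidx X) (\<lambda>x. (\<psi> \<circ> ?g) (inv_into (f ` U) (\<phi> \<circ> ?g) x) j) (\<phi> q)"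
        proof (rule cdiff_at_cong[OF _ _ chart_cspace[OF X U q(1)] cidx_finite[OF X]])
          show "\<forall>\<^sub>F y in cnhds (cidx X) (\<phi> q). \<psi> (inv_into U \<phi> y) j = (\<psi> \<circ> ?g) (inv_into (f ` U) (\<phi> \<circ> ?g) y) j"
            using eventually_chart[OF X U chart_open[OF X U] q(1) q(1)]
            by eventually_elim (use UX gf in \<open>auto simp: image_chart_inv[OF X f U]\<close>)
        qed
        then show "cdiff_at (cidx ?Y) (\<lambda>x. (\<psi> \<circ> ?g) (inv_into (f ` U) (\<phi> \<circ> ?g) x) j) (\<phi> q)" by simp
      qed
      ultimately show "holo_on (cidx ?Y) (\<lambda>x. (\<psi> \<circ> ?g) (inv_into (f ` U) (\<phi> \<circ> ?g) x) j)
        ((\<phi> \<circ> ?g) ` (f ` U \<inter> f ` V))" by simp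
    qed
  qed
qed

lemma holomorphic_map_image:
  assumes X: "complex_manifold X" and f: "inj_on f (points X)"
  shows "holomorphic_map X (image_cmfd f X) f"
proof (rule holomorphic_mapI[OF X complex_manifold_image[OF X f]])
  show "continuous_map (mtop X) (mtop (image_cmfd f X)) f"
    using image_cmfd_homeo[OF f] unfolding homeomorphic_maps_def by blast
  fix p assume p: "p \<in> points X"
  obtain U \<phi> where U: "(U, \<phi>) \<in> atlas X" "p \<in> U" using chart_ex[OF X p] by blast
  have "holo_at X p (\<lambda>q. (\<phi> \<circ> inv_into (points X) f) (f q) k)" if "k \<in> cidx X" for k
    by (rule holo_at_cong[OF X chart_coord_holo[OF X U that]]) (simp add: f)
  with U show "\<exists>(V, \<psi>)\<in>atlas (image_cmfd f X). f p \<in> V \<and> (\<forall>k\<in>cidx (image_cmfd f X). holo_at X p (\<lambda>q. \<psi> (f q) k))"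
    by (intro bexI[of _ "(f ` U, \<phi> \<circ> inv_into (points X) f)"]) (auto simp: image_cmfd_def)
qed

lemma holomorphic_map_image_inv:
  assumes X: "complex_manifold X" and f: "inj_on f (points X)"
  shows "holomorphic_map (image_cmfd f X) X (inv_into (points X) f)"
proof (rule holomorphic_mapI[OF complex_manifold_image[OF X f] X])
  let ?Y = "image_cmfd f X"
  let ?g = "inv_into (points X) f"
  show "continuous_map (mtop ?Y) (mtop X) ?g"
    using image_cmfd_homeo[OF f] unfolding homeomorphic_maps_def by blast
  fix q assume q: "q \<in> points ?Y"
  then obtain p where p: "p \<in> points X" "q = f p" unfolding points_image_cmfd[OF f] by blast
  then have gq: "?g q = p" using f by simp
  obtain U \<phi> where U: "(U, \<phi>) \<in> atlas X" "p \<in> U" using chart_ex[OF X p(1)] by blast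
  have Y: "(f ` U, \<phi> \<circ> ?g) \<in> atlas ?Y" using U(1) by (auto simp: image_cmfd_def)
  have "holo_at ?Y q (\<lambda>q. \<phi> (?g q) k)" if "k \<in> cidx X" for k
    using chart_coord_holo[OF complex_manifold_image[OF X f] Y, of q k] U p that by auto
  with U gq show "\<exists>(V, \<psi>)\<in>atlas X. ?g q \<in> V \<and> (\<forall>k\<in>cidx X. holo_at ?Y q (\<lambda>q. \<psi> (?g q) k))"
    by auto
qed

section \<open>Transported symplectic forms\<close>

definition image_form :: "('p \<Rightarrow> 'q) \<Rightarrow> ('p, 'j) cmfd \<Rightarrow> 'p two_form \<Rightarrow> 'q two_form" where
  "image_form f X \<omega> q v w = (let g = inv_into (points X) f in
     \<omega> (g q) (differential X g q v) (differential X g q w))"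

text \<open>Since coordinate vectors correspond to each other, the coefficients of
  \<open>image_form\<close> in a transported chart are those of \<open>\<omega>\<close> in the
  original one. Holomorphy and closedness, which are statements about coefficients, then carry
  over.\<close>

lemma differential_image_coord_vec:
  assumes X: "complex_manifold X" and f: "inj_on f (points X)" and U: "(U, \<phi>) \<in> atlas X" "p \<in> U"
    and i: "i \<in> cidx X"
  shows "differential X (inv_into (points X) f) (f p)
     (coord_vec (image_cmfd f X) (f ` U) (\<phi> \<circ> inv_into (points X) f) i (f p)) = coord_vec X U \<phi> i p"
proof
  fix h
  let ?g = "inv_into (points X) f"
  let ?Y = "image_cmfd f X"
  have p: "p \<in> points X" using chart_point[OF X U] .
  have g: "?g (f p) = p" using f p by simp
  show "differential X ?g (f p) (coord_vec ?Y (f ` U) (\<phi> \<circ> ?g) i (f p)) h = coord_vec X U \<phi> i p h"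
  proof (cases "holo_at X p h")
    case True
    have "f p \<in> points ?Y" using p points_image_cmfd[OF f] by simp
    then have hY: "holo_at ?Y (f p) (h \<circ> ?g)"
      using holo_at_compose[OF complex_manifold_image[OF X f] X holomorphic_map_image_inv[OF X f]] True g by simp
    have "partial i ((h \<circ> ?g) \<circ> inv_into (f ` U) (\<phi> \<circ> ?g)) (\<phi> p) = partial i (h \<circ> inv_into U \<phi>) (\<phi> p)"
    proof (rule partial_cong[OF _ chart_cspace[OF X U] i])
      show "\<forall>\<^sub>F y in cnhds (cidx X) (\<phi> p). (h \<circ> ?g \<circ> inv_into (f ` U) (\<phi> \<circ> ?g)) y = (h \<circ> inv_into U \<phi>) y"
        using eventually_chart[OF X U(1) chart_open[OF X U(1)] U(2) U(2)]
        by eventually_elim (use chart_sub[OF X U(1)] f in \<open>auto simp: image_chart_inv[OF X f U(1)] subset_iff\<close>)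
    qed
    then show ?thesis using True hY by (simp add: differential_def g coord_vec_def)
  qed (simp add: differential_def g coord_vec_def)
qed

lemma symplectic_manifold_image:
  assumes S: "symplectic_manifold X \<omega>" and f: "inj_on f (points X)"
  shows "symplectic_manifold (image_cmfd f X) (image_form f X \<omega>)"
proof -
  let ?Y = "image_cmfd f X" and ?g = "inv_into (points X) f"
  let ?\<eta> = "image_form f X \<omega>"
  have X: "complex_manifold X" and h2: "holomorphic_two_form X \<omega>" and cl: "closed_form X \<omega>"
    and nd: "nondegenerate_form X \<omega>"
    using S by (auto simp: symplectic_manifold_def)
  have Y: "complex_manifold ?Y" using complex_manifold_image[OF X f] .
  have fh: "holomorphic_map X ?Y f" and gh: "holomorphic_map ?Y X ?g"
    using holomorphic_map_image[OF X f] holomorphic_map_image_inv[OF X f] .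
  have gf: "?g (f p) = p" if "p \<in> points X" for p using f that by simp
  have fg: "f (?g q) = q" if "q \<in> points ?Y" for q 
    using that points_image_cmfd[OF f] by (simp add: f_inv_into_f)
  have dg: "differential X ?g q v \<in> tangent_space X (?g q)"
    if "q \<in> points ?Y" "v \<in> tangent_space ?Y q" for q v
    using differential_tangent[OF Y X gh that] .
  have gX: "?g q \<in> points X" if "q \<in> points ?Y" for q
    using holomorphic_map_points[OF gh that] .
  have form: "form_coeff ?Y ?\<eta> (f ` U) (\<phi> \<circ> ?g) i j x = form_coeff X \<omega> U \<phi> i j x"
    if U: "(U, \<phi>) \<in> atlas X" and x: "x \<in> \<phi> ` U" and i: "i \<in> cidx X" and j: "j \<in> cidx X" for U \<phi> i j x
  proof -
    have p: "inv_into U \<phi> x \<in> U" using x by (rule inv_into_into)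
    show ?thesis
      unfolding form_coeff_def image_chart_inv[OF X f U x] Let_def image_form_def
      using gf[OF chart_point[OF X U p]]
      by (simp add: differential_image_coord_vec[OF X f U p i] differential_image_coord_vec[OF X f U p j])
  qed
  have im: "(\<phi> \<circ> ?g) ` f ` U = \<phi> ` U" if "(U, \<phi>) \<in> atlas X" for U \<phi>
  proof -
    have "(\<phi> \<circ> ?g) (f q) = \<phi> q" if "q \<in> U" for q using gf chart_sub[OF X \<open>(U, \<phi>) \<in> atlas X\<close>] that by auto
    then show ?thesis unfolding image_image by (rule image_cong[OF refl])
  qed
  have evf: "\<forall>\<^sub>F y in cnhds (cidx X) x. form_coeff X \<omega> U \<phi> i j y = form_coeff ?Y ?\<eta> (f ` U) (\<phi> \<circ> ?g) i j y"
    if U: "(U, \<phi>) \<in> atlas X" and x: "x \<in> \<phi> ` U" and i: "i \<in> cidx X" and j: "j \<in> cidx X" for U \<phi> i j x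
    using eventually_cnhds_in_openin[OF chart_image_open[OF X U] x]
    by eventually_elim (simp add: form[OF U _ i j])
  have xc: "x \<in> cspace (cidx X)" if "(U, \<phi>) \<in> atlas X" "x \<in> \<phi> ` U" for U \<phi> x
    using chart_cspace[OF X that(1)] that(2) by blast
  show ?thesis unfolding symplectic_manifold_def
  proof (intro conjI Y)
    show "holomorphic_two_form ?Y ?\<eta>"
      unfolding holomorphic_two_form_def
    proof (intro conjI ballI allI)
      fix q u v w c assume q: "q \<in> points ?Y" and t: "u \<in> tangent_space ?Y q" "v \<in> tangent_space ?Y q" "w \<in> tangent_space ?Y q"
      show "?\<eta> q (\<lambda>h. u h + c * v h) w = ?\<eta> q u w + c * ?\<eta> q v w" "?\<eta> q v w = - ?\<eta> q w v"
        using h2 gX[OF q] dg[OF q t(1)] dg[OF q t(2)] dg[OF q t(3)]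
        unfolding holomorphic_two_form_def image_form_def Let_def differential_linear by blast+
    next
      show "case a of (U, \<phi>) \<Rightarrow> \<forall>i\<in>cidx ?Y. \<forall>j\<in>cidx ?Y. holo_on (cidx ?Y) (form_coeff ?Y ?\<eta> U \<phi> i j) (\<phi> ` U)"
        if a: "a \<in> atlas ?Y" for a
      proof -
        obtain U \<phi> where U: "(U, \<phi>) \<in> atlas X" and a: "a = (f ` U, \<phi> \<circ> ?g)" using a image_cmfd_atlas by blast
        have "cdiff_at (cidx X) (form_coeff ?Y ?\<eta> (f ` U) (\<phi> \<circ> ?g) i j) x" 
          if x: "x \<in> \<phi> ` U" and i: "i \<in> cidx X" and j: "j \<in> cidx X" for i j x
          using h2 U x i j unfolding holomorphic_two_form_def holo_on_def
          by (intro cdiff_at_cong[OF _ evf[OF U x i j] xc[OF U x] cidx_finite[OF X]]) blast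
        then show ?thesis unfolding a prod.case holo_on_def cidx_image_cmfd im[OF U] by blast
      qed
    qed
    show "closed_form ?Y ?\<eta>" unfolding closed_form_def
    proof
      fix a assume "a \<in> atlas ?Y"
      then obtain U \<phi> where U: "(U, \<phi>) \<in> atlas X" and a: "a = (f ` U, \<phi> \<circ> ?g)" using image_cmfd_atlas by blast
      have "partial i (form_coeff ?Y ?\<eta> (f ` U) (\<phi> \<circ> ?g) j k) x = partial i (form_coeff X \<omega> U \<phi> j k) x"
        if x: "x \<in> \<phi> ` U" and i: "i \<in> cidx X" and j: "j \<in> cidx X" and k: "k \<in> cidx X" for i j k x
        using partial_cong[OF evf[OF U x j k] xc[OF U x] i] by simp
      moreover have "\<forall>i\<in>cidx X. \<forall>j\<in>cidx X. \<forall>k\<in>cidx X. \<forall>x\<in>\<phi> ` U.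
         partial i (form_coeff X \<omega> U \<phi> j k) x + partial j (form_coeff X \<omega> U \<phi> k i) x
          + partial k (form_coeff X \<omega> U \<phi> i j) x = 0"
        using cl U unfolding closed_form_def by blast
      ultimately show "case a of (U, \<phi>) \<Rightarrow> \<forall>i\<in>cidx ?Y. \<forall>j\<in>cidx ?Y. \<forall>k\<in>cidx ?Y. \<forall>x\<in>\<phi> ` U.
        partial i (form_coeff ?Y ?\<eta> U \<phi> j k) x + partial j (form_coeff ?Y ?\<eta> U \<phi> k i) x
          + partial k (form_coeff ?Y ?\<eta> U \<phi> i j) x = 0"
        unfolding a prod.case cidx_image_cmfd im[OF U] by simp
    qed
    show "nondegenerate_form ?Y ?\<eta>" unfolding nondegenerate_form_def
    proof (intro ballI impI)
      fix q u assume q: "q \<in> points ?Y" and u: "u \<in> tangent_space ?Y q" and z: "\<forall>v\<in>tangent_space ?Y q. ?\<eta> q u v = 0"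
      have "\<omega> (?g q) (differential X ?g q u) w = 0" if w: "w \<in> tangent_space X (?g q)" for w
      proof -
        have "differential ?Y f (?g q) w \<in> tangent_space ?Y q"
          using differential_tangent[OF X Y fh gX[OF q] w] fg[OF q] by simp
        then have "?\<eta> q u (differential ?Y f (?g q) w) = 0" using z by blast
        moreover have "differential X ?g q (differential ?Y f (?g q) w) = w"
          using differential_left_inverse[OF X Y fh gh gf gX[OF q] w] fg[OF q] by simp
        ultimately show ?thesis by (simp add: image_form_def Let_def)
      qed
      then have "differential X ?g q u = (\<lambda>h. 0)"
        using nd gX[OF q] dg[OF q u] unfolding nondegenerate_form_def by blast
      moreover have "differential ?Y f (?g q) (differential X ?g q u) = u"
        using differential_left_inverse[OF Y X gh fh fg q u] .
      ultimately show "u = (\<lambda>h. 0)" by (auto simp: differential_def)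
    qed
  qed
qed

lemma symplectically_isomorphic_image:
  assumes X: "complex_manifold X" and f: "inj_on f (points X)"
  shows "symplectically_isomorphic X \<omega> (image_cmfd f X) (image_form f X \<omega>)"
  unfolding symplectically_isomorphic_def
proof (intro exI conjI ballI)
  let ?Y = "image_cmfd f X" and ?g = "inv_into (points X) f"
  show fh: "holomorphic_map X ?Y f" and gh: "holomorphic_map ?Y X ?g"
    using holomorphic_map_image[OF X f] holomorphic_map_image_inv[OF X f] .
  show gf: "?g (f p) = p" if "p \<in> points X" for p using f that by simp
  show "f (?g q) = q" if "q \<in> points ?Y" for q 
    using that points_image_cmfd[OF f] by (simp add: f_inv_into_f)
  show "preserves_forms X \<omega> ?Y (image_form f X \<omega>) f"
    unfolding preserves_forms_def image_form_def Let_def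
    using differential_left_inverse[OF X complex_manifold_image[OF X f] fh gh gf] gf by simp
qed

section \<open>Products of manifolds\<close>

lemma continuous_map_euclidean_fun:
  fixes f :: "'a \<Rightarrow> 'i \<Rightarrow> 'b::topological_space"
  assumes "\<And>i. continuous_map T euclidean (\<lambda>x. f x i)"
  shows "continuous_map T euclidean f"
  unfolding euclidean_product_topology[symmetric]
  by (rule continuous_map_coordinatewise_then_product) (use assms in auto)

lemma continuous_on_reindex: "continuous_on S (\<lambda>z :: 'j \<Rightarrow> complex. \<lambda>j. z (e j))"
  by (intro continuous_on_coordinatewise_then_product continuous_on_subset[OF continuous_on_product_coordinates]) auto

text \<open>An explicit inverse \<open>\<kappa>\<close> settles the image, the homeomorphism
  property and the value of \<open>inv_into\<close> together. It is applied to binary products, to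
  finite products and to spaces of matrices.\<close>

lemma chart_criterion:
  assumes U: "U \<subseteq> topspace T" and \<phi>: "continuous_map (subtopology T U) euclidean \<phi>"
    and S: "openin (top_of_set C) S" and \<phi>S: "\<And>p. p \<in> U \<Longrightarrow> \<phi> p \<in> S"
    and \<kappa>: "continuous_map (top_of_set S) T \<kappa>" and \<kappa>U: "\<And>z. z \<in> S \<Longrightarrow> \<kappa> z \<in> U"
    and \<phi>\<kappa>: "\<And>z. z \<in> S \<Longrightarrow> \<phi> (\<kappa> z) = z" and \<kappa>\<phi>: "\<And>p. p \<in> U \<Longrightarrow> \<kappa> (\<phi> p) = p"
  shows "\<phi> ` U = S" "homeomorphic_map (subtopology T U) (top_of_set S) \<phi>"
    "\<And>z. z \<in> S \<Longrightarrow> inv_into U \<phi> z = \<kappa> z"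
proof -
  show im: "\<phi> ` U = S" using \<phi>S \<kappa>U \<phi>\<kappa> by force
  have "homeomorphic_maps (subtopology T U) (top_of_set S) \<phi> \<kappa>"
    unfolding homeomorphic_maps_def using assms
    by (auto simp: continuous_map_in_subtopology)
  then show "homeomorphic_map (subtopology T U) (top_of_set S) \<phi>" using homeomorphic_maps_map by blast
  have "inj_on \<phi> U" using \<kappa>\<phi> by (metis inj_onI)
  then show "inv_into U \<phi> z = \<kappa> z" if "z \<in> S" for z
    using \<kappa>U[OF that] \<phi>\<kappa>[OF that] by (metis inv_into_f_f)
qed

lemma chart_coord_continuous:
  assumes X: "complex_manifold X" and U: "(U, \<phi>) \<in> atlas X"
  shows "continuous_map (subtopology (mtop X) U) euclidean (\<lambda>p. \<phi> p j)"
proof -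
  have "continuous_map (subtopology (mtop X) U) euclidean \<phi>"
    using homeomorphic_imp_continuous_map[OF chart_homeo[OF X U]] by (simp add: continuous_map_in_subtopology)
  then show ?thesis
    unfolding euclidean_product_topology[symmetric] continuous_map_componentwise_UNIV by simp
qed

lemma chart_inv_continuous:
  assumes X: "complex_manifold X" and U: "(U, \<phi>) \<in> atlas X"
  shows "continuous_map (top_of_set (\<phi> ` U)) (mtop X) (inv_into U \<phi>)"
proof -
  have UX: "U \<subseteq> points X" using chart_sub[OF X U] .
  obtain g where g: "homeomorphic_maps (subtopology (mtop X) U) (top_of_set (\<phi> ` U)) \<phi> g"
    using chart_homeo[OF X U] homeomorphic_map_maps by blast
  then have "continuous_map (top_of_set (\<phi> ` U)) (mtop X) g"
    unfolding homeomorphic_maps_def continuous_map_in_subtopology by blast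
  then show ?thesis
    by (rule continuous_map_eq)
       (use g UX in \<open>auto simp: homeomorphic_maps_def chart_inv[OF X U]\<close>)
qed

text \<open>With \<open>e\<close> equal to \<open>Inl\<close>, \<open>Inr\<close> or
  \<open>Pair i\<close>, a function of the coordinates of one factor is pulled back to the product.
  The last premise guarantees that reindexing sends \<open>cspace K\<close> into
  \<open>cspace J\<close>.\<close>

lemma cdiff_at_reindex:
  assumes f: "cdiff_at J f (\<lambda>j. z (e j))" and z: "z \<in> cspace K" and J: "finite J" "finite K"
    and e: "\<And>j. e j \<in> K \<longleftrightarrow> j \<in> J"
  shows "cdiff_at K (\<lambda>z. f (\<lambda>j. z (e j))) z"
proof (rule cdiff_at_compose[where G = "\<lambda>z j. z (e j)", OF f z J(2,1)])
  show "cdiff_at K (\<lambda>y. y (e k)) z" if "k \<in> J" for k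
    using cdiff_at_coordinate[OF _ J(2) z] e that by blast
  show "\<forall>\<^sub>F y in cnhds K z. (\<lambda>j. y (e j)) \<in> cspace J"
    using eventually_cnhds_cspace by (rule eventually_mono) (auto simp: cspace_def e)
qed

lemma openin_cspace_reindex:
  assumes S: "openin (top_of_set (cspace J)) S" and e: "\<And>j. e j \<in> K \<longleftrightarrow> j \<in> J"
  shows "openin (top_of_set (cspace K)) {z \<in> cspace K. (\<lambda>j. z (e j)) \<in> S}"
proof -
  have "openin (top_of_set (cspace K)) (cspace K \<inter> (\<lambda>z j. z (e j)) -` S)"
    by (rule continuous_openin_preimage[OF continuous_on_reindex _ S]) (auto simp: cspace_def e)
  then show ?thesis by (simp add: vimage_def Int_def)
qed

lemma second_countable_prod_topology:
  assumes "second_countable S" "second_countable T"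
  shows "second_countable (prod_topology S T)"
proof -
  obtain A where A: "countable A" "\<And>V. V \<in> A \<Longrightarrow> openin S V" "\<And>U x. openin S U \<and> x \<in> U \<Longrightarrow> \<exists>V\<in>A. x \<in> V \<and> V \<subseteq> U"
    using assms(1) unfolding second_countable_def by (elim exE conjE) blast
  obtain B where B: "countable B" "\<And>V. V \<in> B \<Longrightarrow> openin T V" "\<And>U x. openin T U \<and> x \<in> U \<Longrightarrow> \<exists>V\<in>B. x \<in> V \<and> V \<subseteq> U"
    using assms(2) unfolding second_countable_def by (elim exE conjE) blast
  show ?thesis unfolding second_countable_def
  proof (intro exI[of _ "(\<lambda>(U, V). U \<times> V) ` (A \<times> B)"] conjI ballI allI impI)
    show "countable ((\<lambda>(U, V). U \<times> V) ` (A \<times> B))" using A(1) B(1) by simp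
    show "openin (prod_topology S T) W" if "W \<in> (\<lambda>(U, V). U \<times> V) ` (A \<times> B)" for W
      using that A(2) B(2) by (auto simp: openin_prod_Times_iff)
    fix W z assume W: "openin (prod_topology S T) W \<and> z \<in> W"
    obtain x y where z: "z = (x, y)" by (cases z)
    obtain U V where UV: "openin S U" "openin T V" "x \<in> U" "y \<in> V" "U \<times> V \<subseteq> W"
      using W unfolding z openin_prod_topology_alt by blast
    obtain U' where U': "U' \<in> A" "x \<in> U'" "U' \<subseteq> U" using A(3) UV by blast
    obtain V' where V': "V' \<in> B" "y \<in> V'" "V' \<subseteq> V" using B(3) UV by blast
    show "\<exists>W'\<in>(\<lambda>(U, V). U \<times> V) ` (A \<times> B). z \<in> W' \<and> W' \<subseteq> W"
      by (rule bexI[of _ "U' \<times> V'"]) (use U' V' UV z in auto)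
  qed
qed

text \<open>Finiteness of \<open>I\<close> enters twice: boxes of open sets are open, and there are
  only countably many boxes of basis sets.\<close>

lemma second_countable_product_topology:
  assumes I: "finite I" and T: "\<And>i. i \<in> I \<Longrightarrow> second_countable (T i)"
  shows "second_countable (product_topology T I)"
proof -
  have "\<forall>i\<in>I. \<exists>A. countable A \<and> (\<forall>V\<in>A. openin (T i) V) \<and> (\<forall>U x. openin (T i) U \<and> x \<in> U \<longrightarrow> (\<exists>V\<in>A. x \<in> V \<and> V \<subseteq> U))"
    using T unfolding second_countable_def by blast
  from bchoice[OF this] obtain A where A0: "\<forall>i\<in>I. countable (A i) \<and> (\<forall>V\<in>A i. openin (T i) V) \<and>
      (\<forall>U x. openin (T i) U \<and> x \<in> U \<longrightarrow> (\<exists>V\<in>A i. x \<in> V \<and> V \<subseteq> U))"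
    by (elim exE)
  then have A: "\<And>i. i \<in> I \<Longrightarrow> countable (A i)" "\<And>i V. i \<in> I \<Longrightarrow> V \<in> A i \<Longrightarrow> openin (T i) V"
     "\<And>i U x. i \<in> I \<Longrightarrow> openin (T i) U \<Longrightarrow> x \<in> U \<Longrightarrow> \<exists>V\<in>A i. x \<in> V \<and> V \<subseteq> U"
    by auto
  show ?thesis unfolding second_countable_def
  proof (intro exI[of _ "PiE I ` PiE I A"] conjI ballI allI impI)
    show "countable (PiE I ` PiE I A)" using countable_PiE[OF I, of A] A(1) by blast
    show "openin (product_topology T I) W" if "W \<in> PiE I ` PiE I A" for W
      using that A(2) I by (auto intro!: openin_PiE_gen[THEN iffD2] disjI2 simp: PiE_mem)
    fix W z assume W: "openin (product_topology T I) W \<and> z \<in> W"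
    then have "\<exists>U. (\<forall>i\<in>I. openin (T i) (U i)) \<and> z \<in> PiE I U \<and> PiE I U \<subseteq> W"
      unfolding openin_product_topology_alt by fast
    then obtain U where U: "\<forall>i\<in>I. openin (T i) (U i)" "z \<in> PiE I U" "PiE I U \<subseteq> W" by (elim exE conjE)
    have "\<forall>i\<in>I. \<exists>V\<in>A i. z i \<in> V \<and> V \<subseteq> U i"
      using A(3) U(1,2) by (simp add: PiE_mem)
    from bchoice[OF this[unfolded Bex_def]] obtain V where V: "\<forall>i\<in>I. V i \<in> A i \<and> z i \<in> V i \<and> V i \<subseteq> U i" by (elim exE)
    show "\<exists>W'\<in>PiE I ` PiE I A. z \<in> W' \<and> W' \<subseteq> W"
    proof (intro bexI[of _ "PiE I (restrict V I)"] conjI imageI)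
      show "z \<in> PiE I (restrict V I)" using V U(2) by (auto simp: PiE_iff)
      have "PiE I (restrict V I) \<subseteq> PiE I U" using V by (intro PiE_mono) auto
      then show "PiE I (restrict V I) \<subseteq> W" using U(3) by blast
      show "restrict V I \<in> PiE I A" using V by auto
    qed
  qed
qed

section \<open>Binary products of manifolds\<close>

lemma cidx_prod_cmfd [simp]: "cidx (prod_cmfd X Y) = cidx X <+> cidx Y"
  and mtop_prod_cmfd [simp]: "mtop (prod_cmfd X Y) = prod_topology (mtop X) (mtop Y)"
  by (simp_all add: prod_cmfd_def)

lemma prod_cmfd_atlas:
  "c \<in> atlas (prod_cmfd X Y) \<longleftrightarrow> (\<exists>U \<phi> V \<psi>. (U, \<phi>) \<in> atlas X \<and> (V, \<psi>) \<in> atlas Y \<and>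
     c = (U \<times> V, \<lambda>(x, y). case_sum (\<phi> x) (\<psi> y)))"
  by (auto simp: prod_cmfd_def)

lemma prod_chart:
  assumes X: "complex_manifold X" and Y: "complex_manifold Y" and U: "(U, \<phi>) \<in> atlas X" and V: "(V, \<psi>) \<in> atlas Y"
  defines "\<Phi> \<equiv> \<lambda>(x, y). case_sum (\<phi> x) (\<psi> y)" and "J \<equiv> cidx X <+> cidx Y"
  defines "S \<equiv> {z \<in> cspace J. (\<lambda>j. z (Inl j)) \<in> \<phi> ` U} \<inter> {z \<in> cspace J. (\<lambda>k. z (Inr k)) \<in> \<psi> ` V}"
  shows "openin (top_of_set (cspace J)) S"
    "\<Phi> ` (U \<times> V) = S" 
    "homeomorphic_map (subtopology (prod_topology (mtop X) (mtop Y)) (U \<times> V)) (top_of_set S) \<Phi>"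
    "\<And>z. z \<in> S \<Longrightarrow> inv_into (U \<times> V) \<Phi> z = (inv_into U \<phi> (\<lambda>j. z (Inl j)), inv_into V \<psi> (\<lambda>k. z (Inr k)))"
proof -
  let ?\<kappa> = "\<lambda>z. (inv_into U \<phi> (\<lambda>j. z (Inl j)), inv_into V \<psi> (\<lambda>k. z (Inr k)))"
  show S: "openin (top_of_set (cspace J)) S"
    unfolding S_def
    by (intro openin_Int openin_cspace_reindex[OF chart_image_open[OF X U]] openin_cspace_reindex[OF chart_image_open[OF Y V]])
       (auto simp: J_def)
  have "continuous_map (subtopology (mtop X) U) euclidean (\<lambda>p. \<phi> p j)" for j
    using chart_coord_continuous[OF X U] .
  from continuous_map_compose[OF continuous_map_fst this] 
  have c1: "continuous_map (subtopology (prod_topology (mtop X) (mtop Y)) (U \<times> V)) euclidean (\<lambda>p. \<phi> (fst p) j)" for j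
    by (simp add: subtopology_Times comp_def)
  have "continuous_map (subtopology (mtop Y) V) euclidean (\<lambda>p. \<psi> p j)" for j
    using chart_coord_continuous[OF Y V] .
  from continuous_map_compose[OF continuous_map_snd this] 
  have c2: "continuous_map (subtopology (prod_topology (mtop X) (mtop Y)) (U \<times> V)) euclidean (\<lambda>p. \<psi> (snd p) j)" for j
    by (simp add: subtopology_Times comp_def)
  have 1: "U \<times> V \<subseteq> topspace (prod_topology (mtop X) (mtop Y))"
    using chart_sub[OF X U] chart_sub[OF Y V] by auto
  have 2: "continuous_map (subtopology (prod_topology (mtop X) (mtop Y)) (U \<times> V)) euclidean \<Phi>"
  proof (rule continuous_map_euclidean_fun)
    show "continuous_map (subtopology (prod_topology (mtop X) (mtop Y)) (U \<times> V)) euclidean (\<lambda>p. \<Phi> p i)" for i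
      using c1 c2 by (cases i) (simp_all add: \<Phi>_def case_prod_unfold)
  qed
  have 3: "\<Phi> p \<in> S" if "p \<in> U \<times> V" for p
  proof -
    have "j \<in> cidx X" if "x \<in> U" "\<phi> x j \<noteq> 0" for x j
      using chart_cspace[OF X U that(1)] that(2) by (auto simp: cspace_def)
    moreover have "j \<in> cidx Y" if "y \<in> V" "\<psi> y j \<noteq> 0" for y j
      using chart_cspace[OF Y V that(1)] that(2) by (auto simp: cspace_def)
    ultimately show ?thesis
      using that by (auto simp: \<Phi>_def S_def J_def cspace_def split: sum.splits)
  qed
  have e1: "continuous_map (top_of_set S) (top_of_set (\<phi> ` U)) (\<lambda>z j. z (Inl j))"
    using continuous_on_reindex by (auto simp: S_def)
  have e2: "continuous_map (top_of_set S) (top_of_set (\<psi> ` V)) (\<lambda>z j. z (Inr j))"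
    using continuous_on_reindex by (auto simp: S_def)
  have 4: "continuous_map (top_of_set S) (prod_topology (mtop X) (mtop Y)) ?\<kappa>"
    using continuous_map_compose[OF e1 chart_inv_continuous[OF X U]] continuous_map_compose[OF e2 chart_inv_continuous[OF Y V]]
    unfolding continuous_map_paired by (simp add: comp_def)
  have 5: "?\<kappa> z \<in> U \<times> V" if "z \<in> S" for z
    using that by (auto simp: S_def intro: inv_into_into)
  have 6: "\<Phi> (?\<kappa> z) = z" if "z \<in> S" for z
    using that by (auto simp: S_def \<Phi>_def f_inv_into_f fun_eq_iff split: sum.splits)
  have 7: "?\<kappa> (\<Phi> p) = p" if "p \<in> U \<times> V" for p
    using that by (auto simp: \<Phi>_def chart_inv[OF X U] chart_inv[OF Y V])
  note C = chart_criterion[of "U \<times> V" _ \<Phi> "cspace J" S ?\<kappa>, OF 1 2 S 3 4 5 6 7]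
  show "\<Phi> ` (U \<times> V) = S" by (rule C(1))
  show "homeomorphic_map (subtopology (prod_topology (mtop X) (mtop Y)) (U \<times> V)) (top_of_set S) \<Phi>" by (rule C(2))
  show "inv_into (U \<times> V) \<Phi> z = ?\<kappa> z" if "z \<in> S" for z by (rule C(3)[OF _ _ _ _ that])
qed

lemma complex_manifold_prod:
  assumes X: "complex_manifold X" and Y: "complex_manifold Y"
  shows "complex_manifold (prod_cmfd X Y)"
  unfolding complex_manifold_def
proof (intro conjI)
  let ?Z = "prod_cmfd X Y"
  let ?J = "cidx X <+> cidx Y"
  show "Hausdorff_space (mtop ?Z)" "second_countable (mtop ?Z)" "finite (cidx ?Z)"
    using X Y by (auto simp: complex_manifold_def Hausdorff_space_prod_topology intro!: second_countable_prod_topology)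
  show "points ?Z = (\<Union>(U, \<phi>)\<in>atlas ?Z. U)"
  proof (intro equalityI subsetI)
    fix z assume "z \<in> points ?Z"
    then have z: "fst z \<in> points X" "snd z \<in> points Y" by auto
    obtain U \<phi> where U: "(U, \<phi>) \<in> atlas X" "fst z \<in> U" using chart_ex[OF X z(1)] by blast
    obtain V \<psi> where V: "(V, \<psi>) \<in> atlas Y" "snd z \<in> V" using chart_ex[OF Y z(2)] by blast
    have W: "(U \<times> V, \<lambda>(x, y). case_sum (\<phi> x) (\<psi> y)) \<in> atlas ?Z" using U V prod_cmfd_atlas by blast
    show "z \<in> (\<Union>(U, \<phi>)\<in>atlas ?Z. U)" by (rule UN_I[OF W]) (use U V in \<open>simp add: mem_Times_iff\<close>)
  next
    fix z assume "z \<in> (\<Union>(U, \<phi>)\<in>atlas ?Z. U)"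
    then obtain W \<Phi> where W: "(W, \<Phi>) \<in> atlas ?Z" "z \<in> W" by auto
    then obtain U \<phi> V \<psi> where UV: "(U, \<phi>) \<in> atlas X" "(V, \<psi>) \<in> atlas Y" "W = U \<times> V"
      unfolding prod_cmfd_atlas by auto
    then show "z \<in> points ?Z" using chart_sub[OF X UV(1)] chart_sub[OF Y UV(2)] W(2) by auto
  qed
  show "\<forall>(W, \<Phi>)\<in>atlas ?Z. openin (mtop ?Z) W \<and> openin (top_of_set (cspace (cidx ?Z))) (\<Phi> ` W) \<and>
     homeomorphic_map (subtopology (mtop ?Z) W) (top_of_set (\<Phi> ` W)) \<Phi>"
  proof (clarify, unfold prod_cmfd_atlas, clarify)
    fix U \<phi> V \<psi> assume U: "(U, \<phi>) \<in> atlas X" and V: "(V, \<psi>) \<in> atlas Y"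
    note C = prod_chart[OF X Y U V]
    have "openin (mtop ?Z) (U \<times> V)" 
      using chart_open[OF X U] chart_open[OF Y V] by (simp add: openin_prod_Times_iff)
    then show "openin (mtop ?Z) (U \<times> V) \<and> 
       openin (top_of_set (cspace (cidx ?Z))) ((\<lambda>(x, y). case_sum (\<phi> x) (\<psi> y)) ` (U \<times> V)) \<and>
       homeomorphic_map (subtopology (mtop ?Z) (U \<times> V)) (top_of_set ((\<lambda>(x, y). case_sum (\<phi> x) (\<psi> y)) ` (U \<times> V)))
         (\<lambda>(x, y). case_sum (\<phi> x) (\<psi> y))"
      unfolding C(2) mtop_prod_cmfd cidx_prod_cmfd using C(1,3) by blast
  qed
  show "\<forall>(W, \<Phi>)\<in>atlas ?Z. \<forall>(W', \<Phi>')\<in>atlas ?Z. \<forall>j\<in>cidx ?Z.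
      holo_on (cidx ?Z) (\<lambda>x. \<Phi>' (inv_into W \<Phi> x) j) (\<Phi> ` (W \<inter> W'))"
  proof (clarify, unfold prod_cmfd_atlas, clarify)
    fix U \<phi> V \<psi> U' \<phi>' V' \<psi>' i
    assume U: "(U, \<phi>) \<in> atlas X" and V: "(V, \<psi>) \<in> atlas Y" and U': "(U', \<phi>') \<in> atlas X" and V': "(V', \<psi>') \<in> atlas Y"
      and i: "i \<in> cidx ?Z"
    let ?\<Phi> = "\<lambda>(x, y). case_sum (\<phi> x) (\<psi> y)" and ?\<Phi>' = "\<lambda>(x, y). case_sum (\<phi>' x) (\<psi>' y)"
    note C = prod_chart[OF X Y U V]
    show "holo_on (cidx ?Z) (\<lambda>x. ?\<Phi>' (inv_into (U \<times> V) ?\<Phi> x) i) (?\<Phi> ` (U \<times> V \<inter> U' \<times> V'))"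
      unfolding holo_on_def cidx_prod_cmfd
    proof clarify
      fix x y assume xy: "x \<in> U" "y \<in> V" "x \<in> U'" "y \<in> V'"
      let ?z = "case_sum (\<phi> x) (\<psi> y)"
      have zS: "?z \<in> ?\<Phi> ` (U \<times> V)" using xy by force
      have z: "?z \<in> cspace ?J" 
        using chart_cspace[OF X U xy(1)] chart_cspace[OF Y V xy(2)] by (auto simp: cspace_def split: sum.splits)
      have J: "finite ?J" "finite (cidx X)" "finite (cidx Y)" using cidx_finite[OF X] cidx_finite[OF Y] by auto
      have ev: "\<forall>\<^sub>F w in cnhds ?J ?z. inv_into (U \<times> V) ?\<Phi> w = (inv_into U \<phi> (\<lambda>j. w (Inl j)), inv_into V \<psi> (\<lambda>k. w (Inr k)))"
        using eventually_cnhds_in_openin[OF C(1) zS[unfolded C(2)]] by eventually_elim (rule C(4))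
      show "cdiff_at ?J (\<lambda>w. ?\<Phi>' (inv_into (U \<times> V) ?\<Phi> w) i) ?z"
      proof (cases i)
        case (Inl j)
        then have j: "j \<in> cidx X" using i by auto
        have "cdiff_at (cidx X) (\<lambda>x. \<phi>' (inv_into U \<phi> x) j) (\<lambda>j. ?z (Inl j))"
          using chart_transition[OF X U U' j] xy by (auto simp: holo_on_def)
        then have "cdiff_at ?J (\<lambda>w. \<phi>' (inv_into U \<phi> (\<lambda>j. w (Inl j))) j) ?z"
          by (rule cdiff_at_reindex[where e = Inl, OF _ z J(2,1)]) auto
        then show ?thesis
          by (rule cdiff_at_cong[OF _ _ z J(1)]) (use ev in \<open>auto elim!: eventually_mono simp: Inl\<close>)
      next
        case (Inr k)
        then have k: "k \<in> cidx Y" using i by auto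
        have "cdiff_at (cidx Y) (\<lambda>x. \<psi>' (inv_into V \<psi> x) k) (\<lambda>j. ?z (Inr j))"
          using chart_transition[OF Y V V' k] xy by (auto simp: holo_on_def)
        then have "cdiff_at ?J (\<lambda>w. \<psi>' (inv_into V \<psi> (\<lambda>j. w (Inr j))) k) ?z"
          by (rule cdiff_at_reindex[where e = Inr, OF _ z J(3,1)]) auto
        then show ?thesis
          by (rule cdiff_at_cong[OF _ _ z J(1)]) (use ev in \<open>auto elim!: eventually_mono simp: Inr\<close>)
      qed
    qed
  qed
qed

lemma holomorphic_map_fst:
  assumes X: "complex_manifold X" and Y: "complex_manifold Y"
  shows "holomorphic_map (prod_cmfd X Y) X fst"
proof (rule holomorphic_mapI[OF complex_manifold_prod[OF X Y] X])
  show "continuous_map (mtop (prod_cmfd X Y)) (mtop X) fst" by (simp add: continuous_map_fst)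
  fix p assume "p \<in> points (prod_cmfd X Y)"
  then have p: "fst p \<in> points X" "snd p \<in> points Y" by auto
  obtain U \<phi> where U: "(U, \<phi>) \<in> atlas X" "fst p \<in> U" using chart_ex[OF X p(1)] by blast
  obtain V \<psi> where V: "(V, \<psi>) \<in> atlas Y" "snd p \<in> V" using chart_ex[OF Y p(2)] by blast
  have W: "(U \<times> V, \<lambda>(x, y). case_sum (\<phi> x) (\<psi> y)) \<in> atlas (prod_cmfd X Y)" using U V prod_cmfd_atlas by blast
  have "holo_at (prod_cmfd X Y) p (\<lambda>q. \<phi> (fst q) k)" if "k \<in> cidx X" for k
    using chart_coord_holo[OF complex_manifold_prod[OF X Y] W, of p "Inl k"] U V that
    by (cases p) (auto simp: case_prod_unfold)
  then show "\<exists>(V, \<psi>)\<in>atlas X. fst p \<in> V \<and> (\<forall>k\<in>cidx X. holo_at (prod_cmfd X Y) p (\<lambda>q. \<psi> (fst q) k))"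
    using U by auto
qed

lemma holomorphic_map_snd:
  assumes X: "complex_manifold X" and Y: "complex_manifold Y"
  shows "holomorphic_map (prod_cmfd X Y) Y snd"
proof (rule holomorphic_mapI[OF complex_manifold_prod[OF X Y] Y])
  show "continuous_map (mtop (prod_cmfd X Y)) (mtop Y) snd" by (simp add: continuous_map_snd)
  fix p assume "p \<in> points (prod_cmfd X Y)"
  then have p: "fst p \<in> points X" "snd p \<in> points Y" by auto
  obtain U \<phi> where U: "(U, \<phi>) \<in> atlas X" "fst p \<in> U" using chart_ex[OF X p(1)] by blast
  obtain V \<psi> where V: "(V, \<psi>) \<in> atlas Y" "snd p \<in> V" using chart_ex[OF Y p(2)] by blast
  have W: "(U \<times> V, \<lambda>(x, y). case_sum (\<phi> x) (\<psi> y)) \<in> atlas (prod_cmfd X Y)" using U V prod_cmfd_atlas by blast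
  have "holo_at (prod_cmfd X Y) p (\<lambda>q. \<psi> (snd q) k)" if "k \<in> cidx Y" for k
    using chart_coord_holo[OF complex_manifold_prod[OF X Y] W, of p "Inr k"] U V that
    by (cases p) (auto simp: case_prod_unfold)
  then show "\<exists>(V, \<psi>)\<in>atlas Y. snd p \<in> V \<and> (\<forall>k\<in>cidx Y. holo_at (prod_cmfd X Y) p (\<lambda>q. \<psi> (snd q) k))"
    using V by auto
qed

lemma holomorphic_map_Pair:
  assumes Z: "complex_manifold Z" and X: "complex_manifold X" and Y: "complex_manifold Y"
    and F: "holomorphic_map Z X F" and G: "holomorphic_map Z Y G"
  shows "holomorphic_map Z (prod_cmfd X Y) (\<lambda>z. (F z, G z))"
proof (rule holomorphic_mapI[OF Z complex_manifold_prod[OF X Y]])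
  show "continuous_map (mtop Z) (mtop (prod_cmfd X Y)) (\<lambda>z. (F z, G z))"
    using holomorphic_map_continuous[OF F] holomorphic_map_continuous[OF G] by (simp add: continuous_map_paired)
  fix p assume p: "p \<in> points Z"
  obtain U \<phi> where U: "(U, \<phi>) \<in> atlas X" "F p \<in> U" using chart_ex[OF X holomorphic_map_points[OF F p]] by blast
  obtain V \<psi> where V: "(V, \<psi>) \<in> atlas Y" "G p \<in> V" using chart_ex[OF Y holomorphic_map_points[OF G p]] by blast
  have W: "(U \<times> V, \<lambda>(x, y). case_sum (\<phi> x) (\<psi> y)) \<in> atlas (prod_cmfd X Y)" using U V prod_cmfd_atlas by blast
  have "holo_at Z p (\<lambda>q. case_sum (\<phi> (F q)) (\<psi> (G q)) k)" if "k \<in> cidx (prod_cmfd X Y)" for k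
    using that holomorphic_map_coord_holo[OF Z X F U p] holomorphic_map_coord_holo[OF Z Y G V p] by auto
  then show "\<exists>(W, \<Phi>)\<in>atlas (prod_cmfd X Y). (F p, G p) \<in> W \<and>
      (\<forall>k\<in>cidx (prod_cmfd X Y). holo_at Z p (\<lambda>q. \<Phi> (F q, G q) k))"
    by (intro bexI[OF _ W]) (use U V in auto)
qed

lemma holomorphic_map_const:
  assumes X: "complex_manifold X" and Y: "complex_manifold Y" and y: "y \<in> points Y"
  shows "holomorphic_map X Y (\<lambda>_. y)"
proof (rule holomorphic_mapI[OF X Y])
  show "continuous_map (mtop X) (mtop Y) (\<lambda>_. y)" using y by simp
  fix p assume p: "p \<in> points X"
  obtain V \<psi> where V: "(V, \<psi>) \<in> atlas Y" "y \<in> V" using chart_ex[OF Y y] by blast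
  then show "\<exists>(V, \<psi>)\<in>atlas Y. y \<in> V \<and> (\<forall>k\<in>cidx Y. holo_at X p (\<lambda>q. \<psi> y k))"
    using holo_at_const[OF X p] by auto
qed

lemma tangent_prod_split:
  assumes X: "complex_manifold X" and Y: "complex_manifold Y" and x: "x \<in> points X" and y: "y \<in> points Y"
    and v: "v \<in> tangent_space (prod_cmfd X Y) (x, y)" and h: "holo_at (prod_cmfd X Y) (x, y) h"
  shows "v h = v (\<lambda>q. h (fst q, y)) + v (\<lambda>q. h (x, snd q))"
proof -
  let ?Z = "prod_cmfd X Y"
  note Z = complex_manifold_prod[OF X Y]
  have xy: "(x, y) \<in> points ?Z" using x y by simp
  obtain U \<phi> where U: "(U, \<phi>) \<in> atlas X" "x \<in> U" using chart_ex[OF X x] by blast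
  obtain V \<psi> where V: "(V, \<psi>) \<in> atlas Y" "y \<in> V" using chart_ex[OF Y y] by blast
  define \<Phi> where "\<Phi> = (\<lambda>(x, y). case_sum (\<phi> x) (\<psi> y))"
  have W: "(U \<times> V, \<Phi>) \<in> atlas ?Z" using U V prod_cmfd_atlas unfolding \<Phi>_def by blast
  have xyW: "(x, y) \<in> U \<times> V" using U V by simp
  let ?cv = "\<lambda>k. coord_vec ?Z (U \<times> V) \<Phi> k (x, y) h"
  have F1: "holomorphic_map ?Z ?Z (\<lambda>q. (fst q, y))" and F2: "holomorphic_map ?Z ?Z (\<lambda>q. (x, snd q))"
    using holomorphic_map_Pair[OF Z X Y] holomorphic_map_fst[OF X Y] holomorphic_map_snd[OF X Y]
      holomorphic_map_const[OF Z X x] holomorphic_map_const[OF Z Y y] by auto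
  have fin: "finite (cidx X)" "finite (cidx Y)" using cidx_finite[OF X] cidx_finite[OF Y] .
  have split: "(\<Sum>k\<in>cidx ?Z. g k) = (\<Sum>j\<in>cidx X. g (Inl j)) + (\<Sum>k\<in>cidx Y. g (Inr k))" for g :: "_ \<Rightarrow> complex"
    by (simp add: sum.Plus fin)
  have c: "v (\<lambda>q. \<phi> x j) = 0" "v (\<lambda>q. \<psi> y k) = 0" for j k by (rule tangent_const[OF Z xy v])+
  have "v (h \<circ> (\<lambda>q. (fst q, y))) = (\<Sum>j\<in>cidx X. v (\<lambda>q. \<phi> (fst q) j) * ?cv (Inl j))"
    using differential_chain[OF Z Z F1 xy v W, of h] xyW h unfolding split by (simp add: \<Phi>_def c)
  moreover have "v (h \<circ> (\<lambda>q. (x, snd q))) = (\<Sum>k\<in>cidx Y. v (\<lambda>q. \<psi> (snd q) k) * ?cv (Inr k))"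
    using differential_chain[OF Z Z F2 xy v W, of h] xyW h unfolding split by (simp add: \<Phi>_def c)
  moreover have "v h = (\<Sum>j\<in>cidx X. v (\<lambda>q. \<phi> (fst q) j) * ?cv (Inl j)) + (\<Sum>k\<in>cidx Y. v (\<lambda>q. \<psi> (snd q) k) * ?cv (Inr k))"
    using tangent_expand[OF Z W xyW v, of h] unfolding split by (simp add: \<Phi>_def case_prod_unfold)
  ultimately show ?thesis by (simp add: comp_def)
qed

section \<open>Finite products of manifolds\<close>

lemma cidx_Pi_cmfd [simp]: "cidx (Pi_cmfd I X) = Sigma I (\<lambda>i. cidx (X i))"
  and mtop_Pi_cmfd [simp]: "mtop (Pi_cmfd I X) = product_topology (\<lambda>i. mtop (X i)) I"
  by (simp_all add: Pi_cmfd_def)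

abbreviation Pi_chart :: "'i set \<Rightarrow> ('i \<Rightarrow> 'p set \<times> ('p \<Rightarrow> 'j \<Rightarrow> complex)) \<Rightarrow> ('i \<Rightarrow> 'p) \<Rightarrow> 'i \<times> 'j \<Rightarrow> complex" where
  "Pi_chart I c \<equiv> \<lambda>x (i, j). if i \<in> I then snd (c i) (x i) j else 0"

lemma Pi_cmfd_atlas:
  "a \<in> atlas (Pi_cmfd I X) \<longleftrightarrow>
     (\<exists>c. c \<in> PiE I (\<lambda>i. atlas (X i)) \<and> a = (PiE I (\<lambda>i. fst (c i)), Pi_chart I c))"
  by (auto simp: Pi_cmfd_def)

lemma Pi_cmfd_charts:
  assumes c: "c \<in> PiE I (\<lambda>i. atlas (X i))" and i: "i \<in> I"
  shows "(fst (c i), snd (c i)) \<in> atlas (X i)"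
  using PiE_mem[OF c i] by simp

lemma Pi_chart_props:
  fixes X :: "'i \<Rightarrow> ('p, 'j) cmfd"
  assumes I: "finite I" and X: "\<forall>i\<in>I. complex_manifold (X i)" and c: "c \<in> PiE I (\<lambda>i. atlas (X i))"
  defines "J \<equiv> Sigma I (\<lambda>i. cidx (X i))" and "W \<equiv> PiE I (\<lambda>i. fst (c i))"
  defines "S \<equiv> {z \<in> cspace J. \<forall>i\<in>I. (\<lambda>j. z (i, j)) \<in> snd (c i) ` fst (c i)}"
  shows "openin (top_of_set (cspace J)) S"
    "Pi_chart I c ` W = S" 
    "homeomorphic_map (subtopology (product_topology (\<lambda>i. mtop (X i)) I) W) (top_of_set S) (Pi_chart I c)"
    "\<And>z. z \<in> S \<Longrightarrow> inv_into W (Pi_chart I c) z = (\<lambda>i\<in>I. inv_into (fst (c i)) (snd (c i)) (\<lambda>j. z (i, j)))"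
proof -
  let ?\<kappa> = "\<lambda>z. \<lambda>i\<in>I. inv_into (fst (c i)) (snd (c i)) (\<lambda>j. z (i, j))"
  let ?\<Phi> = "Pi_chart I c" and ?T = "product_topology (\<lambda>i. mtop (X i)) I"
  note C = Pi_cmfd_charts[OF c]
  \<comment> \<open>For empty \<open>I\<close> the intersection would be the whole function space
    instead of \<open>cspace J\<close>.\<close>
  have eS: "S = (if I = {} then cspace J else (\<Inter>i\<in>I. {z \<in> cspace J. (\<lambda>j. z (i, j)) \<in> snd (c i) ` fst (c i)}))"
    by (auto simp: S_def)
  have oi: "openin (top_of_set (cspace J)) {z \<in> cspace J. (\<lambda>j. z (i, j)) \<in> snd (c i) ` fst (c i)}" if i: "i \<in> I" for i
    by (rule openin_cspace_reindex[OF chart_image_open[OF bspec[OF X i] C[OF i]]]) (use i in \<open>auto simp: J_def\<close>)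
  show S: "openin (top_of_set (cspace J)) S"
    unfolding eS using I oi by (auto intro: openin_Inter)
  have WT: "W \<subseteq> topspace ?T"
    unfolding W_def topspace_product_topology using chart_sub[OF bspec[OF X] C] by (intro PiE_mono) auto
  have c1: "continuous_map (subtopology ?T W) euclidean (\<lambda>x. snd (c i) (x i) j)" if i: "i \<in> I" for i j
  proof -
    have "continuous_map (subtopology ?T W) (subtopology (mtop (X i)) (fst (c i))) (\<lambda>x. x i)"
      using i by (intro continuous_map_into_subtopology continuous_map_from_subtopology continuous_map_product_projection)
        (auto simp: W_def)
    from continuous_map_compose[OF this chart_coord_continuous[OF bspec[OF X i] C[OF i]]]
    show ?thesis by (simp add: comp_def)
  qed
  have 2: "continuous_map (subtopology ?T W) euclidean ?\<Phi>"
  proof (rule continuous_map_euclidean_fun)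
    fix a :: "'i \<times> 'j"
    obtain i j where a: "a = (i, j)" by (cases a)
    show "continuous_map (subtopology ?T W) euclidean (\<lambda>x. ?\<Phi> x a)"
      using c1[of i j] by (cases "i \<in> I") (simp_all add: a)
  qed
  have 3: "?\<Phi> p \<in> S" if "p \<in> W" for p
  proof -
    have p: "p i \<in> fst (c i)" if "i \<in> I" for i using \<open>p \<in> W\<close> that by (auto simp: W_def)
    have z: "snd (c i) (p i) j = 0" if "i \<in> I" "j \<notin> cidx (X i)" for i j
      using chart_cspace[OF bspec[OF X] C, OF that(1) that(1) p[OF that(1)]] that(2) by (simp add: cspace_def)
    have "?\<Phi> p \<in> cspace J" unfolding cspace_def J_def using z by auto
    moreover have "(\<lambda>j. ?\<Phi> p (i, j)) = snd (c i) (p i)" if "i \<in> I" for i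
      using that by simp
    ultimately show ?thesis using p by (auto simp: S_def)
  qed
  have 4: "continuous_map (top_of_set S) ?T ?\<kappa>"
  proof (rule continuous_map_coordinatewise_then_product)
    fix i assume i: "i \<in> I"
    have "continuous_map (top_of_set S) (top_of_set (snd (c i) ` fst (c i))) (\<lambda>z j. z (i, j))"
      using continuous_on_reindex i by (auto simp: S_def)
    from continuous_map_compose[OF this chart_inv_continuous[OF bspec[OF X i] C[OF i]]] i
    show "continuous_map (top_of_set S) (mtop (X i)) (\<lambda>z. ?\<kappa> z i)" by (simp add: comp_def)
  qed auto
  have 5: "?\<kappa> z \<in> W" if "z \<in> S" for z
    using that unfolding W_def S_def by (auto intro: inv_into_into)
  have 6: "?\<Phi> (?\<kappa> z) = z" if z: "z \<in> S" for z
  proof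
    fix a :: "'i \<times> 'j"
    obtain i j where a: "a = (i, j)" by (cases a)
    show "?\<Phi> (?\<kappa> z) a = z a"
    proof (cases "i \<in> I")
      case True
      then have "(\<lambda>j. z (i, j)) \<in> snd (c i) ` fst (c i)" using z by (simp add: S_def)
      from f_inv_into_f[OF this] show ?thesis using True by (simp add: a)
    next
      case False
      then show ?thesis using z by (simp add: a S_def cspace_def J_def)
    qed
  qed
  have 7: "?\<kappa> (?\<Phi> p) = p" if p: "p \<in> W" for p
  proof
    fix i
    show "?\<kappa> (?\<Phi> p) i = p i"
    proof (cases "i \<in> I")
      case True
      then have "p i \<in> fst (c i)" using p by (auto simp: W_def)
      then show ?thesis using True chart_inv[OF bspec[OF X True] C[OF True]] by simp
    next
      case False
      then show ?thesis using p by (auto simp: W_def PiE_def extensional_def)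
    qed
  qed
  note D = chart_criterion[of W ?T ?\<Phi> "cspace J" S ?\<kappa>, OF WT 2 S 3 4 5 6 7]
  show "?\<Phi> ` W = S" by (rule D(1))
  show "homeomorphic_map (subtopology ?T W) (top_of_set S) ?\<Phi>" by (rule D(2))
  show "inv_into W ?\<Phi> z = ?\<kappa> z" if "z \<in> S" for z by (rule D(3)[OF _ _ _ _ that])
qed

lemma Pi_chart_ex:
  assumes "\<forall>i\<in>I. complex_manifold (X i)" and z: "z \<in> points (Pi_cmfd I X)"
  obtains c where "c \<in> PiE I (\<lambda>i. atlas (X i))" "z \<in> PiE I (\<lambda>i. fst (c i))"
proof -
  have zi: "z i \<in> points (X i)" if "i \<in> I" for i using z that by (auto simp: topspace_product_topology)
  have "\<forall>i\<in>I. \<exists>a. a \<in> atlas (X i) \<and> z i \<in> fst a"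
  proof
    fix i assume i: "i \<in> I"
    obtain U \<phi> where "(U, \<phi>) \<in> atlas (X i)" "z i \<in> U" using chart_ex[OF _ zi[OF i]] assms(1) i by blast
    then show "\<exists>a. a \<in> atlas (X i) \<and> z i \<in> fst a" by (intro exI[of _ "(U, \<phi>)"]) simp
  qed
  from bchoice[OF this] obtain c where c: "\<forall>i\<in>I. c i \<in> atlas (X i) \<and> z i \<in> fst (c i)" by (elim exE)
  show ?thesis
  proof (rule that[of "restrict c I"])
    show "restrict c I \<in> PiE I (\<lambda>i. atlas (X i))" using c by auto
    show "z \<in> PiE I (\<lambda>i. fst (restrict c I i))"
      using c z by (auto simp: topspace_product_topology PiE_iff)
  qed
qed

lemma complex_manifold_Pi:
  fixes X :: "'i \<Rightarrow> ('p, 'j) cmfd"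
  assumes I: "finite I" and X: "\<forall>i\<in>I. complex_manifold (X i)"
  shows "complex_manifold (Pi_cmfd I X)"
  unfolding complex_manifold_def
proof (intro conjI)
  let ?Z = "Pi_cmfd I X"
  let ?J = "Sigma I (\<lambda>i. cidx (X i))"
  show "Hausdorff_space (mtop ?Z)"
    using X by (simp add: complex_manifold_def Hausdorff_space_product_topology)
  show "second_countable (mtop ?Z)"
    unfolding mtop_Pi_cmfd by (rule second_countable_product_topology[OF I]) (use X in \<open>simp add: complex_manifold_def\<close>)
  show "finite (cidx ?Z)" using I X by (simp add: complex_manifold_def)
  have CW: "PiE I (\<lambda>i. fst (c i)) \<subseteq> points ?Z" if c: "c \<in> PiE I (\<lambda>i. atlas (X i))" for c
    unfolding mtop_Pi_cmfd topspace_product_topology using chart_sub[OF bspec[OF X] Pi_cmfd_charts[OF c]] by (intro PiE_mono) auto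
  show "points ?Z = (\<Union>(U, \<phi>)\<in>atlas ?Z. U)"
  proof (intro equalityI subsetI)
    fix z assume z: "z \<in> points ?Z"
    obtain c where c: "c \<in> PiE I (\<lambda>i. atlas (X i))" "z \<in> PiE I (\<lambda>i. fst (c i))"
      by (fact Pi_chart_ex[OF X z])
    have W: "(PiE I (\<lambda>i. fst (c i)), Pi_chart I c) \<in> atlas ?Z" unfolding Pi_cmfd_atlas using c(1) by blast
    show "z \<in> (\<Union>(U, \<phi>)\<in>atlas ?Z. U)" by (rule UN_I[OF W]) (use c(2) in simp)
  next
    fix z assume "z \<in> (\<Union>(U, \<phi>)\<in>atlas ?Z. U)"
    then obtain W \<Phi> where W: "(W, \<Phi>) \<in> atlas ?Z" "z \<in> W" by auto
    then obtain c where c: "c \<in> PiE I (\<lambda>i. atlas (X i))" "W = PiE I (\<lambda>i. fst (c i))"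
      unfolding Pi_cmfd_atlas by auto
    then show "z \<in> points ?Z" using CW[OF c(1)] W(2) by blast
  qed
  show "\<forall>(W, \<Phi>)\<in>atlas ?Z. openin (mtop ?Z) W \<and> openin (top_of_set (cspace (cidx ?Z))) (\<Phi> ` W) \<and>
     homeomorphic_map (subtopology (mtop ?Z) W) (top_of_set (\<Phi> ` W)) \<Phi>"
  proof
    fix a assume "a \<in> atlas ?Z"
    then obtain c where c: "c \<in> PiE I (\<lambda>i. atlas (X i))" and a: "a = (PiE I (\<lambda>i. fst (c i)), Pi_chart I c)"
      unfolding Pi_cmfd_atlas by (elim exE conjE)
    note C = Pi_chart_props[where X = X, OF I X c]
    have "openin (mtop ?Z) (PiE I (\<lambda>i. fst (c i)))" 
      using chart_open[OF bspec[OF X] Pi_cmfd_charts[OF c]] I by (auto simp: openin_PiE_gen)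
    then show "case a of (W, \<Phi>) \<Rightarrow> openin (mtop ?Z) W \<and> openin (top_of_set (cspace (cidx ?Z))) (\<Phi> ` W) \<and>
     homeomorphic_map (subtopology (mtop ?Z) W) (top_of_set (\<Phi> ` W)) \<Phi>"
      unfolding a prod.case C(2) mtop_Pi_cmfd cidx_Pi_cmfd using C(1,3) by blast
  qed
  have "\<forall>j\<in>cidx ?Z. holo_on (cidx ?Z) (\<lambda>x. snd a' (inv_into (fst a) (snd a) x) j) (snd a ` (fst a \<inter> fst a'))"
    if "a \<in> atlas ?Z" "a' \<in> atlas ?Z" for a a'
  proof -
    from that
    obtain c c' where c: "c \<in> PiE I (\<lambda>i. atlas (X i))" and a: "a = (PiE I (\<lambda>i. fst (c i)), Pi_chart I c)"
      and c': "c' \<in> PiE I (\<lambda>i. atlas (X i))" and a': "a' = (PiE I (\<lambda>i. fst (c' i)), Pi_chart I c')"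
      unfolding Pi_cmfd_atlas by (elim exE conjE)
    note C = Pi_chart_props[where X = X, OF I X c]
    let ?W = "PiE I (\<lambda>i. fst (c i))" and ?W' = "PiE I (\<lambda>i. fst (c' i))"
    have "cdiff_at ?J (\<lambda>w. Pi_chart I c' (inv_into ?W (Pi_chart I c) w) b) (Pi_chart I c x)"
      if b: "b \<in> ?J" and x: "x \<in> ?W" "x \<in> ?W'" for b x
    proof -
      let ?z = "Pi_chart I c x"
      obtain i j where b: "b = (i, j)" and i: "i \<in> I" and j: "j \<in> cidx (X i)" using b by (cases b) auto
      note U = Pi_cmfd_charts[OF c i] and U' = Pi_cmfd_charts[OF c' i]
      have xi: "x i \<in> fst (c i)" "x i \<in> fst (c' i)" using x i by auto
      have zS: "?z \<in> Pi_chart I c ` ?W" using x by blast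
      have z: "?z \<in> cspace ?J" using openin_imp_subset[OF C(1)] zS[unfolded C(2)] by blast
      have J: "finite ?J" "finite (cidx (X i))" using I X i by (auto simp: complex_manifold_def)
      have zi: "(\<lambda>j. ?z (i, j)) = snd (c i) (x i)" using i by simp
      have ev: "\<forall>\<^sub>F w in cnhds ?J ?z. inv_into ?W (Pi_chart I c) w =
          (\<lambda>i\<in>I. inv_into (fst (c i)) (snd (c i)) (\<lambda>j. w (i, j)))"
        using eventually_cnhds_in_openin[OF C(1) zS[unfolded C(2)]] by eventually_elim (rule C(4))
      have "cdiff_at (cidx (X i)) (\<lambda>x. snd (c' i) (inv_into (fst (c i)) (snd (c i)) x) j) (\<lambda>j. ?z (i, j))"
        unfolding zi using chart_transition[OF bspec[OF X i] U U' j] xi by (auto simp: holo_on_def)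
      then have "cdiff_at ?J (\<lambda>w. snd (c' i) (inv_into (fst (c i)) (snd (c i)) (\<lambda>j. w (i, j))) j) ?z"
        by (rule cdiff_at_reindex[where e = "Pair i", OF _ z J(2,1)]) (use i in auto)
      then show ?thesis
        by (rule cdiff_at_cong[OF _ _ z J(1)]) (use ev i in \<open>auto elim!: eventually_mono simp: b\<close>)
    qed
    then show ?thesis
      unfolding a a' fst_conv snd_conv cidx_Pi_cmfd holo_on_def by blast
  qed
  then show "\<forall>(W, \<Phi>)\<in>atlas ?Z. \<forall>(W', \<Phi>')\<in>atlas ?Z. \<forall>j\<in>cidx ?Z.
      holo_on (cidx ?Z) (\<lambda>x. \<Phi>' (inv_into W \<Phi> x) j) (\<Phi> ` (W \<inter> W'))"
    by (simp add: case_prod_unfold)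
qed

lemma holomorphic_map_Pi_proj:
  assumes I: "finite I" and X: "\<forall>i\<in>I. complex_manifold (X i)" and i: "i \<in> I"
  shows "holomorphic_map (Pi_cmfd I X) (X i) (\<lambda>x. x i)"
proof (rule holomorphic_mapI[OF complex_manifold_Pi[OF I X] bspec[OF X i]])
  show "continuous_map (mtop (Pi_cmfd I X)) (mtop (X i)) (\<lambda>x. x i)"
    using continuous_map_product_projection[OF i, of "\<lambda>i. mtop (X i)"] by simp
  fix p assume p: "p \<in> points (Pi_cmfd I X)"
  obtain c where c: "c \<in> PiE I (\<lambda>i. atlas (X i))" "p \<in> PiE I (\<lambda>i. fst (c i))" by (fact Pi_chart_ex[OF X p])
  have W: "(PiE I (\<lambda>i. fst (c i)), Pi_chart I c) \<in> atlas (Pi_cmfd I X)" unfolding Pi_cmfd_atlas using c(1) by blast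
  have "holo_at (Pi_cmfd I X) p (\<lambda>q. snd (c i) (q i) k)" if "k \<in> cidx (X i)" for k
    using chart_coord_holo[OF complex_manifold_Pi[OF I X] W c(2), of "(i, k)"] i that by simp
  then show "\<exists>(V, \<psi>)\<in>atlas (X i). p i \<in> V \<and> (\<forall>k\<in>cidx (X i). holo_at (Pi_cmfd I X) p (\<lambda>q. \<psi> (q i) k))"
    using Pi_cmfd_charts[OF c(1) i] PiE_mem[OF c(2) i] by (intro bexI[of _ "(fst (c i), snd (c i))"]) auto
qed

text \<open>Points of the product are functions with the value \<open>undefined\<close> outside
  \<open>I\<close>; the last premise makes the values of \<open>F\<close> such functions.\<close>

lemma holomorphic_map_into_Pi:
  assumes I: "finite I" and X: "\<forall>i\<in>I. complex_manifold (X i)" and Y: "complex_manifold Y"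
    and F: "\<And>i. i \<in> I \<Longrightarrow> holomorphic_map Y (X i) (\<lambda>y. F y i)" 
    and ext: "\<And>i y. i \<notin> I \<Longrightarrow> y \<in> points Y \<Longrightarrow> F y i = undefined"
  shows "holomorphic_map Y (Pi_cmfd I X) F"
proof (rule holomorphic_mapI[OF Y complex_manifold_Pi[OF I X]])
  show cont: "continuous_map (mtop Y) (mtop (Pi_cmfd I X)) F"
    unfolding mtop_Pi_cmfd
    by (rule continuous_map_coordinatewise_then_product) (use holomorphic_map_continuous[OF F] ext in auto)
  fix p assume p: "p \<in> points Y"
  then have Fp: "F p \<in> points (Pi_cmfd I X)" using continuous_map_image_subset_topspace[OF cont] by blast
  obtain c where c: "c \<in> PiE I (\<lambda>i. atlas (X i))" "F p \<in> PiE I (\<lambda>i. fst (c i))" by (fact Pi_chart_ex[OF X Fp])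
  have W: "(PiE I (\<lambda>i. fst (c i)), Pi_chart I c) \<in> atlas (Pi_cmfd I X)" unfolding Pi_cmfd_atlas using c(1) by blast
  have "holo_at Y p (\<lambda>q. Pi_chart I c (F q) k)" if kI: "k \<in> cidx (Pi_cmfd I X)" for k
  proof -
    obtain i j where k: "k = (i, j)" and i: "i \<in> I" and j: "j \<in> cidx (X i)" using kI by auto
    have "F p i \<in> fst (c i)" using c(2) i by auto
    from holomorphic_map_coord_holo[OF Y bspec[OF X i] F[OF i] Pi_cmfd_charts[OF c(1) i] this p j] i
    show ?thesis by (simp add: k)
  qed
  then show "\<exists>(V, \<psi>)\<in>atlas (Pi_cmfd I X). F p \<in> V \<and> (\<forall>k\<in>cidx (Pi_cmfd I X). holo_at Y p (\<lambda>q. \<psi> (F q) k))"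
    by (intro bexI[OF _ W]) (use c(2) in auto)
qed

lemma coord_vec_coord:
  assumes X: "complex_manifold X" and U: "(U, \<phi>) \<in> atlas X" "p \<in> U" and i: "i \<in> cidx X" and j: "j \<in> cidx X"
  shows "coord_vec X U \<phi> i p (\<lambda>q. \<phi> q j) = (if i = j then 1 else 0)"
proof -
  have x: "\<phi> p \<in> cspace (cidx X)" using chart_cspace[OF X U] .
  have "partial i ((\<lambda>q. \<phi> q j) \<circ> inv_into U \<phi>) (\<phi> p) = partial i (\<lambda>y. y j) (\<phi> p)"
  proof (rule partial_cong[OF _ x i])
    show "\<forall>\<^sub>F y in cnhds (cidx X) (\<phi> p). ((\<lambda>q. \<phi> q j) \<circ> inv_into U \<phi>) y = y j"
      using eventually_chart[OF X U(1) chart_open[OF X U(1)] U(2) U(2)] by eventually_elim simp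
  qed
  also have "\<dots> = (if i = j then 1 else 0)"
    by (rule slope_at_partial[OF slope_at_coordinate[OF j cidx_finite[OF X]] x cidx_finite[OF X] i])
  finally show ?thesis by (simp add: coord_vec_holo[OF chart_coord_holo[OF X U j]])
qed

text \<open>Used at the identity of the group, to realise a matrix as a velocity, and on the line
  gl(1), to realise unit speed.\<close>

lemma tangent_with_coords:
  assumes X: "complex_manifold X" and U: "(U, \<phi>) \<in> atlas X" "p \<in> U"
  obtains v where "v \<in> tangent_space X p" "\<And>j. j \<in> cidx X \<Longrightarrow> v (\<lambda>q. \<phi> q j) = a j"
proof (rule that[OF tangentI[OF U, of a]])
  fix j assume j: "j \<in> cidx X"
  have "(\<Sum>i\<in>cidx X. a i * coord_vec X U \<phi> i p (\<lambda>q. \<phi> q j)) = (\<Sum>i\<in>cidx X. if i = j then a i else 0)"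
    by (intro sum.cong refl) (simp add: coord_vec_coord[OF X U _ j])
  also have "\<dots> = a j" using j cidx_finite[OF X] by simp
  finally show "(\<Sum>i\<in>cidx X. a i * coord_vec X U \<phi> i p (\<lambda>q. \<phi> q j)) = a j" .
qed

section \<open>Invertible matrices\<close>

text \<open>The determinant is what makes \<open>GL n\<close> open in the space of matrices and,
  through cofactors, inversion holomorphic.\<close>

lemma GL_iff_det: "A \<in> GL n \<longleftrightarrow> A \<in> carrier_mat n n \<and> Determinant.det A \<noteq> 0"
proof
  assume "A \<in> GL n"
  then have A: "A \<in> carrier_mat n n" and "invertible_mat A" by (auto simp: GL_def)
  then obtain B where B: "A * B = 1\<^sub>m n" "B * A = 1\<^sub>m (dim_row B)"
    unfolding invertible_mat_def inverts_mat_def by auto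
  have "B \<in> carrier_mat n n"
    using A arg_cong[OF B(1), of dim_col] arg_cong[OF B(2), of dim_col] by auto
  then have "Determinant.det A * Determinant.det B = 1"
    using Determinant.det_mult[OF A, of B] B by simp
  then show "A \<in> carrier_mat n n \<and> Determinant.det A \<noteq> 0" using A by auto
next
  assume *: "A \<in> carrier_mat n n \<and> Determinant.det A \<noteq> 0"
  then have "A \<in> Units (ring_mat TYPE(complex) n ())" by (intro det_non_zero_imp_unit) auto
  then obtain B where "B \<in> carrier_mat n n" "B * A = 1\<^sub>m n" "A * B = 1\<^sub>m n"
    unfolding Units_def ring_mat_def by auto
  then show "A \<in> GL n" using * by (auto simp: GL_def invertible_mat_def inverts_mat_def)
qed

lemma GL_carrier [simp]: "A \<in> GL n \<Longrightarrow> A \<in> carrier_mat n n"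
  by (simp add: GL_def)

lemma minv_inverse:
  assumes A: "A \<in> GL n"
  shows minv_carrier [simp]: "minv A \<in> carrier_mat n n"
    and minv_right: "A * minv A = 1\<^sub>m n" and minv_left: "minv A * A = 1\<^sub>m n"
proof -
  have Ac: "A \<in> carrier_mat n n" and "Determinant.det A \<noteq> 0" using A unfolding GL_iff_det by auto
  then have "A \<in> Units (ring_mat TYPE(complex) n ())" by (intro det_non_zero_imp_unit) auto
  then obtain B where B: "mat_inverse A = Some B"
    using mat_inverse(1)[OF Ac, of "()"] by (cases "mat_inverse A") auto
  from mat_inverse(2)[OF Ac B]
  show "minv A \<in> carrier_mat n n" "A * minv A = 1\<^sub>m n" "minv A * A = 1\<^sub>m n" by (simp_all add: minv_def B)
qed

lemma mat_assoc: "A \<in> carrier_mat n n \<Longrightarrow> B \<in> carrier_mat n n \<Longrightarrow> C \<in> carrier_mat n n \<Longrightarrow> A * B * C = A * (B * C)"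
  for A :: "complex mat"
  by (rule assoc_mult_mat)

lemma minv_cancel:
  assumes A: "A \<in> GL n" and B: "B \<in> carrier_mat n n"
  shows "A * (minv A * B) = B" "minv A * (A * B) = B" "B * A * minv A = B" "B * minv A * A = B"
proof -
  note c = GL_carrier[OF A] minv_carrier[OF A]
  show "A * (minv A * B) = B" using mat_assoc[OF c(1,2) B] B by (simp add: minv_right[OF A])
  show "minv A * (A * B) = B" using mat_assoc[OF c(2,1) B] B by (simp add: minv_left[OF A])
  show "B * A * minv A = B" using mat_assoc[OF B c(1,2)] B by (simp add: minv_right[OF A])
  show "B * minv A * A = B" using mat_assoc[OF B c(2,1)] B by (simp add: minv_left[OF A])
qed

lemma minv_unique:
  assumes A: "A \<in> GL n" and B: "B \<in> carrier_mat n n" and "A * B = 1\<^sub>m n"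
  shows "minv A = B"
  using minv_cancel(2)[OF A B] assms(3) minv_carrier[OF A] by simp

lemma GL_one [simp]: "1\<^sub>m n \<in> GL n"
  by (simp add: GL_iff_det del: GL_carrier)

lemma GL_mult [simp]: "A \<in> GL n \<Longrightarrow> B \<in> GL n \<Longrightarrow> A * B \<in> GL n"
  by (auto simp: GL_iff_det Determinant.det_mult simp del: GL_carrier)

lemma GL_minv [simp]:
  assumes A: "A \<in> GL n"
  shows "minv A \<in> GL n"
  using Determinant.det_mult[OF GL_carrier[OF A] minv_carrier[OF A]] minv_right[OF A] minv_carrier[OF A]
  by (auto simp: GL_iff_det simp del: GL_carrier)

lemma minv_one [simp]: "minv (1\<^sub>m n) = 1\<^sub>m n"
  by (rule minv_unique) auto

lemma minv_minv [simp]: "A \<in> GL n \<Longrightarrow> minv (minv A) = A"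
  by (rule minv_unique[OF GL_minv]) (auto simp: minv_left)

lemma minv_mult:
  assumes A: "A \<in> GL n" and B: "B \<in> GL n"
  shows "minv (A * B) = minv B * minv A"
proof (rule minv_unique[OF GL_mult[OF A B]])
  have "A * B * (minv B * minv A) = A * (B * (minv B * minv A))"
    by (rule mat_assoc[of _ n]) (use A B in auto)
  then show "A * B * (minv B * minv A) = 1\<^sub>m n"
    using A B by (simp add: minv_cancel(1)[OF B] minv_right)
qed (use A B in auto)

lemma minv_adj:
  assumes A: "A \<in> GL n"
  shows "minv A = inverse (Determinant.det A) \<cdot>\<^sub>m adj_mat A"
proof (rule minv_unique[OF A])
  have d: "Determinant.det A \<noteq> 0" and Ac: "A \<in> carrier_mat n n" using A unfolding GL_iff_det by auto
  note adj = adj_mat[OF Ac]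
  show "inverse (Determinant.det A) \<cdot>\<^sub>m adj_mat A \<in> carrier_mat n n" using adj by simp
  show "A * (inverse (Determinant.det A) \<cdot>\<^sub>m adj_mat A) = 1\<^sub>m n"
    using d by (subst mult_smult_distrib[OF Ac adj(1)]) (auto simp: adj(2) intro!: eq_matI)
qed

lemma left_cancel_GL:
  assumes "A \<in> GL n" "B \<in> carrier_mat n n" "C \<in> carrier_mat n n" "A * B = A * C"
  shows "B = C"
  using minv_cancel(2)[OF assms(1,2)] unfolding assms(4) minv_cancel(2)[OF assms(1,3)] by (rule sym)

section \<open>The manifolds of matrices\<close>

lemma cidx_gl [simp]: "cidx (gl_cmfd n) = {..<n} \<times> {..<n}" and cidx_GL [simp]: "cidx (GL_cmfd n) = {..<n} \<times> {..<n}"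
  by (simp_all add: gl_cmfd_def GL_cmfd_def)

lemma points_gl [simp]: "points (gl_cmfd n) = carrier_mat n n"
  by (simp add: gl_cmfd_def topspace_pullback_topology)

lemma points_GL [simp]: "points (GL_cmfd n) = GL n"
  by (auto simp: GL_cmfd_def)

lemma mat_coords_cspace: "mat_coords n A \<in> cspace ({..<n} \<times> {..<n})"
  by (auto simp: mat_coords_def cspace_def)

lemma mat_coords_inverse: "z \<in> cspace ({..<n} \<times> {..<n}) \<Longrightarrow> mat_coords n (Matrix.mat n n z) = z"
  by (auto simp: mat_coords_def cspace_def fun_eq_iff)

lemma mat_of_coords: "A \<in> carrier_mat n n \<Longrightarrow> Matrix.mat n n (mat_coords n A) = A"
  by (auto simp: mat_coords_def)

lemma continuous_mat_coords: "continuous_map (mtop (gl_cmfd n)) euclidean (mat_coords n)"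
  using continuous_map_pullback[OF continuous_map_id, of "carrier_mat n n" "mat_coords n" euclidean] 
  by (simp add: gl_cmfd_def)

lemma continuous_map_into_gl:
  assumes "\<And>x. x \<in> topspace T \<Longrightarrow> F x \<in> carrier_mat n n" 
    and "\<And>i j. i < n \<Longrightarrow> j < n \<Longrightarrow> continuous_map T euclidean (\<lambda>x. F x $$ (i, j))"
  shows "continuous_map T (mtop (gl_cmfd n)) F"
  unfolding gl_cmfd_def cmfd.simps
proof (rule continuous_map_pullback')
  show "continuous_map T euclidean (mat_coords n \<circ> F)"
  proof (rule continuous_map_euclidean_fun)
    fix a :: "nat \<times> nat"
    obtain i j where a: "a = (i, j)" by (cases a)
    show "continuous_map T euclidean (\<lambda>x. (mat_coords n \<circ> F) x a)"
      using assms(2)[of i j] by (cases "i < n \<and> j < n") (auto simp: a mat_coords_def)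
  qed
qed (use assms(1) in auto)

lemma continuous_mat_of_coords:
  "continuous_map (top_of_set S) (mtop (gl_cmfd n)) (Matrix.mat n n)"
proof (rule continuous_map_into_gl)
  fix i j assume "i < n" "j < n"
  then show "continuous_map (top_of_set S) euclidean (\<lambda>z. Matrix.mat n n z $$ (i, j))"
    using continuous_on_subset[OF continuous_on_product_coordinates[of "(i, j)"]] by auto
qed auto

lemma gl_chart:
  shows "mat_coords n ` carrier_mat n n = cspace ({..<n} \<times> {..<n})"
    "homeomorphic_map (mtop (gl_cmfd n)) (top_of_set (cspace ({..<n} \<times> {..<n}))) (mat_coords n)"
    "\<And>z. z \<in> cspace ({..<n} \<times> {..<n}) \<Longrightarrow> inv_into (carrier_mat n n) (mat_coords n) z = Matrix.mat n n z"
proof -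
  let ?C = "cspace ({..<n} \<times> {..<n})" and ?T = "mtop (gl_cmfd n)"
  have sub: "subtopology ?T (carrier_mat n n) = ?T" using subtopology_topspace[of ?T] by simp
  have 1: "carrier_mat n n \<subseteq> topspace ?T" by simp
  have 2: "continuous_map (subtopology ?T (carrier_mat n n)) euclidean (mat_coords n)"
    using continuous_mat_coords sub by simp
  have 3: "openin (top_of_set ?C) ?C" by simp
  have 4: "Matrix.mat n n z \<in> carrier_mat n n" for z :: "nat \<times> nat \<Rightarrow> complex" by simp
  note D = chart_criterion[of "carrier_mat n n" ?T "mat_coords n" ?C ?C "Matrix.mat n n",
      OF 1 2 3 mat_coords_cspace continuous_mat_of_coords 4 mat_coords_inverse mat_of_coords]
  show "mat_coords n ` carrier_mat n n = ?C" by (rule D(1)) auto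
  have "homeomorphic_map (subtopology ?T (carrier_mat n n)) (top_of_set ?C) (mat_coords n)" by (rule D(2)) auto
  then show "homeomorphic_map ?T (top_of_set ?C) (mat_coords n)" using sub by simp
  show "inv_into (carrier_mat n n) (mat_coords n) z = Matrix.mat n n z" if "z \<in> ?C" for z by (rule D(3)) (use that in auto)
qed

lemma second_countable_euclidean: "second_countable (euclidean :: 'a::second_countable_topology topology)"
proof -
  obtain \<B> :: "'a set set" where B: "countable \<B>" "topological_basis \<B>" using ex_countable_basis by blast
  show ?thesis unfolding second_countable_def
  proof (intro exI[of _ \<B>] conjI ballI allI impI)
    show "openin euclidean V" if "V \<in> \<B>" for V using that B(2) topological_basis_open by auto
    fix U and x :: 'a assume U: "openin euclidean U \<and> x \<in> U"
    then show "\<exists>V\<in>\<B>. x \<in> V \<and> V \<subseteq> U" using topological_basisE[OF B(2), of U x] by auto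
  qed (rule B)
qed

lemma complex_manifold_gl: "complex_manifold (gl_cmfd n)"
  unfolding complex_manifold_def
proof (intro conjI)
  let ?C = "cspace ({..<n} \<times> {..<n})" and ?T = "mtop (gl_cmfd n)"
  have hs: "?T homeomorphic_space top_of_set ?C" using gl_chart(2) homeomorphic_map_imp_homeomorphic_space by blast
  show "Hausdorff_space ?T" unfolding homeomorphic_Hausdorff_space[OF hs]
    by (rule Hausdorff_space_subtopology) simp
  show "second_countable ?T" unfolding homeomorphic_space_second_countability[OF hs]
    by (rule second_countable_subtopology[OF second_countable_euclidean])
  have A: "atlas (gl_cmfd n) = {(carrier_mat n n, mat_coords n)}" by (simp add: gl_cmfd_def)
  have sub: "subtopology ?T (carrier_mat n n) = ?T" using subtopology_topspace[of ?T] by simp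
  have o: "openin ?T (carrier_mat n n)" using openin_topspace[of ?T] by simp
  show "points (gl_cmfd n) = (\<Union>(U, \<phi>)\<in>atlas (gl_cmfd n). U)" unfolding A by simp
  show "\<forall>(U, \<phi>)\<in>atlas (gl_cmfd n). openin ?T U \<and> openin (top_of_set (cspace (cidx (gl_cmfd n)))) (\<phi> ` U) \<and>
        homeomorphic_map (subtopology ?T U) (top_of_set (\<phi> ` U)) \<phi>"
    unfolding A using gl_chart(2)[of n] by (simp add: gl_chart(1) sub o)
  have "cdiff_at ({..<n} \<times> {..<n}) (\<lambda>x. mat_coords n (inv_into (carrier_mat n n) (mat_coords n) x) j) x"
    if j: "j \<in> {..<n} \<times> {..<n}" and x: "x \<in> ?C" for j x
  proof (rule cdiff_at_cong[OF cdiff_at_coordinate[OF j _ x] _ x])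
    show "\<forall>\<^sub>F y in cnhds ({..<n} \<times> {..<n}) x. y j = mat_coords n (inv_into (carrier_mat n n) (mat_coords n) y) j"
      using eventually_cnhds_cspace by (rule eventually_mono) (simp add: gl_chart(3) mat_coords_inverse)
  qed auto
  then show "\<forall>(U, \<phi>)\<in>atlas (gl_cmfd n). \<forall>(V, \<psi>)\<in>atlas (gl_cmfd n). \<forall>j\<in>cidx (gl_cmfd n).
       holo_on (cidx (gl_cmfd n)) (\<lambda>x. \<psi> (inv_into U \<phi> x) j) (\<phi> ` (U \<inter> V))"
    unfolding A using mat_coords_cspace[of n] by (auto simp: holo_on_def)
qed simp

lemma openin_GL: "openin (mtop (gl_cmfd n)) (GL n)"
proof -
  \<comment> \<open>The Leibniz expansion, read as a polynomial in the coordinates.\<close>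
  define d where "d z = (\<Sum>p\<in>{p. p permutes {0..<n}}. signof p * (\<Prod>i = 0..<n. z (i, p i)))" for z :: "nat \<times> nat \<Rightarrow> complex"
  have "continuous_on UNIV d"
    unfolding d_def by (intro continuous_intros continuous_on_product_coordinates)
  then have "open (d -` (- {0}))" by (intro open_vimage) auto
  then have "openin (mtop (gl_cmfd n)) {A \<in> topspace (mtop (gl_cmfd n)). mat_coords n A \<in> d -` (- {0})}"
    by (intro openin_continuous_map_preimage[OF continuous_mat_coords]) simp
  moreover have "Determinant.det A = d (mat_coords n A)" if "A \<in> carrier_mat n n" for A
    unfolding d_def det_def'[OF that]
    by (intro sum.cong arg_cong2[where f = "(*)"] prod.cong refl) (auto simp: mat_coords_def dest: permutes_in_image)
  then have "{A \<in> topspace (mtop (gl_cmfd n)). mat_coords n A \<in> d -` (- {0})} = GL n"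
    by (auto simp: GL_iff_det simp del: GL_carrier)
  ultimately show ?thesis by simp
qed

lemma GL_atlas [simp]: "atlas (GL_cmfd n) = {(GL n, mat_coords n)}" and gl_atlas [simp]: "atlas (gl_cmfd n) = {(carrier_mat n n, mat_coords n)}"
  by (simp_all add: GL_cmfd_def gl_cmfd_def)

lemma GL_chart:
  fixes n :: nat
  defines "S \<equiv> mat_coords n ` GL n"
  shows "openin (top_of_set (cspace ({..<n} \<times> {..<n}))) S"
    "homeomorphic_map (mtop (GL_cmfd n)) (top_of_set S) (mat_coords n)"
    "\<And>z. z \<in> S \<Longrightarrow> inv_into (GL n) (mat_coords n) z = Matrix.mat n n z"
proof -
  let ?T = "mtop (gl_cmfd n)" and ?C = "cspace ({..<n} \<times> {..<n})"
  have "GL n = carrier_mat n n \<inter> GL n" by auto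
  then show S: "openin (top_of_set ?C) S"
    using chart_image_openin[OF complex_manifold_gl, of "carrier_mat n n" "mat_coords n" n "GL n"] openin_GL[of n]
    by (simp add: S_def)
  have 1: "GL n \<subseteq> topspace ?T" by auto
  have 2: "continuous_map (subtopology ?T (GL n)) euclidean (mat_coords n)"
    using continuous_mat_coords continuous_map_from_subtopology by blast
  have SC: "z \<in> ?C" if "z \<in> S" for z using that mat_coords_cspace by (auto simp: S_def)
  have 3: "mat_coords n p \<in> S" if "p \<in> GL n" for p using that by (simp add: S_def)
  have 4: "Matrix.mat n n z \<in> GL n" if "z \<in> S" for z
    using that by (auto simp: S_def mat_of_coords)
  note D = chart_criterion[of "GL n" ?T "mat_coords n" ?C S "Matrix.mat n n",
      OF 1 2 S 3 continuous_mat_of_coords 4 mat_coords_inverse[OF SC] mat_of_coords[OF GL_carrier]]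
  have "homeomorphic_map (subtopology ?T (GL n)) (top_of_set S) (mat_coords n)" by (rule D(2))
  then show "homeomorphic_map (mtop (GL_cmfd n)) (top_of_set S) (mat_coords n)" by (simp add: GL_cmfd_def)
  show "inv_into (GL n) (mat_coords n) z = Matrix.mat n n z" if "z \<in> S" for z by (rule D(3)) (use that in auto)
qed

lemma complex_manifold_GL: "complex_manifold (GL_cmfd n)"
  unfolding complex_manifold_def
proof (intro conjI)
  let ?J = "{..<n} \<times> {..<n}" and ?T = "mtop (GL_cmfd n)"
  show "Hausdorff_space ?T" "second_countable ?T"
    using complex_manifold_gl[of n] by (simp_all add: GL_cmfd_def complex_manifold_def Hausdorff_space_subtopology second_countable_subtopology)
  have sub: "subtopology ?T (GL n) = ?T" using subtopology_topspace[of ?T] by simp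
  have o: "openin ?T (GL n)" using openin_topspace[of ?T] by simp
  show "points (GL_cmfd n) = (\<Union>(U, \<phi>)\<in>atlas (GL_cmfd n). U)" by simp
  show "\<forall>(U, \<phi>)\<in>atlas (GL_cmfd n). openin ?T U \<and> openin (top_of_set (cspace (cidx (GL_cmfd n)))) (\<phi> ` U) \<and>
        homeomorphic_map (subtopology ?T U) (top_of_set (\<phi> ` U)) \<phi>"
    using GL_chart(1,2)[of n] by (simp add: sub o)
  have "cdiff_at ?J (\<lambda>x. mat_coords n (inv_into (GL n) (mat_coords n) x) j) x"
    if j: "j \<in> ?J" and x: "x \<in> mat_coords n ` GL n" for j x
  proof -
    have xC: "x \<in> cspace ?J" using x mat_coords_cspace by auto
    show ?thesis
    proof (rule cdiff_at_cong[OF cdiff_at_coordinate[OF j _ xC] _ xC])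
      show "\<forall>\<^sub>F y in cnhds ?J x. y j = mat_coords n (inv_into (GL n) (mat_coords n) y) j"
        using eventually_cnhds_in_openin[OF GL_chart(1) x] eventually_cnhds_cspace
        by eventually_elim (simp add: GL_chart(3) mat_coords_inverse)
    qed auto
  qed
  then show "\<forall>(U, \<phi>)\<in>atlas (GL_cmfd n). \<forall>(V, \<psi>)\<in>atlas (GL_cmfd n). \<forall>j\<in>cidx (GL_cmfd n).
       holo_on (cidx (GL_cmfd n)) (\<lambda>x. \<psi> (inv_into U \<phi> x) j) (\<phi> ` (U \<inter> V))"
    by (simp add: holo_on_def)
qed simp

lemma complex_manifold_TGL: "complex_manifold (TGL_cmfd n)"
  unfolding TGL_cmfd_def by (rule complex_manifold_prod[OF complex_manifold_GL complex_manifold_gl])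

section \<open>Holomorphic matrix-valued functions\<close>

text \<open>The size condition is imposed at every point, holomorphy only near \<open>p\<close>:
  identities such as the entry formula for a product can then be substituted by
  \<open>holo_at_cong\<close>, which asks for equality on all of \<open>X\<close>.\<close>

definition mholo :: "nat \<Rightarrow> ('p, 'j) cmfd \<Rightarrow> 'p \<Rightarrow> ('p \<Rightarrow> complex mat) \<Rightarrow> bool" where
  "mholo n X p F \<longleftrightarrow> (\<forall>q\<in>points X. F q \<in> carrier_mat n n) \<and>
     (\<forall>i<n. \<forall>j<n. holo_at X p (\<lambda>q. F q $$ (i, j)))"

lemma mholo_carrier: "mholo n X p F \<Longrightarrow> q \<in> points X \<Longrightarrow> F q \<in> carrier_mat n n"
  and mholo_entry: "mholo n X p F \<Longrightarrow> i < n \<Longrightarrow> j < n \<Longrightarrow> holo_at X p (\<lambda>q. F q $$ (i, j))"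
  by (simp_all add: mholo_def)

lemma mult_mat_entry:
  assumes "A \<in> carrier_mat n n" "B \<in> carrier_mat n n" "i < n" "j < n"
  shows "(A * B) $$ (i, j) = (\<Sum>k<n. A $$ (i, k) * B $$ (k, j))"
  using assms by (auto simp: scalar_prod_def lessThan_atLeast0 intro!: sum.cong)

lemma mholo_mult:
  assumes X: "complex_manifold X" and p: "p \<in> points X" and F: "mholo n X p F" and G: "mholo n X p G"
  shows "mholo n X p (\<lambda>q. F q * G q)"
  unfolding mholo_def
proof (intro conjI allI impI ballI)
  show "F q * G q \<in> carrier_mat n n" if "q \<in> points X" for q 
    using mholo_carrier[OF F that] mholo_carrier[OF G that] by simp
  fix i j assume ij: "i < n" "j < n"
  have "holo_at X p (\<lambda>q. \<Sum>k<n. F q $$ (i, k) * G q $$ (k, j))"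
    by (intro holo_at_sum[OF X p] holo_at_mult[OF X] mholo_entry[OF F] mholo_entry[OF G] ij) auto
  then show "holo_at X p (\<lambda>q. (F q * G q) $$ (i, j))"
    by (rule holo_at_cong[OF X]) (simp add: mult_mat_entry[OF mholo_carrier[OF F] mholo_carrier[OF G] ij] del: index_mult_mat)
qed

lemma mholo_const:
  assumes X: "complex_manifold X" and p: "p \<in> points X" and A: "A \<in> carrier_mat n n"
  shows "mholo n X p (\<lambda>q. A)"
  using A by (auto simp: mholo_def intro: holo_at_const[OF X p])

lemma add_mat_entry:
  "B \<in> carrier_mat n n \<Longrightarrow> i < n \<Longrightarrow> j < n \<Longrightarrow> (A + B) $$ (i, j) = A $$ (i, j) + B $$ (i, j)"
  and uminus_mat_entry: "A \<in> carrier_mat n n \<Longrightarrow> i < n \<Longrightarrow> j < n \<Longrightarrow> (- A) $$ (i, j) = - A $$ (i, j)"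
  for A B :: "complex mat"
  by auto

lemma minv_entry:
  assumes A: "A \<in> GL n" and ij: "i < n" "j < n"
  shows "minv A $$ (i, j) = inverse (Determinant.det A) * ((- 1) ^ (j + i) * Determinant.det (mat_delete A j i))"
  using ij GL_carrier[OF A] by (auto simp: minv_adj[OF A] adj_mat_def cofactor_def)

lemma mholo_add:
  assumes X: "complex_manifold X" and F: "mholo n X p F" and G: "mholo n X p G"
  shows "mholo n X p (\<lambda>q. F q + G q)"
  unfolding mholo_def
proof (intro conjI allI impI ballI)
  show "F q + G q \<in> carrier_mat n n" if "q \<in> points X" for q 
    using mholo_carrier[OF F that] mholo_carrier[OF G that] by simp
  fix i j assume ij: "i < n" "j < n"
  have "holo_at X p (\<lambda>q. F q $$ (i, j) + G q $$ (i, j))"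
    by (intro holo_at_add[OF X] mholo_entry[OF F] mholo_entry[OF G] ij)
  then show "holo_at X p (\<lambda>q. (F q + G q) $$ (i, j))"
    by (rule holo_at_cong[OF X]) (simp add: add_mat_entry[OF mholo_carrier[OF G] ij])
qed

lemma mholo_uminus:
  assumes X: "complex_manifold X" and F: "mholo n X p F"
  shows "mholo n X p (\<lambda>q. - F q)"
  unfolding mholo_def
proof (intro conjI allI impI ballI)
  show "- F q \<in> carrier_mat n n" if "q \<in> points X" for q 
    using mholo_carrier[OF F that] by simp
  fix i j assume ij: "i < n" "j < n"
  have "holo_at X p (\<lambda>q. - F q $$ (i, j))"
    by (intro holo_at_uminus[OF X] mholo_entry[OF F] ij)
  then show "holo_at X p (\<lambda>q. (- F q) $$ (i, j))"
    by (rule holo_at_cong[OF X]) (simp add: uminus_mat_entry[OF mholo_carrier[OF F] ij])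
qed

lemma holo_at_det:
  assumes X: "complex_manifold X" and p: "p \<in> points X" and F: "mholo n X p F"
  shows "holo_at X p (\<lambda>q. Determinant.det (F q))"
proof -
  have "holo_at X p (\<lambda>q. \<Sum>\<sigma>\<in>{\<sigma>. \<sigma> permutes {0..<n}}. signof \<sigma> * (\<Prod>i = 0..<n. F q $$ (i, \<sigma> i)))"
    by (intro holo_at_sum[OF X p] holo_at_mult[OF X] holo_at_const[OF X p] holo_at_prod[OF X p] mholo_entry[OF F])
       (auto dest: permutes_in_image)
  then show ?thesis
    by (rule holo_at_cong[OF X]) (simp add: det_def'[OF mholo_carrier[OF F]])
qed

text \<open>By Cramer's rule an entry of the inverse is, up to sign, a minor divided by the
  determinant. Both are polynomials in the entries of \<open>F\<close>, and the values in
  \<open>GL n\<close> keep the denominator away from 0.\<close>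

lemma mholo_minv:
  assumes X: "complex_manifold X" and p: "p \<in> points X" and F: "mholo n X p F" 
    and GL: "\<And>q. q \<in> points X \<Longrightarrow> F q \<in> GL n"
  shows "mholo n X p (\<lambda>q. minv (F q))"
  unfolding mholo_def
proof (intro conjI allI impI ballI)
  show "minv (F q) \<in> carrier_mat n n" if "q \<in> points X" for q using GL[OF that] by simp
  fix i j assume ij: "i < n" "j < n"
  \<comment> \<open>Entries of a submatrix are entries of \<open>F\<close> with indices shifted past
    the deleted row and column.\<close>
  have del: "mholo (n - 1) X p (\<lambda>q. mat_delete (F q) j i)"
    unfolding mholo_def
  proof (intro conjI allI impI ballI)
    show "mat_delete (F q) j i \<in> carrier_mat (n - 1) (n - 1)" if "q \<in> points X" for q
      using mat_delete_carrier[OF mholo_carrier[OF F that]] .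
    fix a b assume ab: "a < n - 1" "b < n - 1"
    show "holo_at X p (\<lambda>q. mat_delete (F q) j i $$ (a, b))"
    proof (rule holo_at_cong[OF X mholo_entry[OF F]])
      show "F q $$ (if a < j then a else Suc a, if b < i then b else Suc b) = mat_delete (F q) j i $$ (a, b)"
        if "q \<in> points X" for q
        using mholo_carrier[OF F that] ab by (simp add: mat_delete_def)
    qed (use ab in auto)
  qed
  have "holo_at X p (\<lambda>q. inverse (Determinant.det (F q)) * ((- 1) ^ (j + i) * Determinant.det (mat_delete (F q) j i)))"
    using GL by (intro holo_at_mult[OF X] holo_at_inverse[OF X] holo_at_det[OF X p F] holo_at_det[OF X p del] holo_at_const[OF X p])
      (auto simp: GL_iff_det simp del: GL_carrier)
  then show "holo_at X p (\<lambda>q. minv (F q) $$ (i, j))"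
    by (rule holo_at_cong[OF X]) (simp add: minv_entry[OF GL ij])
qed

lemma upper_left_carrier [simp]: "upper_left i A \<in> carrier_mat i i"
  by (simp add: upper_left_def)

lemma diag_embed_carrier [simp]: "A \<in> carrier_mat k k \<Longrightarrow> diag_embed k A \<in> carrier_mat (Suc k) (Suc k)"
  using four_block_carrier_mat[of A k k "1\<^sub>m 1" 1 1] by (simp add: diag_embed_def)

lemma diag_embed_entry:
  "A \<in> carrier_mat k k \<Longrightarrow> i < Suc k \<Longrightarrow> j < Suc k \<Longrightarrow>
    diag_embed k A $$ (i, j) = (if i < k \<and> j < k then A $$ (i, j) else if i = j then 1 else 0)"
  by (auto simp: diag_embed_def)

lemma mholo_upper_left:
  assumes X: "complex_manifold X" and F: "mholo n X p F" and i: "i \<le> n"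
  shows "mholo i X p (\<lambda>q. upper_left i (F q))"
  using i mholo_entry[OF F] by (auto simp: mholo_def upper_left_def)

lemma mholo_diag_embed:
  assumes X: "complex_manifold X" and p: "p \<in> points X" and F: "mholo k X p F"
  shows "mholo (Suc k) X p (\<lambda>q. diag_embed k (F q))"
  unfolding mholo_def
proof (intro conjI allI impI ballI)
  show "diag_embed k (F q) \<in> carrier_mat (Suc k) (Suc k)" if "q \<in> points X" for q 
    using mholo_carrier[OF F that] by simp
  fix i j assume ij: "i < Suc k" "j < Suc k"
  have "holo_at X p (\<lambda>q. if i < k \<and> j < k then F q $$ (i, j) else if i = j then 1 else 0)"
    using mholo_entry[OF F, of i j] holo_at_const[OF X p] by (cases "i < k \<and> j < k") auto
  then show "holo_at X p (\<lambda>q. diag_embed k (F q) $$ (i, j))"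
    by (rule holo_at_cong[OF X]) (simp add: diag_embed_entry[OF mholo_carrier[OF F] ij])
qed

text \<open>This is how maps into spaces of matrices acquire the continuity that
  \<open>holomorphic_map\<close> demands: it is read off from the entries.\<close>

lemma holo_continuous:
  assumes X: "complex_manifold X" and h: "\<And>p. p \<in> points X \<Longrightarrow> holo_at X p h"
  shows "continuous_map (mtop X) euclidean h"
  unfolding continuous_map
proof (intro conjI allI impI)
  fix V :: "complex set" assume "openin euclidean V"
  then have V: "open V" by simp
  show "openin (mtop X) {x \<in> points X. h x \<in> V}"
    unfolding openin_subopen[of _ "{x \<in> points X. h x \<in> V}"]
  proof
    fix q assume "q \<in> {x \<in> points X. h x \<in> V}"
    then have q: "q \<in> points X" "h q \<in> V" by auto
    obtain U \<phi> where U: "(U, \<phi>) \<in> atlas X" "q \<in> U" using chart_ex[OF X q(1)] by blast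
    have "cdiff_at (cidx X) (h \<circ> inv_into U \<phi>) (\<phi> q)"
      using holo_at_imp_mdiff[OF X h[OF q(1)]] mdiff_iff[OF X U] by blast
    then obtain c where "slope_at (cidx X) (h \<circ> inv_into U \<phi>) (\<phi> q) c"
      using cdiff_at_iff_slope[OF cidx_finite[OF X] chart_cspace[OF X U]] by blast
    from slope_at_tendsto[OF this] have "\<forall>\<^sub>F x in cnhds (cidx X) (\<phi> q). h (inv_into U \<phi> x) \<in> V"
      using V q(2) chart_inv[OF X U] by (auto simp: tendsto_def)
    then obtain S where S: "open S" "\<phi> q \<in> S" "\<forall>x\<in>S \<inter> cspace (cidx X). h (inv_into U \<phi> x) \<in> V"
      unfolding eventually_cnhds by blast
    have "openin (top_of_set (cspace (cidx X))) (S \<inter> cspace (cidx X))" using openin_open_Int[OF S(1)] by (subst Int_commute)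
    from chart_vimage_openin[OF X U(1) this]
    have o: "openin (mtop X) {p \<in> U. \<phi> p \<in> S \<inter> cspace (cidx X)}" .
    show "\<exists>T. openin (mtop X) T \<and> q \<in> T \<and> T \<subseteq> {x \<in> points X. h x \<in> V}"
    proof (intro exI conjI)
      show "q \<in> {p \<in> U. \<phi> p \<in> S \<inter> cspace (cidx X)}" using U S chart_cspace[OF X U] by auto
      show "{p \<in> U. \<phi> p \<in> S \<inter> cspace (cidx X)} \<subseteq> {x \<in> points X. h x \<in> V}"
        using S(3) chart_inv[OF X U(1)] chart_sub[OF X U(1)] by force
    qed (rule o)
  qed
qed simp

lemma holomorphic_map_into_gl:
  assumes X: "complex_manifold X" and F: "\<And>p. p \<in> points X \<Longrightarrow> mholo n X p F"
  shows "holomorphic_map X (gl_cmfd n) F"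
proof (rule holomorphic_mapI[OF X complex_manifold_gl])
  show "continuous_map (mtop X) (mtop (gl_cmfd n)) F"
    by (intro continuous_map_into_gl holo_continuous[OF X] mholo_entry[OF F] mholo_carrier[OF F]) auto
  fix p assume p: "p \<in> points X"
  have "holo_at X p (\<lambda>q. mat_coords n (F q) k)" if "k \<in> cidx (gl_cmfd n)" for k
    using that mholo_entry[OF F[OF p]] by (auto simp: mat_coords_def)
  then show "\<exists>(V, \<psi>)\<in>atlas (gl_cmfd n). F p \<in> V \<and> (\<forall>k\<in>cidx (gl_cmfd n). holo_at X p (\<lambda>q. \<psi> (F q) k))"
    using mholo_carrier[OF F[OF p] p] by simp
qed

lemma holomorphic_map_into_GL:
  assumes X: "complex_manifold X" and F: "\<And>p. p \<in> points X \<Longrightarrow> mholo n X p F" 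
    and GL: "\<And>p. p \<in> points X \<Longrightarrow> F p \<in> GL n"
  shows "holomorphic_map X (GL_cmfd n) F"
proof (rule holomorphic_mapI[OF X complex_manifold_GL])
  show "continuous_map (mtop X) (mtop (GL_cmfd n)) F"
    using holomorphic_map_continuous[OF holomorphic_map_into_gl[OF X F]] GL
    by (auto simp: GL_cmfd_def continuous_map_in_subtopology)
  fix p assume p: "p \<in> points X"
  have "holo_at X p (\<lambda>q. mat_coords n (F q) k)" if "k \<in> cidx (GL_cmfd n)" for k
    using that mholo_entry[OF F[OF p]] by (auto simp: mat_coords_def)
  then show "\<exists>(V, \<psi>)\<in>atlas (GL_cmfd n). F p \<in> V \<and> (\<forall>k\<in>cidx (GL_cmfd n). holo_at X p (\<lambda>q. \<psi> (F q) k))"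
    using GL[OF p] by simp
qed

lemma mholo_of_gl:
  assumes X: "complex_manifold X" and F: "holomorphic_map X (gl_cmfd n) F" and p: "p \<in> points X"
  shows "mholo n X p F"
  unfolding mholo_def
proof (intro conjI allI impI ballI)
  show c: "F q \<in> carrier_mat n n" if "q \<in> points X" for q using holomorphic_map_points[OF F that] by simp
  fix i j assume ij: "i < n" "j < n"
  then show "holo_at X p (\<lambda>q. F q $$ (i, j))"
    using holomorphic_map_coord_holo[OF X complex_manifold_gl F _ _ p, of "carrier_mat n n" "mat_coords n" "(i, j)"] c[OF p]
    by (simp add: mat_coords_def)
qed

lemma mholo_of_GL:
  assumes X: "complex_manifold X" and F: "holomorphic_map X (GL_cmfd n) F" and p: "p \<in> points X"
  shows "mholo n X p F"
  unfolding mholo_def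
proof (intro conjI allI impI ballI)
  show "F q \<in> carrier_mat n n" if "q \<in> points X" for q using holomorphic_map_points[OF F that] by simp
  fix i j assume ij: "i < n" "j < n"
  then show "holo_at X p (\<lambda>q. F q $$ (i, j))"
    using holomorphic_map_coord_holo[OF X complex_manifold_GL F _ _ p, of "GL n" "mat_coords n" "(i, j)"] 
      holomorphic_map_points[OF F p]
    by (simp add: mat_coords_def)
qed

lemma mholo_compose:
  assumes X: "complex_manifold X" and Y: "complex_manifold Y" and G: "holomorphic_map X Y G" and p: "p \<in> points X"
    and F: "mholo n Y (G p) F"
  shows "mholo n X p (\<lambda>q. F (G q))"
  unfolding mholo_def
proof (intro conjI allI impI ballI)
  show "F (G q) \<in> carrier_mat n n" if "q \<in> points X" for q using mholo_carrier[OF F] holomorphic_map_points[OF G that] by simp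
  fix i j assume ij: "i < n" "j < n"
  show "holo_at X p (\<lambda>q. F (G q) $$ (i, j))"
    using holo_at_compose[OF X Y G mholo_entry[OF F ij] p] by (simp add: comp_def)
qed

section \<open>Derivatives of matrix-valued functions\<close>

lemma mat_deriv_carrier [simp]: "mat_deriv n F v \<in> carrier_mat n n"
  by (simp add: mat_deriv_def)

lemma mat_deriv_dim [simp]: "dim_row (mat_deriv n F v) = n" "dim_col (mat_deriv n F v) = n"
  by (simp_all add: mat_deriv_def)

lemma mat_deriv_entry [simp]: "i < n \<Longrightarrow> j < n \<Longrightarrow> mat_deriv n F v $$ (i, j) = v (\<lambda>x. F x $$ (i, j))"
  by (simp add: mat_deriv_def)

lemma mat_deriv_cong:
  assumes X: "complex_manifold X" and p: "p \<in> points X" and v: "v \<in> tangent_space X p"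
    and eq: "\<And>q. q \<in> points X \<Longrightarrow> F q = G q"
  shows "mat_deriv n F v = mat_deriv n G v"
proof (rule eq_matI)
  fix i j assume "i < dim_row (mat_deriv n G v)" "j < dim_col (mat_deriv n G v)"
  then show "mat_deriv n F v $$ (i, j) = mat_deriv n G v $$ (i, j)"
    using tangent_cong[OF X p v, of "\<lambda>q. F q $$ (i, j)" "\<lambda>q. G q $$ (i, j)"] eq by simp
qed auto

lemma mat_deriv_mult:
  assumes X: "complex_manifold X" and p: "p \<in> points X" and v: "v \<in> tangent_space X p"
    and F: "mholo n X p F" and G: "mholo n X p G"
  shows "mat_deriv n (\<lambda>q. F q * G q) v = mat_deriv n F v * G p + F p * mat_deriv n G v"
proof (rule eq_matI)
  have c: "F p \<in> carrier_mat n n" "G p \<in> carrier_mat n n" using mholo_carrier[OF F p] mholo_carrier[OF G p] .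
  fix i j assume "i < dim_row (mat_deriv n F v * G p + F p * mat_deriv n G v)" 
    "j < dim_col (mat_deriv n F v * G p + F p * mat_deriv n G v)"
  then have ij: "i < n" "j < n" using c by auto
  have "v (\<lambda>q. (F q * G q) $$ (i, j)) = v (\<lambda>q. \<Sum>k<n. F q $$ (i, k) * G q $$ (k, j))"
    by (rule tangent_cong[OF X p v])
       (simp add: mult_mat_entry[OF mholo_carrier[OF F] mholo_carrier[OF G] ij] del: index_mult_mat)
  also have "\<dots> = (\<Sum>k<n. v (\<lambda>q. F q $$ (i, k) * G q $$ (k, j)))"
    by (rule tangent_sum[OF X p v]) (intro holo_at_mult[OF X] mholo_entry[OF F] mholo_entry[OF G] ij, auto)
  also have "\<dots> = (\<Sum>k<n. v (\<lambda>q. F q $$ (i, k)) * G p $$ (k, j) + F p $$ (i, k) * v (\<lambda>q. G q $$ (k, j)))"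
    using ij by (intro sum.cong refl tangent_mult[OF X p v] mholo_entry[OF F] mholo_entry[OF G]) auto
  also have "\<dots> = (mat_deriv n F v * G p) $$ (i, j) + (F p * mat_deriv n G v) $$ (i, j)"
    using ij by (subst (1 2) mult_mat_entry[OF _ _ ij]) (auto simp: c sum.distrib)
  finally show "mat_deriv n (\<lambda>q. F q * G q) v $$ (i, j) = (mat_deriv n F v * G p + F p * mat_deriv n G v) $$ (i, j)"
    using ij c by (simp del: index_mult_mat(1))
qed (use mholo_carrier[OF F p] mholo_carrier[OF G p] in auto)

lemma mat_deriv_const:
  assumes X: "complex_manifold X" and p: "p \<in> points X" and v: "v \<in> tangent_space X p"
  shows "mat_deriv n (\<lambda>q. A) v = 0\<^sub>m n n"
  by (rule eq_matI) (auto simp: tangent_const[OF X p v])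

lemma mat_deriv_upper_left: "i \<le> n \<Longrightarrow> mat_deriv i (\<lambda>q. upper_left i (F q)) v = upper_left i (mat_deriv n F v)"
  by (rule eq_matI) (auto simp: upper_left_def)

text \<open>The corner entry 1 is constant, so the derivative has the corner 0. In the notation
  introduced later, the right-hand side is \<open>pad k (mat_deriv k F v)\<close>.\<close>

lemma mat_deriv_diag_embed:
  assumes X: "complex_manifold X" and p: "p \<in> points X" and v: "v \<in> tangent_space X p" and F: "mholo k X p F"
  shows "mat_deriv (Suc k) (\<lambda>q. diag_embed k (F q)) v = four_block_mat (mat_deriv k F v) (0\<^sub>m k 1) (0\<^sub>m 1 k) (0\<^sub>m 1 1)"
proof (rule eq_matI)
  fix i j assume "i < dim_row (four_block_mat (mat_deriv k F v) (0\<^sub>m k 1) (0\<^sub>m 1 k) (0\<^sub>m 1 1))"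
    "j < dim_col (four_block_mat (mat_deriv k F v) (0\<^sub>m k 1) (0\<^sub>m 1 k) (0\<^sub>m 1 1))"
  then have ij: "i < Suc k" "j < Suc k" by auto
  have "v (\<lambda>q. diag_embed k (F q) $$ (i, j)) = v (\<lambda>q. if i < k \<and> j < k then F q $$ (i, j) else if i = j then 1 else 0)"
    by (rule tangent_cong[OF X p v]) (simp add: diag_embed_entry[OF mholo_carrier[OF F] ij])
  also have "\<dots> = (if i < k \<and> j < k then v (\<lambda>q. F q $$ (i, j)) else 0)"
    using tangent_const[OF X p v] by auto
  finally show "mat_deriv (Suc k) (\<lambda>q. diag_embed k (F q)) v $$ (i, j) =
      four_block_mat (mat_deriv k F v) (0\<^sub>m k 1) (0\<^sub>m 1 k) (0\<^sub>m 1 1) $$ (i, j)"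
    using ij by auto
qed auto

lemma mat_deriv_differential:
  assumes F: "mholo n Y (G p) F"
  shows "mat_deriv n F (differential Y G p v) = mat_deriv n (\<lambda>q. F (G q)) v"
proof (rule eq_matI)
  fix i j assume "i < dim_row (mat_deriv n (\<lambda>q. F (G q)) v)" "j < dim_col (mat_deriv n (\<lambda>q. F (G q)) v)"
  then have ij: "i < n" "j < n" by auto
  show "mat_deriv n F (differential Y G p v) $$ (i, j) = mat_deriv n (\<lambda>q. F (G q)) v $$ (i, j)"
    using differential_apply[where F = G and v = v, OF mholo_entry[OF F ij]] ij by (simp add: comp_def)
qed auto

section \<open>Traces of products\<close>

lemma mat_mult_closed: "A \<in> carrier_mat n n \<Longrightarrow> B \<in> carrier_mat n n \<Longrightarrow> A * B \<in> carrier_mat n n"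
  and mat_diff_closed: "A \<in> carrier_mat n n \<Longrightarrow> B \<in> carrier_mat n n \<Longrightarrow> A - B \<in> carrier_mat n n"
  and mat_add_closed: "A \<in> carrier_mat n n \<Longrightarrow> B \<in> carrier_mat n n \<Longrightarrow> A + B \<in> carrier_mat n n"
  for A B :: "complex mat"
  by auto

text \<open>The functions \<open>tr2\<close> and \<open>tr3\<close> are the traces of products of
  two and three matrices, written out in entries. They are multilinear and cyclic, so identities
  between forms become linear arithmetic in traces instead of rewriting of matrix products.\<close>

definition tr2 :: "nat \<Rightarrow> complex mat \<Rightarrow> complex mat \<Rightarrow> complex" where
  "tr2 n A B = (\<Sum>i<n. \<Sum>j<n. A $$ (i, j) * B $$ (j, i))"

definition tr3 :: "nat \<Rightarrow> complex mat \<Rightarrow> complex mat \<Rightarrow> complex mat \<Rightarrow> complex" where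
  "tr3 n A B C = (\<Sum>i<n. \<Sum>j<n. \<Sum>k<n. A $$ (i, j) * B $$ (j, k) * C $$ (k, i))"

lemma mtrace_mult:
  assumes "A \<in> carrier_mat n n" "B \<in> carrier_mat n n"
  shows "mtrace (A * B) = tr2 n A B"
  using assms by (simp add: mtrace_def tr2_def mult_mat_entry[OF assms] del: index_mult_mat(1))

lemma mtrace_diff:
  assumes "A \<in> carrier_mat n n" "B \<in> carrier_mat n n"
  shows "mtrace (A - B) = mtrace A - mtrace B"
  using assms by (simp add: mtrace_def sum_subtractf)

lemma tr2_comm: "tr2 n A B = tr2 n B A"
  unfolding tr2_def by (subst sum.swap) (simp add: mult.commute)

lemma tr2_mult:
  assumes "B \<in> carrier_mat n n" "C \<in> carrier_mat n n"
  shows "tr2 n A (B * C) = tr3 n A B C"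
  unfolding tr2_def tr3_def
  by (intro sum.cong refl) (simp add: mult_mat_entry[OF assms] sum_distrib_left mult.assoc del: index_mult_mat(1))

lemma tr3_cyc: "tr3 n A B C = tr3 n B C A"
proof -
  have "tr3 n A B C = (\<Sum>j<n. \<Sum>i<n. \<Sum>k<n. A $$ (i, j) * B $$ (j, k) * C $$ (k, i))"
    unfolding tr3_def by (rule sum.swap)
  also have "\<dots> = (\<Sum>j<n. \<Sum>k<n. \<Sum>i<n. A $$ (i, j) * B $$ (j, k) * C $$ (k, i))"
    by (intro sum.cong refl sum.swap)
  finally show ?thesis by (simp add: tr3_def mult_ac)
qed

lemma tr2_add_right: "C \<in> carrier_mat n n \<Longrightarrow> tr2 n A (B + C) = tr2 n A B + tr2 n A C"
  and tr2_diff_right: "C \<in> carrier_mat n n \<Longrightarrow> tr2 n A (B - C) = tr2 n A B - tr2 n A C"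
  and tr2_diff_left: "C \<in> carrier_mat n n \<Longrightarrow> tr2 n (B - C) A = tr2 n B A - tr2 n C A"
  and tr2_uminus_left: "B \<in> carrier_mat n n \<Longrightarrow> tr2 n (- B) A = - tr2 n B A"
  by (simp_all add: tr2_def distrib_left right_diff_distrib left_diff_distrib sum.distrib sum_subtractf sum_negf)

lemma tr3_diff2: "C \<in> carrier_mat n n \<Longrightarrow> tr3 n A (B - C) D = tr3 n A B D - tr3 n A C D"
  and tr3_diff3: "C \<in> carrier_mat n n \<Longrightarrow> tr3 n A D (B - C) = tr3 n A D B - tr3 n A D C"
  by (simp_all add: tr3_def right_diff_distrib left_diff_distrib sum_subtractf)

text \<open>The form on the cotangent bundle of the general linear group at \<open>(g, B)\<close>, as a function of
  \<open>B\<close>, \<open>(\<rho>, b)\<close> and \<open>(\<rho>', b')\<close>.\<close>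

definition cot_form :: "complex mat \<Rightarrow> complex mat \<Rightarrow> complex mat \<Rightarrow> complex mat \<Rightarrow> complex mat \<Rightarrow> complex" where
  "cot_form B \<rho> b \<rho>' b' = mtrace (\<rho> * b' - \<rho>' * b - B * (\<rho> * \<rho>' - \<rho>' * \<rho>))"

lemma TGL_form_cot_form:
  "TGL_form n x v w = cot_form (snd x) (mat_deriv n fst v * minv (fst x)) (mat_deriv n snd v)
     (mat_deriv n fst w * minv (fst x)) (mat_deriv n snd w)"
  by (simp add: TGL_form_def cot_form_def Let_def)

lemma cot_form_traces:
  assumes [simp]: "B \<in> carrier_mat n n" "r \<in> carrier_mat n n" "b \<in> carrier_mat n n" "r' \<in> carrier_mat n n" "b' \<in> carrier_mat n n"
  shows "cot_form B r b r' b' = tr2 n r b' - tr2 n r' b - tr3 n B r r' + tr3 n B r' r"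
proof -
  have [simp]: "r * b' \<in> carrier_mat n n" "r' * b \<in> carrier_mat n n" "r * r' \<in> carrier_mat n n" "r' * r \<in> carrier_mat n n"
    "r * r' - r' * r \<in> carrier_mat n n" "r * b' - r' * b \<in> carrier_mat n n"
    "B * (r * r' - r' * r) \<in> carrier_mat n n"
    by (intro mat_mult_closed[where n = n] mat_diff_closed[where n = n] assms)+
  have "cot_form B r b r' b' = mtrace (r * b') - mtrace (r' * b) - mtrace (B * (r * r' - r' * r))"
    unfolding cot_form_def by (simp add: mtrace_diff[of _ n])
  also have "\<dots> = tr2 n r b' - tr2 n r' b - tr2 n B (r * r' - r' * r)"
    by (simp add: mtrace_mult[of _ n])
  finally show ?thesis by (simp add: tr2_diff_right tr2_mult)
qed

text \<open>The effect of a gauge transformation with logarithmic derivative \<open>\<sigma>\<close>; the term that is split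
  off is the summand which makes the forms of consecutive factors telescope.\<close>

lemma cot_form_shift:
  assumes [simp]: "U \<in> carrier_mat n n" "s \<in> carrier_mat n n" "d \<in> carrier_mat n n" "s' \<in> carrier_mat n n" "d' \<in> carrier_mat n n"
    "\<sigma> \<in> carrier_mat n n" "\<sigma>' \<in> carrier_mat n n"
  shows "cot_form U (s - \<sigma>) (d + (U * \<sigma> - \<sigma> * U)) (s' - \<sigma>') (d' + (U * \<sigma>' - \<sigma>' * U)) =
    cot_form U s d s' d' - cot_form U \<sigma> d \<sigma>' d'"
proof -
  have [simp]: "U * \<sigma> \<in> carrier_mat n n" "\<sigma> * U \<in> carrier_mat n n" "U * \<sigma>' \<in> carrier_mat n n" "\<sigma>' * U \<in> carrier_mat n n"
    "s - \<sigma> \<in> carrier_mat n n" "s' - \<sigma>' \<in> carrier_mat n n" "U * \<sigma> - \<sigma> * U \<in> carrier_mat n n" "U * \<sigma>' - \<sigma>' * U \<in> carrier_mat n n"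
    "d + (U * \<sigma> - \<sigma> * U) \<in> carrier_mat n n" "d' + (U * \<sigma>' - \<sigma>' * U) \<in> carrier_mat n n"
    by (intro mat_mult_closed[where n = n] mat_diff_closed[where n = n] mat_add_closed[where n = n] assms)+
  \<comment> \<open>Rotating \<open>U\<close> to the front makes the cubic terms comparable. The
    terms mixing s with \<open>\<sigma>'\<close> and s' with \<open>\<sigma>\<close> cancel by
    invariance of the trace form, tr(s [U, \<sigma>']) = tr(U [\<sigma>', s]); of the terms in
    \<open>\<sigma>\<close> and \<open>\<sigma>'\<close> alone, one copy of tr(U
    [\<sigma>, \<sigma>']) is left.\<close>
  have c: "tr3 n A U C = tr3 n U C A" "tr3 n A C U = tr3 n U A C" for A C
    by (rule tr3_cyc, metis tr3_cyc)
  show ?thesis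
    by (simp add: cot_form_traces[of _ n] tr2_add_right tr2_diff_right tr2_diff_left tr2_mult tr3_diff2 tr3_diff3)
       (simp add: c tr3_diff2 tr3_diff3)
qed

lemma conj_mult:
  assumes e: "e \<in> GL n" and X: "X \<in> carrier_mat n n" and Y: "Y \<in> carrier_mat n n"
  shows "(minv e * X * e) * (minv e * Y * e) = minv e * (X * Y) * e"
proof -
  note c = GL_carrier[OF e] minv_carrier[OF e] X Y
  note m = mat_mult_closed[where n = n]
  have "(minv e * X * e) * (minv e * Y * e) = minv e * X * (e * (minv e * Y * e))"
    by (intro mat_assoc[of _ n] m c)
  also have "e * (minv e * Y * e) = e * (minv e * (Y * e))"
    by (intro arg_cong2[where f = "(*)"] refl mat_assoc[of _ n] m c)
  also have "\<dots> = Y * e" by (rule minv_cancel(1)[OF e]) (intro m c)+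
  also have "minv e * X * (Y * e) = minv e * (X * (Y * e))" by (intro mat_assoc[of _ n] m c)
  also have "X * (Y * e) = X * Y * e" by (intro mat_assoc[of _ n, symmetric] m c)
  also have "minv e * (X * Y * e) = minv e * (X * Y) * e" by (intro mat_assoc[of _ n, symmetric] m c)
  finally show ?thesis .
qed

lemma conj_diff:
  assumes e: "e \<in> GL n" and X: "X \<in> carrier_mat n n" and Y: "Y \<in> carrier_mat n n"
  shows "minv e * X * e - minv e * Y * e = minv e * (X - Y) * e"
proof -
  note c = GL_carrier[OF e] minv_carrier[OF e] X Y
  note m = mat_mult_closed[where n = n]
  have "minv e * (X - Y) * e = (minv e * X - minv e * Y) * e"
    using mult_minus_distrib_mat[OF c(2) X Y] by simp
  also have "\<dots> = minv e * X * e - minv e * Y * e"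
    by (rule minus_mult_distrib_mat[of _ n n _ _ n]) (intro m c)+
  finally show ?thesis by simp
qed

lemma mtrace_conj:
  assumes e: "e \<in> GL n" and X: "X \<in> carrier_mat n n"
  shows "mtrace (minv e * X * e) = mtrace X"
proof -
  note c = GL_carrier[OF e] minv_carrier[OF e] X
  have "mtrace (minv e * X * e) = tr2 n (minv e * X) e" by (rule mtrace_mult) (use c in auto)
  also have "\<dots> = tr2 n e (minv e * X)" by (rule tr2_comm)
  also have "\<dots> = mtrace (e * (minv e * X))" by (rule mtrace_mult[symmetric]) (use c in auto)
  finally show ?thesis using minv_cancel(1)[OF e X] by simp
qed

lemma cot_form_conj:
  assumes e: "e \<in> GL n"
    and c: "U \<in> carrier_mat n n" "r \<in> carrier_mat n n" "b \<in> carrier_mat n n" "r' \<in> carrier_mat n n" "b' \<in> carrier_mat n n"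
  shows "cot_form (minv e * U * e) (minv e * r * e) (minv e * b * e) (minv e * r' * e) (minv e * b' * e) = cot_form U r b r' b'"
  unfolding cot_form_def
  by (simp only: conj_mult[OF e] conj_diff[OF e] mtrace_conj[OF e] mat_mult_closed[where n = n] mat_diff_closed[where n = n] c)

text \<open>The inclusion of gl(k) into gl(k+1) that is tangent to the group embedding
  \<open>diag_embed\<close>; hence 0 and not 1 in the corner.\<close>

definition pad :: "nat \<Rightarrow> complex mat \<Rightarrow> complex mat" where
  "pad k A = four_block_mat A (0\<^sub>m k 1) (0\<^sub>m 1 k) (0\<^sub>m 1 1)"

lemma pad_carrier [simp]: "A \<in> carrier_mat k k \<Longrightarrow> pad k A \<in> carrier_mat (Suc k) (Suc k)"
  using four_block_carrier_mat[of A k k "0\<^sub>m 1 1" 1 1] by (simp add: pad_def)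

lemma pad_entry:
  "A \<in> carrier_mat k k \<Longrightarrow> i < Suc k \<Longrightarrow> j < Suc k \<Longrightarrow> pad k A $$ (i, j) = (if i < k \<and> j < k then A $$ (i, j) else 0)"
  by (auto simp: pad_def)

lemma tr2_pad:
  assumes A: "A \<in> carrier_mat k k"
  shows "tr2 (Suc k) (pad k A) D = tr2 k A (upper_left k D)"
proof -
  have "tr2 (Suc k) (pad k A) D = (\<Sum>i<k. \<Sum>j<k. pad k A $$ (i, j) * D $$ (j, i))"
    unfolding tr2_def by (simp add: pad_entry[OF A])
  then show ?thesis by (simp add: tr2_def pad_entry[OF A] upper_left_def)
qed

lemma tr3_pad:
  assumes A: "A \<in> carrier_mat k k" and B: "B \<in> carrier_mat k k"
  shows "tr3 (Suc k) U (pad k A) (pad k B) = tr3 k (upper_left k U) A B"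
proof -
  have "tr3 (Suc k) U (pad k A) (pad k B) = (\<Sum>i<k. \<Sum>j<k. \<Sum>l<k. U $$ (i, j) * pad k A $$ (j, l) * pad k B $$ (l, i))"
    unfolding tr3_def by (simp add: pad_entry[OF A] pad_entry[OF B])
  then show ?thesis by (simp add: tr3_def pad_entry[OF A] pad_entry[OF B] upper_left_def)
qed

text \<open>Pairing with a matrix bordered by zeros sees only the upper-left block of the other
  factor. This is the step from one size to the next in the telescoping sum.\<close>

lemma cot_form_pad:
  assumes [simp]: "s \<in> carrier_mat k k" "s' \<in> carrier_mat k k" 
    "U \<in> carrier_mat (Suc k) (Suc k)" "d \<in> carrier_mat (Suc k) (Suc k)" "d' \<in> carrier_mat (Suc k) (Suc k)"
  shows "cot_form U (pad k s) d (pad k s') d' = cot_form (upper_left k U) s (upper_left k d) s' (upper_left k d')"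
  by (simp add: cot_form_traces[of _ "Suc k"] cot_form_traces[of _ k] tr2_pad tr3_pad)

section \<open>Products and inverses of block-diagonal matrices\<close>

lemma block_diag_mult:
  fixes A B :: "complex mat"
  assumes A: "A \<in> carrier_mat k k" and B: "B \<in> carrier_mat k k" and C: "C \<in> carrier_mat 1 1" and D: "D \<in> carrier_mat 1 1"
  shows "four_block_mat A (0\<^sub>m k 1) (0\<^sub>m 1 k) C * four_block_mat B (0\<^sub>m k 1) (0\<^sub>m 1 k) D =
    four_block_mat (A * B) (0\<^sub>m k 1) (0\<^sub>m 1 k) (C * D)"
proof -
  have z: "A * 0\<^sub>m k 1 = 0\<^sub>m k 1" "0\<^sub>m k 1 * D = 0\<^sub>m k 1" "0\<^sub>m 1 k * B = 0\<^sub>m 1 k" "C * 0\<^sub>m 1 k = 0\<^sub>m 1 k"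
    using right_mult_zero_mat[OF A] left_mult_zero_mat[OF D] left_mult_zero_mat[OF B] right_mult_zero_mat[OF C] by auto
  have "A * B + 0\<^sub>m k 1 * 0\<^sub>m 1 k = A * B" "0\<^sub>m 1 k * 0\<^sub>m k 1 + C * D = C * D"
    using A B C D by auto
  then show ?thesis
    using mult_four_block_mat[OF A zero_carrier_mat zero_carrier_mat C B zero_carrier_mat zero_carrier_mat D] z
    by (simp del: One_nat_def)
qed

lemma pad_mult_diag_embed:
  assumes "A \<in> carrier_mat k k" "B \<in> carrier_mat k k"
  shows "pad k A * diag_embed k B = pad k (A * B)"
  unfolding diag_embed_def pad_def by (subst block_diag_mult[OF assms]) auto

lemma diag_embed_mult:
  assumes "A \<in> carrier_mat k k" "B \<in> carrier_mat k k"
  shows "diag_embed k A * diag_embed k B = diag_embed k (A * B)"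
  unfolding diag_embed_def by (subst block_diag_mult[OF assms]) auto

lemma diag_embed_one [simp]: "diag_embed k (1\<^sub>m k) = 1\<^sub>m (Suc k)"
  unfolding diag_embed_def by simp

lemma diag_embed_GL [simp]:
  assumes A: "A \<in> GL k"
  shows "diag_embed k A \<in> GL (Suc k)"
proof -
  have "Determinant.det (diag_embed k A) * Determinant.det (diag_embed k (minv A)) = 1"
    using Determinant.det_mult[OF diag_embed_carrier[OF GL_carrier[OF A]] diag_embed_carrier[OF minv_carrier[OF A]]]
    by (simp add: diag_embed_mult GL_carrier[OF A] minv_carrier[OF A] minv_right[OF A])
  then show ?thesis using A by (subst GL_iff_det) auto
qed

lemma minv_diag_embed:
  assumes A: "A \<in> GL k"
  shows "minv (diag_embed k A) = diag_embed k (minv A)"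
  by (rule minv_unique[OF diag_embed_GL[OF A]])
     (simp_all add: diag_embed_mult GL_carrier[OF A] minv_carrier[OF A] minv_right[OF A])

section \<open>Differentiating gauge transformations\<close>

lemma mat_add_eq_imp_eq_diff:
  fixes A B :: "complex mat"
  assumes "A \<in> carrier_mat n n" "B \<in> carrier_mat n n" "A + B = C"
  shows "B = C - A"
  using assms by (auto intro!: eq_matI)

text \<open>With g = e^-1 a, the equation e g = a is differentiated and \<open>e\<close> is
  cancelled on the left, which avoids differentiating an inverse. In terms of s = da a^-1 and
  \<sigma> = de e^-1 the outcome reads dg g^-1 = e^-1 (s - \<sigma>) e.\<close>

lemma mat_deriv_left_quotient:
  assumes X: "complex_manifold X" and p: "p \<in> points X" and v: "v \<in> tangent_space X p"
    and e: "mholo n X p e" "\<And>q. q \<in> points X \<Longrightarrow> e q \<in> GL n" 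
    and a: "mholo n X p a" "\<And>q. q \<in> points X \<Longrightarrow> a q \<in> GL n"
  shows "mat_deriv n (\<lambda>q. minv (e q) * a q) v * minv (minv (e p) * a p) =
    minv (e p) * (mat_deriv n a v * minv (a p) - mat_deriv n e v * minv (e p)) * e p"
proof -
  let ?E = "minv (e p)" and ?A = "minv (a p)" and ?de = "mat_deriv n e v" and ?da = "mat_deriv n a v"
  let ?g = "\<lambda>q. minv (e q) * a q"
  let ?dg = "mat_deriv n ?g v"
  note eG = e(2)[OF p] and aG = a(2)[OF p]
  note m = mat_mult_closed[where n = n] mat_diff_closed[where n = n]
    GL_carrier[OF eG] GL_carrier[OF aG] minv_carrier[OF eG] minv_carrier[OF aG] mat_deriv_carrier
  have g: "mholo n X p ?g" by (intro mholo_mult[OF X p] mholo_minv[OF X p] e a)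
  have gG: "?g p \<in> GL n" using eG aG by simp
  have mg: "minv (?g p) = ?A * e p" using minv_mult[OF GL_minv[OF eG] aG] eG by simp
  have "?da = mat_deriv n (\<lambda>q. e q * ?g q) v"
    by (rule mat_deriv_cong[OF X p v]) (simp add: minv_cancel(1)[OF e(2)] GL_carrier[OF a(2)])
  also have "\<dots> = ?de * ?g p + e p * ?dg" by (rule mat_deriv_mult[OF X p v e(1) g])
  finally have 1: "e p * ?dg = ?da - ?de * ?g p"
    by (intro mat_add_eq_imp_eq_diff[of _ n]) (auto intro!: m)
  have "e p * (?dg * minv (?g p)) = e p * ?dg * minv (?g p)"
    by (rule mat_assoc[of _ n, symmetric]) (use gG in \<open>auto intro!: m\<close>)
  also have "\<dots> = ?da * minv (?g p) - ?de * ?g p * minv (?g p)"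
    unfolding 1 by (rule minus_mult_distrib_mat[of _ n n _ _ n]) (use gG in \<open>auto intro!: m\<close>)
  also have "?de * ?g p * minv (?g p) = ?de" by (rule minv_cancel(3)[OF gG]) simp
  also have "?da * minv (?g p) = ?da * ?A * e p" unfolding mg by (rule mat_assoc[of _ n, symmetric]) (intro m)+
  also have "?da * ?A * e p - ?de = ?da * ?A * e p - ?de * ?E * e p" by (simp add: minv_cancel(4)[OF eG])
  also have "\<dots> = (?da * ?A - ?de * ?E) * e p"
    by (rule minus_mult_distrib_mat[of _ n n _ _ n, symmetric]) (intro m)+
  also have "\<dots> = e p * (?E * ((?da * ?A - ?de * ?E) * e p))" by (rule minv_cancel(1)[OF eG, symmetric]) (intro m)+
  finally have 2: "e p * (?dg * minv (?g p)) = e p * (?E * ((?da * ?A - ?de * ?E) * e p))" .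
  have "?dg * minv (?g p) = ?E * ((?da * ?A - ?de * ?E) * e p)"
    by (rule left_cancel_GL[OF eG _ _ 2]) (use gG in \<open>auto intro!: m\<close>)
  also have "\<dots> = ?E * (?da * ?A - ?de * ?E) * e p" by (rule mat_assoc[of _ n, symmetric]) (intro m)+
  finally show ?thesis .
qed

text \<open>With B = e^-1 U e, the equation e B = U e is differentiated. Together with the preceding
  lemma this produces exactly the arguments of \<open>cot_form_shift\<close>, conjugated by
  \<open>e\<close>.\<close>

lemma mat_deriv_conj:
  assumes X: "complex_manifold X" and p: "p \<in> points X" and v: "v \<in> tangent_space X p"
    and e: "mholo n X p e" "\<And>q. q \<in> points X \<Longrightarrow> e q \<in> GL n" and U: "mholo n X p U"
  defines "\<sigma> \<equiv> mat_deriv n e v * minv (e p)"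
  shows "mat_deriv n (\<lambda>q. minv (e q) * U q * e q) v =
    minv (e p) * (mat_deriv n U v + (U p * \<sigma> - \<sigma> * U p)) * e p"
proof -
  let ?E = "minv (e p)" and ?de = "mat_deriv n e v" and ?dU = "mat_deriv n U v"
  let ?B = "\<lambda>q. minv (e q) * U q * e q"
  let ?dB = "mat_deriv n ?B v"
  note eG = e(2)[OF p]
  note m0 = mat_mult_closed[where n = n] mat_diff_closed[where n = n] mat_add_closed[where n = n]
    GL_carrier[OF eG] minv_carrier[OF eG] mat_deriv_carrier mholo_carrier[OF U p]
  have s: "\<sigma> \<in> carrier_mat n n" unfolding \<sigma>_def by (intro m0)
  note m = m0 s
  have B: "mholo n X p ?B" by (intro mholo_mult[OF X p] mholo_minv[OF X p] e U)
  have se: "\<sigma> * e p = ?de" unfolding \<sigma>_def by (rule minv_cancel(4)[OF eG]) simp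
  have "mat_deriv n (\<lambda>q. U q * e q) v = mat_deriv n (\<lambda>q. e q * ?B q) v"
  proof (rule mat_deriv_cong[OF X p v])
    fix q assume q: "q \<in> points X"
    note c = GL_carrier[OF e(2)[OF q]] minv_carrier[OF e(2)[OF q]] mholo_carrier[OF U q]
    show "U q * e q = e q * ?B q"
      using mat_assoc[OF c(2,3,1)] minv_cancel(1)[OF e(2)[OF q] mat_mult_closed[OF c(3,1)]] by simp
  qed
  then have "?de * ?B p + e p * ?dB = ?dU * e p + U p * ?de"
    by (simp only: mat_deriv_mult[OF X p v e(1) B] mat_deriv_mult[OF X p v U e(1)])
  then have 1: "e p * ?dB = ?dU * e p + U p * ?de - ?de * ?B p"
    by (intro mat_add_eq_imp_eq_diff[of _ n]) (auto intro!: m)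
  have a: "U p * ?de = U p * \<sigma> * e p" unfolding se[symmetric] by (rule mat_assoc[of _ n, symmetric]) (intro m)+
  have "?de * ?B p = \<sigma> * (e p * ?B p)" unfolding se[symmetric] by (rule mat_assoc[of _ n]) (intro m)+
  also have "e p * ?B p = U p * e p"
    using mat_assoc[OF m(5,7,4)] minv_cancel(1)[OF eG mat_mult_closed[OF m(7,4)]] by simp
  also have "\<sigma> * (U p * e p) = \<sigma> * U p * e p" by (rule mat_assoc[of _ n, symmetric]) (intro m)+
  finally have b: "?de * ?B p = \<sigma> * U p * e p" .
  have "(?dU + (U p * \<sigma> - \<sigma> * U p)) * e p = ?dU * e p + (U p * \<sigma> - \<sigma> * U p) * e p"
    by (rule add_mult_distrib_mat[of _ n n _ _ n]) (intro m)+
  also have "(U p * \<sigma> - \<sigma> * U p) * e p = U p * \<sigma> * e p - \<sigma> * U p * e p"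
    by (rule minus_mult_distrib_mat[of _ n n _ _ n]) (intro m)+
  also have "?dU * e p + (U p * \<sigma> * e p - \<sigma> * U p * e p) = ?dU * e p + U p * \<sigma> * e p - \<sigma> * U p * e p"
    by (rule eq_matI) (use m in auto)
  finally have "e p * ?dB = (?dU + (U p * \<sigma> - \<sigma> * U p)) * e p" unfolding 1 a b by simp
  also have "\<dots> = e p * (?E * ((?dU + (U p * \<sigma> - \<sigma> * U p)) * e p))"
    by (rule minv_cancel(1)[OF eG, symmetric]) (intro m)+
  finally have 2: "e p * ?dB = e p * (?E * ((?dU + (U p * \<sigma> - \<sigma> * U p)) * e p))" .
  have "?dB = ?E * ((?dU + (U p * \<sigma> - \<sigma> * U p)) * e p)"
    by (rule left_cancel_GL[OF eG _ _ 2]) (intro m)+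
  also have "\<dots> = ?E * (?dU + (U p * \<sigma> - \<sigma> * U p)) * e p"
    by (rule mat_assoc[of _ n, symmetric]) (intro m)+
  finally show ?thesis .
qed

text \<open>Differentiation of a^-1 a = 1. The factor \<open>a p\<close> on the left turns the
  derivative of the inverse into its right-invariant logarithmic derivative, the form needed for the
  action by \<open>minv a\<close>.\<close>

lemma mat_deriv_minv:
  assumes X: "complex_manifold X" and p: "p \<in> points X" and v: "v \<in> tangent_space X p"
    and a: "mholo n X p a" "\<And>q. q \<in> points X \<Longrightarrow> a q \<in> GL n"
  shows "mat_deriv n (\<lambda>q. minv (a q)) v * a p = - (minv (a p) * (mat_deriv n a v * minv (a p)) * a p)"
proof -
  let ?A = "minv (a p)" and ?da = "mat_deriv n a v" and ?dA = "mat_deriv n (\<lambda>q. minv (a q)) v"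
  note aG = a(2)[OF p]
  note m = mat_mult_closed[where n = n] GL_carrier[OF aG] minv_carrier[OF aG] mat_deriv_carrier
  have "0\<^sub>m n n = mat_deriv n (\<lambda>q. 1\<^sub>m n) v" by (rule mat_deriv_const[OF X p v, symmetric])
  also have "\<dots> = mat_deriv n (\<lambda>q. minv (a q) * a q) v"
    by (rule mat_deriv_cong[OF X p v]) (simp add: minv_left[OF a(2)])
  also have "\<dots> = ?dA * a p + ?A * ?da"
    by (rule mat_deriv_mult[OF X p v mholo_minv[OF X p a] a(1)])
  finally have 0: "?A * ?da + ?dA * a p = 0\<^sub>m n n"
    using comm_add_mat[of "?A * ?da" n n "?dA * a p"] m by simp
  have "?dA * a p = 0\<^sub>m n n - ?A * ?da" by (rule mat_add_eq_imp_eq_diff[of _ n, OF _ _ 0]) (intro m)+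
  also have "\<dots> = - (?A * ?da)" by (rule eq_matI) (use m in auto)
  also have "?A * ?da = ?A * (?da * ?A * a p)" by (simp add: minv_cancel(4)[OF aG])
  also have "\<dots> = ?A * (?da * ?A) * a p" by (rule mat_assoc[of _ n, symmetric]) (intro m)+
  finally show ?thesis .
qed

section \<open>Holomorphic actions\<close>

lemma holomorphic_act:
  assumes X: "complex_manifold X" and M: "complex_manifold M" and A: "holomorphic_GL_action n M act"
    and u: "holomorphic_map X (GL_cmfd n) u" and m: "holomorphic_map X M m"
  shows "holomorphic_map X M (\<lambda>r. act (u r) (m r))"
proof -
  have "holomorphic_map X M ((\<lambda>(g, p). act g p) \<circ> (\<lambda>r. (u r, m r)))"
    by (rule holomorphic_map_compose[OF X complex_manifold_prod[OF complex_manifold_GL M] M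
        holomorphic_map_Pair[OF X complex_manifold_GL M u m]])
       (use A in \<open>simp add: holomorphic_GL_action_def\<close>)
  then show ?thesis by (simp add: comp_def)
qed

lemma holomorphic_act_left:
  assumes M: "complex_manifold M" and A: "holomorphic_GL_action n M act" and g: "g \<in> GL n"
  shows "holomorphic_map M M (act g)"
  using holomorphic_act[OF M M A holomorphic_map_const[OF M complex_manifold_GL, of g n] holomorphic_map_id[OF M]] g
  by simp

lemma holomorphic_orbit_map:
  assumes M: "complex_manifold M" and A: "holomorphic_GL_action n M act" and y: "y \<in> points M"
  shows "holomorphic_map (GL_cmfd n) M (\<lambda>g. act g y)"
  using holomorphic_act[OF complex_manifold_GL M A holomorphic_map_id[OF complex_manifold_GL]
      holomorphic_map_const[OF complex_manifold_GL M y]] by simp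

lemma act_points:
  assumes M: "complex_manifold M" and A: "holomorphic_GL_action n M act" and g: "g \<in> GL n" and y: "y \<in> points M"
  shows "act g y \<in> points M"
  using holomorphic_map_points[OF holomorphic_act_left[OF M A g] y] .

lemma act_one: "holomorphic_GL_action n M act \<Longrightarrow> y \<in> points M \<Longrightarrow> act (1\<^sub>m n) y = y"
  and act_mult: "holomorphic_GL_action n M act \<Longrightarrow> g \<in> GL n \<Longrightarrow> h \<in> GL n \<Longrightarrow> y \<in> points M \<Longrightarrow>
    act (g * h) y = act g (act h y)"
  by (simp_all add: holomorphic_GL_action_def)

lemma act_minv_cancel:
  assumes M: "complex_manifold M" and A: "holomorphic_GL_action n M act" and g: "g \<in> GL n" and y: "y \<in> points M"
  shows "act g (act (minv g) y) = y" "act (minv g) (act g y) = y"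
  using act_mult[OF A g GL_minv[OF g] y] act_mult[OF A GL_minv[OF g] g y] act_one[OF A y]
  by (simp_all add: minv_right[OF g] minv_left[OF g])

section \<open>Fundamental vector fields\<close>

lemma eventually_affine_GL:
  assumes \<xi>: "\<xi> \<in> carrier_mat n n"
  shows "\<forall>\<^sub>F t in nhds 0. 1\<^sub>m n + t \<cdot>\<^sub>m \<xi> \<in> GL n"
proof -
  let ?J = "{..<n} \<times> {..<n}"
  let ?x = "mat_coords n (1\<^sub>m n)"
  have "filterlim (\<lambda>t. mat_coords n (1\<^sub>m n + t \<cdot>\<^sub>m \<xi>)) (cnhds ?J ?x) (nhds 0)"
  proof (rule filterlim_cnhds[OF mat_coords_cspace])
    show "\<forall>\<^sub>F t in nhds 0. mat_coords n (1\<^sub>m n + t \<cdot>\<^sub>m \<xi>) \<in> cspace ?J"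
      by (simp add: mat_coords_cspace)
    fix a assume a: "a \<in> ?J"
    obtain i j where ij: "a = (i, j)" "i < n" "j < n" using a by auto
    have "((\<lambda>t. 1\<^sub>m n $$ (i, j) + t * \<xi> $$ (i, j)) \<longlongrightarrow> 1\<^sub>m n $$ (i, j) + 0 * \<xi> $$ (i, j)) (nhds 0)"
      by (intro tendsto_intros filterlim_ident)
    then show "((\<lambda>t. mat_coords n (1\<^sub>m n + t \<cdot>\<^sub>m \<xi>) a) \<longlongrightarrow> ?x a) (nhds 0)"
      using \<xi> ij by (simp add: mat_coords_def)
  qed
  moreover have "\<forall>\<^sub>F z in cnhds ?J ?x. z \<in> mat_coords n ` GL n"
    by (rule eventually_cnhds_in_openin[OF GL_chart(1)]) simp
  ultimately have "\<forall>\<^sub>F t in nhds 0. mat_coords n (1\<^sub>m n + t \<cdot>\<^sub>m \<xi>) \<in> mat_coords n ` GL n"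
    by (rule eventually_compose_filterlim[rotated])
  then show ?thesis
  proof eventually_elim
    case (elim t)
    then obtain B where B: "B \<in> GL n" "mat_coords n (1\<^sub>m n + t \<cdot>\<^sub>m \<xi>) = mat_coords n B" by blast
    have "1\<^sub>m n + t \<cdot>\<^sub>m \<xi> = Matrix.mat n n (mat_coords n (1\<^sub>m n + t \<cdot>\<^sub>m \<xi>))"
      by (rule mat_of_coords[symmetric]) (use \<xi> in auto)
    also have "\<dots> = B" unfolding B(2) by (rule mat_of_coords[OF GL_carrier[OF B(1)]])
    finally show ?case using B(1) by simp
  qed
qed

text \<open>The curve 1 + t\<xi> stays in the group near t = 0 and has the same coordinate velocity
  as \<open>w\<close>. Thus the one-variable derivative in \<open>fundamental_field\<close> becomes
  the differential of the orbit map, to which tangency and chain rule apply.\<close>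

lemma fundamental_field_eq_differential:
  assumes M: "complex_manifold M" and A: "holomorphic_GL_action n M act" and y: "y \<in> points M"
    and \<xi>: "\<xi> \<in> carrier_mat n n" and w: "w \<in> tangent_space (GL_cmfd n) (1\<^sub>m n)"
    and eq: "\<And>i j. i < n \<Longrightarrow> j < n \<Longrightarrow> w (\<lambda>g. g $$ (i, j)) = \<xi> $$ (i, j)"
  shows "fundamental_field n M act \<xi> y = differential M (\<lambda>g. act g y) (1\<^sub>m n) w"
proof
  fix h
  let ?o = "\<lambda>g. act g y" and ?X = "GL_cmfd n"
  have 1: "act (1\<^sub>m n) y = y" using act_one[OF A y] .
  show "fundamental_field n M act \<xi> y h = differential M ?o (1\<^sub>m n) w h"
  proof (cases "holo_at M y h")
    case True
    define \<gamma> where "\<gamma> t = 1\<^sub>m n + t \<cdot>\<^sub>m \<xi>" for t :: complex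
    have \<gamma>0: "\<gamma> 0 = 1\<^sub>m n" using \<xi> unfolding \<gamma>_def by (auto intro!: eq_matI)
    have U: "(GL n, mat_coords n) \<in> atlas ?X" "1\<^sub>m n \<in> GL n" by auto
    have k: "holo_at ?X (\<gamma> 0) (h \<circ> ?o)"
      unfolding \<gamma>0 using holo_at_compose[OF complex_manifold_GL M holomorphic_orbit_map[OF M A y], of "1\<^sub>m n" h] True 1 by simp
    have "((\<lambda>t. (h \<circ> ?o) (\<gamma> t)) has_field_derivative
        (\<Sum>j\<in>cidx ?X. (case j of (i, j) \<Rightarrow> \<xi> $$ (i, j)) * coord_vec ?X (GL n) (mat_coords n) j (\<gamma> 0) (h \<circ> ?o))) (at 0)"
    proof (rule curve_chain[where \<gamma> = \<gamma>, OF complex_manifold_GL U(1) _ _ _ k])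
      show "\<gamma> 0 \<in> GL n" using \<gamma>0 by simp
      show "\<forall>\<^sub>F t in nhds 0. \<gamma> t \<in> GL n" unfolding \<gamma>_def by (rule eventually_affine_GL[OF \<xi>])
      fix a assume "a \<in> cidx ?X"
      then obtain i j where ij: "a = (i, j)" "i < n" "j < n" by auto
      have "((\<lambda>t. 1\<^sub>m n $$ (i, j) + t * \<xi> $$ (i, j)) has_field_derivative \<xi> $$ (i, j)) (at 0)"
        by (auto intro!: derivative_eq_intros)
      then show "((\<lambda>t. mat_coords n (\<gamma> t) a) has_field_derivative (case a of (i, j) \<Rightarrow> \<xi> $$ (i, j))) (at 0)"
        using ij \<xi> by (simp add: \<gamma>_def mat_coords_def)
    qed
    also have "(\<Sum>j\<in>cidx ?X. (case j of (i, j) \<Rightarrow> \<xi> $$ (i, j)) * coord_vec ?X (GL n) (mat_coords n) j (\<gamma> 0) (h \<circ> ?o))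
        = (\<Sum>j\<in>cidx ?X. w (\<lambda>q. mat_coords n q j) * coord_vec ?X (GL n) (mat_coords n) j (1\<^sub>m n) (h \<circ> ?o))"
      unfolding \<gamma>0 by (intro sum.cong refl) (auto simp: mat_coords_def eq)
    also have "\<dots> = w (h \<circ> ?o)" by (rule tangent_expand[OF complex_manifold_GL U w, symmetric])
    finally have "deriv (\<lambda>t. h (act (1\<^sub>m n + t \<cdot>\<^sub>m \<xi>) y)) 0 = w (h \<circ> ?o)"
      by (intro DERIV_imp_deriv) (simp add: \<gamma>_def)
    then show ?thesis using True 1 by (simp add: fundamental_field_def differential_def)
  qed (simp add: fundamental_field_def differential_def 1)
qed

lemma GL_tangent_vector_ex:
  obtains w where "w \<in> tangent_space (GL_cmfd n) (1\<^sub>m n)" "\<And>i j. i < n \<Longrightarrow> j < n \<Longrightarrow> w (\<lambda>g. g $$ (i, j)) = \<xi> $$ (i, j)"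
proof -
  have U: "(GL n, mat_coords n) \<in> atlas (GL_cmfd n)" "1\<^sub>m n \<in> GL n" by auto
  obtain w where w: "w \<in> tangent_space (GL_cmfd n) (1\<^sub>m n)"
    "\<And>a. a \<in> cidx (GL_cmfd n) \<Longrightarrow> w (\<lambda>q. mat_coords n q a) = (case a of (i, j) \<Rightarrow> \<xi> $$ (i, j))"
    by (fact tangent_with_coords[OF complex_manifold_GL U])
  show ?thesis
  proof (rule that[OF w(1)])
    fix i j assume "i < n" "j < n"
    then show "w (\<lambda>g. g $$ (i, j)) = \<xi> $$ (i, j)" using w(2)[of "(i, j)"] by (simp add: mat_coords_def)
  qed
qed

lemma fundamental_field_tangent:
  assumes M: "complex_manifold M" and A: "holomorphic_GL_action n M act" and y: "y \<in> points M"
    and \<xi>: "\<xi> \<in> carrier_mat n n"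
  shows "fundamental_field n M act \<xi> y \<in> tangent_space M y"
proof -
  obtain w where w: "w \<in> tangent_space (GL_cmfd n) (1\<^sub>m n)" "\<And>i j. i < n \<Longrightarrow> j < n \<Longrightarrow> w (\<lambda>g. g $$ (i, j)) = \<xi> $$ (i, j)"
    by (fact GL_tangent_vector_ex)
  have "differential M (\<lambda>g. act g y) (1\<^sub>m n) w \<in> tangent_space M (act (1\<^sub>m n) y)"
    by (rule differential_tangent[OF complex_manifold_GL M holomorphic_orbit_map[OF M A y] _ w(1)]) simp
  then show ?thesis using fundamental_field_eq_differential[OF M A y \<xi> w] act_one[OF A y] by simp
qed

text \<open>The infinitesimal form of equivariance: \<mu>(g y) = g \<mu>(y) g^-1 is differentiated
  at g = 1 in the direction \<xi>.\<close>

lemma mat_deriv_moment_fundamental_field: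
  assumes M: "complex_manifold M" and H: "hamiltonian_GL_action n M \<omega> act \<mu>" and y: "y \<in> points M"
    and \<xi>: "\<xi> \<in> carrier_mat n n"
  shows "mat_deriv n \<mu> (fundamental_field n M act \<xi> y) = \<xi> * \<mu> y - \<mu> y * \<xi>"
proof -
  let ?X = "GL_cmfd n"
  have A: "holomorphic_GL_action n M act" and \<mu>: "holomorphic_map M (gl_cmfd n) \<mu>"
    and equi: "\<And>g p. g \<in> GL n \<Longrightarrow> p \<in> points M \<Longrightarrow> \<mu> (act g p) = g * \<mu> p * minv g"
    using H by (auto simp: hamiltonian_GL_action_def)
  obtain w where w: "w \<in> tangent_space ?X (1\<^sub>m n)" "\<And>i j. i < n \<Longrightarrow> j < n \<Longrightarrow> w (\<lambda>g. g $$ (i, j)) = \<xi> $$ (i, j)"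
    by (fact GL_tangent_vector_ex)
  note GM = complex_manifold_GL[of n]
  have p1: "1\<^sub>m n \<in> points ?X" by simp
  have \<mu>y: "\<mu> y \<in> carrier_mat n n" using holomorphic_map_points[OF \<mu> y] by simp
  have id: "mholo n ?X (1\<^sub>m n) (\<lambda>g. g)" using mholo_of_GL[OF GM holomorphic_map_id[OF GM] p1] by (simp add: id_def)
  have did: "mat_deriv n (\<lambda>g. g) w = \<xi>" using \<xi> by (intro eq_matI) (auto simp: w(2))
  have c: "mholo n ?X (1\<^sub>m n) (\<lambda>g. \<mu> y)" by (rule mholo_const[OF GM p1 \<mu>y])
  have inv: "mholo n ?X (1\<^sub>m n) (\<lambda>g. minv g)" by (rule mholo_minv[OF GM p1 id]) simp
  let ?dI = "mat_deriv n (\<lambda>g. minv g) w"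
  have dinv: "?dI = - \<xi>"
  proof -
    have "?dI * 1\<^sub>m n = - (minv (1\<^sub>m n) * (\<xi> * minv (1\<^sub>m n)) * 1\<^sub>m n)"
      using mat_deriv_minv[OF GM p1 w(1) id] did by simp
    then show ?thesis using \<xi> by simp
  qed
  have ff: "fundamental_field n M act \<xi> y = differential M (\<lambda>g. act g y) (1\<^sub>m n) w"
    by (rule fundamental_field_eq_differential[OF M A y \<xi> w(1)]) (rule w(2))
  have h1: "mholo n M (act (1\<^sub>m n) y) \<mu>" using mholo_of_gl[OF M \<mu>] y act_one[OF A y] by simp
  have "mat_deriv n \<mu> (fundamental_field n M act \<xi> y) = mat_deriv n (\<lambda>g. \<mu> (act g y)) w"
    unfolding ff
    by (rule mat_deriv_differential[where G = "\<lambda>g. act g y"]) (rule h1)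
  also have "\<dots> = mat_deriv n (\<lambda>g. g * \<mu> y * minv g) w"
    by (rule mat_deriv_cong[OF GM p1 w(1)]) (simp add: equi y)
  also have "\<dots> = mat_deriv n (\<lambda>g. g * \<mu> y) w * minv (1\<^sub>m n) + 1\<^sub>m n * \<mu> y * ?dI"
    by (rule mat_deriv_mult[OF GM p1 w(1) mholo_mult[OF GM p1 id c] inv])
  also have "mat_deriv n (\<lambda>g. g * \<mu> y) w = \<xi> * \<mu> y"
    unfolding mat_deriv_mult[OF GM p1 w(1) id c] mat_deriv_const[OF GM p1 w(1)] did using \<xi> \<mu>y by simp
  finally have "mat_deriv n \<mu> (fundamental_field n M act \<xi> y) = \<xi> * \<mu> y + \<mu> y * (- \<xi>)"
    using \<xi> \<mu>y dinv by simp
  also have "\<dots> = \<xi> * \<mu> y - \<mu> y * \<xi>"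
    using \<xi> \<mu>y by (intro eq_matI) auto
  finally show ?thesis .
qed

text \<open>The factor \<open>1\<close> gives the right-hand side the shape of the linearity clause of
  \<open>holomorphic_two_form\<close>.\<close>

lemma differential_action:
  assumes X: "complex_manifold X" and M: "complex_manifold M" and A: "holomorphic_GL_action n M act"
    and u: "holomorphic_map X (GL_cmfd n) u" and m: "holomorphic_map X M m"
    and q: "q \<in> points X" and v: "v \<in> tangent_space X q"
  shows "differential M (\<lambda>r. act (u r) (m r)) q v =
    (\<lambda>h. differential M (\<lambda>r. act (u q) (m r)) q v h +
         1 * fundamental_field n M act (mat_deriv n u v * minv (u q)) (act (u q) (m q)) h)"
proof
  fix h
  define g where "g = u q"
  define y where "y = act g (m q)"
  \<comment> \<open>Normalised so that \<open>w q\<close> is the identity: then u(r) m(r) = w(r) (g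
    m(r)), and the velocity of \<open>w\<close> at \<open>q\<close> is the matrix
    \<open>\<xi>\<close>.\<close>
  define w where "w r = u r * minv g" for r
  define \<xi> where "\<xi> = mat_deriv n u v * minv g"
  let ?G = "GL_cmfd n" and ?Z = "prod_cmfd (GL_cmfd n) M"
  let ?A = "\<lambda>r. act (u r) (m r)" and ?B = "\<lambda>r. act g (m r)" and ?o = "\<lambda>k. act k y"
  note GM = complex_manifold_GL[of n]
  note Z = complex_manifold_prod[OF GM M]
  have uG: "u r \<in> GL n" and mr: "m r \<in> points M" if "r \<in> points X" for r
    using holomorphic_map_points[OF u that] holomorphic_map_points[OF m that] by auto
  have gG: "g \<in> GL n" using uG[OF q] by (simp add: g_def)
  have y: "y \<in> points M" unfolding y_def by (rule act_points[OF M A gG mr[OF q]])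
  have wmh: "mholo n X p w" if "p \<in> points X" for p
    unfolding w_def by (intro mholo_mult[OF X that] mholo_of_GL[OF X u that] mholo_const[OF X that] minv_carrier[OF gG])
  have w: "holomorphic_map X ?G w"
    by (rule holomorphic_map_into_GL[OF X wmh]) (auto simp: w_def uG gG)
  have B: "holomorphic_map X M ?B"
    using holomorphic_map_compose[OF X M M m holomorphic_act_left[OF M A gG]] by (simp add: comp_def)
  have wq: "w q = 1\<^sub>m n" using minv_right[OF gG] by (simp add: w_def g_def)
  have Aeq: "?A r = act (w r) (?B r)" if "r \<in> points X" for r
  proof -
    have "w r * g = u r" unfolding w_def by (rule minv_cancel(4)[OF gG GL_carrier[OF uG[OF that]]])
    then show ?thesis using act_mult[OF A _ gG mr[OF that], of "w r"] uG[OF that] gG by (simp add: w_def)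
  qed
  have A1: "act (1\<^sub>m n) y = y" using act_one[OF A y] .
  have Aq: "?A q = y" and Bq: "?B q = y" by (simp_all add: y_def g_def)
  let ?F = "\<lambda>r. (w r, ?B r)" and ?\<rho> = "\<lambda>(g, p). act g p"
  have F: "holomorphic_map X ?Z ?F" by (rule holomorphic_map_Pair[OF X GM M w B])
  have \<rho>: "holomorphic_map ?Z M ?\<rho>" using A by (simp add: holomorphic_GL_action_def)
  have Fq: "?F q = (1\<^sub>m n, y)" by (simp add: wq Bq)
  have pZ: "(1\<^sub>m n, y) \<in> points ?Z" using y by simp
  have o: "holomorphic_map ?G M ?o" by (rule holomorphic_orbit_map[OF M A y])
  have \<xi>c: "\<xi> \<in> carrier_mat n n" unfolding \<xi>_def by (intro mat_mult_closed[where n = n] mat_deriv_carrier minv_carrier[OF gG])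
  define v' where "v' = differential ?Z ?F q v"
  have v': "v' \<in> tangent_space ?Z (1\<^sub>m n, y)"
    using differential_tangent[OF X Z F q v] by (simp add: v'_def Fq)
  define w' where "w' = differential ?G w q v"
  have w': "w' \<in> tangent_space ?G (1\<^sub>m n)" using differential_tangent[OF X GM w q v] by (simp add: w'_def wq)
  have w'\<xi>: "w' (\<lambda>k. k $$ (i, j)) = \<xi> $$ (i, j)" if ij: "i < n" "j < n" for i j
  proof -
    have p1: "1\<^sub>m n \<in> points ?G" by simp
    have id: "mholo n ?G (w q) (\<lambda>k. k)"
      unfolding wq using mholo_of_GL[OF GM holomorphic_map_id[OF GM] p1] by (simp add: id_def)
    have c: "mholo n X q (\<lambda>r. minv g)" by (rule mholo_const[OF X q minv_carrier[OF gG]])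
    have "mat_deriv n (\<lambda>k. k) w' = mat_deriv n w v"
      unfolding w'_def by (rule mat_deriv_differential[where G = w, OF id])
    also have "\<dots> = mat_deriv n u v * minv g + u q * 0\<^sub>m n n"
      unfolding w_def[abs_def] mat_deriv_mult[OF X q v mholo_of_GL[OF X u q] c] mat_deriv_const[OF X q v] ..
    also have "\<dots> = \<xi>" using \<xi>c GL_carrier[OF uG[OF q]] by (simp add: \<xi>_def)
    finally have "mat_deriv n (\<lambda>k. k) w' $$ (i, j) = \<xi> $$ (i, j)" by simp
    then show ?thesis using ij by simp
  qed
  have ff: "fundamental_field n M act \<xi> y = differential M ?o (1\<^sub>m n) w'"
    by (rule fundamental_field_eq_differential[OF M A y \<xi>c w' w'\<xi>])
  show "differential M ?A q v h = differential M (\<lambda>r. act (u q) (m r)) q v h +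
      1 * fundamental_field n M act (mat_deriv n u v * minv (u q)) (act (u q) (m q)) h"
    unfolding g_def[symmetric] y_def[symmetric] \<xi>_def[symmetric]
  proof (cases "holo_at M y h")
    case False
    then show "differential M ?A q v h = differential M ?B q v h + 1 * fundamental_field n M act \<xi> y h"
      using Aq Bq by (simp add: differential_def fundamental_field_def)
  next
    case True
    have k: "holo_at ?Z (1\<^sub>m n, y) (h \<circ> ?\<rho>)"
      using holo_at_compose[OF Z M \<rho> _ pZ, of h] True A1 by simp
    have k1: "holo_at ?Z (1\<^sub>m n, y) (h \<circ> ?o \<circ> fst)"
      using holo_at_compose[OF Z GM holomorphic_map_fst[OF GM M] _ pZ, of "h \<circ> ?o"]
        holo_at_compose[OF GM M o, of "1\<^sub>m n" h] True A1 by simp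
    have k2: "holo_at ?Z (1\<^sub>m n, y) (h \<circ> snd)"
      using holo_at_compose[OF Z M holomorphic_map_snd[OF GM M] _ pZ, of h] True by simp
    have "differential M ?A q v h = v (h \<circ> ?A)" using True Aq by (simp add: differential_def)
    also have "\<dots> = v ((h \<circ> ?\<rho>) \<circ> ?F)" by (rule tangent_cong[OF X q v]) (simp add: Aeq)
    also have "\<dots> = v' (h \<circ> ?\<rho>)" unfolding v'_def using k by (simp add: differential_def Fq)
    \<comment> \<open>At (1, y) the first summand involves only the orbit map through
      \<open>y\<close>, and in the second the identity acts, which leaves the motion of g
      m(r).\<close>
    also have "\<dots> = v' (\<lambda>z. (h \<circ> ?\<rho>) (fst z, y)) + v' (\<lambda>z. (h \<circ> ?\<rho>) (1\<^sub>m n, snd z))"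
      by (rule tangent_prod_split[OF GM M _ y v' k]) simp
    also have "(\<lambda>z. (h \<circ> ?\<rho>) (fst z, y)) = h \<circ> ?o \<circ> fst" by auto
    also have "v' (h \<circ> ?o \<circ> fst) = v ((h \<circ> ?o) \<circ> w)"
      unfolding v'_def using k1 by (simp add: differential_def Fq comp_def)
    also have "\<dots> = w' (h \<circ> ?o)"
      unfolding w'_def using holo_at_compose[OF GM M o, of "1\<^sub>m n" h] True A1 by (simp add: differential_def wq)
    also have "\<dots> = fundamental_field n M act \<xi> y h"
      unfolding ff using True A1 by (simp add: differential_def)
    also have "v' (\<lambda>z. (h \<circ> ?\<rho>) (1\<^sub>m n, snd z)) = v' (h \<circ> snd)"
      by (rule tangent_cong[OF Z pZ v']) (auto simp: act_one[OF A])
    also have "\<dots> = v (h \<circ> ?B)" unfolding v'_def using k2 by (simp add: differential_def Fq comp_def)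
    also have "\<dots> = differential M ?B q v h" using True Bq by (simp add: differential_def)
    finally show "differential M ?A q v h = differential M ?B q v h + 1 * fundamental_field n M act \<xi> y h" by simp
  qed
qed

text \<open>Meant for fundamental fields \<open>x\<close> and \<open>y\<close>: they are kept in the
  first argument, where the moment map equation evaluates the form, which is why a mixed term
  appears as \<open>- \<omega> p y a\<close>. Linearity in the second argument comes from
  antisymmetry.\<close>

lemma two_form_sum_expand:
  assumes M: "complex_manifold M" and W: "holomorphic_two_form M \<omega>" and p: "p \<in> points M" 
    and t: "a \<in> tangent_space M p" "x \<in> tangent_space M p" "b \<in> tangent_space M p" "y \<in> tangent_space M p"
  shows "\<omega> p (\<lambda>h. a h + 1 * x h) (\<lambda>h. b h + 1 * y h) = \<omega> p a b + \<omega> p x b - \<omega> p y a + \<omega> p x y"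
proof -
  have lin: "\<omega> p (\<lambda>h. u h + 1 * v h) w = \<omega> p u w + 1 * \<omega> p v w" and anti: "\<omega> p v w = - \<omega> p w v"
    if "u \<in> tangent_space M p" "v \<in> tangent_space M p" "w \<in> tangent_space M p" for u v w
    using W p that unfolding holomorphic_two_form_def by blast+
  have bt: "(\<lambda>h. b h + 1 * y h) \<in> tangent_space M p" by (rule tangent_linear[OF M p t(3,4)])
  have r: "\<omega> p w (\<lambda>h. b h + 1 * y h) = \<omega> p w b + \<omega> p w y" if w: "w \<in> tangent_space M p" for w
    using anti[OF w w bt] lin[OF t(3,4) w] anti[OF w t(3) w] anti[OF w t(4) w] by simp
  show ?thesis
    using lin[OF t(1,2) bt] r[OF t(1)] r[OF t(2)] anti[OF t(1,1,4)] by simp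
qed

lemma tr3_uminus2: "B \<in> carrier_mat n n \<Longrightarrow> tr3 n A (- B) C = - tr3 n A B C"
  and tr3_uminus1: "B \<in> carrier_mat n n \<Longrightarrow> tr3 n (- B) A C = - tr3 n B A C"
  and tr3_uminus3: "B \<in> carrier_mat n n \<Longrightarrow> tr3 n A C (- B) = - tr3 n A C B"
  by (simp_all add: tr3_def sum_negf)

text \<open>The left-hand side collects the three terms in which a fundamental field occurs, for the
  generators \<open>- S\<close> and \<open>- S'\<close>, after evaluation by the moment map and its
  infinitesimal equivariance.\<close>

lemma cot_form_action_terms:
  assumes c: "V \<in> carrier_mat n n" "S \<in> carrier_mat n n" "D \<in> carrier_mat n n" "S' \<in> carrier_mat n n" "D' \<in> carrier_mat n n"
  shows "mtrace (- S * D') - mtrace (- S' * D) + mtrace (- S * (- S' * V - V * - S')) = - cot_form V S D S' D'"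
proof -
  have u: "- S \<in> carrier_mat n n" "- S' \<in> carrier_mat n n" using c by auto
  note m = mat_mult_closed[where n = n] mat_diff_closed[where n = n]
  have p: "- S' * V \<in> carrier_mat n n" "V * - S' \<in> carrier_mat n n" "- S' * V - V * - S' \<in> carrier_mat n n"
    by (intro m u c)+
  have "tr3 n S S' V = tr3 n V S S'" "tr3 n S V S' = tr3 n V S' S" by (metis tr3_cyc)+
  then show ?thesis
    using c u p
    by (simp only: mtrace_mult[of _ n] cot_form_traces[of _ n] tr2_uminus_left tr2_diff_right tr2_mult tr3_uminus1 tr3_uminus2 tr3_uminus3) simp
qed

text \<open>With e = a(q) and s = da a^-1, the differential of \<open>A\<close> is that of r |->
  e^-1 m(r) plus the fundamental field of - e^-1 s e. Expanding the form, the term without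
  fundamental fields reduces to \<open>m\<close> by invariance, and the others are given by the
  moment map. Everything in them is conjugated by \<open>e\<close>, and \<open>cot_form_conj\<close>
  removes the conjugation.\<close>

lemma form_action:
  assumes S: "symplectic_manifold M \<omega>" and H: "hamiltonian_GL_action n M \<omega> act \<mu>"
    and X: "complex_manifold X" and a: "holomorphic_map X (GL_cmfd n) a" and m: "holomorphic_map X M m"
    and q: "q \<in> points X" and v: "v \<in> tangent_space X q" and v': "v' \<in> tangent_space X q"
  defines "A \<equiv> \<lambda>r. act (minv (a r)) (m r)" and "U \<equiv> \<lambda>r. \<mu> (m r)"
  shows "\<omega> (A q) (differential M A q v) (differential M A q v') =
    \<omega> (m q) (differential M m q v) (differential M m q v') -
    cot_form (U q) (mat_deriv n a v * minv (a q)) (mat_deriv n U v) (mat_deriv n a v' * minv (a q)) (mat_deriv n U v')"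
proof -
  have M: "complex_manifold M" and W: "holomorphic_two_form M \<omega>" using S by (auto simp: symplectic_manifold_def)
  have A: "holomorphic_GL_action n M act" and \<mu>: "holomorphic_map M (gl_cmfd n) \<mu>"
    and pres: "\<And>g. g \<in> GL n \<Longrightarrow> preserves_forms M \<omega> M \<omega> (act g)"
    and equi: "\<And>g p. g \<in> GL n \<Longrightarrow> p \<in> points M \<Longrightarrow> \<mu> (act g p) = g * \<mu> p * minv g"
    and mom: "\<And>\<xi> p v. \<xi> \<in> carrier_mat n n \<Longrightarrow> p \<in> points M \<Longrightarrow> v \<in> tangent_space M p \<Longrightarrow>
        mtrace (\<xi> * mat_deriv n \<mu> v) = \<omega> p (fundamental_field n M act \<xi> p) v"
    using H by (auto simp: hamiltonian_GL_action_def)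
  define e where "e = a q"
  define g where "g = minv e"
  define y where "y = act g (m q)"
  have aG: "a r \<in> GL n" and mr: "m r \<in> points M" if "r \<in> points X" for r
    using holomorphic_map_points[OF a that] holomorphic_map_points[OF m that] by auto
  have eG: "e \<in> GL n" and gG: "g \<in> GL n" using aG[OF q] by (auto simp: e_def g_def)
  have mg: "minv g = e" using eG by (simp add: g_def)
  have y: "y \<in> points M" unfolding y_def by (rule act_points[OF M A gG mr[OF q]])
  note ah = mholo_of_GL[OF X a q]
  have uh: "mholo n X p (\<lambda>r. minv (a r))" if "p \<in> points X" for p
    by (rule mholo_minv[OF X that mholo_of_GL[OF X a that] aG])
  have u: "holomorphic_map X (GL_cmfd n) (\<lambda>r. minv (a r))"
    by (rule holomorphic_map_into_GL[OF X uh]) (simp_all add: aG)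
  let ?B = "\<lambda>r. act g (m r)"
  have B: "holomorphic_map X M ?B"
    using holomorphic_map_compose[OF X M M m holomorphic_act_left[OF M A gG]] by (simp add: comp_def)
  have Uh: "mholo n X q U" unfolding U_def
    by (rule mholo_compose[OF X M m q mholo_of_gl[OF M \<mu> mr[OF q]]])
  have Uc: "U q \<in> carrier_mat n n" using mholo_carrier[OF Uh q] .
  let ?s = "\<lambda>v. mat_deriv n a v * minv e" and ?c = "\<lambda>Z. g * Z * e"
  have sc: "?s v \<in> carrier_mat n n" for v by (intro mat_mult_closed[where n = n] mat_deriv_carrier minv_carrier[OF eG])
  have cc: "?c Z \<in> carrier_mat n n" if "Z \<in> carrier_mat n n" for Z
    by (intro mat_mult_closed[where n = n] that GL_carrier gG eG)
  have \<mu>y: "\<mu> y = ?c (U q)" unfolding y_def equi[OF gG mr[OF q]] mg U_def ..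
  have ffc: "- ?c (?s v) \<in> carrier_mat n n" for v using cc[OF sc] by simp
  let ?X = "\<lambda>v. fundamental_field n M act (- ?c (?s v)) y"
  have dA: "differential M A q v = (\<lambda>h. differential M ?B q v h + 1 * ?X v h)" if v: "v \<in> tangent_space X q" for v
  proof -
    have "mat_deriv n (\<lambda>r. minv (a r)) v * minv (minv (a q)) = - ?c (?s v)"
      using mat_deriv_minv[OF X q v ah aG] eG by (simp add: e_def g_def)
    then show ?thesis
      using differential_action[OF X M A u m q v] by (simp add: A_def e_def g_def y_def)
  qed
  have tB: "differential M ?B q v \<in> tangent_space M y" if v: "v \<in> tangent_space X q" for v
    using differential_tangent[OF X M B q v] by (simp add: y_def)
  have tX: "?X v \<in> tangent_space M y" for v by (rule fundamental_field_tangent[OF M A y ffc])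
  have dB: "mat_deriv n \<mu> (differential M ?B q v) = ?c (mat_deriv n U v)" if v: "v \<in> tangent_space X q" for v
  proof -
    have "mholo n M (?B q) \<mu>" using mholo_of_gl[OF M \<mu> y] by (simp add: y_def)
    then have "mat_deriv n \<mu> (differential M ?B q v) = mat_deriv n (\<lambda>r. \<mu> (?B r)) v"
      by (rule mat_deriv_differential)
    also have "\<dots> = mat_deriv n (\<lambda>r. g * U r * e) v"
      by (rule mat_deriv_cong[OF X q v]) (simp add: equi gG mr mg U_def)
    also have "\<dots> = mat_deriv n (\<lambda>r. g * U r) v * e + g * U q * 0\<^sub>m n n"
      using mat_deriv_mult[OF X q v mholo_mult[OF X q mholo_const[OF X q GL_carrier[OF gG]] Uh] mholo_const[OF X q GL_carrier[OF eG]]]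
      by (simp add: mat_deriv_const[OF X q v])
    also have "mat_deriv n (\<lambda>r. g * U r) v = 0\<^sub>m n n * U q + g * mat_deriv n U v"
      using mat_deriv_mult[OF X q v mholo_const[OF X q GL_carrier[OF gG]] Uh] by (simp add: mat_deriv_const[OF X q v])
    also have "\<dots> = g * mat_deriv n U v" using Uc mat_mult_closed[OF GL_carrier[OF gG] mat_deriv_carrier[of n U v]] by simp
    also have "g * mat_deriv n U v * e + g * U q * 0\<^sub>m n n = ?c (mat_deriv n U v)"
      using right_add_zero_mat[OF cc[OF mat_deriv_carrier[of n U v]]]
        right_mult_zero_mat[OF mat_mult_closed[OF GL_carrier[OF gG] Uc], of n] by simp
    finally show ?thesis .
  qed
  have base: "\<omega> y (differential M ?B q v) (differential M ?B q v') = \<omega> (m q) (differential M m q v) (differential M m q v')"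
  proof -
    have "differential M ?B q v = differential M (act g) (m q) (differential M m q v)" for v
      using differential_compose[where F = m, OF M M holomorphic_act_left[OF M A gG] mr[OF q]] by (simp add: comp_def)
    then show ?thesis
      using pres[OF gG] mr[OF q] differential_tangent[OF X M m q v] differential_tangent[OF X M m q v']
      by (simp add: preserves_forms_def y_def)
  qed
  have XB: "\<omega> y (?X v) (differential M ?B q v') = mtrace (- ?c (?s v) * ?c (mat_deriv n U v'))"
    if v': "v' \<in> tangent_space X q" for v v'
    using mom[OF ffc y tB[OF v']] dB[OF v'] by simp
  have XX: "\<omega> y (?X v) (?X v') = mtrace (- ?c (?s v) * (- ?c (?s v') * ?c (U q) - ?c (U q) * - ?c (?s v')))"
    using mom[OF ffc y tX] mat_deriv_moment_fundamental_field[OF M H y ffc] \<mu>y by metis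
  have "A q = y" by (simp add: A_def y_def g_def e_def)
  then have "\<omega> (A q) (differential M A q v) (differential M A q v') =
      \<omega> y (differential M ?B q v) (differential M ?B q v') + \<omega> y (?X v) (differential M ?B q v') 
      - \<omega> y (?X v') (differential M ?B q v) + \<omega> y (?X v) (?X v')"
    unfolding dA[OF v] dA[OF v'] using two_form_sum_expand[OF M W y tB[OF v] tX tB[OF v'] tX] by simp
  also have "\<dots> = \<omega> (m q) (differential M m q v) (differential M m q v') +
      (mtrace (- ?c (?s v) * ?c (mat_deriv n U v')) - mtrace (- ?c (?s v') * ?c (mat_deriv n U v)) +
       mtrace (- ?c (?s v) * (- ?c (?s v') * ?c (U q) - ?c (U q) * - ?c (?s v'))))"
    unfolding base XB[OF v] XB[OF v'] XX by simp
  also have "\<dots> = \<omega> (m q) (differential M m q v) (differential M m q v') -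
      cot_form (?c (U q)) (?c (?s v)) (?c (mat_deriv n U v)) (?c (?s v')) (?c (mat_deriv n U v'))"
    by (subst cot_form_action_terms[of _ n]) (intro cc Uc sc mat_deriv_carrier | simp)+
  also have "cot_form (?c (U q)) (?c (?s v)) (?c (mat_deriv n U v)) (?c (?s v')) (?c (mat_deriv n U v')) =
      cot_form (U q) (?s v) (mat_deriv n U v) (?s v') (mat_deriv n U v')"
    unfolding g_def by (rule cot_form_conj[OF eG Uc sc mat_deriv_carrier sc mat_deriv_carrier])
  finally show ?thesis by (simp add: e_def)
qed

section \<open>The slice\<close>

text \<open>Extending a sequence by the \<open>0 \<times> 0\<close> identity matrix at index \<open>0\<close> makes the first factor,
  on which no left action is given, look like the others: \<open>diag_embed 0 (1\<^sub>m 0)\<close> is the identity.\<close>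

definition with_zeroth :: "(nat \<Rightarrow> complex mat) \<Rightarrow> nat \<Rightarrow> complex mat" where
  "with_zeroth h i = (if i = 0 then 1\<^sub>m 0 else h i)"

text \<open>The manifold of the coordinates \<open>(m', a\<^sub>1, \<dots>, a\<^sub>n)\<close>. The factors \<open>gl_cmfd 0\<close> are points; they
  give the slice the same point and index types as the total space, as the definition of the quotient
  requires of the zero level.\<close>

definition slice_tower_cmfd :: "nat \<Rightarrow> (nat \<Rightarrow> complex mat \<times> complex mat, nat \<times> (nat \<times> nat + nat \<times> nat)) cmfd" where
  "slice_tower_cmfd n = Pi_cmfd {1..n} (\<lambda>i. prod_cmfd (GL_cmfd i) (gl_cmfd 0))"

definition slice_cmfd :: "nat \<Rightarrow> ('p, 'j) cmfd \<Rightarrow>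
    ('p \<times> (nat \<Rightarrow> complex mat \<times> complex mat), 'j + nat \<times> (nat \<times> nat + nat \<times> nat)) cmfd" where
  "slice_cmfd n M = prod_cmfd M (slice_tower_cmfd n)"

definition frame :: "nat \<Rightarrow> 'p \<times> (nat \<Rightarrow> complex mat \<times> complex mat) \<Rightarrow> complex mat" where
  "frame i p = with_zeroth (\<lambda>i. fst (snd p i)) i"

definition subframe :: "nat \<Rightarrow> 'p \<times> (nat \<Rightarrow> complex mat \<times> complex mat) \<Rightarrow> complex mat" where
  "subframe i p = diag_embed (i - 1) (frame (i - 1) p)"

text \<open>For a point \<open>p\<close> of the slice, \<open>frame i p\<close> is \<open>a\<^sub>i\<close> and \<open>subframe i p\<close> is
  \<open>e\<^sub>i = diag(a\<^sub>i\<^sub>-\<^sub>1, 1)\<close>; \<open>total_frame\<close> recovers the \<open>a\<^sub>i\<close> from a point of the total space.\<close>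

primrec total_frame :: "(nat \<Rightarrow> complex mat \<times> complex mat) \<Rightarrow> nat \<Rightarrow> complex mat" where
  "total_frame x 0 = 1\<^sub>m 0"
| "total_frame x (Suc k) = diag_embed k (total_frame x k) * fst (x (Suc k))"

lemma complex_manifold_TGL_tower: "complex_manifold (TGL_tower_cmfd n)"
  unfolding TGL_tower_cmfd_def by (rule complex_manifold_Pi) (auto intro: complex_manifold_TGL)

lemma complex_manifold_slice_tower: "complex_manifold (slice_tower_cmfd n)"
  unfolding slice_tower_cmfd_def
  by (rule complex_manifold_Pi) (auto intro: complex_manifold_prod complex_manifold_GL complex_manifold_gl)

lemma complex_manifold_total: "complex_manifold M \<Longrightarrow> complex_manifold (total_cmfd n M)"
  unfolding total_cmfd_def by (rule complex_manifold_prod[OF _ complex_manifold_TGL_tower])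

lemma complex_manifold_slice: "complex_manifold M \<Longrightarrow> complex_manifold (slice_cmfd n M)"
  unfolding slice_cmfd_def by (rule complex_manifold_prod[OF _ complex_manifold_slice_tower])

lemma points_TGL [simp]: "points (TGL_cmfd i) = GL i \<times> carrier_mat i i"
  by (simp add: TGL_cmfd_def)

lemma points_total: "points (total_cmfd n M) = points M \<times> PiE {1..n} (\<lambda>i. GL i \<times> carrier_mat i i)"
  by (simp add: total_cmfd_def TGL_tower_cmfd_def)

lemma points_slice: "points (slice_cmfd n M) = points M \<times> PiE {1..n} (\<lambda>i. GL i \<times> carrier_mat 0 0)"
  by (simp add: slice_cmfd_def slice_tower_cmfd_def)

lemma total_component_mem:
  "z \<in> points (total_cmfd n M) \<Longrightarrow> i \<in> {1..n} \<Longrightarrow> snd z i \<in> GL i \<times> carrier_mat i i"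
  unfolding points_total mem_Times_iff[of z] using PiE_mem[of "snd z"] by blast

lemma slice_component_mem:
  "z \<in> points (slice_cmfd n M) \<Longrightarrow> i \<in> {1..n} \<Longrightarrow> snd z i \<in> GL i \<times> carrier_mat 0 0"
  unfolding points_slice mem_Times_iff[of z] using PiE_mem[of "snd z"] by blast

lemma holomorphic_map_comp2:
  assumes X: "complex_manifold X" and Y: "complex_manifold Y" and Z: "complex_manifold Z"
    and F: "holomorphic_map X Y F" and G: "holomorphic_map Y Z G"
  shows "holomorphic_map X Z (\<lambda>x. G (F x))"
  using holomorphic_map_compose[OF X Y Z F G] by (simp add: comp_def)

lemma total_component:
  assumes M: "complex_manifold M" and i: "i \<in> {1..n}"
  shows "holomorphic_map (total_cmfd n M) (TGL_cmfd i) (\<lambda>z. snd z i)"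
proof -
  have "holomorphic_map (TGL_tower_cmfd n) (TGL_cmfd i) (\<lambda>x. x i)"
    unfolding TGL_tower_cmfd_def by (rule holomorphic_map_Pi_proj[OF _ _ i]) (auto intro: complex_manifold_TGL)
  moreover have "holomorphic_map (total_cmfd n M) (TGL_tower_cmfd n) snd"
    unfolding total_cmfd_def by (rule holomorphic_map_snd[OF M complex_manifold_TGL_tower])
  ultimately show ?thesis
    using holomorphic_map_comp2[OF complex_manifold_total[OF M] complex_manifold_TGL_tower complex_manifold_TGL] by blast
qed

lemma total_fst_holomorphic:
  assumes M: "complex_manifold M"
  shows "holomorphic_map (total_cmfd n M) M fst"
  unfolding total_cmfd_def by (rule holomorphic_map_fst[OF M complex_manifold_TGL_tower])

lemma TGL_components:
  shows "holomorphic_map (TGL_cmfd i) (GL_cmfd i) fst" "holomorphic_map (TGL_cmfd i) (gl_cmfd i) snd"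
  unfolding TGL_cmfd_def
  by (rule holomorphic_map_fst[OF complex_manifold_GL complex_manifold_gl] holomorphic_map_snd[OF complex_manifold_GL complex_manifold_gl])+

lemma total_component_mholo:
  assumes M: "complex_manifold M" and i: "i \<in> {1..n}" and z: "z \<in> points (total_cmfd n M)"
  shows "mholo i (total_cmfd n M) z (\<lambda>z. fst (snd z i))" "mholo i (total_cmfd n M) z (\<lambda>z. snd (snd z i))"
  using mholo_of_GL[OF complex_manifold_total[OF M] _ z] mholo_of_gl[OF complex_manifold_total[OF M] _ z]
    holomorphic_map_comp2[OF complex_manifold_total[OF M] complex_manifold_TGL _ total_component[OF M i]]
    TGL_components[of i] complex_manifold_GL complex_manifold_gl by blast+

lemma slice_fst_holomorphic:
  assumes M: "complex_manifold M"
  shows "holomorphic_map (slice_cmfd n M) M fst"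
  unfolding slice_cmfd_def by (rule holomorphic_map_fst[OF M complex_manifold_slice_tower])

lemma slice_component_holomorphic:
  assumes M: "complex_manifold M" and i: "i \<in> {1..n}"
  shows "holomorphic_map (slice_cmfd n M) (GL_cmfd i) (\<lambda>z. fst (snd z i))"
proof -
  let ?T = "prod_cmfd (GL_cmfd i) (gl_cmfd 0)"
  have T: "complex_manifold ?T" by (intro complex_manifold_prod complex_manifold_GL complex_manifold_gl)
  have "holomorphic_map (slice_tower_cmfd n) ?T (\<lambda>x. x i)"
    unfolding slice_tower_cmfd_def
    by (rule holomorphic_map_Pi_proj[OF _ _ i]) (auto intro: complex_manifold_prod complex_manifold_GL complex_manifold_gl)
  moreover have "holomorphic_map (slice_cmfd n M) (slice_tower_cmfd n) snd"
    unfolding slice_cmfd_def by (rule holomorphic_map_snd[OF M complex_manifold_slice_tower])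
  ultimately have "holomorphic_map (slice_cmfd n M) ?T (\<lambda>z. snd z i)"
    using holomorphic_map_comp2[OF complex_manifold_slice[OF M] complex_manifold_slice_tower T] by blast
  from holomorphic_map_comp2[OF complex_manifold_slice[OF M] T complex_manifold_GL this holomorphic_map_fst[OF complex_manifold_GL complex_manifold_gl]]
  show ?thesis .
qed

lemma frame_GL:
  assumes "p \<in> points (slice_cmfd n M)" "i \<le> n"
  shows "frame i p \<in> GL i"
proof (cases "i = 0")
  case False
  then have "snd p i \<in> GL i \<times> carrier_mat 0 0"
    using assms by (intro slice_component_mem) auto
  then show ?thesis using False by (auto simp: frame_def with_zeroth_def)
qed (simp add: frame_def with_zeroth_def)

lemma frame_holomorphic:
  assumes M: "complex_manifold M" and i: "i \<le> n"
  shows "holomorphic_map (slice_cmfd n M) (GL_cmfd i) (frame i)"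
proof (cases "i = 0")
  case True
  have "holomorphic_map (slice_cmfd n M) (GL_cmfd 0) (\<lambda>_. 1\<^sub>m 0)"
    by (rule holomorphic_map_const[OF complex_manifold_slice[OF M] complex_manifold_GL]) simp
  then show ?thesis unfolding True by (simp add: frame_def[abs_def] with_zeroth_def)
next
  case False
  then show ?thesis
    using slice_component_holomorphic[OF M, of i n] i by (simp add: frame_def[abs_def] with_zeroth_def)
qed

lemma frame_mholo:
  assumes M: "complex_manifold M" and i: "i \<le> n" and p: "p \<in> points (slice_cmfd n M)"
  shows "mholo i (slice_cmfd n M) p (frame i)"
  by (rule mholo_of_GL[OF complex_manifold_slice[OF M] frame_holomorphic[OF M i] p])

lemma subframe_Suc: "subframe (Suc k) p = diag_embed k (frame k p)"
  by (simp add: subframe_def)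

lemma subframe_GL:
  assumes p: "p \<in> points (slice_cmfd n M)" and i: "i \<in> {1..n}"
  shows "subframe i p \<in> GL i"
proof -
  obtain k where k: "i = Suc k" "k < n" using i by (cases i) auto
  show ?thesis using diag_embed_GL[OF frame_GL[OF p, of k]] k by (simp add: subframe_Suc)
qed

lemma subframe_mholo:
  assumes M: "complex_manifold M" and i: "i \<in> {1..n}" and p: "p \<in> points (slice_cmfd n M)"
  shows "mholo i (slice_cmfd n M) p (subframe i)"
proof -
  obtain k where k: "i = Suc k" "k < n" using i by (cases i) auto
  show ?thesis
    using mholo_diag_embed[OF complex_manifold_slice[OF M] p frame_mholo[OF M _ p, of k]] k
    by (simp add: subframe_Suc[abs_def])
qed

lemma total_frame_GL:
  assumes z: "z \<in> points (total_cmfd n M)" and i: "i \<le> n"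
  shows "total_frame (snd z) i \<in> GL i"
  using i
proof (induction i)
  case (Suc k)
  then have "snd z (Suc k) \<in> GL (Suc k) \<times> carrier_mat (Suc k) (Suc k)"
    using z by (intro total_component_mem) auto
  then show ?case using Suc by auto
qed simp

lemma total_frame_mholo:
  assumes M: "complex_manifold M" and z: "z \<in> points (total_cmfd n M)" and i: "i \<le> n"
  shows "mholo i (total_cmfd n M) z (\<lambda>z. total_frame (snd z) i)"
  using i
proof (induction i)
  case 0
  show ?case using mholo_const[OF complex_manifold_total[OF M] z] by simp
next
  case (Suc k)
  then show ?case
    using mholo_mult[OF complex_manifold_total[OF M] z mholo_diag_embed[OF complex_manifold_total[OF M] z] total_component_mholo(1)[OF M _ z]]
    by simp
qed

section \<open>The parametrisation of the zero level and its left inverse\<close>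

locale gl_reduction =
  fixes n :: nat and M :: "('p, 'j) cmfd" and \<omega> :: "'p two_form"
    and act :: "complex mat \<Rightarrow> 'p \<Rightarrow> 'p" and \<mu> :: "'p \<Rightarrow> complex mat"
  assumes n: "n \<ge> 1" and symp: "symplectic_manifold M \<omega>" and ham: "hamiltonian_GL_action n M \<omega> act \<mu>"
begin

abbreviation "X \<equiv> total_cmfd n M"
abbreviation "P \<equiv> slice_cmfd n M"

lemma M: "complex_manifold M" using symp by (simp add: symplectic_manifold_def)
lemma act: "holomorphic_GL_action n M act" using ham by (simp add: hamiltonian_GL_action_def)
lemma moment_holomorphic: "holomorphic_map M (gl_cmfd n) \<mu>" using ham by (simp add: hamiltonian_GL_action_def)
lemma moment_equivariant: "g \<in> GL n \<Longrightarrow> p \<in> points M \<Longrightarrow> \<mu> (act g p) = g * \<mu> p * minv g"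
  using ham by (simp add: hamiltonian_GL_action_def)
lemma moment_carrier: "p \<in> points M \<Longrightarrow> \<mu> p \<in> carrier_mat n n"
  using holomorphic_map_points[OF moment_holomorphic] by simp

lemmas XM = complex_manifold_total[OF M, of n] and PM = complex_manifold_slice[OF M, of n]

text \<open>The matrix U_i in slice coordinates. It depends on \<open>fst p\<close>, that is m',
  alone; therefore the group will leave it fixed.\<close>

definition level :: "nat \<Rightarrow> 'p \<times> (nat \<Rightarrow> complex mat \<times> complex mat) \<Rightarrow> complex mat" where
  "level i p = upper_left i (\<mu> (fst p))"

lemma level_carrier [simp]: "level i p \<in> carrier_mat i i"
  by (simp add: level_def)

lemma slice_fst: "p \<in> points P \<Longrightarrow> fst p \<in> points M"
  by (auto simp: points_slice)

lemma level_mholo: "i \<le> n \<Longrightarrow> p \<in> points P \<Longrightarrow> mholo i P p (level i)"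
  unfolding level_def[abs_def]
  by (intro mholo_upper_left[OF PM, of n] mholo_compose[OF PM M slice_fst_holomorphic[OF M]]
      mholo_of_gl[OF M moment_holomorphic] slice_fst)

text \<open>The components solve m' = a_n m and a_i = e_i g_i for m and g_i, and the moment map
  equations for B_i.\<close>

definition iota :: "'p \<times> (nat \<Rightarrow> complex mat \<times> complex mat) \<Rightarrow> 'p \<times> (nat \<Rightarrow> complex mat \<times> complex mat)" where
  "iota p = (act (minv (frame n p)) (fst p),
     \<lambda>i\<in>{1..n}. (minv (subframe i p) * frame i p, minv (subframe i p) * level i p * subframe i p))"

text \<open>Defined on the whole total space and not just on the zero level: it reads off m' and the
  a_i and forgets the B_i. Its holomorphy there is what makes the zero level an embedded
  submanifold.\<close>

definition retr :: "'p \<times> (nat \<Rightarrow> complex mat \<times> complex mat) \<Rightarrow> 'p \<times> (nat \<Rightarrow> complex mat \<times> complex mat)" where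
  "retr z = (act (total_frame (snd z) n) (fst z), \<lambda>i\<in>{1..n}. (total_frame (snd z) i, 1\<^sub>m 0))"

lemma iota_components:
  "fst (iota p) = act (minv (frame n p)) (fst p)"
  "i \<in> {1..n} \<Longrightarrow> fst (snd (iota p) i) = minv (subframe i p) * frame i p"
  "i \<in> {1..n} \<Longrightarrow> snd (snd (iota p) i) = minv (subframe i p) * level i p * subframe i p"
  by (simp_all add: iota_def)

lemma iota_component_GL: "p \<in> points P \<Longrightarrow> i \<in> {1..n} \<Longrightarrow> minv (subframe i p) * frame i p \<in> GL i"
  using subframe_GL[of p n M i] frame_GL[of p n M i] by simp

lemma iota_component_carrier:
  "p \<in> points P \<Longrightarrow> i \<in> {1..n} \<Longrightarrow> minv (subframe i p) * level i p * subframe i p \<in> carrier_mat i i"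
  by (intro mat_mult_closed[where n = i] level_carrier GL_carrier GL_minv subframe_GL)

lemma iota_points: "p \<in> points P \<Longrightarrow> iota p \<in> points X"
  using act_points[OF M act GL_minv[OF frame_GL[of p n M n]] slice_fst] iota_component_GL iota_component_carrier
  by (auto simp: points_total iota_def)

lemma retr_points:
  assumes z: "z \<in> points X"
  shows "retr z \<in> points P"
proof -
  have "fst z \<in> points M" using z by (auto simp: points_total)
  then show ?thesis
    using act_points[OF M act total_frame_GL[OF z, of n]] total_frame_GL[OF z] by (auto simp: points_slice retr_def)
qed

lemma iota_holomorphic: "holomorphic_map P X iota"
  unfolding total_cmfd_def iota_def[abs_def]
proof (rule holomorphic_map_Pair[OF PM M complex_manifold_TGL_tower])
  have "holomorphic_map P (GL_cmfd n) (\<lambda>p. minv (frame n p))"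
    by (rule holomorphic_map_into_GL[OF PM]) (auto intro!: mholo_minv[OF PM] frame_mholo[OF M] GL_minv frame_GL)
  then show "holomorphic_map P M (\<lambda>p. act (minv (frame n p)) (fst p))"
    by (rule holomorphic_act[OF PM M act _ slice_fst_holomorphic[OF M]])
  show "holomorphic_map P (TGL_tower_cmfd n) (\<lambda>p. \<lambda>i\<in>{1..n}. (minv (subframe i p) * frame i p, minv (subframe i p) * level i p * subframe i p))"
    unfolding TGL_tower_cmfd_def
  proof (rule holomorphic_map_into_Pi[OF _ _ PM])
    fix i assume i: "i \<in> {1..n}"
    have a: "mholo i P p (\<lambda>p. minv (subframe i p))" if p: "p \<in> points P" for p
      by (rule mholo_minv[OF PM p subframe_mholo[OF M i p] subframe_GL[OF _ i]])
    have "holomorphic_map P (TGL_cmfd i) (\<lambda>p. (minv (subframe i p) * frame i p, minv (subframe i p) * level i p * subframe i p))"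
      unfolding TGL_cmfd_def
    proof (rule holomorphic_map_Pair[OF PM complex_manifold_GL complex_manifold_gl])
      show "holomorphic_map P (GL_cmfd i) (\<lambda>p. minv (subframe i p) * frame i p)"
        using i by (intro holomorphic_map_into_GL[OF PM] mholo_mult[OF PM] a frame_mholo[OF M] iota_component_GL) auto
      show "holomorphic_map P (gl_cmfd i) (\<lambda>p. minv (subframe i p) * level i p * subframe i p)"
        using i by (intro holomorphic_map_into_gl[OF PM] mholo_mult[OF PM] a level_mholo subframe_mholo[OF M]) auto
    qed
    then show "holomorphic_map P (TGL_cmfd i) (\<lambda>p. (\<lambda>i\<in>{1..n}. (minv (subframe i p) * frame i p, minv (subframe i p) * level i p * subframe i p)) i)"
      using i by simp
  qed (auto intro: complex_manifold_TGL)
qed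

lemma retr_holomorphic: "holomorphic_map X P retr"
  unfolding slice_cmfd_def retr_def[abs_def]
proof (rule holomorphic_map_Pair[OF XM M complex_manifold_slice_tower])
  have fr: "holomorphic_map X (GL_cmfd i) (\<lambda>z. total_frame (snd z) i)" if "i \<le> n" for i
    by (rule holomorphic_map_into_GL[OF XM total_frame_mholo[OF M _ that] total_frame_GL[OF _ that]])
  show "holomorphic_map X M (\<lambda>z. act (total_frame (snd z) n) (fst z))"
    by (rule holomorphic_act[OF XM M act fr total_fst_holomorphic[OF M]]) simp
  show "holomorphic_map X (slice_tower_cmfd n) (\<lambda>z. \<lambda>i\<in>{1..n}. (total_frame (snd z) i, 1\<^sub>m 0))"
    unfolding slice_tower_cmfd_def
  proof (rule holomorphic_map_into_Pi[OF _ _ XM])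
    fix i assume i: "i \<in> {1..n}"
    have "holomorphic_map X (prod_cmfd (GL_cmfd i) (gl_cmfd 0)) (\<lambda>z. (total_frame (snd z) i, 1\<^sub>m 0))"
      using i by (intro holomorphic_map_Pair[OF XM complex_manifold_GL complex_manifold_gl] fr
          holomorphic_map_const[OF XM complex_manifold_gl]) auto
    then show "holomorphic_map X (prod_cmfd (GL_cmfd i) (gl_cmfd 0)) (\<lambda>z. (\<lambda>i\<in>{1..n}. (total_frame (snd z) i, 1\<^sub>m 0)) i)"
      using i by simp
  qed (auto intro: complex_manifold_prod complex_manifold_GL complex_manifold_gl)
qed

lemma total_frame_iota:
  assumes p: "p \<in> points P" and i: "i \<le> n"
  shows "total_frame (snd (iota p)) i = frame i p"
  using i
proof (induction i)
  case 0
  show ?case by (simp add: frame_def with_zeroth_def)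
next
  case (Suc k)
  then have k: "Suc k \<in> {1..n}" by simp
  have "total_frame (snd (iota p)) (Suc k) = subframe (Suc k) p * (minv (subframe (Suc k) p) * frame (Suc k) p)"
    using Suc by (simp add: iota_components(2)[OF k] subframe_Suc)
  also have "\<dots> = frame (Suc k) p"
    using Suc.prems by (intro minv_cancel(1)[OF subframe_GL[OF p k]] GL_carrier frame_GL[OF p])
  finally show ?case .
qed

lemma slice_eqI:
  assumes p: "p \<in> points P" and q: "q \<in> points P" and eq: "fst p = fst q" "\<And>i. i \<in> {1..n} \<Longrightarrow> frame i p = frame i q"
  shows "p = q"
proof -
  have "snd p = snd q"
  proof
    fix i
    show "snd p i = snd q i"
    proof (cases "i \<in> {1..n}")
      case True
      have mem: "snd p i \<in> GL i \<times> carrier_mat 0 0" "snd q i \<in> GL i \<times> carrier_mat 0 0"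
        using slice_component_mem[OF p True] slice_component_mem[OF q True] .
      \<comment> \<open>Any two matrices of size 0 are equal, so the dummy second components carry
        no information.\<close>
      then have "snd (snd p i) = snd (snd q i)" by (auto intro!: eq_matI)
      moreover have "fst (snd p i) = fst (snd q i)" using eq(2)[OF True] True by (auto simp: frame_def with_zeroth_def)
      ultimately show ?thesis by (simp add: prod_eq_iff)
    next
      case False
      have "snd p \<in> extensional {1..n}" "snd q \<in> extensional {1..n}"
        using p q unfolding points_slice by (auto simp: PiE_def)
      then show ?thesis using False by (simp add: extensional_def)
    qed
  qed
  then show ?thesis using eq(1) by (simp add: prod_eq_iff)
qed

lemma retr_iota:
  assumes p: "p \<in> points P"
  shows "retr (iota p) = p"
proof (rule slice_eqI[OF retr_points[OF iota_points[OF p]] p])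
  show "fst (retr (iota p)) = fst p"
    using act_minv_cancel(1)[OF M act frame_GL[OF p] slice_fst[OF p]]
    by (simp add: retr_def total_frame_iota[OF p] iota_components(1))
  fix i assume i: "i \<in> {1..n}"
  then show "frame i (retr (iota p)) = frame i p"
    using total_frame_iota[OF p, of i] by (simp add: retr_def frame_def with_zeroth_def)
qed

end

section \<open>The zero level of the moment map and its orbits\<close>

lemma conj_compose:
  assumes g: "g \<in> GL n" and e: "e \<in> GL n" and U: "U \<in> carrier_mat n n"
  shows "minv g * (minv e * U * e) * g = minv (e * g) * U * (e * g)"
proof -
  note c = GL_carrier[OF g] GL_carrier[OF e] minv_carrier[OF g] minv_carrier[OF e] U
  note m = mat_mult_closed[where n = n]
  have "minv (e * g) * U * (e * g) = minv g * minv e * (U * (e * g))"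
    unfolding minv_mult[OF e g] by (rule mat_assoc[of _ n]) (intro m c)+
  also have "\<dots> = minv g * (minv e * (U * (e * g)))" by (rule mat_assoc[of _ n]) (intro m c)+
  also have "U * (e * g) = U * e * g" by (rule mat_assoc[of _ n, symmetric]) (intro m c)+
  also have "minv e * (U * e * g) = minv e * (U * e) * g" by (rule mat_assoc[of _ n, symmetric]) (intro m c)+
  also have "minv e * (U * e) = minv e * U * e" by (rule mat_assoc[of _ n, symmetric]) (intro m c)+
  also have "minv g * (minv e * U * e * g) = minv g * (minv e * U * e) * g" by (rule mat_assoc[of _ n, symmetric]) (intro m c)+
  finally show ?thesis by simp
qed

lemma conj_cancel:
  assumes g: "g \<in> GL n" and Y: "Y \<in> carrier_mat n n" and Z: "Z \<in> carrier_mat n n"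
    and eq: "minv g * Y * g = minv g * Z * g"
  shows "Y = Z"
proof -
  have "minv (g * minv g) * A * (g * minv g) = A" if "A \<in> carrier_mat n n" for A
    using that minv_right[OF g] by simp
  then show ?thesis
    using conj_compose[OF GL_minv[OF g] g Y] conj_compose[OF GL_minv[OF g] g Z] eq Y Z by metis
qed

lemma add_uminus_eq_zero_iff:
  fixes A B :: "complex mat"
  assumes "A \<in> carrier_mat n n" "B \<in> carrier_mat n n"
  shows "A + - B = 0\<^sub>m n n \<longleftrightarrow> A = B" "- B + A = 0\<^sub>m n n \<longleftrightarrow> A = B"
proof -
  have "A = B" if "A + - B = 0\<^sub>m n n"
  proof (rule eq_matI)
    fix i j assume ij: "i < dim_row B" "j < dim_col B"
    then have "(A + - B) $$ (i, j) = 0" using that assms by simp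
    then show "A $$ (i, j) = B $$ (i, j)" using ij assms by simp
  qed (use assms in auto)
  moreover have "A + - A = 0\<^sub>m n n" using assms by (intro eq_matI) auto
  moreover have "- B + A = A + - B" using comm_add_mat[of "- B" n n A] assms by simp
  ultimately show "A + - B = 0\<^sub>m n n \<longleftrightarrow> A = B" "- B + A = 0\<^sub>m n n \<longleftrightarrow> A = B" by auto
qed

lemma upper_left_diag_embed_mult:
  assumes A: "A \<in> carrier_mat k k" and U: "U \<in> carrier_mat (Suc k) (Suc k)"
  shows "upper_left k (diag_embed k A * U) = A * upper_left k U"
proof (rule eq_matI)
  fix i j assume "i < dim_row (A * upper_left k U)" "j < dim_col (A * upper_left k U)"
  then have ij: "i < k" "j < k" using A by (auto simp: upper_left_def)
  have "upper_left k (diag_embed k A * U) $$ (i, j) = (diag_embed k A * U) $$ (i, j)"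
    using ij by (simp add: upper_left_def del: index_mult_mat)
  also have "\<dots> = (\<Sum>l<Suc k. diag_embed k A $$ (i, l) * U $$ (l, j))"
    using ij by (intro mult_mat_entry diag_embed_carrier A U) auto
  also have "\<dots> = (\<Sum>l<k. A $$ (i, l) * upper_left k U $$ (l, j))"
    using ij by (simp add: diag_embed_entry[OF A] upper_left_def)
  also have "\<dots> = (A * upper_left k U) $$ (i, j)"
    using ij by (intro mult_mat_entry[symmetric] A upper_left_carrier) auto
  finally show "upper_left k (diag_embed k A * U) $$ (i, j) = (A * upper_left k U) $$ (i, j)" .
qed (use A in \<open>auto simp: upper_left_def\<close>)

lemma upper_left_mult_diag_embed:
  assumes A: "A \<in> carrier_mat k k" and U: "U \<in> carrier_mat (Suc k) (Suc k)"
  shows "upper_left k (U * diag_embed k A) = upper_left k U * A"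
proof (rule eq_matI)
  fix i j assume "i < dim_row (upper_left k U * A)" "j < dim_col (upper_left k U * A)"
  then have ij: "i < k" "j < k" using A by (auto simp: upper_left_def)
  have "upper_left k (U * diag_embed k A) $$ (i, j) = (U * diag_embed k A) $$ (i, j)"
    using ij by (simp add: upper_left_def del: index_mult_mat)
  also have "\<dots> = (\<Sum>l<Suc k. U $$ (i, l) * diag_embed k A $$ (l, j))"
    using ij by (intro mult_mat_entry diag_embed_carrier A U) auto
  also have "\<dots> = (\<Sum>l<k. upper_left k U $$ (i, l) * A $$ (l, j))"
    using ij by (simp add: diag_embed_entry[OF A] upper_left_def)
  also have "\<dots> = (upper_left k U * A) $$ (i, j)"
    using ij by (intro mult_mat_entry[symmetric] A upper_left_carrier) auto
  finally show "upper_left k (U * diag_embed k A) $$ (i, j) = (upper_left k U * A) $$ (i, j)" .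
qed (use A in \<open>auto simp: upper_left_def\<close>)

text \<open>A block-diagonal matrix does not mix the first k rows or columns with the last one, so
  taking the upper-left block is equivariant under the embedded subgroup. This links the moment map
  equations of neighbouring factors.\<close>

lemma upper_left_conj:
  assumes A: "A \<in> GL k" and U: "U \<in> carrier_mat (Suc k) (Suc k)"
  shows "upper_left k (minv (diag_embed k A) * U * diag_embed k A) = minv A * upper_left k U * A"
proof -
  have "diag_embed k (minv A) * U \<in> carrier_mat (Suc k) (Suc k)"
    by (intro mat_mult_closed[where n = "Suc k"] diag_embed_carrier minv_carrier[OF A] U)
  then show ?thesis
    by (simp add: minv_diag_embed[OF A] upper_left_mult_diag_embed[OF GL_carrier[OF A]]
        upper_left_diag_embed_mult[OF minv_carrier[OF A] U])
qed

lemma upper_left_upper_left: "i \<le> j \<Longrightarrow> upper_left i (upper_left j A) = upper_left i A"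
  by (rule eq_matI) (auto simp: upper_left_def)

lemma upper_left_self: "A \<in> carrier_mat n n \<Longrightarrow> upper_left n A = A"
  by (rule eq_matI) (auto simp: upper_left_def)

lemma with_zeroth_GL: "h \<in> GL_product n \<Longrightarrow> i \<le> n \<Longrightarrow> with_zeroth h i \<in> GL i"
  using PiE_mem[of h "{1..n}" GL i] by (cases "i = 0") (auto simp: with_zeroth_def GL_product_def)

context gl_reduction
begin

lemma total_moment_less:
  "i < n \<Longrightarrow> total_moment n \<mu> i z =
    - (minv (fst (snd z i)) * snd (snd z i) * fst (snd z i)) + upper_left i (snd (snd z (Suc i)))"
  by (simp add: total_moment_def mu_R_def mu_L_def case_prod_unfold)

lemma total_moment_top:
  "total_moment n \<mu> n z = \<mu> (fst z) + - (minv (fst (snd z n)) * snd (snd z n) * fst (snd z n))"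
  by (simp add: total_moment_def mu_R_def case_prod_unfold)

definition zero_level :: "('p \<times> (nat \<Rightarrow> complex mat \<times> complex mat)) set" where
  "zero_level = {x \<in> points X. \<forall>i\<in>{1..n}. total_moment n \<mu> i x = 0\<^sub>m i i}"

text \<open>Since e_i g_i = a_i, the conjugations by g_i and e_i combine into one by a_i. So the
  right moment map at the i-th factor depends only on U_i and a_i.\<close>

lemma iota_conj:
  assumes p: "p \<in> points P" and i: "i \<in> {1..n}"
  shows "minv (fst (snd (iota p) i)) * snd (snd (iota p) i) * fst (snd (iota p) i) = minv (frame i p) * level i p * frame i p"
proof -
  have fG: "frame i p \<in> GL i" using frame_GL[OF p] i by simp
  note e = subframe_GL[OF p i]
  show ?thesis
    unfolding iota_components(2,3)[OF i] conj_compose[OF iota_component_GL[OF p i] e level_carrier]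
      minv_cancel(1)[OF e GL_carrier[OF fG]] ..
qed

text \<open>At i = n the equation is equivariance of \<open>\<mu>\<close> under a_n^-1. For i < n,
  the block of B_(i+1) is U_i conjugated by a_i because e_(i+1) = diag(a_i, 1), and this is
  cancelled by the right moment map of the i-th factor.\<close>

lemma iota_zero_level:
  assumes p: "p \<in> points P"
  shows "iota p \<in> zero_level"
  unfolding zero_level_def
proof (intro CollectI conjI ballI iota_points[OF p])
  fix i assume i: "i \<in> {1..n}"
  have fG: "frame i p \<in> GL i" using frame_GL[OF p] i by simp
  have c: "minv (frame i p) * level i p * frame i p \<in> carrier_mat i i"
    by (intro mat_mult_closed[where n = i] minv_carrier[OF fG] GL_carrier[OF fG] level_carrier)
  show "total_moment n \<mu> i (iota p) = 0\<^sub>m i i"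
  proof (cases "i = n")
    case True
    have "\<mu> (fst (iota p)) = minv (frame n p) * level n p * frame n p"
      using moment_equivariant[OF GL_minv[OF frame_GL[OF p order_refl]] slice_fst[OF p]] frame_GL[OF p order_refl]
        upper_left_self[OF moment_carrier[OF slice_fst[OF p]]]
      by (simp add: iota_components level_def)
    then show ?thesis
      using iota_conj[OF p i] c by (simp add: True total_moment_top add_uminus_eq_zero_iff[of _ n])
  next
    case False
    then have i': "i < n" "Suc i \<in> {1..n}" using i by auto
    have "upper_left i (snd (snd (iota p) (Suc i))) = minv (frame i p) * upper_left i (level (Suc i) p) * frame i p"
      unfolding iota_components(3)[OF i'(2)] subframe_Suc by (rule upper_left_conj[OF fG level_carrier])
    also have "upper_left i (level (Suc i) p) = level i p" by (simp add: level_def upper_left_upper_left)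
    finally show ?thesis
      using iota_conj[OF p i] c by (simp add: total_moment_less[OF i'(1)] add_uminus_eq_zero_iff[of _ i])
  qed
qed

lemma frame_retr: "i \<le> n \<Longrightarrow> frame i (retr z) = total_frame (snd z) i"
  by (auto simp: frame_def with_zeroth_def retr_def)

text \<open>The components m and g_i are recovered without the moment map equations. The equations
  determine the B_i: the last one fixes B_n through \<open>\<mu>\<close>, and the i-th fixes B_i
  through the block of B_(i+1).\<close>

lemma iota_retr:
  assumes z: "z \<in> zero_level"
  shows "iota (retr z) = z"
proof -
  have zX: "z \<in> points X" and mom: "\<And>i. i \<in> {1..n} \<Longrightarrow> total_moment n \<mu> i z = 0\<^sub>m i i"
    using z by (auto simp: zero_level_def)
  define p where "p = retr z"
  have p: "p \<in> points P" unfolding p_def by (rule retr_points[OF zX])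
  have mz: "fst z \<in> points M" using zX by (auto simp: points_total)
  define g where "g i = fst (snd z i)" for i
  define B where "B i = snd (snd z i)" for i
  have gG: "g i \<in> GL i" and Bc: "B i \<in> carrier_mat i i" if "i \<in> {1..n}" for i
    using total_component_mem[OF zX that] by (auto simp: g_def B_def)
  have fr: "frame i p = subframe i p * g i" if "i \<in> {1..n}" for i
    using that by (cases i) (auto simp: p_def frame_retr subframe_Suc g_def)
  have e: "minv (subframe i p) * frame i p = g i" if i: "i \<in> {1..n}" for i
    unfolding fr[OF i] by (rule minv_cancel(2)[OF subframe_GL[OF p i] GL_carrier[OF gG[OF i]]])
  have fn: "frame n p \<in> GL n" using frame_GL[OF p] by simp
  have fp: "fst p = act (frame n p) (fst z)" by (simp add: p_def frame_retr) (simp add: retr_def)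
  have B: "B i = minv (subframe i p) * level i p * subframe i p" if 1: "1 \<le> i" and "i \<le> n" for i
    using \<open>i \<le> n\<close> 1
  \<comment> \<open>The induction descends from i = n, the index at which the equation involves
    \<open>\<mu>\<close> in place of a next factor.\<close>
  proof (induction rule: inc_induct)
    case base
    have n1: "n \<in> {1..n}" using n by simp
    note E = subframe_GL[OF p n1] and G = gG[OF n1]
    have c: "minv (g n) * B n * g n \<in> carrier_mat n n"
      by (intro mat_mult_closed[where n = n] minv_carrier[OF G] GL_carrier[OF G] Bc[OF n1])
    have "\<mu> (fst z) = minv (g n) * B n * g n"
      using mom[OF n1] add_uminus_eq_zero_iff(1)[OF moment_carrier[OF mz] c] by (simp add: total_moment_top g_def B_def)
    moreover have "\<mu> (fst z) = minv (frame n p) * level n p * frame n p"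
    proof -
      have "level n p = minv (minv (frame n p)) * \<mu> (fst z) * minv (frame n p)"
        using moment_equivariant[OF fn mz] upper_left_self[OF moment_carrier[OF slice_fst[OF p]]] fn
        by (simp add: level_def fp)
      then have "minv (frame n p) * level n p * frame n p = minv (minv (frame n p) * frame n p) * \<mu> (fst z) * (minv (frame n p) * frame n p)"
        using conj_compose[OF fn GL_minv[OF fn] moment_carrier[OF mz]] by simp
      then show ?thesis using moment_carrier[OF mz] by (simp add: minv_left[OF fn])
    qed
    ultimately have "minv (g n) * B n * g n = minv (g n) * (minv (subframe n p) * level n p * subframe n p) * g n"
      unfolding conj_compose[OF G E level_carrier] fr[OF n1, symmetric] by simp
    then show ?case
      by (rule conj_cancel[OF G Bc[OF n1], rotated])
         (intro mat_mult_closed[where n = n] minv_carrier[OF E] GL_carrier[OF E] level_carrier)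
  next
    case (step i)
    have i: "i \<in> {1..n}" "Suc i \<in> {1..n}" using step by auto
    note E = subframe_GL[OF p i(1)] and G = gG[OF i(1)]
    have fi: "frame i p \<in> GL i" using frame_GL[OF p] i by simp
    have c: "minv (g i) * B i * g i \<in> carrier_mat i i"
      by (intro mat_mult_closed[where n = i] minv_carrier[OF G] GL_carrier[OF G] Bc[OF i(1)])
    have "upper_left i (B (Suc i)) = minv (g i) * B i * g i"
      using mom[OF i(1)] add_uminus_eq_zero_iff(2)[OF upper_left_carrier c] step(2)
      by (simp add: total_moment_less g_def B_def)
    moreover have "upper_left i (B (Suc i)) = minv (frame i p) * level i p * frame i p"
    proof -
      have "B (Suc i) = minv (subframe (Suc i) p) * level (Suc i) p * subframe (Suc i) p" using step by simp
      then have "upper_left i (B (Suc i)) = minv (frame i p) * upper_left i (level (Suc i) p) * frame i p"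
        unfolding subframe_Suc by (simp add: upper_left_conj[OF fi level_carrier])
      then show ?thesis by (simp add: level_def upper_left_upper_left)
    qed
    ultimately have "minv (g i) * B i * g i = minv (g i) * (minv (subframe i p) * level i p * subframe i p) * g i"
      unfolding conj_compose[OF G E level_carrier] fr[OF i(1), symmetric] by simp
    then show ?case
      by (rule conj_cancel[OF G Bc[OF i(1)], rotated])
         (intro mat_mult_closed[where n = i] minv_carrier[OF E] GL_carrier[OF E] level_carrier)
  qed
  have "fst (iota p) = fst z"
    unfolding iota_components(1) fp by (rule act_minv_cancel(2)[OF M act fn mz])
  moreover have "snd (iota p) i = snd z i" for i
  proof (cases "i \<in> {1..n}")
    case True
    have "fst (snd (iota p) i) = fst (snd z i)" unfolding iota_components(2)[OF True] e[OF True] by (simp add: g_def)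
    moreover have "snd (snd (iota p) i) = snd (snd z i)"
      unfolding iota_components(3)[OF True] using B[of i] True by (simp add: B_def)
    ultimately show ?thesis by (simp add: prod_eq_iff)
  next
    case False
    have "snd z \<in> extensional {1..n}" using zX unfolding points_total by (auto simp: PiE_def)
    then show ?thesis using False by (auto simp: iota_def extensional_def)
  qed
  ultimately show ?thesis unfolding p_def by (simp add: prod_eq_iff fun_eq_iff)
qed

lemma zero_level_eq: "zero_level = iota ` points P"
proof (intro equalityI subsetI)
  fix z assume z: "z \<in> zero_level"
  then have "retr z \<in> points P" using retr_points by (auto simp: zero_level_def)
  then show "z \<in> iota ` points P" using iota_retr[OF z] by (metis imageI)
qed (auto intro: iota_zero_level)

lemma inj_iota: "inj_on iota (points P)"
  using retr_iota by (metis inj_on_inverseI)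

section \<open>The group action and its orbits in slice coordinates\<close>

definition shift :: "(nat \<Rightarrow> complex mat) \<Rightarrow> 'p \<times> (nat \<Rightarrow> complex mat \<times> complex mat) \<Rightarrow> 'p \<times> (nat \<Rightarrow> complex mat \<times> complex mat)" where
  "shift h p = (fst p, \<lambda>i\<in>{1..n}. (frame i p * minv (h i), 1\<^sub>m 0))"

lemma GL_product_mem: "h \<in> GL_product n \<Longrightarrow> i \<in> {1..n} \<Longrightarrow> h i \<in> GL i"
  using PiE_mem[of h "{1..n}" GL i] by (simp add: GL_product_def)

lemma shift_points:
  assumes p: "p \<in> points P" and h: "h \<in> GL_product n"
  shows "shift h p \<in> points P"
  using slice_fst[OF p] frame_GL[OF p] GL_minv[OF GL_product_mem[OF h]] by (auto simp: points_slice shift_def)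

lemma frame_shift:
  "i \<le> n \<Longrightarrow> frame i (shift h p) = frame i p * minv (with_zeroth h i)"
  by (auto simp: frame_def with_zeroth_def shift_def)

text \<open>By \<open>with_zeroth\<close> it is the 1 x 1 identity for i = 1, so a single formula
  covers the case distinction in \<open>total_act\<close>.\<close>

definition left_factor :: "(nat \<Rightarrow> complex mat) \<Rightarrow> nat \<Rightarrow> complex mat" where
  "left_factor h i = diag_embed (i - 1) (with_zeroth h (i - 1))"

lemma left_factor_GL:
  assumes h: "h \<in> GL_product n" and i: "i \<in> {1..n}"
  shows "left_factor h i \<in> GL i"
proof -
  obtain k where k: "i = Suc k" "k < n" using i by (cases i) auto
  show ?thesis using diag_embed_GL[OF with_zeroth_GL[OF h, of k]] k by (simp add: left_factor_def)
qed

lemma left_factor_1: "left_factor h 1 = 1\<^sub>m 1"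
  using diag_embed_one[of 0] by (simp add: left_factor_def with_zeroth_def)

lemma subframe_shift:
  assumes p: "p \<in> points P" and h: "h \<in> GL_product n" and i: "i \<in> {1..n}"
  shows "subframe i (shift h p) = subframe i p * minv (left_factor h i)"
proof -
  obtain k where k: "i = Suc k" "k < n" using i by (cases i) auto
  have H: "with_zeroth h k \<in> GL k" by (rule with_zeroth_GL[OF h]) (use k in simp)
  have F: "frame k p \<in> GL k" using frame_GL[OF p] k by simp
  show ?thesis
    using k by (simp add: subframe_Suc left_factor_def frame_shift minv_diag_embed[OF H]
        diag_embed_mult[OF GL_carrier[OF F] minv_carrier[OF H]])
qed

lemma total_act_components:
  assumes z: "z \<in> points X" and h: "h \<in> GL_product n" and i: "i \<in> {1..n}"
  shows "snd (total_act n act h z) i =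
    (left_factor h i * (fst (snd z i) * minv (h i)), left_factor h i * snd (snd z i) * minv (left_factor h i))"
proof (cases "i = 1")
  case True
  have 1: "1 \<in> {1..n}" using i True by simp
  have c: "fst (snd z 1) * minv (h 1) \<in> carrier_mat 1 1" "snd (snd z 1) \<in> carrier_mat 1 1"
    using total_component_mem[OF z 1] minv_carrier[OF GL_product_mem[OF h 1]]
    by (auto intro!: mat_mult_closed[where n = 1] simp del: One_nat_def)
  have "snd (total_act n act h z) 1 = (fst (snd z 1) * minv (h 1), snd (snd z 1))"
    using n by (simp add: total_act_def case_prod_unfold right_act_def)
  then show ?thesis unfolding True left_factor_1 using left_mult_one_mat[OF c(1)] left_mult_one_mat[OF c(2)] right_mult_one_mat[OF c(2)]
    by (simp del: One_nat_def)
next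
  case False
  then show ?thesis
    using i by (simp add: total_act_def case_prod_unfold right_act_def left_act_def left_factor_def with_zeroth_def)
qed

text \<open>Replacing each a_i by a_i h_i^-1 multiplies e_i on the right by the inverse of
  diag(h_(i-1), 1). Hence e_i^-1 acquires exactly the left factor with which h_(i-1) acts on the
  i-th cotangent bundle.\<close>

lemma total_act_iota:
  assumes p: "p \<in> points P" and h: "h \<in> GL_product n"
  shows "total_act n act h (iota p) = iota (shift h p)"
proof -
  have fn: "frame n p \<in> GL n" using frame_GL[OF p] by simp
  have hn: "h n \<in> GL n" using GL_product_mem[OF h] n by simp
  have wn: "with_zeroth h n = h n" using n by (simp add: with_zeroth_def)
  have "fst (total_act n act h (iota p)) = act (h n * minv (frame n p)) (fst p)"
    by (simp add: total_act_def case_prod_unfold iota_components(1) act_mult[OF act hn GL_minv[OF fn] slice_fst[OF p]])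
  also have "h n * minv (frame n p) = minv (frame n p * minv (h n))"
    using minv_mult[OF fn GL_minv[OF hn]] hn by simp
  also have "act (minv (frame n p * minv (h n))) (fst p) = fst (iota (shift h p))"
    by (simp add: iota_components(1) frame_shift wn) (simp add: shift_def)
  finally have 1: "fst (total_act n act h (iota p)) = fst (iota (shift h p))" .
  have 2: "snd (total_act n act h (iota p)) i = snd (iota (shift h p)) i" for i
  proof (cases "i \<in> {1..n}")
    case i: True
    note e = subframe_GL[OF p i] and k = left_factor_GL[OF h i] and hi = GL_product_mem[OF h i]
    have f: "frame i p \<in> GL i" using frame_GL[OF p] i by simp
    have wi: "with_zeroth h i = h i" using i by (simp add: with_zeroth_def)
    note c = GL_carrier[OF e] GL_carrier[OF k] GL_carrier[OF f] minv_carrier[OF e] minv_carrier[OF k] minv_carrier[OF hi]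
    note m = mat_mult_closed[where n = i]
    have lv: "level i (shift h p) = level i p" by (simp add: level_def shift_def)
    have s: "subframe i (shift h p) = subframe i p * minv (left_factor h i)" by (rule subframe_shift[OF p h i])
    have s': "minv (subframe i (shift h p)) = left_factor h i * minv (subframe i p)"
      unfolding s using minv_mult[OF e GL_minv[OF k]] k by simp
    have fs: "frame i (shift h p) = frame i p * minv (h i)" using i by (simp add: frame_shift wi)
    have "left_factor h i * (minv (subframe i p) * frame i p * minv (h i)) =
        left_factor h i * minv (subframe i p) * (frame i p * minv (h i))"
    proof -
      have "minv (subframe i p) * frame i p * minv (h i) = minv (subframe i p) * (frame i p * minv (h i))"
        by (rule mat_assoc[of _ i]) (intro m c)+
      also have "left_factor h i * \<dots> = left_factor h i * minv (subframe i p) * (frame i p * minv (h i))"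
        by (rule mat_assoc[of _ i, symmetric]) (intro m c)+
      finally show ?thesis .
    qed
    moreover have "left_factor h i * (minv (subframe i p) * level i p * subframe i p) * minv (left_factor h i) =
        minv (subframe i (shift h p)) * level i p * subframe i (shift h p)"
      using conj_compose[OF GL_minv[OF k] e level_carrier[of i p]] k by (simp add: s)
    ultimately show ?thesis
      unfolding total_act_components[OF iota_points[OF p] h i] iota_components(2,3)[OF i]
      using i by (simp add: iota_def lv s' fs)
  next
    case False
    then show ?thesis by (auto simp: total_act_def iota_def case_prod_unfold)
  qed
  from 1 2 show ?thesis by (simp add: prod_eq_iff fun_eq_iff)
qed

lemma orbit_iota:
  assumes p: "p \<in> points P"
  shows "orbit_of n (total_act n act) (iota p) = iota ` {q \<in> points P. fst q = fst p}"
proof (intro equalityI subsetI)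
  fix z assume "z \<in> orbit_of n (total_act n act) (iota p)"
  then obtain h where h: "h \<in> GL_product n" "z = total_act n act h (iota p)" by (auto simp: orbit_of_def)
  then have "z = iota (shift h p)" using total_act_iota[OF p] by simp
  then show "z \<in> iota ` {q \<in> points P. fst q = fst p}"
    using shift_points[OF p h(1)] by (auto simp: shift_def)
next
  fix z assume "z \<in> iota ` {q \<in> points P. fst q = fst p}"
  then obtain q where q: "q \<in> points P" "fst q = fst p" "z = iota q" by auto
  \<comment> \<open>The solution of a_i(p) h_i^-1 = a_i(q): the group acts transitively on the
    frames and so on the fibre over \<open>fst p\<close>.\<close>
  define h where "h = (\<lambda>i\<in>{1..n}. minv (frame i q) * frame i p)"
  have G: "frame i p \<in> GL i" "frame i q \<in> GL i" if "i \<in> {1..n}" for i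
    using frame_GL[OF p] frame_GL[OF q(1)] that by auto
  have h: "h \<in> GL_product n" unfolding h_def GL_product_def using G by auto
  have "shift h p = q"
  proof (rule slice_eqI[OF shift_points[OF p h] q(1)])
    show "fst (shift h p) = fst q" by (simp add: shift_def q)
    fix i assume i: "i \<in> {1..n}"
    have "minv (h i) = minv (frame i p) * frame i q"
      using i minv_mult[OF GL_minv[OF G(2)[OF i]] G(1)[OF i]] G(2)[OF i] by (simp add: h_def)
    moreover have "with_zeroth h i = h i" "i \<le> n" using i by (auto simp: with_zeroth_def)
    ultimately show "frame i (shift h p) = frame i q"
      using minv_cancel(1)[OF G(1)[OF i] GL_carrier[OF G(2)[OF i]]] by (simp add: frame_shift)
  qed
  then have "z = total_act n act h (iota p)" using total_act_iota[OF p h] q by simp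
  then show "z \<in> orbit_of n (total_act n act) (iota p)" using h by (auto simp: orbit_of_def)
qed

text \<open>Freeness holds on the whole total space, by induction along the tower: once h_(i-1) = 1
  the left factor at i is trivial, and g_i h_i^-1 = g_i forces h_i = 1.\<close>

lemma total_act_free:
  assumes z: "z \<in> points X" and h: "h \<in> GL_product n" and fx: "total_act n act h z = z"
  shows "h = (\<lambda>i\<in>{1..n}. 1\<^sub>m i)"
proof -
  have "with_zeroth h i = 1\<^sub>m i" if "i \<le> n" for i
    using that
  proof (induction i)
    case (Suc k)
    have i: "Suc k \<in> {1..n}" using Suc by simp
    note hi = GL_product_mem[OF h i]
    have g: "fst (snd z (Suc k)) \<in> GL (Suc k)" using total_component_mem[OF z i] by auto
    have "left_factor h (Suc k) = 1\<^sub>m (Suc k)" using Suc by (simp add: left_factor_def)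
    then have "fst (snd z (Suc k)) * minv (h (Suc k)) = fst (snd z (Suc k))"
      using total_act_components[OF z h i] fx left_mult_one_mat[OF mat_mult_closed[OF GL_carrier[OF g] minv_carrier[OF hi]]]
      by (simp add: prod_eq_iff)
    then have "minv (h (Suc k)) = 1\<^sub>m (Suc k)"
      using left_cancel_GL[OF g minv_carrier[OF hi] one_carrier_mat] GL_carrier[OF g] by simp
    then have "h (Suc k) = 1\<^sub>m (Suc k)" using minv_minv[OF hi] by simp
    then show ?case by (simp add: with_zeroth_def)
  qed (simp add: with_zeroth_def)
  note w = this
  have "h i = 1\<^sub>m i" if "i \<in> {1..n}" for i using w[of i] that by (auto simp: with_zeroth_def)
  moreover have "h \<in> extensional {1..n}" using h by (simp add: GL_product_def PiE_def)
  ultimately show ?thesis by (auto simp: extensional_def fun_eq_iff)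
qed

end

section \<open>Regularity and the restriction of the symplectic form\<close>

lemma conj_affine:
  assumes g: "g \<in> GL n" and B: "B \<in> carrier_mat n n" and b: "b \<in> carrier_mat n n"
  shows "minv g * (B + t \<cdot>\<^sub>m b) * g = minv g * B * g + t \<cdot>\<^sub>m (minv g * b * g)"
proof -
  note c = GL_carrier[OF g] minv_carrier[OF g] B b
  have tb: "t \<cdot>\<^sub>m b \<in> carrier_mat n n" using b by simp
  have "minv g * (B + t \<cdot>\<^sub>m b) * g = (minv g * B + minv g * (t \<cdot>\<^sub>m b)) * g"
    using mult_add_distrib_mat[OF c(2) B tb] by simp
  also have "minv g * (t \<cdot>\<^sub>m b) = t \<cdot>\<^sub>m (minv g * b)" by (rule mult_smult_distrib[OF c(2) b])
  also have "(minv g * B + t \<cdot>\<^sub>m (minv g * b)) * g = minv g * B * g + t \<cdot>\<^sub>m (minv g * b) * g"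
    by (rule add_mult_distrib_mat[of _ n n _ _ n]) (use c in auto)
  also have "t \<cdot>\<^sub>m (minv g * b) * g = t \<cdot>\<^sub>m (minv g * b * g)"
    by (rule mult_smult_assoc_mat[of _ n n _ n]) (use c in auto)
  finally show ?thesis .
qed

lemma upper_left_dim [simp]: "dim_row (upper_left i A) = i" "dim_col (upper_left i A) = i"
  by (simp_all add: upper_left_def)

lemma affine_difference:
  fixes A a w :: "complex mat"
  assumes "A \<in> carrier_mat n n" "a \<in> carrier_mat n n" "w \<in> carrier_mat n n"
  shows "- (A + t \<cdot>\<^sub>m a) + (A + t \<cdot>\<^sub>m w) = t \<cdot>\<^sub>m (- a + w)"
  using assms by (intro eq_matI) (auto simp: algebra_simps)

lemma conj_minv_conj:
  assumes g: "g \<in> GL n" and Y: "Y \<in> carrier_mat n n"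
  shows "minv g * (g * Y * minv g) * g = Y"
  using conj_compose[OF g GL_minv[OF g] Y] Y g by (simp add: minv_left[OF g])

context gl_reduction
begin

lemma total_moment_mholo:
  assumes z: "z \<in> points X" and i: "i \<in> {1..n}"
  shows "mholo i X z (total_moment n \<mu> i)"
proof -
  note G = total_component_mholo(1)[OF M i] and B = total_component_mholo(2)[OF M i]
  have GG: "fst (snd q i) \<in> GL i" if "q \<in> points X" for q using total_component_mem[OF that i] by auto
  have c: "mholo i X z (\<lambda>z. - (minv (fst (snd z i)) * snd (snd z i) * fst (snd z i)))"
    by (intro mholo_uminus[OF XM] mholo_mult[OF XM z] mholo_minv[OF XM z] G B GG z)
  show ?thesis
  proof (cases "i = n")
    case True
    have "fst z \<in> points M" using z by (auto simp: points_total)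
    then have "mholo n X z (\<lambda>z. \<mu> (fst z))"
      by (intro mholo_compose[OF XM M total_fst_holomorphic[OF M] z] mholo_of_gl[OF M moment_holomorphic])
    then have "mholo n X z (\<lambda>z. \<mu> (fst z) + - (minv (fst (snd z n)) * snd (snd z n) * fst (snd z n)))"
      using c unfolding True by (rule mholo_add[OF XM])
    then show ?thesis unfolding True using total_moment_top by presburger
  next
    case False
    then have i': "i < n" "Suc i \<in> {1..n}" using i by auto
    have "mholo i X z (\<lambda>z. upper_left i (snd (snd z (Suc i))))"
      by (rule mholo_upper_left[OF XM total_component_mholo(2)[OF M i'(2) z]]) simp
    with c have "mholo i X z (\<lambda>z. - (minv (fst (snd z i)) * snd (snd z i) * fst (snd z i)) + upper_left i (snd (snd z (Suc i))))"
      by (rule mholo_add[OF XM])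
    then show ?thesis using total_moment_less[OF i'(1)] by presburger
  qed
qed

text \<open>The linearised moment map equations in the fibre directions are triangular and are solved
  from \<open>i = n\<close> downwards.\<close>

lemma moment_preimage_ex:
  assumes z: "z \<in> points X" and c: "\<And>i. i \<in> {1..n} \<Longrightarrow> c i \<in> carrier_mat i i"
  obtains b where "\<And>i. i \<in> {1..n} \<Longrightarrow> b i \<in> carrier_mat i i"
    "\<And>i. i \<in> {1..n} \<Longrightarrow> i < n \<Longrightarrow> - (minv (fst (snd z i)) * b i * fst (snd z i)) + upper_left i (b (Suc i)) = c i"
    "- (minv (fst (snd z n)) * b n * fst (snd z n)) = c n"
proof -
  define g where "g i = fst (snd z i)" for i
  have gG: "g i \<in> GL i" if "i \<in> {1..n}" for i using total_component_mem[OF z that] by (auto simp: g_def)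
  \<comment> \<open>Primitive recursion on the distance d = n - i, as the equations are solved from
    the top downwards.\<close>
  define \<beta> where "\<beta> = rec_nat (g n * (- c n) * minv (g n))
    (\<lambda>d D. g (n - Suc d) * (upper_left (n - Suc d) D - c (n - Suc d)) * minv (g (n - Suc d)))"
  define b where "b i = \<beta> (n - i)" for i
  have bn: "b n = g n * (- c n) * minv (g n)" by (simp add: b_def \<beta>_def)
  have bS: "b i = g i * (upper_left i (b (Suc i)) - c i) * minv (g i)" if "i < n" for i
  proof -
    have "n - i = Suc (n - Suc i)" "n - Suc (n - Suc i) = i" using that by auto
    then show ?thesis unfolding b_def \<beta>_def by simp
  qed
  have n1: "n \<in> {1..n}" using n by simp
  have cn: "- c n \<in> carrier_mat n n" using c[OF n1] by simp
  have d: "upper_left i (b (Suc i)) - c i \<in> carrier_mat i i" if "i \<in> {1..n}" for i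
    by (rule mat_diff_closed[OF upper_left_carrier c[OF that]])
  show ?thesis
  proof (rule that[of b])
    fix i assume i: "i \<in> {1..n}"
    show "b i \<in> carrier_mat i i"
    proof (cases "i = n")
      case True
      show ?thesis unfolding True bn by (intro mat_mult_closed[where n = n] cn GL_carrier minv_carrier gG n1)
    next
      case False
      then have "i < n" using i by simp
      from bS[OF this] show ?thesis
        using mat_mult_closed[OF mat_mult_closed[OF GL_carrier[OF gG[OF i]] d[OF i]] minv_carrier[OF gG[OF i]]] by simp
    qed
    assume "i < n"
    have "minv (g i) * b i * g i = upper_left i (b (Suc i)) - c i"
      unfolding bS[OF \<open>i < n\<close>] by (rule conj_minv_conj[OF gG[OF i] d[OF i]])
    then show "- (minv (fst (snd z i)) * b i * fst (snd z i)) + upper_left i (b (Suc i)) = c i"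
      unfolding g_def[symmetric] using carrier_matD[OF c[OF i]] by (intro eq_matI) auto
  next
    have "minv (g n) * b n * g n = - c n" unfolding bn by (rule conj_minv_conj[OF gG[OF n1] cn])
    then show "- (minv (fst (snd z n)) * b n * fst (snd z n)) = c n"
      unfolding g_def[symmetric] using c[OF n1] by (auto intro!: eq_matI)
  qed
qed

text \<open>Keeping m and the g_i fixed and moving each B_i along a line in the direction b_i, the
  moment map becomes an affine function of the parameter. A preimage \<open>b\<close> of
  \<open>c\<close> under its linear part gives the required tangent vector.\<close>

lemma zero_level_regular:
  assumes z0: "z \<in> zero_level" and c: "c \<in> PiE {1..n} (\<lambda>i. carrier_mat i i)"
  shows "\<exists>v\<in>tangent_space X z. \<forall>i\<in>{1..n}. mat_deriv i (total_moment n \<mu> i) v = c i"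
proof -
  have z: "z \<in> points X" and mom: "\<And>i. i \<in> {1..n} \<Longrightarrow> total_moment n \<mu> i z = 0\<^sub>m i i"
    using z0 by (auto simp: zero_level_def)
  have cc: "c i \<in> carrier_mat i i" if "i \<in> {1..n}" for i using PiE_mem[OF c that] .
  obtain b where b: "\<And>i. i \<in> {1..n} \<Longrightarrow> b i \<in> carrier_mat i i"
    "\<And>i. i \<in> {1..n} \<Longrightarrow> i < n \<Longrightarrow> - (minv (fst (snd z i)) * b i * fst (snd z i)) + upper_left i (b (Suc i)) = c i"
    "- (minv (fst (snd z n)) * b n * fst (snd z n)) = c n"
    using moment_preimage_ex[OF z, of c] cc by blast
  define g where "g i = fst (snd z i)" for i
  define B where "B i = snd (snd z i)" for i
  have gG: "g i \<in> GL i" and Bc: "B i \<in> carrier_mat i i" if "i \<in> {1..n}" for i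
    using total_component_mem[OF z that] by (auto simp: g_def B_def)
  have mz: "fst z \<in> points M" using z by (auto simp: points_total)
  \<comment> \<open>The space of 1 x 1 matrices serves as the complex line: it is already a
    manifold, so the line \<open>L\<close> has a differential.\<close>
  let ?C = "gl_cmfd 1"
  note CM = complex_manifold_gl[of 1]
  define L where "L T = (fst z, \<lambda>i\<in>{1..n}. (g i, B i + T $$ (0, 0) \<cdot>\<^sub>m b i))" for T :: "complex mat"
  have T00: "holo_at ?C T (\<lambda>T. T $$ (0, 0))" if "T \<in> points ?C" for T
    using mholo_entry[OF mholo_of_gl[OF CM holomorphic_map_id[OF CM] that], of 0 0] by simp
  have L: "holomorphic_map ?C X L"
    unfolding L_def[abs_def] total_cmfd_def
  proof (rule holomorphic_map_Pair[OF CM M complex_manifold_TGL_tower holomorphic_map_const[OF CM M mz]])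
    show "holomorphic_map ?C (TGL_tower_cmfd n) (\<lambda>T. \<lambda>i\<in>{1..n}. (g i, B i + T $$ (0, 0) \<cdot>\<^sub>m b i))"
      unfolding TGL_tower_cmfd_def
    proof (rule holomorphic_map_into_Pi[OF _ _ CM])
      fix i assume i: "i \<in> {1..n}"
      have "mholo i ?C T (\<lambda>T. B i + T $$ (0, 0) \<cdot>\<^sub>m b i)" if T: "T \<in> points ?C" for T
        unfolding mholo_def
      proof (intro conjI allI impI ballI)
        fix k l assume kl: "k < i" "l < i"
        have "holo_at ?C T (\<lambda>T. B i $$ (k, l) + T $$ (0, 0) * b i $$ (k, l))"
          by (intro holo_at_add[OF CM] holo_at_mult[OF CM] holo_at_const[OF CM T] T00 T)
        then show "holo_at ?C T (\<lambda>T. (B i + T $$ (0, 0) \<cdot>\<^sub>m b i) $$ (k, l))"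
          using kl Bc[OF i] b(1)[OF i] by simp
      qed (use b(1)[OF i] in simp)
      then have "holomorphic_map ?C (gl_cmfd i) (\<lambda>T. B i + T $$ (0, 0) \<cdot>\<^sub>m b i)"
        by (rule holomorphic_map_into_gl[OF CM])
      then have "holomorphic_map ?C (TGL_cmfd i) (\<lambda>T. (g i, B i + T $$ (0, 0) \<cdot>\<^sub>m b i))"
        unfolding TGL_cmfd_def
        by (intro holomorphic_map_Pair[OF CM complex_manifold_GL complex_manifold_gl] holomorphic_map_const[OF CM complex_manifold_GL])
           (simp add: gG[OF i])
      then show "holomorphic_map ?C (TGL_cmfd i) (\<lambda>T. (\<lambda>i\<in>{1..n}. (g i, B i + T $$ (0, 0) \<cdot>\<^sub>m b i)) i)" using i by simp
    qed (auto intro: complex_manifold_TGL)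
  qed
  have p0: "0\<^sub>m 1 1 \<in> points ?C" by simp
  have L0: "L (0\<^sub>m 1 1) = z"
  proof -
    have "snd (L (0\<^sub>m 1 1)) i = snd z i" for i
    proof (cases "i \<in> {1..n}")
      case True
      have "B i + 0 \<cdot>\<^sub>m b i = B i" using Bc[OF True] b(1)[OF True] by (intro eq_matI) auto
      then show ?thesis using True by (simp add: L_def g_def B_def)
    next
      case False
      have "snd z \<in> extensional {1..n}" using z unfolding points_total by (auto simp: PiE_def)
      then show ?thesis using False by (auto simp: L_def extensional_def)
    qed
    then show ?thesis by (auto simp: prod_eq_iff L_def)
  qed
  \<comment> \<open>The constant part vanishes because \<open>z\<close> lies on the zero level; the
    moment map along the line is then exactly linear in the parameter.\<close>
  have mL: "total_moment n \<mu> i (L T) = T $$ (0, 0) \<cdot>\<^sub>m c i" if i: "i \<in> {1..n}" for i T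
  proof -
    let ?t = "T $$ (0, 0)"
    have Li: "fst (snd (L T) j) = g j" "snd (snd (L T) j) = B j + ?t \<cdot>\<^sub>m b j" if "j \<in> {1..n}" for j
      using that by (simp_all add: L_def)
    have cj: "minv (g i) * Y * g i \<in> carrier_mat i i" if "Y \<in> carrier_mat i i" for Y
      by (intro mat_mult_closed[where n = i] minv_carrier GL_carrier gG i that)
    note A = cj[OF Bc[OF i]] and a = cj[OF b(1)[OF i]]
    have conj: "minv (g i) * (B i + ?t \<cdot>\<^sub>m b i) * g i = minv (g i) * B i * g i + ?t \<cdot>\<^sub>m (minv (g i) * b i * g i)"
      by (rule conj_affine[OF gG[OF i] Bc[OF i] b(1)[OF i]])
    show ?thesis
    proof (cases "i = n")
      case True
      have m0: "\<mu> (fst z) = minv (g i) * B i * g i"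
        using mom[OF i] add_uminus_eq_zero_iff(1)[OF moment_carrier[OF mz] A[unfolded True]]
        by (simp add: True total_moment_top g_def B_def)
      have "c i = - (minv (g i) * b i * g i)" using b(3) by (simp add: True g_def)
      moreover have "total_moment n \<mu> i (L T) = minv (g i) * B i * g i +
          - (minv (g i) * B i * g i + ?t \<cdot>\<^sub>m (minv (g i) * b i * g i))"
        using total_moment_top[of "L T"] conj m0 Li[OF i] by (simp add: True L_def)
      ultimately show ?thesis using A a by (auto intro!: eq_matI)
    next
      case False
      then have i': "i < n" "Suc i \<in> {1..n}" using i by auto
      let ?u = "upper_left i (B (Suc i))" and ?w = "upper_left i (b (Suc i))"
      have m0: "?u = minv (g i) * B i * g i"
        using mom[OF i] add_uminus_eq_zero_iff(2)[OF upper_left_carrier A, of "B (Suc i)"]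
        by (simp add: total_moment_less[OF i'(1)] g_def B_def)
      have ul: "upper_left i (B (Suc i) + ?t \<cdot>\<^sub>m b (Suc i)) = ?u + ?t \<cdot>\<^sub>m ?w"
        using Bc[OF i'(2)] b(1)[OF i'(2)] by (intro eq_matI) (auto simp: upper_left_def)
      have "c i = - (minv (g i) * b i * g i) + ?w" using b(2)[OF i i'(1)] by (simp add: g_def)
      moreover have "total_moment n \<mu> i (L T) = - (minv (g i) * B i * g i + ?t \<cdot>\<^sub>m (minv (g i) * b i * g i)) + (minv (g i) * B i * g i + ?t \<cdot>\<^sub>m ?w)"
        using total_moment_less[OF i'(1), of "L T"] conj ul m0 by (simp only: Li[OF i] Li[OF i'(2)])
      ultimately show ?thesis using affine_difference[OF A a upper_left_carrier] by simp
    qed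
  qed
  have U: "(carrier_mat 1 1, mat_coords 1) \<in> atlas ?C" "0\<^sub>m 1 1 \<in> carrier_mat 1 1" by auto
  obtain w where w: "w \<in> tangent_space ?C (0\<^sub>m 1 1)" "\<And>a. a \<in> cidx ?C \<Longrightarrow> w (\<lambda>q. mat_coords 1 q a) = 1"
    by (fact tangent_with_coords[OF CM U])
  have w1: "w (\<lambda>T. T $$ (0, 0)) = 1" using w(2)[of "(0, 0)"] by (simp add: mat_coords_def)
  define v where "v = differential X L (0\<^sub>m 1 1) w"
  have v: "v \<in> tangent_space X z" using differential_tangent[OF CM XM L p0 w(1)] unfolding v_def L0 .
  moreover have "mat_deriv i (total_moment n \<mu> i) v = c i" if i: "i \<in> {1..n}" for i
  proof -
    have "mholo i X (L (0\<^sub>m 1 1)) (total_moment n \<mu> i)" unfolding L0 by (rule total_moment_mholo[OF z i])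
    then have "mat_deriv i (total_moment n \<mu> i) v = mat_deriv i (\<lambda>T. total_moment n \<mu> i (L T)) w"
      unfolding v_def by (rule mat_deriv_differential)
    also have "\<dots> = mat_deriv i (\<lambda>T. T $$ (0, 0) \<cdot>\<^sub>m c i) w" by (simp add: mL[OF i])
    also have "\<dots> = c i"
    proof (rule eq_matI)
      fix k l assume kl: "k < dim_row (c i)" "l < dim_col (c i)"
      have "w (\<lambda>T. T $$ (0, 0) * c i $$ (k, l)) = c i $$ (k, l)"
        using tangent_mult[OF CM p0 w(1) T00[OF p0] holo_at_const[OF CM p0]] tangent_const[OF CM p0 w(1)] by (simp add: w1)
      then show "mat_deriv i (\<lambda>T. T $$ (0, 0) \<cdot>\<^sub>m c i) w $$ (k, l) = c i $$ (k, l)"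
        using kl cc[OF i] by simp
    qed (use cc[OF i] in auto)
    finally show ?thesis .
  qed
  ultimately show ?thesis by blast
qed

text \<open>The form \<open>f\<^sub>i\<close> of the telescoping sum.\<close>

definition frame_form :: "nat \<Rightarrow> 'p \<times> (nat \<Rightarrow> complex mat \<times> complex mat) \<Rightarrow> _ tangent \<Rightarrow> _ tangent \<Rightarrow> complex" where
  "frame_form i p v w = cot_form (level i p) (mat_deriv i (frame i) v * minv (frame i p)) (mat_deriv i (level i) v)
     (mat_deriv i (frame i) w * minv (frame i p)) (mat_deriv i (level i) w)"

text \<open>Conjugation by e_i drops out, and \<open>cot_form_shift\<close> splits off the cotangent
  form of \<sigma> = de_i e_i^-1 from f_i. As \<sigma> is s_(i-1) bordered by zeros, the part split
  off is f_(i-1).\<close>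

lemma TGL_form_iota:
  assumes p: "p \<in> points P" and v: "v \<in> tangent_space P p" and w: "w \<in> tangent_space P p" and k: "k < n"
  shows "TGL_form (Suc k) (snd (iota p) (Suc k)) (differential (TGL_cmfd (Suc k)) (\<lambda>p. snd (iota p) (Suc k)) p v)
      (differential (TGL_cmfd (Suc k)) (\<lambda>p. snd (iota p) (Suc k)) p w) = frame_form (Suc k) p v w - frame_form k p v w"
proof -
  let ?i = "Suc k"
  have i: "?i \<in> {1..n}" using k by simp
  let ?e = "subframe ?i" and ?a = "frame ?i" and ?U = "level ?i"
  let ?u = "\<lambda>v. differential (TGL_cmfd ?i) (\<lambda>p. snd (iota p) ?i) p v"
  have pT: "snd (iota p) ?i \<in> points (TGL_cmfd ?i)" using total_component_mem[OF iota_points[OF p] i] by simp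
  have eG: "?e q \<in> GL ?i" and aG: "?a q \<in> GL ?i" if "q \<in> points P" for q
    using subframe_GL[OF that i] frame_GL[OF that, of ?i] k by auto
  have kG: "frame k p \<in> GL k" using frame_GL[OF p, of k] k by simp
  note e = subframe_mholo[OF M i p] eG
  have a: "mholo ?i P p ?a" by (rule frame_mholo[OF M _ p]) (use k in simp)
  have kh: "mholo k P p (frame k)" by (rule frame_mholo[OF M _ p]) (use k in simp)
  have U: "mholo ?i P p ?U" by (rule level_mholo[OF _ p]) (use k in simp)
  let ?s = "\<lambda>v. mat_deriv ?i ?a v * minv (?a p)" and ?\<sigma> = "\<lambda>v. mat_deriv ?i ?e v * minv (?e p)" and ?d = "\<lambda>v. mat_deriv ?i ?U v"
  let ?c = "\<lambda>Z. minv (?e p) * Z * ?e p"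
  have sc: "?s v \<in> carrier_mat ?i ?i" "?\<sigma> v \<in> carrier_mat ?i ?i" for v
    by (intro mat_mult_closed[where n = ?i] mat_deriv_carrier minv_carrier[OF aG[OF p]] minv_carrier[OF eG[OF p]])+
  note mm = mat_mult_closed[where n = ?i] mat_diff_closed[where n = ?i] mat_add_closed[where n = ?i]
  have fstd: "mat_deriv ?i fst (?u v) * minv (fst (snd (iota p) ?i)) = ?c (?s v - ?\<sigma> v)" if v: "v \<in> tangent_space P p" for v
  proof -
    have "mat_deriv ?i fst (?u v) = mat_deriv ?i (\<lambda>q. fst (snd (iota q) ?i)) v"
      by (rule mat_deriv_differential[where G = "\<lambda>p. snd (iota p) ?i", OF mholo_of_GL[OF complex_manifold_TGL TGL_components(1) pT]])
    then show ?thesis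
      using mat_deriv_left_quotient[OF PM p v e a aG] by (simp add: iota_components(2)[OF i])
  qed
  have sndd: "mat_deriv ?i snd (?u v) = ?c (?d v + (?U p * ?\<sigma> v - ?\<sigma> v * ?U p))" if v: "v \<in> tangent_space P p" for v
  proof -
    have "mat_deriv ?i snd (?u v) = mat_deriv ?i (\<lambda>q. snd (snd (iota q) ?i)) v"
      by (rule mat_deriv_differential[where G = "\<lambda>p. snd (iota p) ?i", OF mholo_of_gl[OF complex_manifold_TGL TGL_components(2) pT]])
    then show ?thesis
      using mat_deriv_conj[OF PM p v e U] by (simp add: iota_components(3)[OF i])
  qed
  \<comment> \<open>The corner of diag(a_k, 1) is constant, so its logarithmic derivative is that of
    a_k bordered by zeros.\<close>
  have \<sigma>: "?\<sigma> v = pad k (mat_deriv k (frame k) v * minv (frame k p))" if v: "v \<in> tangent_space P p" for v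
  proof -
    have "mat_deriv ?i ?e v = pad k (mat_deriv k (frame k) v)"
      using mat_deriv_diag_embed[OF PM p v kh] by (simp add: subframe_Suc[abs_def] pad_def)
    then show ?thesis
      by (simp add: subframe_Suc minv_diag_embed[OF kG] pad_mult_diag_embed[OF mat_deriv_carrier minv_carrier[OF kG]])
  qed
  have Uk: "upper_left k (?U p) = level k p" for p by (simp add: level_def upper_left_upper_left)
  have dk: "upper_left k (?d v) = mat_deriv k (level k) v" for v
    using mat_deriv_upper_left[of k ?i ?U v] by (simp add: Uk)
  have sk: "mat_deriv k (frame k) v * minv (frame k p) \<in> carrier_mat k k" for v
    by (intro mat_mult_closed[where n = k] mat_deriv_carrier minv_carrier[OF kG])
  have "TGL_form ?i (snd (iota p) ?i) (?u v) (?u w) =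
      cot_form (?c (?U p)) (?c (?s v - ?\<sigma> v)) (?c (?d v + (?U p * ?\<sigma> v - ?\<sigma> v * ?U p)))
        (?c (?s w - ?\<sigma> w)) (?c (?d w + (?U p * ?\<sigma> w - ?\<sigma> w * ?U p)))"
    unfolding TGL_form_cot_form fstd[OF v] fstd[OF w] sndd[OF v] sndd[OF w] by (simp only: iota_components(3)[OF i])
  also have "\<dots> = cot_form (?U p) (?s v - ?\<sigma> v) (?d v + (?U p * ?\<sigma> v - ?\<sigma> v * ?U p))
        (?s w - ?\<sigma> w) (?d w + (?U p * ?\<sigma> w - ?\<sigma> w * ?U p))"
    by (rule cot_form_conj[OF eG[OF p]]) (intro mm sc level_carrier mat_deriv_carrier)+
  also have "\<dots> = cot_form (?U p) (?s v) (?d v) (?s w) (?d w) - cot_form (?U p) (?\<sigma> v) (?d v) (?\<sigma> w) (?d w)"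
    by (rule cot_form_shift[OF level_carrier sc(1) mat_deriv_carrier sc(1) mat_deriv_carrier sc(2) sc(2)])
  also have "cot_form (?U p) (?\<sigma> v) (?d v) (?\<sigma> w) (?d w) = frame_form k p v w"
    unfolding \<sigma>[OF v] \<sigma>[OF w] cot_form_pad[OF sk sk level_carrier mat_deriv_carrier mat_deriv_carrier] Uk dk frame_form_def ..
  finally show ?thesis by (simp add: frame_form_def)
qed

lemma total_form_iota:
  assumes p: "p \<in> points P" and v: "v \<in> tangent_space P p" and w: "w \<in> tangent_space P p"
  shows "total_form n M \<omega> (iota p) (differential X iota p v) (differential X iota p w) =
    \<omega> (fst p) (differential M fst p v) (differential M fst p w)"
proof -
  let ?A = "\<lambda>p. act (minv (frame n p)) (fst p)" and ?f = "\<lambda>i. frame_form i p v w"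
  have A: "differential M fst (iota p) (differential X iota p v) = differential M ?A p v" for v
    using differential_compose[where F = iota, OF XM M total_fst_holomorphic[OF M] iota_points[OF p], of v]
    by (simp add: comp_def iota_components(1))
  have B: "differential (TGL_cmfd i) (\<lambda>y. y i) (snd (iota p)) (differential (TGL_tower_cmfd n) snd (iota p) (differential X iota p v)) =
      differential (TGL_cmfd i) (\<lambda>p. snd (iota p) i) p v" if i: "i \<in> {1..n}" for i v
  proof -
    have s: "holomorphic_map X (TGL_tower_cmfd n) snd"
      unfolding total_cmfd_def by (rule holomorphic_map_snd[OF M complex_manifold_TGL_tower])
    have t: "holomorphic_map (TGL_tower_cmfd n) (TGL_cmfd i) (\<lambda>y. y i)"
      unfolding TGL_tower_cmfd_def by (rule holomorphic_map_Pi_proj[OF _ _ i]) (auto intro: complex_manifold_TGL)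
    have "differential (TGL_tower_cmfd n) snd (iota p) (differential X iota p v) = differential (TGL_tower_cmfd n) (\<lambda>p. snd (iota p)) p v"
      using differential_compose[where F = iota, OF XM complex_manifold_TGL_tower s iota_points[OF p], of v] by (simp add: comp_def)
    moreover have "differential (TGL_cmfd i) (\<lambda>y. y i) (snd (iota p)) (differential (TGL_tower_cmfd n) (\<lambda>p. snd (iota p)) p v) =
        differential (TGL_cmfd i) (\<lambda>p. snd (iota p) i) p v"
      using differential_compose[where F = "\<lambda>p. snd (iota p)", OF complex_manifold_TGL_tower complex_manifold_TGL t
          holomorphic_map_points[OF s iota_points[OF p]], of v] by (simp add: comp_def)
    ultimately show ?thesis by simp
  qed
  have "Pi_form {1..n} TGL_cmfd TGL_form (snd (iota p)) (differential (TGL_tower_cmfd n) snd (iota p) (differential X iota p v))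
      (differential (TGL_tower_cmfd n) snd (iota p) (differential X iota p w)) =
    (\<Sum>i\<in>{1..n}. TGL_form i (snd (iota p) i) (differential (TGL_cmfd i) (\<lambda>p. snd (iota p) i) p v)
      (differential (TGL_cmfd i) (\<lambda>p. snd (iota p) i) p w))"
    unfolding Pi_form_def by (intro sum.cong refl) (simp only: B)
  also have "\<dots> = (\<Sum>k<n. TGL_form (Suc k) (snd (iota p) (Suc k)) (differential (TGL_cmfd (Suc k)) (\<lambda>p. snd (iota p) (Suc k)) p v)
      (differential (TGL_cmfd (Suc k)) (\<lambda>p. snd (iota p) (Suc k)) p w))"
    by (simp add: sum.atLeast1_atMost_eq)
  also have "\<dots> = (\<Sum>k<n. ?f (Suc k) - ?f k)"
    by (intro sum.cong refl TGL_form_iota[OF p v w]) simp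
  also have "\<dots> = ?f n - ?f 0" by (rule sum_lessThan_telescope)
  \<comment> \<open>The telescoping ends with matrices of size 0, all of whose traces
    vanish.\<close>
  also have "?f 0 = 0"
  proof -
    have "mat_deriv 0 (frame 0) v * minv (frame 0 p) \<in> carrier_mat 0 0" for v
      by (intro mat_mult_closed[where n = 0] mat_deriv_carrier minv_carrier frame_GL[OF p]) simp
    then show ?thesis
      unfolding frame_form_def by (subst cot_form_traces[of _ 0]) (auto simp: tr2_def tr3_def)
  qed
  finally have tower: "Pi_form {1..n} TGL_cmfd TGL_form (snd (iota p)) (differential (TGL_tower_cmfd n) snd (iota p) (differential X iota p v))
      (differential (TGL_tower_cmfd n) snd (iota p) (differential X iota p w)) = ?f n" by simp
  have lev: "mat_deriv n (\<lambda>r. \<mu> (fst r)) v = mat_deriv n (level n) v" if v: "v \<in> tangent_space P p" for v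
    by (rule mat_deriv_cong[OF PM p v]) (simp add: level_def upper_left_self[OF moment_carrier[OF slice_fst]])
  have levp: "\<mu> (fst p) = level n p" by (simp add: level_def upper_left_self[OF moment_carrier[OF slice_fst[OF p]]])
  \<comment> \<open>The summand f_n subtracted here is the one left over by the tower, so that only
    the form of \<open>M\<close> at m' survives.\<close>
  have "\<omega> (?A p) (differential M ?A p v) (differential M ?A p w) =
      \<omega> (fst p) (differential M fst p v) (differential M fst p w) - ?f n"
    using form_action[OF symp ham PM frame_holomorphic[OF M order_refl] slice_fst_holomorphic[OF M] p v w]
    unfolding frame_form_def lev[OF v] lev[OF w] levp .
  then show ?thesis
    unfolding total_form_def prod_form_def A tower by (simp add: iota_components(1))
qed

end

section \<open>The quotient\<close>

context gl_reduction
begin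

text \<open>The fibre of m' inside the zero level. By \<open>orbit_iota\<close> it is the orbit of
  \<open>iota p\<close> for every slice point \<open>p\<close> over \<open>m\<close>; describing it
  as a fibre makes it a function of \<open>m\<close> without choosing \<open>p\<close>.\<close>

definition orbit_map :: "'p \<Rightarrow> ('p \<times> (nat \<Rightarrow> complex mat \<times> complex mat)) set" where
  "orbit_map m = iota ` {q \<in> points P. fst q = m}"

lemma slice_pair_points: "m \<in> points M \<Longrightarrow> x \<in> points (slice_tower_cmfd n) \<Longrightarrow> (m, x) \<in> points P"
  by (simp add: slice_cmfd_def)

lemma slice_tower_point: "(\<lambda>i\<in>{1..n}. (1\<^sub>m i, 1\<^sub>m 0)) \<in> points (slice_tower_cmfd n)"
  by (auto simp: slice_tower_cmfd_def)

lemma orbit_map_inj: "inj_on orbit_map (points M)"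
proof (rule inj_onI)
  fix m m' assume m: "m \<in> points M" "m' \<in> points M" and eq: "orbit_map m = orbit_map m'"
  \<comment> \<open>Identity frames provide a point of the fibre over \<open>m\<close>; fibres over
    different points are disjoint since \<open>iota\<close> is injective.\<close>
  let ?q = "(m, \<lambda>i\<in>{1..n}. (1\<^sub>m i, 1\<^sub>m 0))"
  have q: "?q \<in> points P" by (rule slice_pair_points[OF m(1) slice_tower_point])
  have "iota ?q \<in> orbit_map m" unfolding orbit_map_def by (intro imageI) (simp only: q mem_Collect_eq fst_conv)
  then have "iota ?q \<in> orbit_map m'" unfolding eq .
  then obtain q' where q': "q' \<in> points P" "fst q' = m'" "iota ?q = iota q'" unfolding orbit_map_def by auto
  then have "?q = q'" using inj_onD[OF inj_iota q'(3) q q'(1)] by simp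
  then show "m = m'" using q'(2) by auto
qed

abbreviation "orb \<equiv> orbit_of n (total_act n act)"
abbreviation "Z \<equiv> image_cmfd iota P"
abbreviation "Q \<equiv> image_cmfd orbit_map M"

lemma orb_iota: "p \<in> points P \<Longrightarrow> orb (iota p) = orbit_map (fst p)"
  by (simp add: orbit_iota orbit_map_def)

lemma orb_zero_level: "z \<in> zero_level \<Longrightarrow> orb z = orbit_map (fst (retr z))"
  using orb_iota retr_iota unfolding zero_level_eq by auto

lemmas ZM = complex_manifold_image[OF PM inj_iota] and QM = complex_manifold_image[OF M orbit_map_inj]

lemma points_Z: "points Z = zero_level"
  by (simp add: points_image_cmfd[OF inj_iota] zero_level_eq)

lemma points_Q: "points Q = orb ` zero_level"
proof -
  have "orb ` zero_level = orbit_map ` fst ` points P"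
    unfolding zero_level_eq image_image by (intro image_cong refl orb_iota)
  also have "fst ` points P = points M"
    using slice_fst slice_pair_points[OF _ slice_tower_point] by force
  finally show ?thesis by (simp add: points_image_cmfd[OF orbit_map_inj])
qed

lemma iota_Z: "holomorphic_map P Z iota"
  by (rule holomorphic_map_image[OF PM inj_iota])

text \<open>On the zero level the inverse given by \<open>inv_into\<close> is the explicit map
  \<open>retr\<close>, which is also defined and holomorphic off it.\<close>

lemma retr_Z: "holomorphic_map Z P retr"
proof (rule holomorphic_map_cong[OF ZM PM holomorphic_map_image_inv[OF PM inj_iota]])
  fix z assume "z \<in> points Z"
  then obtain p where "p \<in> points P" "z = iota p" unfolding points_Z zero_level_eq by auto
  then show "inv_into (points P) iota z = retr z" using retr_iota inv_into_f_f[OF inj_iota] by simp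
qed

lemma Z_iota_retr: "z \<in> points Z \<Longrightarrow> iota (retr z) = z"
  by (simp add: points_Z iota_retr)

lemma id_Z: "holomorphic_map Z X id"
  by (rule holomorphic_map_cong[OF ZM XM holomorphic_map_comp2[OF ZM PM XM retr_Z iota_holomorphic]])
     (simp add: Z_iota_retr)

text \<open>A holomorphic retraction of the total space onto the zero level. It is the reason both
  for the subspace topology of \<open>Z\<close> and for the injective differentials of the
  inclusion.\<close>

lemma X_to_Z: "holomorphic_map X Z (\<lambda>z. iota (retr z))"
  by (rule holomorphic_map_comp2[OF XM PM ZM retr_holomorphic iota_Z])

lemma mtop_Z: "mtop Z = subtopology (mtop X) zero_level"
proof -
  have sub: "topspace (subtopology (mtop X) zero_level) = zero_level"
    by (auto simp: zero_level_def)
  have "continuous_map (mtop Z) (subtopology (mtop X) zero_level) id"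
    by (rule continuous_map_into_subtopology[OF holomorphic_map_continuous[OF id_Z]]) (auto simp: points_Z)
  moreover have "continuous_map (subtopology (mtop X) zero_level) (mtop Z) id"
    by (rule continuous_map_eq[OF continuous_map_from_subtopology[OF holomorphic_map_continuous[OF X_to_Z]]])
       (simp add: sub iota_retr)
  ultimately have "homeomorphic_maps (mtop Z) (subtopology (mtop X) zero_level) id id"
    by (simp add: homeomorphic_maps_def)
  then have "homeomorphic_map (mtop Z) (subtopology (mtop X) zero_level) id" by (rule homeomorphic_maps_imp_map)
  then show ?thesis unfolding homeomorphic_map_id by (rule sym)
qed

lemma embedded_Z: "embedded_submanifold Z X"
  unfolding embedded_submanifold_def
proof (intro conjI ballI ZM id_Z)
  show "points Z \<subseteq> points X" by (auto simp: points_Z zero_level_def)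
  show "mtop Z = subtopology (mtop X) (points Z)" unfolding points_Z by (rule mtop_Z)
  fix z assume z: "z \<in> points Z"
  show "inj_on (differential X id z) (tangent_space Z z)"
  proof (rule inj_on_inverseI)
    fix v assume v: "v \<in> tangent_space Z z"
    show "differential Z (\<lambda>z. iota (retr z)) (id z) (differential X id z v) = v"
      by (rule differential_left_inverse[OF ZM XM id_Z X_to_Z _ z v]) (simp add: Z_iota_retr)
  qed
qed

lemma orb_Z: "holomorphic_map Z Q orb"
proof (rule holomorphic_map_cong[OF ZM QM])
  show "holomorphic_map Z Q (\<lambda>z. orbit_map (fst (retr z)))"
    by (rule holomorphic_map_comp2[OF ZM M QM holomorphic_map_comp2[OF ZM PM M retr_Z slice_fst_holomorphic[OF M]]
        holomorphic_map_image[OF M orbit_map_inj]])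
qed (simp add: points_Z orb_zero_level)

section \<open>Sections of the orbit projection, submersion and comparison of forms\<close>

abbreviation "Q_inv \<equiv> inv_into (points M) orbit_map"

lemma Q_inv_holomorphic: "holomorphic_map Q M Q_inv"
  by (rule holomorphic_map_image_inv[OF M orbit_map_inj])

text \<open>Holding the frames \<open>x\<close> fixed gives a global section of the orbit
  projection. The choice of \<open>x\<close> is free, so there is a section through any prescribed
  point of the zero level; this yields surjective differentials at every point.\<close>

lemma section_Q:
  assumes x: "x \<in> points (slice_tower_cmfd n)"
  shows "holomorphic_map Q Z (\<lambda>q. iota (Q_inv q, x))" "\<And>q. q \<in> points Q \<Longrightarrow> orb (iota (Q_inv q, x)) = q"
proof -
  have "holomorphic_map Q P (\<lambda>q. (Q_inv q, x))"
    unfolding slice_cmfd_def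
    by (rule holomorphic_map_Pair[OF QM M complex_manifold_slice_tower Q_inv_holomorphic
        holomorphic_map_const[OF QM complex_manifold_slice_tower x]])
  then show "holomorphic_map Q Z (\<lambda>q. iota (Q_inv q, x))" by (rule holomorphic_map_comp2[OF QM PM ZM _ iota_Z])
  fix q assume q: "q \<in> points Q"
  have "orb (iota (Q_inv q, x)) = orbit_map (Q_inv q)"
    using orb_iota[OF slice_pair_points[OF holomorphic_map_points[OF Q_inv_holomorphic q] x]] by simp
  also have "\<dots> = q" using q unfolding points_image_cmfd[OF orbit_map_inj] by (rule f_inv_into_f)
  finally show "orb (iota (Q_inv q, x)) = q" .
qed

lemma Q_inv_orb: "p \<in> points P \<Longrightarrow> Q_inv (orb (iota p)) = fst p"
  using inv_into_f_f[OF orbit_map_inj slice_fst] by (simp add: orb_iota)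

lemma submersion_orb: "submersion Z Q orb"
  unfolding submersion_def
proof (intro conjI ballI orb_Z equalityI subsetI)
  fix z v assume z: "z \<in> points Z" and "v \<in> differential Q orb z ` tangent_space Z z"
  then show "v \<in> tangent_space Q (orb z)" using differential_tangent[OF ZM QM orb_Z z] by blast
next
  fix z w assume z: "z \<in> points Z" and w: "w \<in> tangent_space Q (orb z)"
  obtain p where p: "p \<in> points P" "z = iota p" using z unfolding points_Z zero_level_eq by auto
  have x: "snd p \<in> points (slice_tower_cmfd n)" using p(1) by (simp add: slice_cmfd_def mem_Times_iff)
  have oz: "orb z \<in> points Q" using holomorphic_map_points[OF orb_Z z] .
  let ?\<sigma> = "\<lambda>q. iota (Q_inv q, snd p)"
  have \<sigma>z: "?\<sigma> (orb z) = z" using Q_inv_orb[OF p(1)] by (simp add: p(2))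
  have "differential Q orb (?\<sigma> (orb z)) (differential Z ?\<sigma> (orb z) w) = w"
    by (rule differential_left_inverse[OF QM ZM section_Q(1)[OF x] orb_Z section_Q(2)[OF x] oz w])
  moreover have "differential Z ?\<sigma> (orb z) w \<in> tangent_space Z z"
    using differential_tangent[OF QM ZM section_Q(1)[OF x] oz w] unfolding \<sigma>z .
  ultimately show "w \<in> differential Q orb z ` tangent_space Z z" unfolding \<sigma>z by (rule image_eqI[OF sym])
qed

text \<open>A continuous map with a continuous section is a quotient map.\<close>

lemma quotient_map_orb: "quotient_map (subtopology (mtop X) zero_level) (mtop Q) orb"
proof -
  have "retraction_maps (mtop Z) (mtop Q) orb (\<lambda>q. iota (Q_inv q, \<lambda>i\<in>{1..n}. (1\<^sub>m i, 1\<^sub>m 0)))"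
    unfolding retraction_maps_def
    using holomorphic_map_continuous[OF orb_Z] holomorphic_map_continuous[OF section_Q(1)[OF slice_tower_point]]
      section_Q(2)[OF slice_tower_point] by blast
  then show ?thesis unfolding mtop_Z[symmetric] by (intro retraction_imp_quotient_map) (auto simp: retraction_map_def)
qed

text \<open>Both sides are moved to the slice by the differential of \<open>retr\<close>: the orbit
  projection becomes \<open>fst\<close> and the inclusion becomes \<open>iota\<close>, and
  \<open>total_form_iota\<close> compares the two forms there.\<close>

lemma pullback_forms_agree:
  assumes z: "z \<in> points Z" and v: "v \<in> tangent_space Z z" and w: "w \<in> tangent_space Z z"
  shows "image_form orbit_map M \<omega> (orb z) (differential Q orb z v) (differential Q orb z w) =
    total_form n M \<omega> z (differential X id z v) (differential X id z w)"
proof -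
  obtain p where p: "p \<in> points P" "z = iota p" using z unfolding points_Z zero_level_eq by auto
  have rz: "retr z = p" using retr_iota[OF p(1)] by (simp add: p(2))
  let ?d = "\<lambda>v. differential P retr z v"
  have d: "?d v \<in> tangent_space P p" if "v \<in> tangent_space Z z" for v
    using differential_tangent[OF ZM PM retr_Z z that] unfolding rz .
  have "differential M Q_inv (orb z) (differential Q orb z v) = differential M fst p (?d v)" if v: "v \<in> tangent_space Z z" for v
  proof -
    have "differential M Q_inv (orb z) (differential Q orb z v) = differential M (Q_inv \<circ> orb) z v"
      by (rule differential_compose[where F = orb, OF QM M Q_inv_holomorphic holomorphic_map_points[OF orb_Z z]])
    also have "\<dots> = differential M (fst \<circ> retr) z v"
    proof (rule differential_cong[OF ZM z v])
      fix y assume "y \<in> points Z"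
      then obtain r where "r \<in> points P" "y = iota r" unfolding points_Z zero_level_eq by auto
      then show "(Q_inv \<circ> orb) y = (fst \<circ> retr) y" using Q_inv_orb retr_iota by simp
    qed
    also have "\<dots> = differential M fst (retr z) (?d v)"
      by (rule differential_compose[where F = retr, OF PM M slice_fst_holomorphic[OF M] holomorphic_map_points[OF retr_Z z], symmetric])
    finally show ?thesis by (simp add: rz)
  qed
  moreover have "Q_inv (orb z) = fst p" using Q_inv_orb[OF p(1)] by (simp add: p(2))
  ultimately have 1: "image_form orbit_map M \<omega> (orb z) (differential Q orb z v) (differential Q orb z w) =
      \<omega> (fst p) (differential M fst p (?d v)) (differential M fst p (?d w))"
    using v w by (simp add: image_form_def)
  have 2: "differential X id z v = differential X iota p (?d v)" if v: "v \<in> tangent_space Z z" for v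
  proof -
    have "differential X id z v = differential X (iota \<circ> retr) z v"
      by (rule differential_cong[OF ZM z v]) (simp add: Z_iota_retr)
    also have "\<dots> = differential X iota (retr z) (?d v)"
      by (rule differential_compose[where F = retr, OF PM XM iota_holomorphic holomorphic_map_points[OF retr_Z z], symmetric])
    finally show ?thesis by (simp add: rz)
  qed
  show ?thesis
    unfolding 1 2[OF v] 2[OF w] using total_form_iota[OF p(1) d[OF v] d[OF w]] p(2) by simp
qed

lemma symplectic_quotient:
  "is_symplectic_quotient X (total_form n M \<omega>) n (total_act n act) (total_moment n \<mu>) Q (image_form orbit_map M \<omega>)"
  unfolding is_symplectic_quotient_def Let_def zero_level_def[symmetric]
proof (intro conjI ballI impI)
  show "\<exists>v\<in>tangent_space X z. \<forall>i\<in>{1..n}. mat_deriv i (total_moment n \<mu> i) v = c i"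
    if "z \<in> zero_level" "c \<in> PiE {1..n} (\<lambda>i. carrier_mat i i)" for z c
    using zero_level_regular that .
  show "h = (\<lambda>i\<in>{1..n}. 1\<^sub>m i)" if "z \<in> zero_level" "h \<in> GL_product n" "total_act n act h z = z" for z h
    using total_act_free[of z h] that by (simp add: zero_level_def)
  show "symplectic_manifold Q (image_form orbit_map M \<omega>)"
    by (rule symplectic_manifold_image[OF symp orbit_map_inj])
  show "points Q = orb ` zero_level" by (rule points_Q)
  show "quotient_map (subtopology (mtop X) zero_level) (mtop Q) orb" by (rule quotient_map_orb)
  show "\<exists>Z :: ('p \<times> (nat \<Rightarrow> complex mat \<times> complex mat), 'j + nat \<times> (nat \<times> nat + nat \<times> nat)) cmfd. embedded_submanifold Z X \<and> points Z = zero_level \<and> submersion Z Q orb \<and>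
     (\<forall>z\<in>points Z. \<forall>v\<in>tangent_space Z z. \<forall>w\<in>tangent_space Z z.
        image_form orbit_map M \<omega> (orb z) (differential Q orb z v) (differential Q orb z w) =
        total_form n M \<omega> z (differential X id z v) (differential X id z w))"
    by (intro exI conjI ballI, rule embedded_Z, rule points_Z, rule submersion_orb, rule pullback_forms_agree)
qed

end

theorem proposition5p3:
  fixes M :: "('p, 'j) cmfd"
    and \<omega> :: "'p two_form"
    and act :: "complex mat \<Rightarrow> 'p \<Rightarrow> 'p"
    and \<mu> :: "'p \<Rightarrow> complex mat"
    and n :: nat
  assumes "n \<ge> 1"
    and "symplectic_manifold M \<omega>"
    and "hamiltonian_GL_action n M \<omega> act \<mu>"
  shows "\<exists>(Q :: (('p \<times> (nat \<Rightarrow> complex mat \<times> complex mat)) set, 'j) cmfd) \<eta>.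
           is_symplectic_quotient (total_cmfd n M) (total_form n M \<omega>) n
             (total_act n act) (total_moment n \<mu>) Q \<eta> \<and>
           symplectically_isomorphic M \<omega> Q \<eta>"
proof -
  interpret gl_reduction n M \<omega> act \<mu>
    by (rule gl_reduction.intro[OF assms])
  show ?thesis
    by (intro exI conjI, rule symplectic_quotient, rule symplectically_isomorphic_image[OF M orbit_map_inj])
qed

end
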